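(* Let $\mathbf{k}$ be an algebraically closed field of characteristic $0$, let $r,s\ge 1$ and let $\Lambda=\mathbf{k}S_{(r,s)}/I$ be a $2$-representation-finite $(r,s)$-star algebra. Assume that $\Lambda$ is semi-regular. Then $\overline{B_\Lambda}$ is a reflexive graph. Moreover, $\overline{B_\Lambda}$ is a Salem graph if and only if $(r,s)\neq(1,1)$ and $(r,s)\neq(4,4)$.
   Context: The star quiver $S_{(r,s)}$ has vertices $x_1,\dots,x_r,z,y_1,\dots,y_s$ and arrows $a_i:x_i\to z$, $b_j:z\to y_j$. The path "first $a_i$, then $b_j$" is written $a_ib_j$. An $(r,s)$-star algebra is a bound quiver algebra $\Lambda=\mathbf{k}S_{(r,s)}/I$ with $I$ admissible; such an $I$ is automatically generated by a set of paths $a_ib_j$. The quiver $B_\Lambda$ has vertex set $\{x_1,\dots,x_r,y_1,\dots,y_s\}$ and one arrow $y_j\to x_i$ for each $(i,j)$ with $a_ib_j\notin I$; $\overline{B_\Lambda}$ is its underlying (bipartite) graph. $\Lambda$ is semi-regular if all $x_i$ have the same degree in $\overline{B_\Lambda}$ and all $y_j$ have the same degree in $\overline{B_\Lambda}$ (degree $0$ is allowed). A finite-dimensional algebra $\Lambda$ of global dimension at most $n$ is $n$-representation-finite if for every indecomposable projective $\Lambda$-module $P$ there is some $i\ge 0$ such that $\nu_n^{-i}(P)$ is an indecomposable injective $\Lambda$-module, where $\nu$ is the derived Nakayama functor (Serre functor) of $D^b(\mathrm{mod}\,\Lambda)$ and $\nu_n=\nu\circ[-n]$. A graph is reflexive if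 the second largest eigenvalue (eigenvalues listed with multiplicity) of its adjacency matrix is at most $2$. A Salem graph is a bipartite reflexive graph whose largest eigenvalue is strictly greater than $2$. *)

theory Defs
  imports
    "HOL-Algebra.Algebraic_Closure_Type"
    "HOL-Algebra.QuotRing"
    "HOL-Algebra.Module"
    "Graph_Theory.Digraph"
    "Graph_Theory.Arc_Walk"
    "Jordan_Normal_Form.Char_Poly"
    "HOL-Library.Multiset"
begin

hide_const (open) Polynomial.smult Modules.module Multiset.mult

section \<open>Finite-dimensional algebras and modules\<close>

text \<open>
  The ground field is a type \<open>'k :: field\<close>; \<open>ring_of_type_algebra\<close> is that field as a
  record.  The record type \<open>('k, 'a) module\<close> has ring operations and a scalar
  multiplication, which are the operations of a (not necessarily commutative) \<open>'k\<close>-algebra.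
\<close>

definition fd_space :: "('k::field, 'm, 'z) module_scheme \<Rightarrow> bool" where
  "fd_space V \<longleftrightarrow> Module.module (ring_of_type_algebra :: 'k ring) V \<and>
     (\<exists>B. finite B \<and> B \<subseteq> carrier V \<and>
        (\<forall>x \<in> carrier V. \<exists>c. x = (\<Oplus>\<^bsub>V\<^esub> b \<in> B. c b \<odot>\<^bsub>V\<^esub> b)))"

definition fd_algebra :: "('k::field, 'a) module \<Rightarrow> bool" where
  "fd_algebra A \<longleftrightarrow> ring A \<and> fd_space A \<and>
     (\<forall>c. \<forall>a \<in> carrier A. \<forall>b \<in> carrier A.
        (c \<odot>\<^bsub>A\<^esub> a) \<otimes>\<^bsub>A\<^esub> b = c \<odot>\<^bsub>A\<^esub> (a \<otimes>\<^bsub>A\<^esub> b) \<and>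
        a \<otimes>\<^bsub>A\<^esub> (c \<odot>\<^bsub>A\<^esub> b) = c \<odot>\<^bsub>A\<^esub> (a \<otimes>\<^bsub>A\<^esub> b))"

text \<open>
  Right modules, so that modules over a path algebra with paths composed from left to right are
  representations of the quiver.  The inherited fields \<open>mult\<close> and \<open>one\<close> are not used.
\<close>

record ('k, 'a, 'm) rmod = "('k, 'm) module" +
  ract :: "'m \<Rightarrow> 'a \<Rightarrow> 'm"

definition fd_rmod :: "('k::field, 'a) module \<Rightarrow> ('k, 'a, 'm) rmod \<Rightarrow> bool" where
  "fd_rmod A M \<longleftrightarrow> fd_space M \<and>
     (\<forall>x \<in> carrier M. \<forall>a \<in> carrier A. ract M x a \<in> carrier M) \<and>
     (\<forall>x \<in> carrier M. \<forall>y \<in> carrier M. \<forall>a \<in> carrier A.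
        ract M (x \<oplus>\<^bsub>M\<^esub> y) a = ract M x a \<oplus>\<^bsub>M\<^esub> ract M y a) \<and>
     (\<forall>x \<in> carrier M. \<forall>a \<in> carrier A. \<forall>b \<in> carrier A.
        ract M x (a \<oplus>\<^bsub>A\<^esub> b) = ract M x a \<oplus>\<^bsub>M\<^esub> ract M x b \<and>
        ract M x (a \<otimes>\<^bsub>A\<^esub> b) = ract M (ract M x a) b) \<and>
     (\<forall>x \<in> carrier M. ract M x \<one>\<^bsub>A\<^esub> = x) \<and>
     (\<forall>c. \<forall>x \<in> carrier M. \<forall>a \<in> carrier A.
        ract M x (c \<odot>\<^bsub>A\<^esub> a) = c \<odot>\<^bsub>M\<^esub> ract M x a \<and>
        ract M (c \<odot>\<^bsub>M\<^esub> x) a = c \<odot>\<^bsub>M\<^esub> ract M x a)"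

text \<open>
  Homomorphisms are extensional functions, so that a homomorphism is determined by its values
  on the carrier.  Compatibility with the action of \<open>c \<odot> \<one>\<close> makes them \<open>'k\<close>-linear.
\<close>

definition rhom ::
  "('k::field, 'a) module \<Rightarrow> ('k, 'a, 'm) rmod \<Rightarrow> ('k, 'a, 'n) rmod \<Rightarrow> ('m \<Rightarrow> 'n) set" where
  "rhom A M N = {f \<in> carrier M \<rightarrow>\<^sub>E carrier N.
     (\<forall>x \<in> carrier M. \<forall>y \<in> carrier M. f (x \<oplus>\<^bsub>M\<^esub> y) = f x \<oplus>\<^bsub>N\<^esub> f y) \<and>
     (\<forall>x \<in> carrier M. \<forall>a \<in> carrier A. f (ract M x a) = ract N (f x) a)}"

definition is_zero_mod :: "('k::field, 'a, 'm) rmod \<Rightarrow> bool" where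
  "is_zero_mod M \<longleftrightarrow> carrier M = {\<zero>\<^bsub>M\<^esub>}"

definition rsubmod :: "('k::field, 'a) module \<Rightarrow> ('k, 'a, 'm) rmod \<Rightarrow> 'm set \<Rightarrow> bool" where
  "rsubmod A M U \<longleftrightarrow> U \<subseteq> carrier M \<and> \<zero>\<^bsub>M\<^esub> \<in> U \<and>
     (\<forall>x \<in> U. \<forall>y \<in> U. x \<oplus>\<^bsub>M\<^esub> y \<in> U) \<and> (\<forall>x \<in> U. \<forall>a \<in> carrier A. ract M x a \<in> U)"

definition indecomposable_rmod :: "('k::field, 'a) module \<Rightarrow> ('k, 'a, 'm) rmod \<Rightarrow> bool" where
  "indecomposable_rmod A M \<longleftrightarrow> \<not> is_zero_mod M \<and>
     (\<forall>U V. rsubmod A M U \<longrightarrow> rsubmod A M V \<longrightarrow> U \<inter> V = {\<zero>\<^bsub>M\<^esub>} \<longrightarrow>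
        U <+>\<^bsub>M\<^esub> V = carrier M \<longrightarrow> U = {\<zero>\<^bsub>M\<^esub>} \<or> V = {\<zero>\<^bsub>M\<^esub>})"

text \<open>
  The category of finite-dimensional modules is represented by the modules whose elements are
  taken from \<open>nat \<Rightarrow> 'k\<close>; every finite-dimensional module is isomorphic to one of these.
\<close>

type_synonym ('k, 'a) fmod = "('k, 'a, nat \<Rightarrow> 'k) rmod"

definition projective_rmod :: "('k::field, 'a) module \<Rightarrow> ('k, 'a) fmod \<Rightarrow> bool" where
  "projective_rmod A P \<longleftrightarrow> fd_rmod A P \<and>
     (\<forall>(M :: ('k, 'a) fmod) (N :: ('k, 'a) fmod). \<forall>g \<in> rhom A M N. \<forall>f \<in> rhom A P N.
        fd_rmod A M \<longrightarrow> fd_rmod A N \<longrightarrow> g ` carrier M = carrier N \<longrightarrow>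
        (\<exists>h \<in> rhom A P M. \<forall>x \<in> carrier P. g (h x) = f x))"

definition injective_rmod :: "('k::field, 'a) module \<Rightarrow> ('k, 'a) fmod \<Rightarrow> bool" where
  "injective_rmod A J \<longleftrightarrow> fd_rmod A J \<and>
     (\<forall>(M :: ('k, 'a) fmod) (N :: ('k, 'a) fmod). \<forall>g \<in> rhom A M N. \<forall>f \<in> rhom A M J.
        fd_rmod A M \<longrightarrow> fd_rmod A N \<longrightarrow> inj_on g (carrier M) \<longrightarrow>
        (\<exists>h \<in> rhom A N J. \<forall>x \<in> carrier M. h (g x) = f x))"


section \<open>Bounded complexes and isomorphism in the bounded derived category\<close>

text \<open>Complexes are cochain complexes: the differential raises the degree by one.\<close>

record ('k, 'a, 'm) mod_complex =
  cterm :: "int \<Rightarrow> ('k, 'a, 'm) rmod"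
  cdiff :: "int \<Rightarrow> 'm \<Rightarrow> 'm"

type_synonym ('k, 'a) fcomplex = "('k, 'a, nat \<Rightarrow> 'k) mod_complex"

definition bounded_complex ::
  "('k::field, 'a) module \<Rightarrow> ('k, 'a, 'm) mod_complex \<Rightarrow> bool" where
  "bounded_complex A C \<longleftrightarrow>
     (\<forall>i. fd_rmod A (cterm C i)) \<and>
     (\<forall>i. cdiff C i \<in> rhom A (cterm C i) (cterm C (i + 1))) \<and>
     (\<forall>i. \<forall>x \<in> carrier (cterm C i).
        cdiff C (i + 1) (cdiff C i x) = \<zero>\<^bsub>cterm C (i + 1 + 1)\<^esub>) \<and>
     finite {i. \<not> is_zero_mod (cterm C i)}"

definition cocycles :: "('k::field, 'a, 'm) mod_complex \<Rightarrow> int \<Rightarrow> 'm set" where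
  "cocycles C i = {x \<in> carrier (cterm C i). cdiff C i x = \<zero>\<^bsub>cterm C (i + 1)\<^esub>}"

definition coboundaries :: "('k::field, 'a, 'm) mod_complex \<Rightarrow> int \<Rightarrow> 'm set" where
  "coboundaries C i = cdiff C (i - 1) ` carrier (cterm C (i - 1))"

definition chain_map ::
  "('k::field, 'a) module \<Rightarrow> ('k, 'a, 'm) mod_complex \<Rightarrow> ('k, 'a, 'n) mod_complex \<Rightarrow>
   (int \<Rightarrow> 'm \<Rightarrow> 'n) \<Rightarrow> bool" where
  "chain_map A C D f \<longleftrightarrow>
     (\<forall>i. f i \<in> rhom A (cterm C i) (cterm D i)) \<and>
     (\<forall>i. \<forall>x \<in> carrier (cterm C i). f (i + 1) (cdiff C i x) = cdiff D i (f i x))"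

text \<open>
  The last two conditions say that the map induced on cohomology in degree \<open>i\<close> is injective
  and surjective.
\<close>

definition quasi_iso ::
  "('k::field, 'a) module \<Rightarrow> ('k, 'a, 'm) mod_complex \<Rightarrow> ('k, 'a, 'n) mod_complex \<Rightarrow>
   (int \<Rightarrow> 'm \<Rightarrow> 'n) \<Rightarrow> bool" where
  "quasi_iso A C D f \<longleftrightarrow> chain_map A C D f \<and>
     (\<forall>i. \<forall>x \<in> cocycles C i. f i x \<in> coboundaries D i \<longrightarrow> x \<in> coboundaries C i) \<and>
     (\<forall>i. \<forall>y \<in> cocycles D i. \<exists>x \<in> cocycles C i. y \<ominus>\<^bsub>cterm D i\<^esub> f i x \<in> coboundaries D i)"

text \<open>
  The derived category is the localisation of the category of bounded complexes at the
  quasi-isomorphisms.  Since an isomorphism there is represented by a roof of two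
  quasi-isomorphisms, two complexes are isomorphic in it iff they are connected by a
  zigzag of quasi-isomorphisms.
\<close>

definition derived_iso ::
  "('k::field, 'a) module \<Rightarrow> ('k, 'a) fcomplex \<Rightarrow> ('k, 'a) fcomplex \<Rightarrow> bool" where
  "derived_iso A = equivclp (\<lambda>C D.
     bounded_complex A C \<and> bounded_complex A D \<and> (\<exists>f. quasi_iso A C D f))"

definition stalk_complex :: "('k::field, 'a, 'm) rmod \<Rightarrow> ('k, 'a, 'm) mod_complex" where
  "stalk_complex M = (let T = \<lambda>i::int. if i = 0 then M else M\<lparr>carrier := {\<zero>\<^bsub>M\<^esub>}\<rparr> in
     \<lparr>cterm = T, cdiff = \<lambda>i. \<lambda>x \<in> carrier (T i). \<zero>\<^bsub>M\<^esub>\<rparr>)"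

text \<open>\<open>shift_complex m C\<close> is \<open>C[m]\<close>, that is, \<open>C[m]\<^sup>i = C\<^sup>i\<^sup>+\<^sup>m\<close> with differential \<open>(-1)\<^sup>m d\<close>.\<close>

definition shift_complex :: "int \<Rightarrow> ('k::field, 'a, 'm) mod_complex \<Rightarrow> ('k, 'a, 'm) mod_complex"
  where
  "shift_complex m C = \<lparr>cterm = \<lambda>i. cterm C (i + m),
     cdiff = \<lambda>i. if even m then cdiff C (i + m)
       else (\<lambda>x \<in> carrier (cterm C (i + m)). \<ominus>\<^bsub>cterm C (i + m + 1)\<^esub> cdiff C (i + m) x)\<rparr>"

definition projective_complex :: "('k::field, 'a) module \<Rightarrow> ('k, 'a) fcomplex \<Rightarrow> bool" where
  "projective_complex A P \<longleftrightarrow> bounded_complex A P \<and> (\<forall>i. projective_rmod A (cterm P i))"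

text \<open>
  A quasi-isomorphism from a complex of projectives in degrees \<open>-n, \<dots>, 0\<close> to the stalk
  complex of \<open>M\<close> is a projective resolution of \<open>M\<close> of length at most \<open>n\<close>.
\<close>

definition global_dim_le :: "('k::field, 'a) module \<Rightarrow> nat \<Rightarrow> bool" where
  "global_dim_le A n \<longleftrightarrow> (\<forall>M :: ('k, 'a) fmod. fd_rmod A M \<longrightarrow>
     (\<exists>P f. projective_complex A P \<and> (\<forall>i. i < - int n \<or> i > 0 \<longrightarrow> is_zero_mod (cterm P i)) \<and>
        quasi_iso A P (stalk_complex M) f))"


section \<open>The derived Nakayama functor and $n$-representation-finiteness\<close>

definition regular_rmod :: "('k::field, 'a) module \<Rightarrow> ('k, 'a, 'a) rmod" where
  "regular_rmod A = module.extend A (rmod.fields (\<lambda>x a. x \<otimes>\<^bsub>A\<^esub> a))"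

text \<open>
  The Nakayama functor \<open>\<nu> = D Hom\<^sub>A(-, A)\<close>, with \<open>D\<close> the \<open>'k\<close>-dual.  The left
  multiplication of \<open>A\<close> on itself makes \<open>Hom\<^sub>A(M, A)\<close> a left module and its dual a right module.
\<close>

definition nakayama_mod ::
  "('k::field, 'a) module \<Rightarrow> ('k, 'a, 'm) rmod \<Rightarrow> ('k, 'a, ('m \<Rightarrow> 'a) \<Rightarrow> 'k) rmod" where
  "nakayama_mod A M = (let H = rhom A M (regular_rmod A) in
     \<lparr>carrier = {\<phi> \<in> H \<rightarrow>\<^sub>E UNIV.
        (\<forall>f \<in> H. \<forall>g \<in> H. \<phi> (\<lambda>x \<in> carrier M. f x \<oplus>\<^bsub>A\<^esub> g x) = \<phi> f + \<phi> g) \<and>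
        (\<forall>c. \<forall>f \<in> H. \<phi> (\<lambda>x \<in> carrier M. c \<odot>\<^bsub>A\<^esub> f x) = c * \<phi> f)},
      mult = undefined, one = undefined,
      zero = (\<lambda>f \<in> H. 0),
      add = (\<lambda>\<phi> \<psi>. \<lambda>f \<in> H. \<phi> f + \<psi> f),
      smult = (\<lambda>c \<phi>. \<lambda>f \<in> H. c * \<phi> f),
      ract = (\<lambda>\<phi> a. \<lambda>f \<in> H. \<phi> (\<lambda>x \<in> carrier M. a \<otimes>\<^bsub>A\<^esub> f x))\<rparr>)"

definition nakayama_map ::
  "('k::field, 'a) module \<Rightarrow> ('k, 'a, 'm) rmod \<Rightarrow> ('k, 'a, 'n) rmod \<Rightarrow> ('m \<Rightarrow> 'n) \<Rightarrow>
   (('m \<Rightarrow> 'a) \<Rightarrow> 'k) \<Rightarrow> (('n \<Rightarrow> 'a) \<Rightarrow> 'k)" where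
  "nakayama_map A M N u =
     (\<lambda>\<phi> \<in> carrier (nakayama_mod A M). \<lambda>g \<in> rhom A N (regular_rmod A).
        \<phi> (compose (carrier M) g u))"

definition nakayama_complex ::
  "('k::field, 'a) module \<Rightarrow> ('k, 'a, 'm) mod_complex \<Rightarrow>
   ('k, 'a, ('m \<Rightarrow> 'a) \<Rightarrow> 'k) mod_complex" where
  "nakayama_complex A C = \<lparr>cterm = \<lambda>i. nakayama_mod A (cterm C i),
     cdiff = \<lambda>i. nakayama_map A (cterm C i) (cterm C (i + 1)) (cdiff C i)\<rparr>"

text \<open>
  \<open>derived_nakayama A C D\<close> says that \<open>D\<close> is isomorphic to \<open>\<nu> C\<close> in the derived category:
  the derived functor is computed by applying the Nakayama functor termwise to a bounded
  complex \<open>P\<close> of projectives isomorphic to \<open>C\<close>.  The complex \<open>Z\<close> is a copy of the result with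
  terms in \<open>nat \<Rightarrow> 'k\<close>.
\<close>

definition derived_nakayama ::
  "('k::field, 'a) module \<Rightarrow> ('k, 'a) fcomplex \<Rightarrow> ('k, 'a) fcomplex \<Rightarrow> bool" where
  "derived_nakayama A C D \<longleftrightarrow>
     (\<exists>P Z f. projective_complex A P \<and> derived_iso A P C \<and>
        bounded_complex A Z \<and> quasi_iso A (nakayama_complex A P) Z f \<and> derived_iso A Z D)"

text \<open>
  \<open>nu_inv A n C D\<close> says that \<open>D\<close> is isomorphic to \<open>\<nu>\<^sub>n\<^sup>-\<^sup>1(C)\<close>, that is, \<open>\<nu>(D[-n])\<close> is
  isomorphic to \<open>C\<close>.
\<close>

definition nu_inv ::
  "('k::field, 'a) module \<Rightarrow> nat \<Rightarrow> ('k, 'a) fcomplex \<Rightarrow> ('k, 'a) fcomplex \<Rightarrow> bool" where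
  "nu_inv A n C D \<longleftrightarrow> bounded_complex A D \<and> derived_nakayama A (shift_complex (- int n) D) C"

definition n_representation_finite :: "nat \<Rightarrow> ('k::field, 'a) module \<Rightarrow> bool" where
  "n_representation_finite n A \<longleftrightarrow> fd_algebra A \<and> global_dim_le A n \<and>
     (\<forall>P :: ('k, 'a) fmod. projective_rmod A P \<longrightarrow> indecomposable_rmod A P \<longrightarrow>
        (\<exists>i D J. (nu_inv A n ^^ i) (stalk_complex P) D \<and>
           injective_rmod A J \<and> indecomposable_rmod A J \<and> derived_iso A D (stalk_complex J)))"


section \<open>Bound quiver algebras\<close>

text \<open>
  A path is a pair of its starting vertex and its list of arrows; \<open>(v, [])\<close> is the trivial
  path at \<open>v\<close>.
\<close>

type_synonym ('v, 'e) path = "'v \<times> 'e list"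

definition quiver_paths :: "('v, 'e) pre_digraph \<Rightarrow> ('v, 'e) path set" where
  "quiver_paths Q = {(u, p). \<exists>v. pre_digraph.awalk Q u p v}"

text \<open>
  Elements of the path algebra are coefficient functions.  The path \<open>p\<close> followed by the path
  \<open>q\<close> is the product \<open>p q\<close>, so the coefficient of a path in \<open>f \<otimes> g\<close> is the sum over all
  ways of cutting it in two.
\<close>

definition path_algebra ::
  "('v, 'e) pre_digraph \<Rightarrow> ('k::field, ('v, 'e) path \<Rightarrow> 'k) module" where
  "path_algebra Q =
     \<lparr>carrier = {f. finite {\<pi>. f \<pi> \<noteq> 0} \<and> {\<pi>. f \<pi> \<noteq> 0} \<subseteq> quiver_paths Q},
      mult = (\<lambda>f g (u, p). \<Sum>i \<le> length p.
        f (u, take i p) * g (pre_digraph.awlast Q u (take i p), drop i p)),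
      one = (\<lambda>(u, p). if u \<in> verts Q \<and> p = [] then 1 else 0),
      zero = (\<lambda>\<pi>. 0),
      add = (\<lambda>f g \<pi>. f \<pi> + g \<pi>),
      smult = (\<lambda>c f \<pi>. c * f \<pi>)\<rparr>"

definition path_elem :: "('v, 'e) path \<Rightarrow> ('v, 'e) path \<Rightarrow> 'k::field" where
  "path_elem \<pi> = (\<lambda>\<rho>. if \<rho> = \<pi> then 1 else 0)"

text \<open>The \<open>m\<close>-th power of the arrow ideal is spanned by the paths of length at least \<open>m\<close>.\<close>

definition arrow_ideal_power ::
  "('v, 'e) pre_digraph \<Rightarrow> nat \<Rightarrow> (('v, 'e) path \<Rightarrow> 'k::field) set" where
  "arrow_ideal_power Q m =
     {f \<in> carrier (path_algebra Q). \<forall>u p. length p < m \<longrightarrow> f (u, p) = 0}"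

definition admissible_ideal ::
  "('v, 'e) pre_digraph \<Rightarrow> (('v, 'e) path \<Rightarrow> 'k::field) set \<Rightarrow> bool" where
  "admissible_ideal Q I \<longleftrightarrow> ideal I (path_algebra Q) \<and>
     (\<exists>m \<ge> 2. arrow_ideal_power Q m \<subseteq> I) \<and> I \<subseteq> arrow_ideal_power Q 2"

text \<open>
  The quotient ring with its scalar multiplication.  For a coset \<open>C = I + a\<close> the set
  \<open>I + c C\<close> is the coset of \<open>c a\<close>, also for \<open>c = 0\<close>.
\<close>

definition bound_quiver_algebra ::
  "('v, 'e) pre_digraph \<Rightarrow> (('v, 'e) path \<Rightarrow> 'k::field) set \<Rightarrow>
   ('k, (('v, 'e) path \<Rightarrow> 'k) set) module" where
  "bound_quiver_algebra Q I = (let R = (path_algebra Q :: ('k, ('v, 'e) path \<Rightarrow> 'k) module) in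
     ring.extend (R Quot I)
       (module.fields (\<lambda>c C. I <+>\<^bsub>R\<^esub> ((\<lambda>f. c \<odot>\<^bsub>R\<^esub> f) ` C))))"


section \<open>Star algebras\<close>

datatype star_vertex = VX nat | VZ | VY nat

datatype star_arrow = ArrA nat | ArrB nat

definition star_quiver :: "nat \<Rightarrow> nat \<Rightarrow> (star_vertex, star_arrow) pre_digraph" where
  "star_quiver r s =
     \<lparr>verts = VX ` {1..r} \<union> {VZ} \<union> VY ` {1..s},
      arcs = ArrA ` {1..r} \<union> ArrB ` {1..s},
      tail = (\<lambda>e. case e of ArrA i \<Rightarrow> VX i | ArrB j \<Rightarrow> VZ),
      head = (\<lambda>e. case e of ArrA i \<Rightarrow> VZ | ArrB j \<Rightarrow> VY j)\<rparr>"

text \<open>The arrow \<open>(i, j)\<close> runs from \<open>y\<^sub>j\<close> to \<open>x\<^sub>i\<close>.\<close>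

definition B_quiver :: "nat \<Rightarrow> nat \<Rightarrow> ((star_vertex, star_arrow) path \<Rightarrow> 'k::field) set \<Rightarrow>
    (star_vertex, nat \<times> nat) pre_digraph" where
  "B_quiver r s I =
     \<lparr>verts = VX ` {1..r} \<union> VY ` {1..s},
      arcs = {(i, j). i \<in> {1..r} \<and> j \<in> {1..s} \<and> path_elem (VX i, [ArrA i, ArrB j]) \<notin> I},
      tail = (\<lambda>(i, j). VY j),
      head = (\<lambda>(i, j). VX i)\<rparr>"


section \<open>Graphs and their spectra\<close>

text \<open>A graph is a pair of a vertex set and a set of edges \<open>{u, v}\<close>.\<close>

type_synonym 'v ugraph = "'v set \<times> 'v set set"

text \<open>Parallel arrows would be merged; the quivers \<open>B_quiver r s I\<close> have none.\<close>

definition underlying_graph :: "('v, 'e) pre_digraph \<Rightarrow> 'v ugraph" where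
  "underlying_graph Q = (verts Q, (\<lambda>e. {tail Q e, head Q e}) ` arcs Q)"

definition degree_in :: "'v ugraph \<Rightarrow> 'v \<Rightarrow> nat" where
  "degree_in G v = card {e \<in> snd G. v \<in> e}"

definition bipartite_graph :: "'v ugraph \<Rightarrow> bool" where
  "bipartite_graph G \<longleftrightarrow> (\<exists>U V. U \<union> V = fst G \<and> U \<inter> V = {} \<and>
     (\<forall>e \<in> snd G. \<exists>u \<in> U. \<exists>v \<in> V. e = {u, v}))"

definition adjacency_mat :: "'v ugraph \<Rightarrow> 'v list \<Rightarrow> real mat" where
  "adjacency_mat G vs = mat (length vs) (length vs)
     (\<lambda>(i, j). if {vs ! i, vs ! j} \<in> snd G then 1 else 0)"

text \<open>
  The eigenvalues with multiplicity in decreasing order, for a finite graph.  All roots of the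
  characteristic polynomial are real because the matrix is symmetric, and they do not depend
  on the chosen enumeration of the vertices.
\<close>

definition graph_eigenvalues :: "'v ugraph \<Rightarrow> real list" where
  "graph_eigenvalues G =
     (let vs = (SOME vs. distinct vs \<and> set vs = fst G)
      in rev (sorted_list_of_multiset (proots (char_poly (adjacency_mat G vs)))))"

text \<open>A graph with fewer than two vertices has no second largest eigenvalue and counts as
  reflexive.\<close>

definition reflexive_graph :: "'v ugraph \<Rightarrow> bool" where
  "reflexive_graph G \<longleftrightarrow>
     (length (graph_eigenvalues G) \<ge> 2 \<longrightarrow> graph_eigenvalues G ! 1 \<le> 2)"

definition salem_graph :: "'v ugraph \<Rightarrow> bool" where
  "salem_graph G \<longleftrightarrow> bipartite_graph G \<and> reflexive_graph G \<and>
     graph_eigenvalues G \<noteq> [] \<and> graph_eigenvalues G ! 0 > 2"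

definition semi_regular ::
  "nat \<Rightarrow> nat \<Rightarrow> ((star_vertex, star_arrow) path \<Rightarrow> 'k::field) set \<Rightarrow> bool" where
  "semi_regular r s I \<longleftrightarrow> (let G = underlying_graph (B_quiver r s I) in
     (\<forall>i \<in> {1..r}. \<forall>i' \<in> {1..r}. degree_in G (VX i) = degree_in G (VX i')) \<and>
     (\<forall>j \<in> {1..s}. \<forall>j' \<in> {1..s}. degree_in G (VY j) = degree_in G (VY j')))"

end

theory Submission
  imports Defs "Jordan_Normal_Form.DL_Rank" "Jordan_Normal_Form.Schur_Decomposition"
begin

hide_const (open) Polynomial.smult Modules.module Multiset.mult

text \<open>
  For a bounded complex of projectives, four-term exact sequences relate the parts of the complex and
  of its image under the Nakayama functor at the vertices of the star.  Hence \<open>\<nu>\<^sub>2\<^sup>-\<^sup>1\<close> acts on dimension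
  vectors by an explicit integral map \<open>\<Phi>\<close>, and cohomology in degree \<open>0\<close> only is inherited by the objects
  between a projective and the injective that ends its orbit.  So \<open>2\<close>-representation-finiteness says that
  some power of \<open>\<Phi>\<close> carries the dimension vector of every indecomposable projective to one of the same
  kind, and that \<open>\<Phi>\<close> keeps these vectors nonnegative; in particular all their \<open>\<Phi>\<close>-orbits are finite.

  An eigenvector for \<open>\<theta> > 2\<close> of the adjacency matrix whose entries sum to zero on both sides gives a
  linear functional that satisfies \<open>u\<^sub>m\<^sub>+\<^sub>2 = (2 - \<theta>\<^sup>2) u\<^sub>m\<^sub>+\<^sub>1 - u\<^sub>m\<close> along an orbit, which is unbounded unless it is
  zero.  Thus all eigenvectors for eigenvalues above \<open>2\<close> are constant on both sides, where the matrix has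
  trace \<open>0\<close>; hence there is at most one, namely \<open>\<surd>(d e)\<close> for the degrees \<open>d\<close> and \<open>e\<close>.  The coordinate sums
  satisfy the same kind of recurrence with \<open>2 - N\<close> in place of \<open>2 - \<theta>\<^sup>2\<close>, where \<open>N = r + s + d e - r d\<close>.
  This forces \<open>0 \<le> N \<le> 4\<close>, the value \<open>4\<close> occurs for \<open>r = s = 4\<close> only, and nonnegativity excludes the
  remaining cases with \<open>d e \<le> 4\<close>.
\<close>

section \<open>Subspaces and dimensions\<close>

text \<open>Projectives are never decomposed. A dual basis of a projective P expands every f in
  Hom(P, A) as the sum of the f(b) F_b, and this expansion yields exact sequences between the parts
  of P and of \<nu>P; so arbitrary complexes of projectives can be handled. Of an object of the
  derived category only the numbers dim H^i(C) e are kept, for idempotents e. They are invariant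
  under quasi-isomorphisms, hence along zigzags. The orbits close up because the orbit of P_v ends
  in an injective with the dimension vector of some \<nu>P_w. One more application of the inverse of
  \<nu>_2 turns \<nu>P_w into P_w[2], and an even shift leaves Euler characteristics unchanged, so
  the orbit has come back to the vector of a projective. The number N is 3 minus the trace of the 3
  x 3 matrix that \<Phi> induces on the sum over the x_i, the entry at z and the sum over the y_j.
  This matrix has determinant 1 and, because r d = s e, the eigenvalue 1. Differences of consecutive
  values remove that eigenvalue and leave the factor X^2 - (2 - N) X + 1.\<close>

abbreviation scalars :: "'k::field ring" where
  "scalars \<equiv> ring_of_type_algebra"

lemma scalars_simps [simp]:
  "carrier scalars = UNIV" "\<zero>\<^bsub>scalars\<^esub> = 0" "\<one>\<^bsub>scalars\<^esub> = 1"
  "a \<oplus>\<^bsub>scalars\<^esub> b = a + b" "a \<otimes>\<^bsub>scalars\<^esub> b = a * b"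
  by (simp_all add: ring_of_type_algebra_def)

lemma field_scalars: "field (scalars :: 'k::field ring)"
  by (rule field_from_type_algebra)

definition subsp :: "('k::field, 'm, 'z) module_scheme \<Rightarrow> 'm set \<Rightarrow> bool" where
  "subsp V U \<longleftrightarrow> U \<subseteq> carrier V \<and> \<zero>\<^bsub>V\<^esub> \<in> U \<and>
     (\<forall>x \<in> U. \<forall>y \<in> U. x \<oplus>\<^bsub>V\<^esub> y \<in> U) \<and> (\<forall>c. \<forall>x \<in> U. c \<odot>\<^bsub>V\<^esub> x \<in> U)"

definition lin_on ::
  "('k::field, 'm, 'y) module_scheme \<Rightarrow> ('k, 'n, 'z) module_scheme \<Rightarrow> 'm set \<Rightarrow> ('m \<Rightarrow> 'n) \<Rightarrow> bool"
  where
  "lin_on V W U f \<longleftrightarrow> (\<forall>x \<in> U. f x \<in> carrier W) \<and>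
     (\<forall>x \<in> U. \<forall>y \<in> U. f (x \<oplus>\<^bsub>V\<^esub> y) = f x \<oplus>\<^bsub>W\<^esub> f y) \<and>
     (\<forall>c. \<forall>x \<in> U. f (c \<odot>\<^bsub>V\<^esub> x) = c \<odot>\<^bsub>W\<^esub> f x)"

text \<open>Subspaces are subsets of one fixed record, and dimensions are taken by restricting its
  carrier: the parts \<open>M e\<close>, the cocycles and the coboundaries all live in the same
  module.\<close>

definition vdim :: "('k::field, 'm, 'z) module_scheme \<Rightarrow> 'm set \<Rightarrow> nat" where
  "vdim V U = vectorspace.dim scalars (V\<lparr>carrier := U\<rparr>)"

definition lker :: "('k::field, 'n, 'z) module_scheme \<Rightarrow> 'm set \<Rightarrow> ('m \<Rightarrow> 'n) \<Rightarrow> 'm set" where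
  "lker W U f = {x \<in> U. f x = \<zero>\<^bsub>W\<^esub>}"

lemma vectorspaceI_module:
  "Module.module (scalars :: 'k::field ring) V \<Longrightarrow> vectorspace scalars V"
  by (simp add: vectorspace_def field_scalars)

lemma vectorspace_fd_space: "fd_space V \<Longrightarrow> vectorspace scalars V"
  by (simp add: fd_space_def vectorspaceI_module)

lemma module_fd_space: "fd_space V \<Longrightarrow> Module.module scalars V"
  by (simp add: fd_space_def)

lemma fin_dim_fd_space:
  assumes "fd_space V"
  shows "vectorspace.fin_dim scalars V"
proof -
  interpret vectorspace scalars V
    by (rule vectorspace_fd_space[OF assms])
  obtain B where B: "finite B" "B \<subseteq> carrier V"
    "\<And>x. x \<in> carrier V \<Longrightarrow> \<exists>c. x = (\<Oplus>\<^bsub>V\<^esub> b \<in> B. c b \<odot>\<^bsub>V\<^esub> b)"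
    using assms unfolding fd_space_def by blast
  have "span B = carrier V"
  proof
    show "span B \<subseteq> carrier V" by (rule span_is_subset2[OF B(2)])
    show "carrier V \<subseteq> span B"
      using B unfolding span_def lincomb_def by fastforce
  qed
  with B show ?thesis unfolding fin_dim_def by blast
qed

lemma fd_spaceI:
  assumes "vectorspace (scalars :: 'k::field ring) V" "vectorspace.fin_dim scalars V"
  shows "fd_space V"
proof -
  interpret vectorspace scalars V
    by (rule assms(1))
  obtain B where B: "finite B" "B \<subseteq> carrier V" "span B = carrier V"
    using assms(2) unfolding fin_dim_def by blast
  have "\<exists>c. x = (\<Oplus>\<^bsub>V\<^esub> b \<in> B. c b \<odot>\<^bsub>V\<^esub> b)" if "x \<in> carrier V" for x
    using that B finite_span[OF B(1,2)] unfolding lincomb_def by blast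
  with B show ?thesis
    unfolding fd_space_def using module_axioms is_module by blast
qed

lemma subspD:
  assumes "subsp V U"
  shows "U \<subseteq> carrier V" "\<zero>\<^bsub>V\<^esub> \<in> U" "x \<in> U \<Longrightarrow> y \<in> U \<Longrightarrow> x \<oplus>\<^bsub>V\<^esub> y \<in> U" "x \<in> U \<Longrightarrow> c \<odot>\<^bsub>V\<^esub> x \<in> U"
    "x \<in> U \<Longrightarrow> x \<in> carrier V"
  using assms unfolding subsp_def by auto

lemma subsp_carrier:
  assumes "Module.module (scalars :: 'k::field ring) V"
  shows "subsp V (carrier V)"
proof -
  interpret Module.module scalars V by (rule assms)
  show ?thesis unfolding subsp_def by auto
qed

lemma module_uminus_eq:
  assumes "Module.module (scalars :: 'k::field ring) V" "x \<in> carrier V"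
  shows "\<ominus>\<^bsub>V\<^esub> x = (-1) \<odot>\<^bsub>V\<^esub> x"
proof -
  interpret Module.module scalars V by (rule assms)
  have "(-1) \<odot>\<^bsub>V\<^esub> x \<oplus>\<^bsub>V\<^esub> x = (-1 + 1) \<odot>\<^bsub>V\<^esub> x"
    using smult_l_distr[of "-1" 1 x] smult_one[of x] assms(2) by simp
  also have "\<dots> = \<zero>\<^bsub>V\<^esub>"
    using lmult_0[of x] assms(2) by simp
  finally show ?thesis
    using assms(2) M.minus_equality smult_closed[of "-1" x] by simp
qed

lemma subsp_minus:
  assumes "Module.module (scalars :: 'k::field ring) V" "subsp V U" "x \<in> U" "y \<in> U"
  shows "x \<ominus>\<^bsub>V\<^esub> y \<in> U"
proof -
  have "y \<in> carrier V" using assms(2,4) by (simp add: subspD(5))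
  then have "x \<ominus>\<^bsub>V\<^esub> y = x \<oplus>\<^bsub>V\<^esub> (-1) \<odot>\<^bsub>V\<^esub> y"
    using module_uminus_eq[OF assms(1)] unfolding a_minus_def by simp
  then show ?thesis using assms(2-4) unfolding subsp_def by simp
qed

lemma subsp_submodule:
  assumes "Module.module (scalars :: 'k::field ring) V"
  shows "subsp V U \<longleftrightarrow> submodule scalars U V"
  using assms unfolding subsp_def submodule_def by auto

lemma module_subsp:
  assumes "Module.module (scalars :: 'k::field ring) V" "subsp V U"
  shows "Module.module scalars (V\<lparr>carrier := U\<rparr>)"
  using assms LinearCombinations.module.submodule_is_module subsp_submodule by blast

text \<open>Independent subsets of \<open>U\<close> stay independent in \<open>V\<close>, so their
  size is bounded by dim V; a maximal one is a finite basis of \<open>U\<close>.\<close>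

lemma fd_space_subsp:
  assumes "fd_space V" "subsp V U"
  shows "fd_space (V\<lparr>carrier := U\<rparr>)"
proof -
  interpret V: vectorspace scalars V
    by (rule vectorspace_fd_space[OF assms(1)])
  have mod: "Module.module scalars V" by (rule module_fd_space[OF assms(1)])
  interpret U: vectorspace scalars "V\<lparr>carrier := U\<rparr>"
    by (rule vectorspaceI_module[OF module_subsp[OF mod assms(2)]])
  have sm: "submodule scalars U V" using assms(2) subsp_submodule[OF mod] by simp
  have UV: "U \<subseteq> carrier V" by (rule subspD[OF assms(2)])
  have fd: "V.fin_dim" by (rule fin_dim_fd_space[OF assms(1)])
  have ind: "V.lin_indpt S" if "U.lin_indpt S" "S \<subseteq> U" for S
    using V.span_li_not_depend(2)[OF that(2) sm] that by simp
  have "\<exists>S. finite S \<and> maximal S (\<lambda>S. S \<subseteq> carrier (V\<lparr>carrier := U\<rparr>) \<and> U.lin_indpt S)"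
  proof (rule maximal_exists)
    show "finite S \<and> card S \<le> V.dim" if "S \<subseteq> carrier (V\<lparr>carrier := U\<rparr>) \<and> U.lin_indpt S" for S
      using V.li_le_dim[OF fd, of S] ind[of S] that UV by auto
    show "{} \<subseteq> carrier (V\<lparr>carrier := U\<rparr>) \<and> U.lin_indpt {}"
      unfolding U.lin_dep_def by auto
  qed
  then obtain S where "finite S" "U.basis S"
    using U.max_li_is_basis by blast
  then have "U.fin_dim" unfolding U.fin_dim_def U.basis_def by blast
  then show ?thesis by (intro fd_spaceI) (auto intro: U.vectorspace_axioms)
qed

lemma lin_on_subset: "lin_on V W U f \<Longrightarrow> U' \<subseteq> U \<Longrightarrow> lin_on V W U' f"
  unfolding lin_on_def by blast

context
  fixes V :: "('k::field, 'm, 'y) module_scheme" and W :: "('k, 'n, 'z) module_scheme" and U f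
  assumes V: "Module.module (scalars :: 'k ring) V" and W: "Module.module (scalars :: 'k ring) W"
    and U: "subsp V U" and f: "lin_on V W U f"
begin

interpretation V: Module.module scalars V by (rule V)
interpretation W: Module.module scalars W by (rule W)

lemma lin_on_zero: "f \<zero>\<^bsub>V\<^esub> = \<zero>\<^bsub>W\<^esub>"
proof -
  have z: "\<zero>\<^bsub>V\<^esub> \<in> U" using subspD[OF U] by simp
  have "f (0 \<odot>\<^bsub>V\<^esub> \<zero>\<^bsub>V\<^esub>) = 0 \<odot>\<^bsub>W\<^esub> f \<zero>\<^bsub>V\<^esub>" "f \<zero>\<^bsub>V\<^esub> \<in> carrier W"
    using f z unfolding lin_on_def by blast+
  then show ?thesis
    using V.lmult_0[of "\<zero>\<^bsub>V\<^esub>"] W.lmult_0[of "f \<zero>\<^bsub>V\<^esub>"] by simp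
qed

lemma lin_on_diff:
  assumes "x \<in> U" "y \<in> U"
  shows "f (x \<ominus>\<^bsub>V\<^esub> y) = f x \<ominus>\<^bsub>W\<^esub> f y"
proof -
  have "(-1) \<odot>\<^bsub>V\<^esub> y \<in> U" "f y \<in> carrier W"
    using assms subspD[OF U] f unfolding lin_on_def by auto
  moreover have "y \<in> carrier V" using assms subspD(5)[OF U] by simp
  ultimately show ?thesis
    using assms f module_uminus_eq[OF V, of y] module_uminus_eq[OF W, of "f y"]
    unfolding lin_on_def a_minus_def by simp
qed

lemma subsp_lker: "subsp V (lker W U f)"
  unfolding subsp_def lker_def
  using subspD[OF U] f lin_on_zero W.smult_r_null unfolding lin_on_def by auto

lemma subsp_image:
  shows "subsp W (f ` U)"
proof -
  have "c \<odot>\<^bsub>W\<^esub> f x = f (c \<odot>\<^bsub>V\<^esub> x)" "f x \<in> carrier W" if "x \<in> U" for c x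
    using f that unfolding lin_on_def by auto
  moreover have "f x \<oplus>\<^bsub>W\<^esub> f y = f (x \<oplus>\<^bsub>V\<^esub> y)" if "x \<in> U" "y \<in> U" for x y
    using f that unfolding lin_on_def by auto
  moreover have "\<zero>\<^bsub>W\<^esub> \<in> f ` U" using lin_on_zero subspD[OF U] by (metis imageI)
  ultimately show ?thesis
    unfolding subsp_def using subspD[OF U] by auto
qed

lemma lin_on_inj:
  assumes "lker W U f \<subseteq> {\<zero>\<^bsub>V\<^esub>}"
  shows "inj_on f U"
proof
  fix x y assume xy: "x \<in> U" "y \<in> U" "f x = f y"
  have "f y \<in> carrier W" using xy f unfolding lin_on_def by blast
  then have "f (x \<ominus>\<^bsub>V\<^esub> y) = \<zero>\<^bsub>W\<^esub>"
    using lin_on_diff[OF xy(1,2)] xy(3) W.M.r_neg unfolding a_minus_def by simp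
  then have "x \<ominus>\<^bsub>V\<^esub> y = \<zero>\<^bsub>V\<^esub>"
    using assms subsp_minus[OF V U xy(1,2)] unfolding lker_def by auto
  then show "x = y" using xy subspD(5)[OF U] V.M.minus_equality[of x "\<ominus>\<^bsub>V\<^esub> y"]
    V.M.minus_minus unfolding a_minus_def by simp
qed

end

theorem rank_nullity_on:
  fixes V :: "('k::field, 'm, 'y) module_scheme" and W :: "('k, 'n, 'z) module_scheme"
  assumes V: "fd_space V" and W: "Module.module (scalars :: 'k ring) W"
    and U: "subsp V U" and f: "lin_on V W U f"
  shows "vdim V U = vdim V (lker W U f) + vdim W (f ` U)"
proof -
  have mU: "Module.module scalars (V\<lparr>carrier := U\<rparr>)"
    by (rule module_subsp[OF module_fd_space[OF V] U])
  interpret linear_map scalars "V\<lparr>carrier := U\<rparr>" W f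
  proof (intro linear_map.intro mod_hom.intro vectorspaceI_module mU W)
    show "mod_hom_axioms scalars (V\<lparr>carrier := U\<rparr>) W f"
      using f unfolding mod_hom_axioms_def module_hom_def lin_on_def by auto
  qed
  have "V.fin_dim" by (rule fin_dim_fd_space[OF fd_space_subsp[OF V U]])
  from rank_nullity[OF this] show ?thesis
    unfolding vdim_def im_def ker_def lker_def by simp
qed

lemma fd_space_image:
  fixes V :: "('k::field, 'm, 'y) module_scheme" and W :: "('k, 'n, 'z) module_scheme"
  assumes V: "fd_space V" and W: "Module.module (scalars :: 'k ring) W"
    and f: "lin_on V W (carrier V) f" and surj: "f ` carrier V = carrier W"
  shows "fd_space W"
proof -
  interpret linear_map scalars V W f
  proof (intro linear_map.intro mod_hom.intro vectorspaceI_module W module_fd_space[OF V])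
    show "mod_hom_axioms scalars V W f"
      using f unfolding mod_hom_axioms_def module_hom_def lin_on_def by auto
  qed
  have "V.fin_dim" by (rule fin_dim_fd_space[OF V])
  then have "W.fin_dim" using surj by (rule surj_fin_dim)
  then show ?thesis by (intro fd_spaceI) (auto intro: W.vectorspace_axioms)
qed

lemma vdim_zero:
  assumes "Module.module (scalars :: 'k::field ring) V"
  shows "vdim V {\<zero>\<^bsub>V\<^esub>} = 0"
proof -
  have s: "subsp V {\<zero>\<^bsub>V\<^esub>}"
  proof -
    interpret V: Module.module scalars V by (rule assms)
    show ?thesis unfolding subsp_def using V.smult_r_null by simp
  qed
  interpret vectorspace scalars "V\<lparr>carrier := {\<zero>\<^bsub>V\<^esub>}\<rparr>"
    by (rule vectorspaceI_module[OF module_subsp[OF assms s]])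
  have "gen_set {\<zero>\<^bsub>V\<^esub>}"
    using span_empty span_is_subset2[of "{\<zero>\<^bsub>V\<^esub>}"] in_own_span[of "{\<zero>\<^bsub>V\<^esub>}"] by auto
  then show ?thesis unfolding vdim_def using dim0I by simp
qed

lemma vdim_span1:
  assumes "Module.module (scalars :: 'k::field ring) V" "v \<in> carrier V" "v \<noteq> \<zero>\<^bsub>V\<^esub>"
  shows "vdim V (range (\<lambda>c. c \<odot>\<^bsub>V\<^esub> v)) = 1"
proof -
  interpret V: Module.module scalars V by (rule assms)
  let ?U = "range (\<lambda>c. c \<odot>\<^bsub>V\<^esub> v)"
  have s: "subsp V ?U"
  proof -
    have "\<zero>\<^bsub>V\<^esub> = 0 \<odot>\<^bsub>V\<^esub> v" using assms V.lmult_0[of v] by simp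
    moreover have "a \<odot>\<^bsub>V\<^esub> v \<oplus>\<^bsub>V\<^esub> b \<odot>\<^bsub>V\<^esub> v = (a + b) \<odot>\<^bsub>V\<^esub> v" "a \<odot>\<^bsub>V\<^esub> (b \<odot>\<^bsub>V\<^esub> v) = (a * b) \<odot>\<^bsub>V\<^esub> v"
      "a \<odot>\<^bsub>V\<^esub> v \<in> carrier V" for a b
      using V.smult_l_distr[of a b v] V.smult_assoc1[of a b v] assms(2) by simp_all
    ultimately show ?thesis unfolding subsp_def by auto
  qed
  interpret vectorspace scalars "V\<lparr>carrier := ?U\<rparr>"
    by (rule vectorspaceI_module[OF module_subsp[OF assms(1) s]])
  have vU: "v \<in> ?U" using V.smult_one[of v] assms(2) by (metis rangeI scalars_simps(3))
  have "gen_set {v}"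
  proof
    show "span {v} \<subseteq> carrier (V\<lparr>carrier := ?U\<rparr>)"
      using span_is_subset2[of "{v}"] vU by simp
    show "carrier (V\<lparr>carrier := ?U\<rparr>) \<subseteq> span {v}"
    proof
      fix x assume "x \<in> carrier (V\<lparr>carrier := ?U\<rparr>)"
      then obtain c where "x = c \<odot>\<^bsub>V\<^esub> v" by auto
      moreover have "v \<in> span {v}" using in_own_span[of "{v}"] vU by simp
      moreover have "submodule scalars (span {v}) (V\<lparr>carrier := ?U\<rparr>)"
        using span_is_submodule[of "{v}"] vU by simp
      ultimately show "x \<in> span {v}"
        using submodule.smult_closed[of scalars "span {v}" "V\<lparr>carrier := ?U\<rparr>" c v] by simp
    qed
  qed
  then show ?thesis unfolding vdim_def using dim1I[of v] assms(3) vU by simp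
qed

lemma subsp_vs:
  assumes "subsp V U" "subsp V U'" "U \<subseteq> U'"
  shows "subsp (V\<lparr>carrier := U'\<rparr>) U"
  using assms unfolding subsp_def by auto

lemma vdim_mono:
  assumes V: "fd_space V" and U: "subsp V U" and U': "subsp V U'" and UU: "U \<subseteq> U'"
  shows "vdim V U \<le> vdim V U'"
proof -
  interpret vectorspace scalars "V\<lparr>carrier := U'\<rparr>"
    by (rule vectorspace_fd_space[OF fd_space_subsp[OF V U']])
  have "subspace scalars U (V\<lparr>carrier := U'\<rparr>)"
    unfolding subspace_def
    using subsp_vs[OF U U' UU] vectorspace_axioms
      subsp_submodule[OF module_subsp[OF module_fd_space[OF V] U']] by blast
  from subspace_dim[OF this] show ?thesis
    unfolding vdim_def using fin_dim_fd_space[OF fd_space_subsp[OF V U']]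
      fin_dim_fd_space[OF fd_space_subsp[OF V U]] by simp
qed

text \<open>A basis of \<open>U\<close> is independent in \<open>U'\<close> and has dim U' elements,
  so it is a basis of \<open>U'\<close> as well.\<close>

lemma vdim_eq_imp_eq:
  assumes V: "fd_space V" and U: "subsp V U" and U': "subsp V U'" and UU: "U \<subseteq> U'"
    and eq: "vdim V U = vdim V U'"
  shows "U = U'"
proof -
  interpret V: vectorspace scalars "V\<lparr>carrier := U'\<rparr>"
    by (rule vectorspace_fd_space[OF fd_space_subsp[OF V U']])
  interpret U: vectorspace scalars "V\<lparr>carrier := U\<rparr>"
    by (rule vectorspace_fd_space[OF fd_space_subsp[OF V U]])
  have sm: "submodule scalars U (V\<lparr>carrier := U'\<rparr>)"
    using subsp_vs[OF U U' UU] subsp_submodule[OF module_subsp[OF module_fd_space[OF V] U']] by blast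
  have fdU: "U.fin_dim" "V.fin_dim"
    using fin_dim_fd_space[OF fd_space_subsp[OF V U']]
      fin_dim_fd_space[OF fd_space_subsp[OF V U]] by auto
  obtain b where b: "finite b" "U.basis b" using U.finite_basis_exists[OF fdU(1)] by blast
  then have bU: "b \<subseteq> U" "U.lin_indpt b" "U.span b = U" unfolding U.basis_def by auto
  have li: "V.lin_indpt b" "V.span b = U"
    using V.span_li_not_depend[OF bU(1) sm] bU by simp_all
  have "V.dim = card b" using U.dim_basis[OF b] eq unfolding vdim_def by simp
  then have "V.basis b" using V.dim_li_is_basis[OF fdU(2) b(1) _ li(1)] bU(1) UU by auto
  then show ?thesis using li(2) unfolding V.basis_def by simp
qed

lemma fd_space_direct_sum:
  assumes V: "fd_space (V :: ('k::field, 'm) module)" and W: "fd_space (W :: ('k, 'n) module)"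
  shows "fd_space (direct_sum V W)"
proof -
  let ?S = "direct_sum V W"
  interpret V: vectorspace scalars V by (rule vectorspace_fd_space[OF V])
  interpret W: vectorspace scalars W by (rule vectorspace_fd_space[OF W])
  interpret S: vectorspace scalars ?S
    by (rule direct_sum_is_vs) unfold_locales
  have mV: "Module.module scalars V" and mW: "Module.module scalars W"
    using V W by (auto simp: fd_space_def)
  interpret i1: mod_hom scalars V ?S "inj1 V W" by (rule inj1_hom[OF mV mW])
  interpret i2: mod_hom scalars W ?S "inj2 V W" by (rule inj2_hom[OF mV mW])
  obtain B where B: "finite B" "B \<subseteq> carrier V"
    "\<And>x. x \<in> carrier V \<Longrightarrow> \<exists>c. x = (\<Oplus>\<^bsub>V\<^esub> b \<in> B. c b \<odot>\<^bsub>V\<^esub> b)"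
    using V unfolding fd_space_def by blast
  obtain C where C: "finite C" "C \<subseteq> carrier W"
    "\<And>x. x \<in> carrier W \<Longrightarrow> \<exists>c. x = (\<Oplus>\<^bsub>W\<^esub> b \<in> C. c b \<odot>\<^bsub>W\<^esub> b)"
    using W unfolding fd_space_def by blast
  let ?G = "inj1 V W ` B \<union> inj2 V W ` C"
  have G: "?G \<subseteq> carrier ?S" using B(2) C(2) by auto
  have sm: "submodule scalars (S.span ?G) ?S" by (rule S.span_is_submodule[OF G])
  have sp: "subsp ?S (S.span ?G)" using sm subsp_submodule[OF direct_sum_is_module[OF mV mW]] by simp
  have gen: "S.span ?G = carrier ?S"
  proof
    show "S.span ?G \<subseteq> carrier ?S" by (rule S.span_is_subset2[OF G])
    have 1: "inj1 V W x \<in> S.span ?G" if x: "x \<in> carrier V" for x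
    proof -
      obtain c where c: "x = (\<Oplus>\<^bsub>V\<^esub> b \<in> B. c b \<odot>\<^bsub>V\<^esub> b)" using B(3)[OF x] by blast
      have "(\<lambda>b. c b \<odot>\<^bsub>V\<^esub> b) \<in> B \<rightarrow> carrier V" using B(2) by auto
      from i1.hom_sum[OF B(2) this]
      have "inj1 V W x = (\<Oplus>\<^bsub>?S\<^esub> b \<in> B. inj1 V W (c b \<odot>\<^bsub>V\<^esub> b))" using c by simp
      moreover have "(\<Oplus>\<^bsub>?S\<^esub> b \<in> F. inj1 V W (c b \<odot>\<^bsub>V\<^esub> b)) \<in> S.span ?G" if "F \<subseteq> B" for F
        using finite_subset[OF that B(1)] that
      proof (induct F rule: finite_induct)
        case empty
        show ?case using subspD[OF sp] by simp
      next
        case (insert a F)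
        have a: "inj1 V W a \<in> S.span ?G"
          using S.in_own_span[OF G] insert by auto
        have car: "b \<in> insert a F \<Longrightarrow> inj1 V W (c b \<odot>\<^bsub>V\<^esub> b) \<in> carrier ?S" for b
          using insert B(2) by auto
        have "(\<Oplus>\<^bsub>?S\<^esub> b \<in> insert a F. inj1 V W (c b \<odot>\<^bsub>V\<^esub> b)) =
          c a \<odot>\<^bsub>?S\<^esub> inj1 V W a \<oplus>\<^bsub>?S\<^esub> (\<Oplus>\<^bsub>?S\<^esub> b \<in> F. inj1 V W (c b \<odot>\<^bsub>V\<^esub> b))"
          using insert car B(2) by (subst S.finsum_insert) auto
        then show ?case using insert a subspD[OF sp] by auto
      qed
      ultimately show ?thesis by simp
    qed
    have 2: "inj2 V W x \<in> S.span ?G" if x: "x \<in> carrier W" for x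
    proof -
      obtain c where c: "x = (\<Oplus>\<^bsub>W\<^esub> b \<in> C. c b \<odot>\<^bsub>W\<^esub> b)" using C(3)[OF x] by blast
      have "(\<lambda>b. c b \<odot>\<^bsub>W\<^esub> b) \<in> C \<rightarrow> carrier W" using C(2) by auto
      from i2.hom_sum[OF C(2) this]
      have "inj2 V W x = (\<Oplus>\<^bsub>?S\<^esub> b \<in> C. inj2 V W (c b \<odot>\<^bsub>W\<^esub> b))" using c by simp
      moreover have "(\<Oplus>\<^bsub>?S\<^esub> b \<in> F. inj2 V W (c b \<odot>\<^bsub>W\<^esub> b)) \<in> S.span ?G" if "F \<subseteq> C" for F
        using finite_subset[OF that C(1)] that
      proof (induct F rule: finite_induct)
        case empty
        show ?case using subspD[OF sp] by simp
      next
        case (insert a F)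
        have a: "inj2 V W a \<in> S.span ?G"
          using S.in_own_span[OF G] insert by auto
        have car: "b \<in> insert a F \<Longrightarrow> inj2 V W (c b \<odot>\<^bsub>W\<^esub> b) \<in> carrier ?S" for b
          using insert C(2) by auto
        have "(\<Oplus>\<^bsub>?S\<^esub> b \<in> insert a F. inj2 V W (c b \<odot>\<^bsub>W\<^esub> b)) =
          c a \<odot>\<^bsub>?S\<^esub> inj2 V W a \<oplus>\<^bsub>?S\<^esub> (\<Oplus>\<^bsub>?S\<^esub> b \<in> F. inj2 V W (c b \<odot>\<^bsub>W\<^esub> b))"
          using insert car C(2) by (subst S.finsum_insert) auto
        then show ?case using insert a subspD[OF sp] by auto
      qed
      ultimately show ?thesis by simp
    qed
    show "carrier ?S \<subseteq> S.span ?G"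
    proof
      fix z assume "z \<in> carrier ?S"
      then obtain x y where z: "z = (x, y)" "x \<in> carrier V" "y \<in> carrier W"
        unfolding direct_sum_def by auto
      then have "z = inj1 V W x \<oplus>\<^bsub>?S\<^esub> inj2 V W y"
        unfolding inj1_def inj2_def direct_sum_def by simp
      then show "z \<in> S.span ?G" using 1 2 z subspD[OF sp] by auto
    qed
  qed
  show ?thesis
    using B(1) C(1) G gen
    by (intro fd_spaceI S.vectorspace_axioms) (auto simp only: S.fin_dim_def intro!: exI[of _ ?G])
qed

section \<open>Complexes of vector spaces\<close>

lemma vdim_inj_image:
  assumes "fd_space V" "Module.module scalars W" "subsp V U" "lin_on V W U f"
    and "lker W U f \<subseteq> {\<zero>\<^bsub>V\<^esub>}"
  shows "vdim W (f ` U) = vdim V U"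
proof -
  have "\<zero>\<^bsub>V\<^esub> \<in> lker W U f"
    using subspD(2)[OF subsp_lker[OF module_fd_space[OF assms(1)] assms(2-4)]] .
  then have "lker W U f = {\<zero>\<^bsub>V\<^esub>}" using assms(5) by blast
  then show ?thesis
    using rank_nullity_on[OF assms(1-4)] vdim_zero[OF module_fd_space[OF assms(1)]] by simp
qed

text \<open>Drops the additional record fields, because \<open>fd_space_direct_sum\<close> is stated
  for bare module records.\<close>

definition plain :: "('k, 'm, 'z) module_scheme \<Rightarrow> ('k, 'm) module" where
  "plain V = \<lparr>carrier = carrier V, mult = mult V, one = one V, zero = zero V, add = add V,
     smult = smult V\<rparr>"

lemma plain_simps [simp]:
  "carrier (plain V) = carrier V" "\<zero>\<^bsub>plain V\<^esub> = \<zero>\<^bsub>V\<^esub>" "x \<oplus>\<^bsub>plain V\<^esub> y = x \<oplus>\<^bsub>V\<^esub> y"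
  "c \<odot>\<^bsub>plain V\<^esub> x = c \<odot>\<^bsub>V\<^esub> x"
  by (simp_all add: plain_def)

lemma module_plain:
  assumes "Module.module (scalars :: 'k::field ring) V"
  shows "Module.module scalars (plain V)"
proof -
  interpret V: Module.module scalars V by (rule assms)
  show ?thesis
  proof (rule Module.moduleI)
    show "abelian_group (plain V)"
    proof (rule abelian_groupI)
      show "\<exists>y \<in> carrier (plain V). y \<oplus>\<^bsub>plain V\<^esub> x = \<zero>\<^bsub>plain V\<^esub>" if "x \<in> carrier (plain V)" for x
        using that by (auto intro!: bexI[of _ "\<ominus>\<^bsub>V\<^esub> x"] simp: V.M.l_neg)
    qed (auto simp: V.M.a_ac)
    show "cring (scalars :: 'k ring)" by (rule cring_from_type_algebra)
  qed (auto simp: V.smult_l_distr[simplified] V.smult_r_distr[simplified] V.smult_assoc1[simplified]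
      V.smult_closed[simplified] V.smult_one[simplified])
qed

lemma fd_space_plain:
  assumes "fd_space V"
  shows "fd_space (plain V)"
  by (rule fd_space_image[OF assms module_plain[OF module_fd_space[OF assms]], where f = id])
    (use module_fd_space[OF assms] in \<open>auto simp: lin_on_def\<close>)

lemma direct_sum_simps [simp]:
  "carrier (direct_sum V W) = carrier V \<times> carrier W" "\<zero>\<^bsub>direct_sum V W\<^esub> = (\<zero>\<^bsub>V\<^esub>, \<zero>\<^bsub>W\<^esub>)"
  "p \<oplus>\<^bsub>direct_sum V W\<^esub> q = (fst p \<oplus>\<^bsub>V\<^esub> fst q, snd p \<oplus>\<^bsub>W\<^esub> snd q)"
  "c \<odot>\<^bsub>direct_sum V W\<^esub> p = (c \<odot>\<^bsub>V\<^esub> fst p, c \<odot>\<^bsub>W\<^esub> snd p)"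
  by (simp_all add: direct_sum_def)

text \<open>The map \<open>Z \<oplus> B' \<rightarrow> W\<close>, \<open>(z, b) \<mapsto> f z + b\<close>, has kernel isomorphic to \<open>f\<^sup>-\<^sup>1(B') \<inter> Z\<close>.\<close>

lemma vdim_preimage:
  fixes V :: "('k::field, 'm, 'y) module_scheme" and W :: "('k, 'n, 'z) module_scheme"
  assumes V: "fd_space V" and W: "fd_space W" and Z: "subsp V Z" and B': "subsp W B'"
    and f: "lin_on V W Z f" and Z': "Z' = {f z \<oplus>\<^bsub>W\<^esub> b | z b. z \<in> Z \<and> b \<in> B'}"
  shows "vdim V Z + vdim W B' = vdim V {z \<in> Z. f z \<in> B'} + vdim W Z'"
proof -
  let ?S = "direct_sum (plain V) (plain W)"
  have mV: "Module.module scalars V" and mW: "Module.module scalars W"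
    using V W by (auto simp: module_fd_space)
  interpret V: Module.module scalars V by (rule mV)
  interpret W: Module.module scalars W by (rule mW)
  have S: "fd_space ?S" by (intro fd_space_direct_sum fd_space_plain V W)
  have U: "subsp ?S (Z \<times> B')"
    using subspD[OF Z] subspD[OF B'] unfolding subsp_def by auto
  have U0: "subsp ?S ({\<zero>\<^bsub>V\<^esub>} \<times> B')"
    using subspD[OF B'] V.smult_r_null unfolding subsp_def by auto
  \<comment> \<open>dim (Z \<times> B') is computed twice by rank and nullity: along the first
    projection, and below along \<open>?g\<close>. The first projection carries the kernel of
    \<open>?g\<close> isomorphically onto the preimage.\<close>
  have lf: "lin_on ?S V (Z \<times> B') fst"
    using subspD[OF Z] unfolding lin_on_def by auto
  have "lker V (Z \<times> B') fst = {\<zero>\<^bsub>V\<^esub>} \<times> B'" "fst ` (Z \<times> B') = Z"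
    using subspD(2)[OF Z] subspD(2)[OF B'] by (auto simp: lker_def)
  then have 1: "vdim ?S (Z \<times> B') = vdim ?S ({\<zero>\<^bsub>V\<^esub>} \<times> B') + vdim V Z"
    using rank_nullity_on[OF S mV U lf] by simp
  have ls: "lin_on ?S W ({\<zero>\<^bsub>V\<^esub>} \<times> B') snd"
    using subspD[OF B'] unfolding lin_on_def by auto
  have "vdim W (snd ` ({\<zero>\<^bsub>V\<^esub>} \<times> B')) = vdim ?S ({\<zero>\<^bsub>V\<^esub>} \<times> B')"
    by (rule vdim_inj_image[OF S mW U0 ls]) (auto simp: lker_def)
  moreover have "snd ` ({\<zero>\<^bsub>V\<^esub>} \<times> B') = B'" by force
  ultimately have 2: "vdim ?S ({\<zero>\<^bsub>V\<^esub>} \<times> B') = vdim W B'" by simp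
  let ?g = "\<lambda>p. f (fst p) \<oplus>\<^bsub>W\<^esub> snd p"
  have fz: "f z \<in> carrier W" "b \<in> carrier W" if "z \<in> Z" "b \<in> B'" for z b
    using f that subspD(5)[OF B'] unfolding lin_on_def by auto
  have lg: "lin_on ?S W (Z \<times> B') ?g"
    unfolding lin_on_def
  proof (intro conjI ballI allI)
    fix x y c assume x: "x \<in> Z \<times> B'"
    have cx: "f (fst x) \<in> carrier W" "snd x \<in> carrier W" using fz x by auto
    show "?g x \<in> carrier W" using cx by simp
    show "?g (c \<odot>\<^bsub>?S\<^esub> x) = c \<odot>\<^bsub>W\<^esub> ?g x"
      using x f cx W.smult_r_distr[of c] unfolding lin_on_def by auto
    assume y: "y \<in> Z \<times> B'"
    have cy: "f (fst y) \<in> carrier W" "snd y \<in> carrier W" using fz y by auto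
    have "f (fst x \<oplus>\<^bsub>V\<^esub> fst y) = f (fst x) \<oplus>\<^bsub>W\<^esub> f (fst y)"
      using x y f unfolding lin_on_def by auto
    then show "?g (x \<oplus>\<^bsub>?S\<^esub> y) = ?g x \<oplus>\<^bsub>W\<^esub> ?g y"
      using cx cy by (simp add: W.M.a_ac)
  qed
  have "?g ` (Z \<times> B') = Z'" unfolding Z' by force
  then have 3: "vdim ?S (Z \<times> B') = vdim ?S (lker W (Z \<times> B') ?g) + vdim W Z'"
    using rank_nullity_on[OF S mW U lg] by simp
  let ?K = "lker W (Z \<times> B') ?g"
  have K: "subsp ?S ?K" by (rule subsp_lker[OF module_fd_space[OF S] mW U lg])
  have lK: "lin_on ?S V ?K fst" by (rule lin_on_subset[OF lf]) (auto simp: lker_def)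
  have f0: "f \<zero>\<^bsub>V\<^esub> = \<zero>\<^bsub>W\<^esub>" by (rule lin_on_zero[OF mV mW Z f])
  have "vdim V (fst ` ?K) = vdim ?S ?K"
  proof (rule vdim_inj_image[OF S mV K lK])
    show "lker V ?K fst \<subseteq> {\<zero>\<^bsub>?S\<^esub>}"
      using f0 subspD(5)[OF B'] by (auto simp: lker_def)
  qed
  moreover have "fst ` ?K = {z \<in> Z. f z \<in> B'}"
  proof (intro equalityI subsetI)
    fix z assume "z \<in> fst ` ?K"
    then obtain b where zb: "z \<in> Z" "b \<in> B'" "f z \<oplus>\<^bsub>W\<^esub> b = \<zero>\<^bsub>W\<^esub>" by (auto simp: lker_def)
    have "f z = \<ominus>\<^bsub>W\<^esub> b" using W.M.minus_equality[OF zb(3)] fz[OF zb(1,2)] by simp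
    then show "z \<in> {z \<in> Z. f z \<in> B'}"
      using zb module_uminus_eq[OF mW, of b] fz[OF zb(1,2)] subspD(4)[OF B'] by simp
  next
    fix z assume "z \<in> {z \<in> Z. f z \<in> B'}"
    then have z: "z \<in> Z" "f z \<in> B'" by auto
    have "\<ominus>\<^bsub>W\<^esub> f z \<in> B'" "f z \<oplus>\<^bsub>W\<^esub> (\<ominus>\<^bsub>W\<^esub> f z) = \<zero>\<^bsub>W\<^esub>"
      using z module_uminus_eq[OF mW, of "f z"] subspD(4,5)[OF B'] W.M.r_neg[of "f z"] by auto
    then have "(z, \<ominus>\<^bsub>W\<^esub> f z) \<in> ?K" using z by (auto simp: lker_def)
    then show "z \<in> fst ` ?K" by (metis fst_conv imageI)
  qed
  ultimately show ?thesis using 1 2 3 by simp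
qed

text \<open>A complex of subspaces \<open>U i\<close> of given spaces \<open>V i\<close>. For an
  idempotent \<open>e\<close> the parts \<open>M e\<close> of the terms of a complex of modules are
  of this form, with the same differential.\<close>

definition vcpx ::
  "(int \<Rightarrow> ('k::field, 'm, 'z) module_scheme) \<Rightarrow> (int \<Rightarrow> 'm set) \<Rightarrow> (int \<Rightarrow> 'm \<Rightarrow> 'm) \<Rightarrow> bool" where
  "vcpx V U d \<longleftrightarrow> (\<forall>i. fd_space (V i) \<and> subsp (V i) (U i) \<and> lin_on (V i) (V (i + 1)) (U i) (d i) \<and>
     d i ` U i \<subseteq> U (i + 1) \<and> (\<forall>x \<in> U i. d (i + 1) (d i x) = \<zero>\<^bsub>V (i + 1 + 1)\<^esub>))"

definition vcyc ::
  "(int \<Rightarrow> ('k::field, 'm, 'z) module_scheme) \<Rightarrow> (int \<Rightarrow> 'm set) \<Rightarrow> (int \<Rightarrow> 'm \<Rightarrow> 'm) \<Rightarrow> int \<Rightarrow> 'm set"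
  where "vcyc V U d i = lker (V (i + 1)) (U i) (d i)"

definition vbd :: "(int \<Rightarrow> 'm set) \<Rightarrow> (int \<Rightarrow> 'm \<Rightarrow> 'm) \<Rightarrow> int \<Rightarrow> 'm set" where
  "vbd U d i = d (i - 1) ` U (i - 1)"

text \<open>The dimension of the i-th cohomology without forming a quotient; integer-valued, so that
  it can enter alternating sums.\<close>

definition hdim ::
  "(int \<Rightarrow> ('k::field, 'm, 'z) module_scheme) \<Rightarrow> (int \<Rightarrow> 'm set) \<Rightarrow> (int \<Rightarrow> 'm \<Rightarrow> 'm) \<Rightarrow> int \<Rightarrow> int"
  where "hdim V U d i = int (vdim (V i) (vcyc V U d i)) - int (vdim (V i) (vbd U d i))"

lemma vcpxD:
  assumes "vcpx V U d"
  shows "fd_space (V i)" "Module.module scalars (V i)" "subsp (V i) (U i)"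
    "lin_on (V i) (V (i + 1)) (U i) (d i)" "x \<in> U i \<Longrightarrow> d i x \<in> U (i + 1)"
    "x \<in> U i \<Longrightarrow> d (i + 1) (d i x) = \<zero>\<^bsub>V (i + 1 + 1)\<^esub>"
    "x \<in> U (i - 1) \<Longrightarrow> d (i - 1) x \<in> U i" "x \<in> U (i - 1) \<Longrightarrow> d i (d (i - 1) x) = \<zero>\<^bsub>V (i + 1)\<^esub>"
proof -
  show "fd_space (V i)" "subsp (V i) (U i)"
    "lin_on (V i) (V (i + 1)) (U i) (d i)" "x \<in> U i \<Longrightarrow> d i x \<in> U (i + 1)"
    "x \<in> U i \<Longrightarrow> d (i + 1) (d i x) = \<zero>\<^bsub>V (i + 1 + 1)\<^esub>" for i x
    using assms unfolding vcpx_def by blast+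
  from this(1) this(4,5)[of x "i - 1"]
  show "Module.module scalars (V i)" "x \<in> U (i - 1) \<Longrightarrow> d (i - 1) x \<in> U i"
    "x \<in> U (i - 1) \<Longrightarrow> d i (d (i - 1) x) = \<zero>\<^bsub>V (i + 1)\<^esub>"
    by (simp_all add: module_fd_space)
qed

lemma subsp_vcyc: "vcpx V U d \<Longrightarrow> subsp (V i) (vcyc V U d i)"
  unfolding vcyc_def by (intro subsp_lker vcpxD)

lemma subsp_vbd:
  assumes "vcpx V U d"
  shows "subsp (V i) (vbd U d i)"
  unfolding vbd_def
  using subsp_image[OF vcpxD(2,2,3,4)[OF assms], of "i - 1"] by simp

lemma vbd_vcyc: "vcpx V U d \<Longrightarrow> vbd U d i \<subseteq> vcyc V U d i"
  unfolding vcyc_def vbd_def lker_def by (auto simp: vcpxD(7,8))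

lemma hdim_nonneg:
  assumes "vcpx V U d"
  shows "hdim V U d i \<ge> 0"
  unfolding hdim_def
  using vdim_mono[OF vcpxD(1)[OF assms, of i] subsp_vbd[OF assms] subsp_vcyc[OF assms] vbd_vcyc[OF assms]]
  by simp

text \<open>Vanishing of a dimension becomes an inclusion of sets, the form in which the diagram
  chases below use and produce it.\<close>

lemma hdim_eq_0_iff:
  assumes "vcpx V U d"
  shows "hdim V U d i = 0 \<longleftrightarrow> vcyc V U d i \<subseteq> vbd U d i"
proof
  assume "hdim V U d i = 0"
  then have "vdim (V i) (vbd U d i) = vdim (V i) (vcyc V U d i)" unfolding hdim_def by simp
  from vdim_eq_imp_eq[OF vcpxD(1)[OF assms, of i] subsp_vbd[OF assms] subsp_vcyc[OF assms]
      vbd_vcyc[OF assms] this]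
  show "vcyc V U d i \<subseteq> vbd U d i" by simp
next
  assume "vcyc V U d i \<subseteq> vbd U d i"
  then have "vcyc V U d i = vbd U d i" using vbd_vcyc[OF assms, of i] by simp
  then show "hdim V U d i = 0" unfolding hdim_def by simp
qed

definition esgn :: "int \<Rightarrow> int" where "esgn i = (if even i then 1 else -1)"

lemma esgn_add1 [simp]: "esgn (i + 1) = - esgn i" by (simp add: esgn_def)

text \<open>Summing over the support makes the Euler characteristic independent of a choice of
  bounds; \<open>echar_eq\<close> inserts bounds where there are some.\<close>

definition echar :: "(int \<Rightarrow> int) \<Rightarrow> int" where
  "echar h = (\<Sum>i | h i \<noteq> 0. esgn i * h i)"

lemma echar_eq:
  assumes "\<And>i. i < -n \<or> i > n \<Longrightarrow> h i = 0"
  shows "echar h = (\<Sum>i = -n..n. esgn i * h i)"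
  unfolding echar_def
proof (rule sum.mono_neutral_left)
  show "{i. h i \<noteq> 0} \<subseteq> {-n..n}" using assms by (auto simp: not_less[symmetric])
qed auto

lemma esgn_telescope:
  "(\<Sum>i = a..a + int k. esgn i * (b i + b (i + 1))) =
     esgn a * b a + esgn (a + int k) * b (a + int k + 1)"
proof (induct k)
  case (Suc k)
  have "{a..a + int (Suc k)} = insert (a + int k + 1) {a..a + int k}" by auto
  then show ?case using Suc by (simp add: algebra_simps esgn_def)
qed (simp add: algebra_simps)

lemma vdim_vcpx:
  assumes "vcpx V U d"
  shows "vdim (V i) (U i) = vdim (V i) (vcyc V U d i) + vdim (V (i + 1)) (vbd U d (i + 1))"
  using rank_nullity_on[OF vcpxD(1,2,3,4)[OF assms], of i] unfolding vcyc_def vbd_def by simp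

text \<open>dim U_i = h_i + b_i + b_{i+1}, where h_i is the dimension of the cohomology and b_i that
  of the coboundaries; in the alternating sum the b_i cancel in pairs.\<close>

theorem echar_hdim:
  assumes C: "vcpx V U d" and n: "\<And>i. i \<le> -n \<or> i \<ge> n \<Longrightarrow> U i = {\<zero>\<^bsub>V i\<^esub>}" and "n \<ge> 0"
  shows "echar (hdim V U d) = echar (\<lambda>i. int (vdim (V i) (U i)))"
proof -
  define b where "b i = int (vdim (V i) (vbd U d i))" for i
  have z: "vdim (V i) (U i) = 0" if "i \<le> -n \<or> i \<ge> n" for i
    using vdim_zero[OF vcpxD(2)[OF C]] n[OF that] by simp
  have e: "int (vdim (V i) (U i)) = hdim V U d i + (b i + b (i + 1))" for i
    using vdim_vcpx[OF C, of i] unfolding b_def hdim_def by simp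
  have b0: "b i \<ge> 0" for i unfolding b_def by simp
  have hb: "hdim V U d i = 0 \<and> b i = 0 \<and> b (i + 1) = 0" if "i \<le> -n \<or> i \<ge> n" for i
    using e[of i] z[OF that] b0[of i] b0[of "i + 1"] hdim_nonneg[OF C, of i] by linarith
  have "echar (\<lambda>i. int (vdim (V i) (U i))) = (\<Sum>i = -n..n. esgn i * int (vdim (V i) (U i)))"
    by (rule echar_eq) (use z in auto)
  also have "\<dots> = (\<Sum>i = -n..n. esgn i * hdim V U d i + esgn i * (b i + b (i + 1)))"
    by (simp add: e algebra_simps)
  \<comment> \<open>Telescoping leaves b(-n) and b(n+1), and both vanish because the complex is zero
    in degrees -n and n.\<close>
  also have "\<dots> = (\<Sum>i = -n..n. esgn i * hdim V U d i)"
    using esgn_telescope[of b "-n" "nat (2 * n)"] \<open>n \<ge> 0\<close> hb[of "-n"] hb[of n]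
    by (simp add: sum.distrib)
  also have "\<dots> = echar (hdim V U d)"
    by (rule echar_eq[symmetric]) (use hb in auto)
  finally show ?thesis by simp
qed

section \<open>Vanishing of cohomology along short exact sequences of complexes\<close>

definition ses ::
  "(int \<Rightarrow> ('k::field, 'm, 'x) module_scheme) \<Rightarrow> (int \<Rightarrow> 'm set) \<Rightarrow> (int \<Rightarrow> 'm \<Rightarrow> 'm) \<Rightarrow> (int \<Rightarrow> 'm \<Rightarrow> 'n) \<Rightarrow>
   (int \<Rightarrow> ('k, 'n, 'y) module_scheme) \<Rightarrow> (int \<Rightarrow> 'n set) \<Rightarrow> (int \<Rightarrow> 'n \<Rightarrow> 'n) \<Rightarrow> (int \<Rightarrow> 'n \<Rightarrow> 'l) \<Rightarrow>
   (int \<Rightarrow> ('k, 'l, 'z) module_scheme) \<Rightarrow> (int \<Rightarrow> 'l set) \<Rightarrow> (int \<Rightarrow> 'l \<Rightarrow> 'l) \<Rightarrow> bool" where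
  "ses V U d f V' U' d' g V'' U'' d'' \<longleftrightarrow> vcpx V U d \<and> vcpx V' U' d' \<and> vcpx V'' U'' d'' \<and>
     (\<forall>i. lin_on (V i) (V' i) (U i) (f i) \<and> lin_on (V' i) (V'' i) (U' i) (g i) \<and>
       (\<forall>x \<in> U i. f (i + 1) (d i x) = d' i (f i x)) \<and>
       (\<forall>x \<in> U' i. g (i + 1) (d' i x) = d'' i (g i x)) \<and>
       lker (V' i) (U i) (f i) \<subseteq> {\<zero>\<^bsub>V i\<^esub>} \<and> f i ` U i = lker (V'' i) (U' i) (g i) \<and>
       g i ` U' i = U'' i)"

context
  fixes V :: "int \<Rightarrow> ('k::field, 'm, 'x) module_scheme" and U d f
    and V' :: "int \<Rightarrow> ('k, 'n, 'y) module_scheme" and U' d' g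
    and V'' :: "int \<Rightarrow> ('k, 'l, 'z) module_scheme" and U'' d''
  assumes ses: "ses V U d f V' U' d' g V'' U'' d''"
begin

lemma sesD:
  shows "vcpx V U d" "vcpx V' U' d'" "vcpx V'' U'' d''"
    "lin_on (V i) (V' i) (U i) (f i)" "lin_on (V' i) (V'' i) (U' i) (g i)"
    "x \<in> U i \<Longrightarrow> f (i + 1) (d i x) = d' i (f i x)"
    "y \<in> U' i \<Longrightarrow> g (i + 1) (d' i y) = d'' i (g i y)"
    "lker (V' i) (U i) (f i) \<subseteq> {\<zero>\<^bsub>V i\<^esub>}" "f i ` U i = lker (V'' i) (U' i) (g i)"
    "g i ` U' i = U'' i"
  using ses unfolding ses_def by blast+

lemma ses_pred:
  shows "x \<in> U (i - 1) \<Longrightarrow> f i (d (i - 1) x) = d' (i - 1) (f (i - 1) x)"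
    "y \<in> U' (i - 1) \<Longrightarrow> g i (d' (i - 1) y) = d'' (i - 1) (g (i - 1) y)"
  using sesD(6)[of x "i - 1"] sesD(7)[of y "i - 1"] by simp_all

lemma ses_f_in: "x \<in> U i \<Longrightarrow> f i x \<in> U' i \<and> g i (f i x) = \<zero>\<^bsub>V'' i\<^esub>"
  using sesD(9)[of i] unfolding lker_def by blast

lemma ses_f_inj: "inj_on (f i) (U i)"
  by (rule lin_on_inj[OF vcpxD(2)[OF sesD(1)] vcpxD(2)[OF sesD(2)] vcpxD(3)[OF sesD(1)] sesD(4) sesD(8)])

lemma ses_lift: "y \<in> U' i \<Longrightarrow> g i y = \<zero>\<^bsub>V'' i\<^esub> \<Longrightarrow> \<exists>x \<in> U i. y = f i x"
  using sesD(9)[of i] unfolding lker_def by blast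

lemma ses_zero:
  "f i \<zero>\<^bsub>V i\<^esub> = \<zero>\<^bsub>V' i\<^esub>" "g i \<zero>\<^bsub>V' i\<^esub> = \<zero>\<^bsub>V'' i\<^esub>"
  by (rule lin_on_zero[OF vcpxD(2)[OF sesD(1)] vcpxD(2)[OF sesD(2)] vcpxD(3)[OF sesD(1)] sesD(4)])
    (rule lin_on_zero[OF vcpxD(2)[OF sesD(2)] vcpxD(2)[OF sesD(3)] vcpxD(3)[OF sesD(2)] sesD(5)])

lemma ses_vdim: "vdim (V' i) (U' i) = vdim (V i) (U i) + vdim (V'' i) (U'' i)"
  using rank_nullity_on[OF vcpxD(1)[OF sesD(2)] vcpxD(2)[OF sesD(3)] vcpxD(3)[OF sesD(2)] sesD(5), of i]
    vdim_inj_image[OF vcpxD(1)[OF sesD(1)] vcpxD(2)[OF sesD(2)] vcpxD(3)[OF sesD(1)] sesD(4,8), of i]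
    sesD(9,10)[of i] by simp

text \<open>\<open>ses_mid\<close>, \<open>ses_right\<close> and \<open>ses_left\<close> are the
  exactness statements of the long exact cohomology sequence at its three kinds of places, for the
  case that both neighbours vanish. Each is a diagram chase in which an element of the middle
  complex is corrected until it lifts or becomes a cocycle.\<close>

lemma ses_mid:
  assumes "hdim V U d i = 0" "hdim V'' U'' d'' i = 0"
  shows "hdim V' U' d' i = 0"
  unfolding hdim_eq_0_iff[OF sesD(2)]
proof
  fix y assume "y \<in> vcyc V' U' d' i"
  then have y: "y \<in> U' i" "d' i y = \<zero>\<^bsub>V' (i + 1)\<^esub>" unfolding vcyc_def lker_def by auto
  have "g i y \<in> vcyc V'' U'' d'' i"
    using y sesD(7)[OF y(1)] ses_zero(2)[of "i + 1"] sesD(10)[of i] unfolding vcyc_def lker_def by auto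
  then obtain w where w: "w \<in> U'' (i - 1)" "g i y = d'' (i - 1) w"
    using assms(2) unfolding hdim_eq_0_iff[OF sesD(3)] vbd_def by blast
  obtain v where v: "v \<in> U' (i - 1)" "w = g (i - 1) v" using w(1) sesD(10)[of "i - 1"] by blast
  \<comment> \<open>\<open>g i y\<close> is the coboundary of \<open>w\<close>, and \<open>v\<close>
    lifts \<open>w\<close>; subtracting d' v moves \<open>y\<close> into the image of
    \<open>f\<close> without changing its class.\<close>
  let ?y = "y \<ominus>\<^bsub>V' i\<^esub> d' (i - 1) v"
  note sub = vcpxD(3)[OF sesD(2), of i] and m' = vcpxD(2)[OF sesD(2), of i] and m1 = vcpxD(2)[OF sesD(2), of "i + 1"]
    and m'' = vcpxD(2)[OF sesD(3), of i]
  interpret m': Module.module scalars "V' i" by (rule m')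
  interpret m1: Module.module scalars "V' (i + 1)" by (rule m1)
  interpret m'': Module.module scalars "V'' i" by (rule m'')
  have dv: "d' (i - 1) v \<in> U' i" "d' i (d' (i - 1) v) = \<zero>\<^bsub>V' (i + 1)\<^esub>"
    using vcpxD(7,8)[OF sesD(2) v(1)] by auto
  have y': "?y \<in> U' i" by (rule subsp_minus[OF m' sub y(1) dv(1)])
  have gy: "g i y \<in> carrier (V'' i)" using sesD(5)[of i] y(1) unfolding lin_on_def by blast
  have "g i ?y = g i y \<ominus>\<^bsub>V'' i\<^esub> g i (d' (i - 1) v)"
    by (rule lin_on_diff[OF m' m'' sub sesD(5) y(1) dv(1)])
  also have "g i (d' (i - 1) v) = g i y" using ses_pred(2)[OF v(1)] v w by simp
  finally have "g i ?y = \<zero>\<^bsub>V'' i\<^esub>" using gy m''.M.r_neg unfolding a_minus_def by simp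
  then obtain x where x: "x \<in> U i" "?y = f i x" using ses_lift[OF y'] by blast
  have "d' i ?y = d' i y \<ominus>\<^bsub>V' (i + 1)\<^esub> d' i (d' (i - 1) v)"
    by (rule lin_on_diff[OF m' m1 sub vcpxD(4)[OF sesD(2)] y(1) dv(1)])
  then have "d' i ?y = \<zero>\<^bsub>V' (i + 1)\<^esub>" using y(2) dv(2) m1.M.r_neg unfolding a_minus_def by simp
  then have "f (i + 1) (d i x) = f (i + 1) \<zero>\<^bsub>V (i + 1)\<^esub>" using x sesD(6)[OF x(1)] ses_zero by simp
  then have "d i x = \<zero>\<^bsub>V (i + 1)\<^esub>"
    using inj_onD[OF ses_f_inj] vcpxD(5)[OF sesD(1) x(1)] subspD(2)[OF vcpxD(3)[OF sesD(1)]] by blast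
  then obtain u where u: "u \<in> U (i - 1)" "x = d (i - 1) u"
    using assms(1) x(1) unfolding hdim_eq_0_iff[OF sesD(1)] vcyc_def lker_def vbd_def by blast
  have "?y = d' (i - 1) (f (i - 1) u)" using x u ses_pred(1)[OF u(1)] by simp
  moreover have "f (i - 1) u \<in> U' (i - 1)" using ses_f_in[OF u(1)] by simp
  ultimately have "?y \<in> vbd U' d' i" unfolding vbd_def by blast
  moreover have "d' (i - 1) v \<in> vbd U' d' i" using v unfolding vbd_def by blast
  ultimately have "?y \<oplus>\<^bsub>V' i\<^esub> d' (i - 1) v \<in> vbd U' d' i"
    using subspD(3)[OF subsp_vbd[OF sesD(2)]] by blast
  moreover have "?y \<oplus>\<^bsub>V' i\<^esub> d' (i - 1) v = y"
    using subspD(5)[OF sub] y(1) dv(1) m'.M.l_neg m'.M.a_assoc unfolding a_minus_def by simp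
  ultimately show "y \<in> vbd U' d' i" by simp
qed

lemma ses_right:
  assumes "hdim V' U' d' i = 0" "hdim V U d (i + 1) = 0"
  shows "hdim V'' U'' d'' i = 0"
  unfolding hdim_eq_0_iff[OF sesD(3)]
proof
  fix w assume "w \<in> vcyc V'' U'' d'' i"
  then have w: "w \<in> U'' i" "d'' i w = \<zero>\<^bsub>V'' (i + 1)\<^esub>" unfolding vcyc_def lker_def by auto
  obtain y where y: "y \<in> U' i" "w = g i y" using w(1) sesD(10)[of i] by blast
  have dy: "d' i y \<in> U' (i + 1)" using vcpxD(5)[OF sesD(2) y(1)] .
  have "g (i + 1) (d' i y) = \<zero>\<^bsub>V'' (i + 1)\<^esub>" using sesD(7)[OF y(1)] w y by simp
  then obtain x where x: "x \<in> U (i + 1)" "d' i y = f (i + 1) x" using ses_lift[OF dy] by blast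
  have "f (i + 1 + 1) (d (i + 1) x) = f (i + 1 + 1) \<zero>\<^bsub>V (i + 1 + 1)\<^esub>"
    using x sesD(6)[OF x(1)] ses_zero vcpxD(6)[OF sesD(2) y(1)] by simp
  then have "d (i + 1) x = \<zero>\<^bsub>V (i + 1 + 1)\<^esub>"
    using inj_onD[OF ses_f_inj] vcpxD(5)[OF sesD(1) x(1)] subspD(2)[OF vcpxD(3)[OF sesD(1)]] by blast
  then have "x \<in> vbd U d (i + 1)"
    using assms(2) x(1) unfolding hdim_eq_0_iff[OF sesD(1)] vcyc_def lker_def by blast
  then obtain u where u: "u \<in> U i" "x = d i u" unfolding vbd_def by auto
  note sub = vcpxD(3)[OF sesD(2), of i] and m' = vcpxD(2)[OF sesD(2), of i] and m1 = vcpxD(2)[OF sesD(2), of "i + 1"]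
    and m'' = vcpxD(2)[OF sesD(3), of i]
  interpret m': Module.module scalars "V' i" by (rule m')
  interpret m1: Module.module scalars "V' (i + 1)" by (rule m1)
  interpret m'': Module.module scalars "V'' i" by (rule m'')
  \<comment> \<open>The obstruction d' y to being a cocycle comes from \<open>x\<close> = d u in the
    first complex; subtracting f u removes it and leaves the image under \<open>g\<close>
    unchanged.\<close>
  let ?y = "y \<ominus>\<^bsub>V' i\<^esub> f i u"
  have fu: "f i u \<in> U' i" "g i (f i u) = \<zero>\<^bsub>V'' i\<^esub>" using ses_f_in[OF u(1)] by auto
  have y': "?y \<in> U' i" by (rule subsp_minus[OF m' sub y(1) fu(1)])
  have "d' i ?y = d' i y \<ominus>\<^bsub>V' (i + 1)\<^esub> d' i (f i u)"
    by (rule lin_on_diff[OF m' m1 sub vcpxD(4)[OF sesD(2)] y(1) fu(1)])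
  also have "d' i (f i u) = d' i y" using sesD(6)[OF u(1)] u x by simp
  finally have "d' i ?y = \<zero>\<^bsub>V' (i + 1)\<^esub>"
    using subspD(5)[OF vcpxD(3)[OF sesD(2)] dy] m1.M.r_neg unfolding a_minus_def by simp
  then obtain v where v: "v \<in> U' (i - 1)" "?y = d' (i - 1) v"
    using assms(1) y' unfolding hdim_eq_0_iff[OF sesD(2)] vcyc_def lker_def vbd_def by blast
  have "g i ?y = g i y \<ominus>\<^bsub>V'' i\<^esub> g i (f i u)"
    by (rule lin_on_diff[OF m' m'' sub sesD(5) y(1) fu(1)])
  then have "w = g i ?y" using fu y subspD(5)[OF vcpxD(3)[OF sesD(3)] w(1)] unfolding a_minus_def by simp
  then have "w = d'' (i - 1) (g (i - 1) v)" using v ses_pred(2)[OF v(1)] by simp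
  moreover have "g (i - 1) v \<in> U'' (i - 1)" using v sesD(10)[of "i - 1"] by blast
  ultimately show "w \<in> vbd U'' d'' i" unfolding vbd_def by blast
qed

lemma ses_left:
  assumes "hdim V' U' d' i = 0" "hdim V'' U'' d'' (i - 1) = 0"
  shows "hdim V U d i = 0"
  unfolding hdim_eq_0_iff[OF sesD(1)]
proof
  fix x assume "x \<in> vcyc V U d i"
  then have x: "x \<in> U i" "d i x = \<zero>\<^bsub>V (i + 1)\<^esub>" unfolding vcyc_def lker_def by auto
  have fx: "f i x \<in> U' i" "g i (f i x) = \<zero>\<^bsub>V'' i\<^esub>" using ses_f_in[OF x(1)] by auto
  have "d' i (f i x) = \<zero>\<^bsub>V' (i + 1)\<^esub>" using sesD(6)[OF x(1)] x ses_zero by simp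
  then obtain y where y: "y \<in> U' (i - 1)" "f i x = d' (i - 1) y"
    using assms(1) fx unfolding hdim_eq_0_iff[OF sesD(2)] vcyc_def lker_def vbd_def by blast
  have gy: "g (i - 1) y \<in> U'' (i - 1)" using y sesD(10)[of "i - 1"] by blast
  moreover have "d'' (i - 1) (g (i - 1) y) = \<zero>\<^bsub>V'' (i - 1 + 1)\<^esub>"
    using ses_pred(2)[OF y(1)] y fx by simp
  ultimately have "g (i - 1) y \<in> vbd U'' d'' (i - 1)"
    using assms(2) unfolding hdim_eq_0_iff[OF sesD(3)] vcyc_def lker_def by blast
  then obtain w where w: "w \<in> U'' (i - 1 - 1)" "g (i - 1) y = d'' (i - 1 - 1) w"
    unfolding vbd_def by blast
  obtain v where v: "v \<in> U' (i - 1 - 1)" "w = g (i - 1 - 1) v" using w(1) sesD(10)[of "i - 1 - 1"] by blast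
  note sub = vcpxD(3)[OF sesD(2), of "i - 1"] and m' = vcpxD(2)[OF sesD(2), of "i - 1"]
    and m1 = vcpxD(2)[OF sesD(2), of "i - 1 + 1"] and m'' = vcpxD(2)[OF sesD(3), of "i - 1"]
  interpret m1: Module.module scalars "V' i" using m1 by simp
  interpret m'': Module.module scalars "V'' (i - 1)" by (rule m'')
  let ?v = "d' (i - 1 - 1) v"
  let ?y = "y \<ominus>\<^bsub>V' (i - 1)\<^esub> ?v"
  have dv: "?v \<in> U' (i - 1)" "d' (i - 1) ?v = \<zero>\<^bsub>V' (i - 1 + 1)\<^esub>"
    using vcpxD(7,8)[OF sesD(2) v(1)] by auto
  have y': "?y \<in> U' (i - 1)" by (rule subsp_minus[OF m' sub y(1) dv(1)])
  have "g (i - 1) ?y = g (i - 1) y \<ominus>\<^bsub>V'' (i - 1)\<^esub> g (i - 1) ?v"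
    by (rule lin_on_diff[OF m' m'' sub sesD(5) y(1) dv(1)])
  also have "g (i - 1) ?v = g (i - 1) y" using ses_pred(2)[OF v(1)] v w by simp
  finally have "g (i - 1) ?y = \<zero>\<^bsub>V'' (i - 1)\<^esub>"
    using subspD(5)[OF vcpxD(3)[OF sesD(3)] gy] m''.M.r_neg unfolding a_minus_def by simp
  then obtain u where u: "u \<in> U (i - 1)" "?y = f (i - 1) u" using ses_lift[OF y'] by blast
  have "d' (i - 1) ?y = d' (i - 1) y \<ominus>\<^bsub>V' (i - 1 + 1)\<^esub> d' (i - 1) ?v"
    by (rule lin_on_diff[OF m' m1 sub vcpxD(4)[OF sesD(2)] y(1) dv(1)])
  moreover have "d' (i - 1) y \<in> carrier (V' (i - 1 + 1))"
    using vcpxD(4)[OF sesD(2), of "i - 1"] y(1) unfolding lin_on_def by blast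
  moreover have "\<ominus>\<^bsub>V' i\<^esub> \<zero>\<^bsub>V' i\<^esub> = \<zero>\<^bsub>V' i\<^esub>"
    using module_uminus_eq[of "V' i" "\<zero>\<^bsub>V' i\<^esub>"] m1 m1.smult_r_null by simp
  ultimately have "d' (i - 1) ?y = d' (i - 1) y" using dv(2) unfolding a_minus_def by simp
  then have "f i x = f i (d (i - 1) u)" using y u ses_pred(1)[OF u(1)] by simp
  then have "x = d (i - 1) u"
    using inj_onD[OF ses_f_inj] x(1) vcpxD(7)[OF sesD(1) u(1)] by blast
  then show "x \<in> vbd U d i" using u(1) unfolding vbd_def by blast
qed

end

section \<open>Modules over finite-dimensional algebras\<close>

lemma fd_algebraD:
  assumes "fd_algebra A"
  shows "ring A" "fd_space A" "Module.module scalars A"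
    "a \<in> carrier A \<Longrightarrow> b \<in> carrier A \<Longrightarrow> (c \<odot>\<^bsub>A\<^esub> a) \<otimes>\<^bsub>A\<^esub> b = c \<odot>\<^bsub>A\<^esub> (a \<otimes>\<^bsub>A\<^esub> b)"
    "a \<in> carrier A \<Longrightarrow> b \<in> carrier A \<Longrightarrow> a \<otimes>\<^bsub>A\<^esub> (c \<odot>\<^bsub>A\<^esub> b) = c \<odot>\<^bsub>A\<^esub> (a \<otimes>\<^bsub>A\<^esub> b)"
  using assms unfolding fd_algebra_def by (auto simp: module_fd_space)

lemma fd_rmodD:
  assumes "fd_rmod A M"
  shows "fd_space M" "Module.module scalars M"
    "x \<in> carrier M \<Longrightarrow> a \<in> carrier A \<Longrightarrow> ract M x a \<in> carrier M"
    "x \<in> carrier M \<Longrightarrow> y \<in> carrier M \<Longrightarrow> a \<in> carrier A \<Longrightarrow>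
       ract M (x \<oplus>\<^bsub>M\<^esub> y) a = ract M x a \<oplus>\<^bsub>M\<^esub> ract M y a"
    "x \<in> carrier M \<Longrightarrow> a \<in> carrier A \<Longrightarrow> b \<in> carrier A \<Longrightarrow>
       ract M x (a \<oplus>\<^bsub>A\<^esub> b) = ract M x a \<oplus>\<^bsub>M\<^esub> ract M x b"
    "x \<in> carrier M \<Longrightarrow> a \<in> carrier A \<Longrightarrow> b \<in> carrier A \<Longrightarrow>
       ract M x (a \<otimes>\<^bsub>A\<^esub> b) = ract M (ract M x a) b"
    "x \<in> carrier M \<Longrightarrow> ract M x \<one>\<^bsub>A\<^esub> = x"
    "x \<in> carrier M \<Longrightarrow> a \<in> carrier A \<Longrightarrow> ract M x (c \<odot>\<^bsub>A\<^esub> a) = c \<odot>\<^bsub>M\<^esub> ract M x a"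
    "x \<in> carrier M \<Longrightarrow> a \<in> carrier A \<Longrightarrow> ract M (c \<odot>\<^bsub>M\<^esub> x) a = c \<odot>\<^bsub>M\<^esub> ract M x a"
  using assms unfolding fd_rmod_def by (auto simp: module_fd_space)

lemma rhomD:
  assumes "f \<in> rhom A M N"
  shows "x \<in> carrier M \<Longrightarrow> f x \<in> carrier N"
    "x \<in> carrier M \<Longrightarrow> y \<in> carrier M \<Longrightarrow> f (x \<oplus>\<^bsub>M\<^esub> y) = f x \<oplus>\<^bsub>N\<^esub> f y"
    "x \<in> carrier M \<Longrightarrow> a \<in> carrier A \<Longrightarrow> f (ract M x a) = ract N (f x) a"
    "f \<in> extensional (carrier M)"
  using assms unfolding rhom_def by (auto simp: PiE_iff)

lemma ract_zero:
  assumes "fd_rmod A M" "a \<in> carrier A"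
  shows "ract M \<zero>\<^bsub>M\<^esub> a = \<zero>\<^bsub>M\<^esub>"
proof -
  interpret Module.module scalars M by (rule fd_rmodD[OF assms(1)])
  have z: "\<zero>\<^bsub>M\<^esub> \<in> carrier M" by simp
  have "ract M (0 \<odot>\<^bsub>M\<^esub> \<zero>\<^bsub>M\<^esub>) a = 0 \<odot>\<^bsub>M\<^esub> ract M \<zero>\<^bsub>M\<^esub> a"
    by (rule fd_rmodD(9)[OF assms(1) z assms(2)])
  then show ?thesis
    using lmult_0[of "\<zero>\<^bsub>M\<^esub>"] lmult_0[of "ract M \<zero>\<^bsub>M\<^esub> a"] fd_rmodD(3)[OF assms(1) z assms(2)] by simp
qed

lemma lin_on_ract:
  assumes "fd_rmod A M" "a \<in> carrier A" "U \<subseteq> carrier M"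
  shows "lin_on M M U (\<lambda>x. ract M x a)"
  unfolding lin_on_def
  using fd_rmodD(3,4,9)[OF assms(1)] assms(2) subsetD[OF assms(3)] by simp

locale fd_alg =
  fixes A :: "('k::field, 'a) module"
  assumes fd_algebra: "fd_algebra A"
begin

sublocale ring A by (rule fd_algebraD[OF fd_algebra])

lemma smult_carrier: "a \<in> carrier A \<Longrightarrow> c \<odot>\<^bsub>A\<^esub> a \<in> carrier A"
proof -
  interpret M: Module.module scalars A by (rule fd_algebraD[OF fd_algebra])
  show "a \<in> carrier A \<Longrightarrow> c \<odot>\<^bsub>A\<^esub> a \<in> carrier A" by simp
qed

lemma ract_scalar:
  assumes "fd_rmod A M" "x \<in> carrier M"
  shows "ract M x (c \<odot>\<^bsub>A\<^esub> \<one>\<^bsub>A\<^esub>) = c \<odot>\<^bsub>M\<^esub> x"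
  using fd_rmodD(7)[OF assms] fd_rmodD(8)[OF assms, of "\<one>\<^bsub>A\<^esub>"] by simp

lemma rhom_smult:
  assumes "fd_rmod A M" "fd_rmod A N" "f \<in> rhom A M N" "x \<in> carrier M"
  shows "f (c \<odot>\<^bsub>M\<^esub> x) = c \<odot>\<^bsub>N\<^esub> f x"
  using rhomD(3)[OF assms(3,4), of "c \<odot>\<^bsub>A\<^esub> \<one>\<^bsub>A\<^esub>"] ract_scalar[OF assms(1,4)]
    ract_scalar[OF assms(2) rhomD(1)[OF assms(3,4)]] smult_carrier by simp

lemma lin_on_rhom:
  assumes "fd_rmod A M" "fd_rmod A N" "f \<in> rhom A M N" "U \<subseteq> carrier M"
  shows "lin_on M N U f"
  unfolding lin_on_def
  using rhomD(1,2)[OF assms(3)] rhom_smult[OF assms(1-3)] subsetD[OF assms(4)] by simp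

lemma rhom_zero:
  assumes "fd_rmod A M" "fd_rmod A N" "f \<in> rhom A M N"
  shows "f \<zero>\<^bsub>M\<^esub> = \<zero>\<^bsub>N\<^esub>"
  by (rule lin_on_zero[OF fd_rmodD(2)[OF assms(1)] fd_rmodD(2)[OF assms(2)]
      subsp_carrier[OF fd_rmodD(2)[OF assms(1)]] lin_on_rhom[OF assms subset_refl]])

end

text \<open>For an idempotent \<open>e\<close>, \<open>mpart M e\<close> is the subspace \<open>M e\<close>.\<close>

definition mpart :: "('k::field, 'a, 'm) rmod \<Rightarrow> 'a \<Rightarrow> 'm set" where
  "mpart M e = {x \<in> carrier M. ract M x e = x}"

definition cpart :: "('k::field, 'a, 'm) mod_complex \<Rightarrow> 'a \<Rightarrow> int \<Rightarrow> 'm set" where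
  "cpart C e i = mpart (cterm C i) e"

text \<open>The dimension of H^i(C) e. Right multiplication by an idempotent is exact, so for the
  idempotent of a vertex this is an entry of the dimension vector of H^i(C).\<close>

definition hd_part :: "('k::field, 'a, 'm) mod_complex \<Rightarrow> 'a \<Rightarrow> int \<Rightarrow> int" where
  "hd_part C e = hdim (cterm C) (cpart C e) (cdiff C)"

lemma subsp_mpart:
  assumes "fd_rmod A M" "e \<in> carrier A"
  shows "subsp M (mpart M e)"
proof -
  interpret Module.module scalars M by (rule fd_rmodD[OF assms(1)])
  note r = fd_rmodD(4)[OF assms(1) _ _ assms(2)] fd_rmodD(9)[OF assms(1) _ assms(2)]
  show ?thesis
    unfolding subsp_def mpart_def
    by (simp add: r ract_zero[OF assms] smult_closed[simplified])
qed

lemma mpart_ract: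
  assumes "fd_rmod A M" "a \<in> carrier A" "e \<in> carrier A" "a \<otimes>\<^bsub>A\<^esub> e = a" "x \<in> carrier M"
  shows "ract M x a \<in> mpart M e"
  using fd_rmodD(3)[OF assms(1,5,2)] fd_rmodD(6)[OF assms(1,5,2,3)] assms(4) unfolding mpart_def by simp

lemma (in fd_alg) vcpx_cpart:
  assumes C: "bounded_complex A C" and e: "e \<in> carrier A"
  shows "vcpx (cterm C) (cpart C e) (cdiff C)"
  unfolding vcpx_def
proof (intro allI conjI ballI)
  fix i
  have M: "fd_rmod A (cterm C i)" "fd_rmod A (cterm C (i + 1))"
    and d: "cdiff C i \<in> rhom A (cterm C i) (cterm C (i + 1))" for i
    using C unfolding bounded_complex_def by auto
  show "fd_space (cterm C i)" by (rule fd_rmodD[OF M(1)])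
  show "subsp (cterm C i) (cpart C e i)" unfolding cpart_def by (rule subsp_mpart[OF M(1) e])
  show "lin_on (cterm C i) (cterm C (i + 1)) (cpart C e i) (cdiff C i)"
    by (rule lin_on_rhom[OF M d]) (auto simp: cpart_def mpart_def)
  show "cdiff C i ` cpart C e i \<subseteq> cpart C e (i + 1)"
    using rhomD(1)[OF d] rhomD(3)[OF d _ e, symmetric] unfolding cpart_def mpart_def by auto
  show "cdiff C (i + 1) (cdiff C i x) = \<zero>\<^bsub>cterm C (i + 1 + 1)\<^esub>" if "x \<in> cpart C e i" for x
    using C that unfolding bounded_complex_def cpart_def mpart_def by blast
qed

text \<open>The conditions on a quasi-isomorphism are multiplied by \<open>e\<close>. For the
  cocycles Z, Z' and the coboundaries B, B' of the parts they become f Z + B' = Z' and: the preimage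
  of B' in Z is B. With this, \<open>vdim_preimage\<close> reads dim Z - dim B = dim Z' - dim
  B'.\<close>

lemma (in fd_alg) quasi_iso_hd_part:
  assumes C: "bounded_complex A C" and D: "bounded_complex A D" and f: "quasi_iso A C D f"
    and e: "e \<in> carrier A" and ee: "e \<otimes>\<^bsub>A\<^esub> e = e"
  shows "hd_part C e i = hd_part D e i"
proof -
  have CM: "fd_rmod A (cterm C i)" and DM: "fd_rmod A (cterm D i)"
    and dC: "cdiff C i \<in> rhom A (cterm C i) (cterm C (i + 1))"
    and dD: "cdiff D i \<in> rhom A (cterm D i) (cterm D (i + 1))" for i
    using C D unfolding bounded_complex_def by auto
  have cf: "f i \<in> rhom A (cterm C i) (cterm D i)"
    and comm: "x \<in> carrier (cterm C i) \<Longrightarrow> f (i + 1) (cdiff C i x) = cdiff D i (f i x)" for i x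
    using f unfolding quasi_iso_def chain_map_def by auto
  have inj: "x \<in> cocycles C i \<Longrightarrow> f i x \<in> coboundaries D i \<Longrightarrow> x \<in> coboundaries C i"
    and sur: "y \<in> cocycles D i \<Longrightarrow> \<exists>x \<in> cocycles C i. y \<ominus>\<^bsub>cterm D i\<^esub> f i x \<in> coboundaries D i" for i x y
    using f unfolding quasi_iso_def by auto
  let ?Z = "vcyc (cterm C) (cpart C e) (cdiff C) i" and ?B = "vbd (cpart C e) (cdiff C) i"
  let ?Z' = "vcyc (cterm D) (cpart D e) (cdiff D) i" and ?B' = "vbd (cpart D e) (cdiff D) i"
  note vC = vcpx_cpart[OF C e] and vD = vcpx_cpart[OF D e]
  let ?M = "cterm C i" and ?N = "cterm D i"
  interpret M: Module.module scalars ?M by (rule fd_rmodD[OF CM])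
  interpret N: Module.module scalars ?N by (rule fd_rmodD[OF DM])
  have ZM: "?Z \<subseteq> carrier ?M" "?Z' \<subseteq> carrier ?N"
    unfolding vcyc_def lker_def cpart_def mpart_def by auto
  have Zc: "z \<in> ?Z \<longleftrightarrow> z \<in> cocycles C i \<and> ract ?M z e = z" for z
    unfolding vcyc_def lker_def cpart_def mpart_def cocycles_def by auto
  have Zc': "z \<in> ?Z' \<longleftrightarrow> z \<in> cocycles D i \<and> ract ?N z e = z" for z
    unfolding vcyc_def lker_def cpart_def mpart_def cocycles_def by auto
  have Bc: "ract ?M z e \<in> ?B" if z: "z \<in> coboundaries C i" for z
  proof -
    obtain w where w: "w \<in> carrier (cterm C (i - 1))" "z = cdiff C (i - 1) w"
      using z unfolding coboundaries_def by auto
    have "ract ?M z e = cdiff C (i - 1) (ract (cterm C (i - 1)) w e)"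
      using rhomD(3)[OF dC[of "i - 1"] w(1) e] w by simp
    moreover have "ract (cterm C (i - 1)) w e \<in> cpart C e (i - 1)"
      unfolding cpart_def by (rule mpart_ract[OF CM e e ee w(1)])
    ultimately show ?thesis unfolding vbd_def by blast
  qed
  have Bc': "ract ?N z e \<in> ?B'" if z: "z \<in> coboundaries D i" for z
  proof -
    obtain w where w: "w \<in> carrier (cterm D (i - 1))" "z = cdiff D (i - 1) w"
      using z unfolding coboundaries_def by auto
    have "ract ?N z e = cdiff D (i - 1) (ract (cterm D (i - 1)) w e)"
      using rhomD(3)[OF dD[of "i - 1"] w(1) e] w by simp
    moreover have "ract (cterm D (i - 1)) w e \<in> cpart D e (i - 1)"
      unfolding cpart_def by (rule mpart_ract[OF DM e e ee w(1)])
    ultimately show ?thesis unfolding vbd_def by blast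
  qed
  have Bsub: "?B \<subseteq> coboundaries C i" "?B' \<subseteq> coboundaries D i"
    unfolding vbd_def cpart_def mpart_def coboundaries_def by auto
  have fZ: "f i z \<in> ?Z'" if "z \<in> ?Z" for z
  proof -
    have z: "z \<in> carrier ?M" "cdiff C i z = \<zero>\<^bsub>cterm C (i + 1)\<^esub>" "ract ?M z e = z"
      using that unfolding Zc cocycles_def by auto
    have "cdiff D i (f i z) = \<zero>\<^bsub>cterm D (i + 1)\<^esub>"
      using comm[OF z(1)] z(2) rhom_zero[OF CM DM cf[of "i + 1"]] by simp
    moreover have "ract ?N (f i z) e = f i z" using rhomD(3)[OF cf z(1) e] z(3) by simp
    ultimately show ?thesis using rhomD(1)[OF cf z(1)] unfolding Zc' cocycles_def by simp
  qed
  have sB': "subsp ?N ?B'" and sZ': "subsp ?N ?Z'" and sZ: "subsp ?M ?Z"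
    by (intro subsp_vbd subsp_vcyc vC vD)+
  have lf: "lin_on ?M ?N ?Z (f i)" by (rule lin_on_rhom[OF CM DM cf ZM(1)])
  have 1: "?Z' = {f i z \<oplus>\<^bsub>?N\<^esub> b | z b. z \<in> ?Z \<and> b \<in> ?B'}"
  proof (intro equalityI subsetI)
    fix y assume y: "y \<in> ?Z'"
    then obtain x where x: "x \<in> cocycles C i" "y \<ominus>\<^bsub>?N\<^esub> f i x \<in> coboundaries D i"
      using sur Zc' by blast
    have xM: "x \<in> carrier ?M" using x(1) unfolding cocycles_def by simp
    let ?x = "ract ?M x e"
    have xe: "?x \<in> carrier ?M" by (rule fd_rmodD(3)[OF CM xM e])
    have "cdiff C i ?x = \<zero>\<^bsub>cterm C (i + 1)\<^esub>"
      using rhomD(3)[OF dC xM e] x(1) ract_zero[OF CM e] unfolding cocycles_def by simp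
    then have xZ: "?x \<in> ?Z"
      using mpart_ract[OF CM e e ee xM] unfolding vcyc_def lker_def cpart_def by simp
    have yN: "y \<in> carrier ?N" "ract ?N y e = y" using y unfolding Zc' cocycles_def by auto
    have fx: "f i x \<in> carrier ?N" "f i ?x \<in> carrier ?N" "f i ?x = ract ?N (f i x) e"
      using rhomD(1)[OF cf xM] rhomD(1)[OF cf xe] rhomD(3)[OF cf xM e] by auto
    have "ract ?N (y \<ominus>\<^bsub>?N\<^esub> f i x) e = y \<ominus>\<^bsub>?N\<^esub> f i ?x"
      using lin_on_diff[OF fd_rmodD(2)[OF DM] fd_rmodD(2)[OF DM] subsp_carrier[OF fd_rmodD(2)[OF DM]]
          lin_on_ract[OF DM e subset_refl] yN(1) fx(1)] yN(2) fx(3) by simp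
    then have "y \<ominus>\<^bsub>?N\<^esub> f i ?x \<in> ?B'" using Bc'[OF x(2)] by simp
    moreover have "y = f i ?x \<oplus>\<^bsub>?N\<^esub> (y \<ominus>\<^bsub>?N\<^esub> f i ?x)"
      using yN(1) fx(2) unfolding a_minus_def by (simp add: N.M.a_lcomm N.M.r_neg)
    ultimately show "y \<in> {f i z \<oplus>\<^bsub>?N\<^esub> b | z b. z \<in> ?Z \<and> b \<in> ?B'}" using xZ by blast
  next
    fix y assume "y \<in> {f i z \<oplus>\<^bsub>?N\<^esub> b | z b. z \<in> ?Z \<and> b \<in> ?B'}"
    then show "y \<in> ?Z'" using fZ vbd_vcyc[OF vD] subspD(3)[OF sZ'] by blast
  qed
  have 2: "{z \<in> ?Z. f i z \<in> ?B'} = ?B"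
  proof (intro equalityI subsetI)
    fix z assume "z \<in> {z \<in> ?Z. f i z \<in> ?B'}"
    then have "z \<in> coboundaries C i" "ract ?M z e = z" using inj Bsub(2) unfolding Zc by auto
    then show "z \<in> ?B" using Bc by metis
  next
    fix z assume z: "z \<in> ?B"
    then obtain w where w: "w \<in> cpart C e (i - 1)" "z = cdiff C (i - 1) w" unfolding vbd_def by auto
    have wM: "w \<in> carrier (cterm C (i - 1))" "ract (cterm C (i - 1)) w e = w"
      using w unfolding cpart_def mpart_def by auto
    have "f i z = cdiff D (i - 1) (f (i - 1) w)" using comm[OF wM(1)] w by simp
    moreover have "f (i - 1) w \<in> cpart D e (i - 1)"
      using rhomD(1)[OF cf wM(1)] rhomD(3)[OF cf wM(1) e] wM(2) unfolding cpart_def mpart_def by simp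
    ultimately have "f i z \<in> ?B'" unfolding vbd_def by blast
    then show "z \<in> {z \<in> ?Z. f i z \<in> ?B'}" using z vbd_vcyc[OF vC] by blast
  qed
  show ?thesis
    using vdim_preimage[OF fd_rmodD(1)[OF CM] fd_rmodD(1)[OF DM] sZ sB' lf 1] 2
    unfolding hd_part_def hdim_def by simp
qed

lemma (in fd_alg) derived_iso_hd_part:
  assumes "derived_iso A C D" "e \<in> carrier A" "e \<otimes>\<^bsub>A\<^esub> e = e"
  shows "hd_part C e i = hd_part D e i"
  using assms(1) unfolding derived_iso_def
  by (induct rule: equivclp_induct) (auto dest: quasi_iso_hd_part[OF _ _ _ assms(2,3), where i = i])

text \<open>An even shift introduces no sign in the differential, so cocycles and coboundaries are
  the same sets in shifted degrees.\<close>

lemma hd_part_shift: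
  assumes "bounded_complex A C" "e \<in> carrier A"
  shows "hd_part (shift_complex (-2) C) e i = hd_part C e (i - 2)"
  unfolding hd_part_def hdim_def vcyc_def vbd_def lker_def cpart_def shift_complex_def
  by (simp add: algebra_simps)

lemma hd_part_bounded:
  assumes "bounded_complex A C"
  obtains n where "n \<ge> 0" "\<And>i. i \<le> -n \<or> i \<ge> n \<Longrightarrow> carrier (cterm C i) = {\<zero>\<^bsub>cterm C i\<^esub>}"
proof -
  have "finite {i. \<not> is_zero_mod (cterm C i)}" using assms unfolding bounded_complex_def by blast
  from finite_imageI[OF this, of abs]
  have n: "\<bar>i\<bar> \<le> Max (abs ` {i. \<not> is_zero_mod (cterm C i)})" if "\<not> is_zero_mod (cterm C i)" for i
    using that by (intro Max_ge) auto
  show thesis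
  proof (rule that[of "\<bar>Max (abs ` {i. \<not> is_zero_mod (cterm C i)})\<bar> + 1"])
    fix i :: int
    assume "i \<le> - (\<bar>Max (abs ` {i. \<not> is_zero_mod (cterm C i)})\<bar> + 1) \<or>
      i \<ge> \<bar>Max (abs ` {i. \<not> is_zero_mod (cterm C i)})\<bar> + 1"
    then have "is_zero_mod (cterm C i)" using n[of i] by linarith
    then show "carrier (cterm C i) = {\<zero>\<^bsub>cterm C i\<^esub>}" by (simp add: is_zero_mod_def)
  qed simp
qed

text \<open>Every module axiom for \<open>W\<close> is pulled back along the surjection
  \<open>f\<close>. This establishes the structure of copies in other types, whose operations are
  only given as functions.\<close>

lemma module_image:
  assumes V: "Module.module (scalars :: 'k::field ring) V"
    and surj: "f ` carrier V = carrier W" and zero: "f \<zero>\<^bsub>V\<^esub> = \<zero>\<^bsub>W\<^esub>"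
    and add: "\<And>x y. x \<in> carrier V \<Longrightarrow> y \<in> carrier V \<Longrightarrow> f (x \<oplus>\<^bsub>V\<^esub> y) = f x \<oplus>\<^bsub>W\<^esub> f y"
    and smult: "\<And>c x. x \<in> carrier V \<Longrightarrow> f (c \<odot>\<^bsub>V\<^esub> x) = c \<odot>\<^bsub>W\<^esub> f x"
  shows "Module.module scalars W"
proof -
  interpret V: Module.module scalars V by (rule V)
  have sc: "c \<odot>\<^bsub>V\<^esub> x \<in> carrier V" if "x \<in> carrier V" for c x using V.smult_closed[of c x] that by simp
  have f: "\<exists>x \<in> carrier V. y = f x" if "y \<in> carrier W" for y using surj that by blast
  have fc: "f x \<in> carrier W" if "x \<in> carrier V" for x using surj that by blast
  show ?thesis
  proof (rule Module.moduleI)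
    show "cring (scalars :: 'k ring)" by (rule cring_from_type_algebra)
    show "abelian_group W"
    proof (rule abelian_groupI)
      show "x \<oplus>\<^bsub>W\<^esub> y \<in> carrier W" if "x \<in> carrier W" "y \<in> carrier W" for x y
        using f[OF that(1)] f[OF that(2)] add fc V.M.a_closed by metis
      show "\<zero>\<^bsub>W\<^esub> \<in> carrier W" using fc[OF V.M.zero_closed] zero by simp
      show "x \<oplus>\<^bsub>W\<^esub> y \<oplus>\<^bsub>W\<^esub> z = x \<oplus>\<^bsub>W\<^esub> (y \<oplus>\<^bsub>W\<^esub> z)"
        if xyz: "x \<in> carrier W" "y \<in> carrier W" "z \<in> carrier W" for x y z
      proof -
        obtain x' y' z' where e: "x' \<in> carrier V" "y' \<in> carrier V" "z' \<in> carrier V"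
          "x = f x'" "y = f y'" "z = f z'" using f xyz by metis
        have "f (x' \<oplus>\<^bsub>V\<^esub> y' \<oplus>\<^bsub>V\<^esub> z') = f (x' \<oplus>\<^bsub>V\<^esub> (y' \<oplus>\<^bsub>V\<^esub> z'))" using e V.M.a_assoc by simp
        then show ?thesis using e by (simp add: add)
      qed
      show "x \<oplus>\<^bsub>W\<^esub> y = y \<oplus>\<^bsub>W\<^esub> x" if xy: "x \<in> carrier W" "y \<in> carrier W" for x y
      proof -
        obtain x' y' where e: "x' \<in> carrier V" "y' \<in> carrier V" "x = f x'" "y = f y'" using f xy by metis
        have "f (x' \<oplus>\<^bsub>V\<^esub> y') = f (y' \<oplus>\<^bsub>V\<^esub> x')" using e V.M.a_comm by simp
        then show ?thesis using e by (simp add: add)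
      qed
      show "\<zero>\<^bsub>W\<^esub> \<oplus>\<^bsub>W\<^esub> x = x" if "x \<in> carrier W" for x
        using f[OF that] add[of "\<zero>\<^bsub>V\<^esub>"] zero V.M.l_zero V.M.zero_closed by metis
      show "\<exists>y \<in> carrier W. y \<oplus>\<^bsub>W\<^esub> x = \<zero>\<^bsub>W\<^esub>" if "x \<in> carrier W" for x
        using f[OF that] add zero V.M.l_neg V.M.a_inv_closed fc by metis
    qed
    show "c \<odot>\<^bsub>W\<^esub> x \<in> carrier W" if "x \<in> carrier W" for c x
      using f[OF that] smult sc fc by metis
    show "(a \<oplus>\<^bsub>scalars\<^esub> b) \<odot>\<^bsub>W\<^esub> x = a \<odot>\<^bsub>W\<^esub> x \<oplus>\<^bsub>W\<^esub> b \<odot>\<^bsub>W\<^esub> x" if xW: "x \<in> carrier W" for a b x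
    proof -
      obtain x' where e: "x' \<in> carrier V" "x = f x'" using f[OF xW] by blast
      have "f ((a + b) \<odot>\<^bsub>V\<^esub> x') = f (a \<odot>\<^bsub>V\<^esub> x' \<oplus>\<^bsub>V\<^esub> b \<odot>\<^bsub>V\<^esub> x')"
        using V.smult_l_distr[of a b x'] e by simp
      then show ?thesis using e sc by (simp add: add smult)
    qed
    show "a \<odot>\<^bsub>W\<^esub> (x \<oplus>\<^bsub>W\<^esub> y) = a \<odot>\<^bsub>W\<^esub> x \<oplus>\<^bsub>W\<^esub> a \<odot>\<^bsub>W\<^esub> y" if xy: "x \<in> carrier W" "y \<in> carrier W" for a x y
    proof -
      obtain x' y' where e: "x' \<in> carrier V" "y' \<in> carrier V" "x = f x'" "y = f y'" using f xy by metis
      have "f (a \<odot>\<^bsub>V\<^esub> (x' \<oplus>\<^bsub>V\<^esub> y')) = f (a \<odot>\<^bsub>V\<^esub> x' \<oplus>\<^bsub>V\<^esub> a \<odot>\<^bsub>V\<^esub> y')"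
        using V.smult_r_distr[of a x' y'] e by simp
      then show ?thesis using e sc by (simp add: add smult)
    qed
    show "(a \<otimes>\<^bsub>scalars\<^esub> b) \<odot>\<^bsub>W\<^esub> x = a \<odot>\<^bsub>W\<^esub> (b \<odot>\<^bsub>W\<^esub> x)" if xW: "x \<in> carrier W" for a b x
    proof -
      obtain x' where e: "x' \<in> carrier V" "x = f x'" using f[OF xW] by blast
      have "f ((a * b) \<odot>\<^bsub>V\<^esub> x') = f (a \<odot>\<^bsub>V\<^esub> (b \<odot>\<^bsub>V\<^esub> x'))"
        using V.smult_assoc1[of a b x'] e by simp
      then show ?thesis using e sc by (simp add: smult)
    qed
    show "\<one>\<^bsub>scalars\<^esub> \<odot>\<^bsub>W\<^esub> x = x" if "x \<in> carrier W" for x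
      using f[OF that] smult[of _ 1] V.smult_one by (metis scalars_simps(3))
  qed
qed

lemma fd_space_hom_image:
  assumes V: "fd_space V"
    and surj: "f ` carrier V = carrier W" and zero: "f \<zero>\<^bsub>V\<^esub> = \<zero>\<^bsub>W\<^esub>"
    and add: "\<And>x y. x \<in> carrier V \<Longrightarrow> y \<in> carrier V \<Longrightarrow> f (x \<oplus>\<^bsub>V\<^esub> y) = f x \<oplus>\<^bsub>W\<^esub> f y"
    and smult: "\<And>c x. x \<in> carrier V \<Longrightarrow> f (c \<odot>\<^bsub>V\<^esub> x) = c \<odot>\<^bsub>W\<^esub> f x"
  shows "fd_space W"
proof (rule fd_space_image[OF V _ _ surj])
  show "Module.module scalars W"
    by (rule module_image[OF module_fd_space[OF V] surj zero add smult])
  show "lin_on V W (carrier V) f"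
    unfolding lin_on_def using surj add smult by auto
qed

lemma fd_rmod_hom_image:
  assumes A: "fd_algebra A" and V: "fd_rmod A V"
    and surj: "f ` carrier V = carrier W" and zero: "f \<zero>\<^bsub>V\<^esub> = \<zero>\<^bsub>W\<^esub>"
    and add: "\<And>x y. x \<in> carrier V \<Longrightarrow> y \<in> carrier V \<Longrightarrow> f (x \<oplus>\<^bsub>V\<^esub> y) = f x \<oplus>\<^bsub>W\<^esub> f y"
    and smult: "\<And>c x. x \<in> carrier V \<Longrightarrow> f (c \<odot>\<^bsub>V\<^esub> x) = c \<odot>\<^bsub>W\<^esub> f x"
    and ract: "\<And>x a. x \<in> carrier V \<Longrightarrow> a \<in> carrier A \<Longrightarrow> f (ract V x a) = ract W (f x) a"
  shows "fd_rmod A W"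
proof -
  interpret A: ring A by (rule fd_algebraD[OF A])
  interpret A: Module.module scalars A by (rule fd_algebraD[OF A])
  interpret V: Module.module scalars V by (rule fd_rmodD[OF V])
  have Ac: "c \<odot>\<^bsub>A\<^esub> x \<in> carrier A" if "x \<in> carrier A" for c x using A.smult_closed[of c x] that by simp
  have Vc: "c \<odot>\<^bsub>V\<^esub> x \<in> carrier V" if "x \<in> carrier V" for c x using V.smult_closed[of c x] that by simp
  have fc: "f x \<in> carrier W" if "x \<in> carrier V" for x using surj that by blast
  note r = fd_rmodD(3)[OF V]
  have "\<forall>x \<in> f ` carrier V. \<forall>a \<in> carrier A. ract W x a \<in> carrier W"
    using fc r by (auto simp: ract[symmetric])
  moreover have "\<forall>x \<in> f ` carrier V. \<forall>y \<in> f ` carrier V. \<forall>a \<in> carrier A.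
      ract W (x \<oplus>\<^bsub>W\<^esub> y) a = ract W x a \<oplus>\<^bsub>W\<^esub> ract W y a"
    using r fd_rmodD(4)[OF V] by (auto simp: ract[symmetric] add[symmetric])
  moreover have "\<forall>x \<in> f ` carrier V. \<forall>a \<in> carrier A. \<forall>b \<in> carrier A.
      ract W x (a \<oplus>\<^bsub>A\<^esub> b) = ract W x a \<oplus>\<^bsub>W\<^esub> ract W x b \<and> ract W x (a \<otimes>\<^bsub>A\<^esub> b) = ract W (ract W x a) b"
    using r fd_rmodD(5,6)[OF V] by (auto simp: ract[symmetric] add[symmetric])
  moreover have "\<forall>x \<in> f ` carrier V. ract W x \<one>\<^bsub>A\<^esub> = x"
    using fd_rmodD(7)[OF V] by (auto simp: ract[symmetric])
  moreover have "\<forall>c. \<forall>x \<in> f ` carrier V. \<forall>a \<in> carrier A.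
      ract W x (c \<odot>\<^bsub>A\<^esub> a) = c \<odot>\<^bsub>W\<^esub> ract W x a \<and> ract W (c \<odot>\<^bsub>W\<^esub> x) a = c \<odot>\<^bsub>W\<^esub> ract W x a"
    using r fd_rmodD(8,9)[OF V] Ac Vc by (auto simp: ract[symmetric] smult[symmetric])
  ultimately show ?thesis
    unfolding fd_rmod_def surj
    using fd_space_hom_image[OF fd_rmodD(1)[OF V] surj zero add smult] by blast
qed

text \<open>Projectivity and injectivity quantify over modules with elements in
  \<open>nat \<Rightarrow> 'k\<close>. Free modules, right ideals e A and Nakayama duals live in
  other types and are moved there along an injection before these properties apply to them.\<close>

definition rmod_copy :: "('k, 'a, 'm) rmod \<Rightarrow> ('m \<Rightarrow> 'n) \<Rightarrow> ('k, 'a, 'n) rmod" where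
  "rmod_copy M f = (let g = inv_into (carrier M) f in
     \<lparr>carrier = f ` carrier M, mult = undefined, one = undefined, zero = f \<zero>\<^bsub>M\<^esub>,
      add = (\<lambda>x y. f (g x \<oplus>\<^bsub>M\<^esub> g y)), smult = (\<lambda>c x. f (c \<odot>\<^bsub>M\<^esub> g x)),
      ract = (\<lambda>x a. f (ract M (g x) a))\<rparr>)"

lemma rmod_copy_simps:
  assumes "inj_on f (carrier M)"
  shows "carrier (rmod_copy M f) = f ` carrier M" "\<zero>\<^bsub>rmod_copy M f\<^esub> = f \<zero>\<^bsub>M\<^esub>"
    "x \<in> carrier M \<Longrightarrow> y \<in> carrier M \<Longrightarrow> f x \<oplus>\<^bsub>rmod_copy M f\<^esub> f y = f (x \<oplus>\<^bsub>M\<^esub> y)"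
    "x \<in> carrier M \<Longrightarrow> c \<odot>\<^bsub>rmod_copy M f\<^esub> f x = f (c \<odot>\<^bsub>M\<^esub> x)"
    "x \<in> carrier M \<Longrightarrow> ract (rmod_copy M f) (f x) a = f (ract M x a)"
  using assms by (simp_all add: rmod_copy_def Let_def inv_into_f_f)

lemma fd_rmod_copy:
  assumes "fd_algebra A" "fd_rmod A M" "inj_on f (carrier M)"
  shows "fd_rmod A (rmod_copy M f)"
  by (rule fd_rmod_hom_image[OF assms(1,2), where f = f]) (simp_all add: rmod_copy_simps[OF assms(3)])

text \<open>Coefficients with respect to a finite generating set, chosen arbitrarily for each
  vector, determine the vector. The embedding may fail to be linear; \<open>rmod_copy\<close>
  transports the operations along it.\<close>

lemma coordinates_exist:
  assumes "fd_space (V :: ('k::field, 'm, 'z) module_scheme)"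
  shows "\<exists>f :: 'm \<Rightarrow> nat \<Rightarrow> 'k. inj_on f (carrier V)"
proof -
  obtain B where B: "finite B" "B \<subseteq> carrier V"
    "\<And>x. x \<in> carrier V \<Longrightarrow> \<exists>c. x = (\<Oplus>\<^bsub>V\<^esub> b \<in> B. c b \<odot>\<^bsub>V\<^esub> b)"
    using assms unfolding fd_space_def by blast
  interpret Module.module scalars V by (rule module_fd_space[OF assms])
  from B(3) obtain c where c: "\<And>x. x \<in> carrier V \<Longrightarrow> x = (\<Oplus>\<^bsub>V\<^esub> b \<in> B. c x b \<odot>\<^bsub>V\<^esub> b)" by metis
  obtain e :: "nat \<Rightarrow> 'm" where e: "B \<subseteq> range e"
    using finite_imp_nat_seg_image_inj_on[OF B(1)] by blast
  have "inj_on (\<lambda>x n. c x (e n)) (carrier V)"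
  proof
    fix x y assume xy: "x \<in> carrier V" "y \<in> carrier V" "(\<lambda>n. c x (e n)) = (\<lambda>n. c y (e n))"
    have "c x b = c y b" if "b \<in> B" for b using that e fun_cong[OF xy(3)] by auto
    then have "(\<Oplus>\<^bsub>V\<^esub> b \<in> B. c x b \<odot>\<^bsub>V\<^esub> b) = (\<Oplus>\<^bsub>V\<^esub> b \<in> B. c y b \<odot>\<^bsub>V\<^esub> b)"
      using B(2) smult_closed by (intro M.finsum_cong') auto
    then show "x = y" using c[OF xy(1)] c[OF xy(2)] by simp
  qed
  then show ?thesis by blast
qed

lemma lin_on_finsum:
  assumes V: "Module.module (scalars :: 'k::field ring) V" and W: "Module.module (scalars :: 'k ring) W"
    and f: "lin_on V W (carrier V) f" and B: "finite B" and g: "\<And>b. b \<in> B \<Longrightarrow> g b \<in> carrier V"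
  shows "f (\<Oplus>\<^bsub>V\<^esub> b \<in> B. g b) = (\<Oplus>\<^bsub>W\<^esub> b \<in> B. f (g b))"
proof -
  interpret V: Module.module scalars V by (rule V)
  interpret W: Module.module scalars W by (rule W)
  show ?thesis using B g
  proof (induct B rule: finite_induct)
    case empty
    show ?case using lin_on_zero[OF V W subsp_carrier[OF V] f] by simp
  next
    case (insert a B)
    have g: "g \<in> B \<rightarrow> carrier V" "g a \<in> carrier V" using insert by auto
    have fg: "(\<lambda>b. f (g b)) \<in> B \<rightarrow> carrier W" "f (g a) \<in> carrier W"
      using insert f unfolding lin_on_def by auto
    have "(\<Oplus>\<^bsub>V\<^esub> b \<in> B. g b) \<in> carrier V" using g(1) by simp
    then have "f (g a \<oplus>\<^bsub>V\<^esub> (\<Oplus>\<^bsub>V\<^esub> b \<in> B. g b)) = f (g a) \<oplus>\<^bsub>W\<^esub> f (\<Oplus>\<^bsub>V\<^esub> b \<in> B. g b)"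
      using f g(2) unfolding lin_on_def by simp
    then show ?case using insert g fg by simp
  qed
qed

lemma subsp_finsum:
  assumes V: "Module.module (scalars :: 'k::field ring) V" and U: "subsp V U"
    and B: "finite B" and g: "\<And>b. b \<in> B \<Longrightarrow> g b \<in> U"
  shows "(\<Oplus>\<^bsub>V\<^esub> b \<in> B. g b) \<in> U"
proof -
  interpret V: Module.module scalars V by (rule V)
  show ?thesis using B g
  proof (induct B rule: finite_induct)
    case (insert a B)
    have "g \<in> B \<rightarrow> carrier V" "g a \<in> carrier V" using insert subspD(5)[OF U] by auto
    then show ?case using insert subspD(3)[OF U] by simp
  qed (simp add: subspD[OF U])
qed

section \<open>Free modules and dual bases of projective modules\<close>

lemma regular_rmod_simps [simp]:
  "carrier (regular_rmod A) = carrier A" "\<zero>\<^bsub>regular_rmod A\<^esub> = \<zero>\<^bsub>A\<^esub>" "add (regular_rmod A) = add A"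
  "smult (regular_rmod A) = smult A" "ract (regular_rmod A) = mult A"
  by (simp_all add: regular_rmod_def module.extend_def rmod.fields_def fun_eq_iff)

lemma projective_lift:
  fixes M N :: "('k::field, 'a) fmod"
  assumes "projective_rmod A P" "fd_rmod A M" "fd_rmod A N" "g \<in> rhom A M N" "f \<in> rhom A P N"
    and "g ` carrier M = carrier N"
  shows "\<exists>h \<in> rhom A P M. \<forall>x \<in> carrier P. g (h x) = f x"
  using assms unfolding projective_rmod_def by blast

definition free_rmod :: "('k, 'a) module \<Rightarrow> 'b set \<Rightarrow> ('k, 'a, 'b \<Rightarrow> 'a) rmod" where
  "free_rmod A B = \<lparr>carrier = B \<rightarrow>\<^sub>E carrier A, mult = undefined, one = undefined,
     zero = (\<lambda>b \<in> B. \<zero>\<^bsub>A\<^esub>), add = (\<lambda>f g. \<lambda>b \<in> B. f b \<oplus>\<^bsub>A\<^esub> g b), smult = (\<lambda>c f. \<lambda>b \<in> B. c \<odot>\<^bsub>A\<^esub> f b),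
     ract = (\<lambda>f a. \<lambda>b \<in> B. f b \<otimes>\<^bsub>A\<^esub> a)\<rparr>"

context fd_alg
begin

lemma fd_rmod_regular: "fd_rmod A (regular_rmod A)"
proof -
  interpret M: Module.module scalars A by (rule fd_algebraD[OF fd_algebra])
  have "fd_space (regular_rmod A)"
    by (rule fd_space_hom_image[OF fd_algebraD(2)[OF fd_algebra], where f = id]) simp_all
  then show ?thesis
    unfolding fd_rmod_def
    using fd_algebraD(4,5)[OF fd_algebra] by (auto simp: l_distr r_distr m_assoc)
qed

lemma fd_space_free:
  assumes "finite B"
  shows "fd_space (free_rmod A B)"
  using assms
proof (induct B rule: finite_induct)
  case empty
  have [simp]: "carrier (free_rmod A {}) = {\<zero>\<^bsub>free_rmod A {}\<^esub>}"
    "\<zero>\<^bsub>free_rmod A {}\<^esub> \<oplus>\<^bsub>free_rmod A {}\<^esub> \<zero>\<^bsub>free_rmod A {}\<^esub> = \<zero>\<^bsub>free_rmod A {}\<^esub>"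
    "c \<odot>\<^bsub>free_rmod A {}\<^esub> \<zero>\<^bsub>free_rmod A {}\<^esub> = \<zero>\<^bsub>free_rmod A {}\<^esub>" for c
    by (auto simp: free_rmod_def restrict_def)
  have m: "Module.module scalars (free_rmod A {})"
    by (rule Module.moduleI) (auto simp: cring_from_type_algebra intro!: abelian_groupI)
  interpret M: Module.module scalars "free_rmod A {}" by (rule m)
  show ?case
    unfolding fd_space_def using m by (intro conjI exI[of _ "{}"]) auto
next
  case (insert b B)
  interpret M: Module.module scalars A by (rule fd_algebraD[OF fd_algebra])
  let ?S = "direct_sum (plain (free_rmod A B)) (plain A)"
  have S: "fd_space ?S"
    by (intro fd_space_direct_sum fd_space_plain insert fd_algebraD[OF fd_algebra])
  show ?case
  proof (rule fd_space_hom_image[OF S, where f = "\<lambda>(g, a). g(b := a)"])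
    show "(\<lambda>(g, a). g(b := a)) ` carrier ?S = carrier (free_rmod A (insert b B))"
    proof (intro equalityI subsetI)
      fix g assume g: "g \<in> carrier (free_rmod A (insert b B))"
      then have "(restrict g B, g b) \<in> carrier ?S" "g = (\<lambda>(g, a). g(b := a)) (restrict g B, g b)"
        using insert(2) by (auto simp: free_rmod_def PiE_iff extensional_def fun_eq_iff)
      then show "g \<in> (\<lambda>(g, a). g(b := a)) ` carrier ?S" by (rule rev_image_eqI)
    qed (auto simp: free_rmod_def PiE_iff extensional_def)
  qed (use insert(2) in \<open>auto simp: free_rmod_def fun_eq_iff restrict_def\<close>)
qed

lemma fd_rmod_free:
  assumes "finite B"
  shows "fd_rmod A (free_rmod A B)"
proof -
  interpret M: Module.module scalars A by (rule fd_algebraD[OF fd_algebra])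
  show ?thesis
    unfolding fd_rmod_def
    using fd_space_free[OF assms] fd_algebraD(4,5)[OF fd_algebra] smult_carrier
    by (auto simp: free_rmod_def PiE_iff l_distr r_distr m_assoc fun_eq_iff extensional_def restrict_def)
qed

text \<open>The surjection \<open>p\<close> from the free module on a generating set
  \<open>B\<close> onto \<open>P\<close> splits, and the coordinates of the splitting are the
  functionals \<open>F b\<close>. The lifting property is applied to a copy \<open>?M\<close> of the
  free module with elements in \<open>nat \<Rightarrow> 'k\<close>.\<close>

theorem dual_basis:
  fixes P :: "('k, 'a) fmod"
  assumes P: "projective_rmod A P"
  obtains B F where "finite B" "B \<subseteq> carrier P"
    "\<And>b. b \<in> B \<Longrightarrow> F b \<in> rhom A P (regular_rmod A)"
    "\<And>x. x \<in> carrier P \<Longrightarrow> x = (\<Oplus>\<^bsub>P\<^esub> b \<in> B. ract P b (F b x))"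
proof -
  have fP: "fd_rmod A P" using P unfolding projective_rmod_def by blast
  interpret P: Module.module scalars P by (rule fd_rmodD[OF fP])
  obtain B where B: "finite B" "B \<subseteq> carrier P"
    "\<And>x. x \<in> carrier P \<Longrightarrow> \<exists>c. x = (\<Oplus>\<^bsub>P\<^esub> b \<in> B. c b \<odot>\<^bsub>P\<^esub> b)"
    using fd_rmodD(1)[OF fP] unfolding fd_space_def by blast
  let ?L = "free_rmod A B"
  have L: "fd_rmod A ?L" by (rule fd_rmod_free[OF B(1)])
  obtain f :: "((nat \<Rightarrow> 'k) \<Rightarrow> 'a) \<Rightarrow> nat \<Rightarrow> 'k" where f: "inj_on f (carrier ?L)"
    using coordinates_exist[OF fd_rmodD(1)[OF L]] by blast
  let ?M = "rmod_copy ?L f"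
  note cs = rmod_copy_simps[OF f]
  have M: "fd_rmod A ?M" by (rule fd_rmod_copy[OF fd_algebra L f])
  let ?i = "inv_into (carrier ?L) f"
  have i: "?i (f u) = u" if "u \<in> carrier ?L" for u using f that by simp
  define p where "p u = (\<Oplus>\<^bsub>P\<^esub> b \<in> B. ract P b (u b))" for u
  have Lc: "u b \<in> carrier A" if "u \<in> carrier ?L" "b \<in> B" for u b
    using that by (auto simp: free_rmod_def)
  have t: "ract P b (u b) \<in> carrier P" if "u \<in> carrier ?L" "b \<in> B" for u b
    using fd_rmodD(3)[OF fP] B(2) Lc that by blast
  have pc: "p u \<in> carrier P" if "u \<in> carrier ?L" for u
    unfolding p_def using t that by (intro P.M.finsum_closed) auto
  have padd: "p (u \<oplus>\<^bsub>?L\<^esub> v) = p u \<oplus>\<^bsub>P\<^esub> p v" if uv: "u \<in> carrier ?L" "v \<in> carrier ?L" for u v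
  proof -
    have "p (u \<oplus>\<^bsub>?L\<^esub> v) = (\<Oplus>\<^bsub>P\<^esub> b \<in> B. ract P b (u b) \<oplus>\<^bsub>P\<^esub> ract P b (v b))"
      unfolding p_def
    proof (rule P.M.finsum_cong')
      show "ract P b ((u \<oplus>\<^bsub>?L\<^esub> v) b) = ract P b (u b) \<oplus>\<^bsub>P\<^esub> ract P b (v b)" if b: "b \<in> B" for b
        using fd_rmodD(5)[OF fP subsetD[OF B(2) b] Lc[OF uv(1) b] Lc[OF uv(2) b]] b
        by (simp add: free_rmod_def)
    qed (use t uv in auto)
    also have "\<dots> = p u \<oplus>\<^bsub>P\<^esub> p v"
      unfolding p_def using t uv by (intro P.M.finsum_addf) auto
    finally show ?thesis .
  qed
  have pract: "p (ract ?L u a) = ract P (p u) a" if u: "u \<in> carrier ?L" and a: "a \<in> carrier A" for u a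
  proof -
    have "ract P (p u) a = (\<Oplus>\<^bsub>P\<^esub> b \<in> B. ract P (ract P b (u b)) a)"
      unfolding p_def
      by (rule lin_on_finsum[OF _ _ lin_on_ract[OF fP a]]) (use fd_rmodD(2)[OF fP] B t u in auto)
    also have "\<dots> = p (ract ?L u a)"
      unfolding p_def
    proof (rule P.M.finsum_cong')
      show "ract P (ract P b (u b)) a = ract P b (ract ?L u a b)" if b: "b \<in> B" for b
        using fd_rmodD(6)[OF fP subsetD[OF B(2) b] Lc[OF u b] a] b
        by (simp add: free_rmod_def)
      show "(\<lambda>b. ract P b (ract ?L u a b)) \<in> B \<rightarrow> carrier P"
        using t[OF fd_rmodD(3)[OF L u a]] by auto
    qed simp
    finally show ?thesis by simp
  qed
  define q where "q = (\<lambda>x \<in> carrier ?M. p (?i x))"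
  have qf: "q (f u) = p u" if "u \<in> carrier ?L" for u
    unfolding q_def using that i by (simp add: cs)
  have q: "q \<in> rhom A ?M P"
    unfolding rhom_def
  proof (intro CollectI conjI ballI)
    show "q \<in> carrier ?M \<rightarrow>\<^sub>E carrier P" unfolding q_def using pc i by (auto simp: cs)
    fix x assume "x \<in> carrier ?M"
    then obtain u where u: "u \<in> carrier ?L" "x = f u" by (auto simp: cs)
    show "q (x \<oplus>\<^bsub>?M\<^esub> y) = q x \<oplus>\<^bsub>P\<^esub> q y" if y: "y \<in> carrier ?M" for y
    proof -
      obtain v where v: "v \<in> carrier ?L" "y = f v" using y by (auto simp: cs)
      interpret L: Module.module scalars ?L by (rule fd_rmodD[OF L])
      show ?thesis using u v padd qf by (simp add: cs)
    qed
    show "q (ract ?M x a) = ract P (q x) a" if "a \<in> carrier A" for a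
      using u that pract qf fd_rmodD(3)[OF L] by (simp add: cs)
  qed
  have sur: "q ` carrier ?M = carrier P"
  proof (intro equalityI subsetI)
    fix x assume "x \<in> carrier P"
    then obtain c where c: "x = (\<Oplus>\<^bsub>P\<^esub> b \<in> B. c b \<odot>\<^bsub>P\<^esub> b)" using B(3) by blast
    \<comment> \<open>The scalar coefficients of \<open>x\<close> are turned into algebra elements c
      1, which act on \<open>P\<close> as scalars.\<close>
    let ?u = "\<lambda>b \<in> B. c b \<odot>\<^bsub>A\<^esub> \<one>\<^bsub>A\<^esub>"
    have u: "?u \<in> carrier ?L" using smult_carrier by (auto simp: free_rmod_def)
    have "p ?u = x"
      unfolding p_def c
    proof (rule P.M.finsum_cong')
      show "ract P b (?u b) = c b \<odot>\<^bsub>P\<^esub> b" if "b \<in> B" for b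
        using ract_scalar[OF fP] that B(2) by auto
      show "(\<lambda>b. c b \<odot>\<^bsub>P\<^esub> b) \<in> B \<rightarrow> carrier P" using B(2) P.smult_closed by auto
    qed simp
    then show "x \<in> q ` carrier ?M" using qf[OF u] u by (force simp: cs)
  qed (use rhomD(1)[OF q] in auto)
  have id: "(\<lambda>x \<in> carrier P. x) \<in> rhom A P P"
    unfolding rhom_def using fd_rmodD(3)[OF fP] by auto
  have "\<exists>h \<in> rhom A P ?M. \<forall>x \<in> carrier P. q (h x) = (\<lambda>x \<in> carrier P. x) x"
    by (rule projective_lift[OF P M fP q id sur])
  then obtain h where h: "h \<in> rhom A P ?M" "\<And>x. x \<in> carrier P \<Longrightarrow> q (h x) = x" by auto
  define F where "F b = (\<lambda>x \<in> carrier P. ?i (h x) b)" for b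
  have hx: "?i (h x) \<in> carrier ?L \<and> f (?i (h x)) = h x" if "x \<in> carrier P" for x
    using rhomD(1)[OF h(1) that] by (auto simp: cs inv_into_into f_inv_into_f)
  show thesis
  proof (rule that[OF B(1,2)])
    show "F b \<in> rhom A P (regular_rmod A)" if b: "b \<in> B" for b
      unfolding rhom_def
    proof (intro CollectI conjI ballI)
      show "F b \<in> carrier P \<rightarrow>\<^sub>E carrier (regular_rmod A)" unfolding F_def using hx Lc b by auto
      fix x assume x: "x \<in> carrier P"
      show "F b (x \<oplus>\<^bsub>P\<^esub> y) = F b x \<oplus>\<^bsub>regular_rmod A\<^esub> F b y" if y: "y \<in> carrier P" for y
      proof -
        interpret L: Module.module scalars ?L by (rule fd_rmodD[OF L])
        have "h (x \<oplus>\<^bsub>P\<^esub> y) = f (?i (h x)) \<oplus>\<^bsub>?M\<^esub> f (?i (h y))" using rhomD(2)[OF h(1) x y] hx x y by simp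
        also have "\<dots> = f (?i (h x) \<oplus>\<^bsub>?L\<^esub> ?i (h y))" by (rule cs(3)) (use hx x y in auto)
        finally have "?i (h (x \<oplus>\<^bsub>P\<^esub> y)) = ?i (h x) \<oplus>\<^bsub>?L\<^esub> ?i (h y)" using i hx x y by simp
        then show ?thesis unfolding F_def using x y b by (simp add: free_rmod_def)
      qed
      show "F b (ract P x a) = ract (regular_rmod A) (F b x) a" if a: "a \<in> carrier A" for a
      proof -
        have "h (ract P x a) = ract ?M (f (?i (h x))) a" using rhomD(3)[OF h(1) x a] hx x by simp
        also have "\<dots> = f (ract ?L (?i (h x)) a)" by (rule cs(5)) (use hx x in auto)
        finally have "?i (h (ract P x a)) = ract ?L (?i (h x)) a" using i hx x fd_rmodD(3)[OF L _ a] by simp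
        then show ?thesis unfolding F_def using x b fd_rmodD(3)[OF fP x a] by (simp add: free_rmod_def)
      qed
    qed
    show "x = (\<Oplus>\<^bsub>P\<^esub> b \<in> B. ract P b (F b x))" if x: "x \<in> carrier P" for x
    proof -
      have "x = p (?i (h x))" using h(2)[OF x] qf[of "?i (h x)"] hx[OF x] by simp
      then show ?thesis unfolding p_def F_def using x by simp
    qed
  qed
qed

end

section \<open>The Nakayama functor on projective modules\<close>

text \<open>The field as an algebra over itself: linear functionals become maps into a module, and
  \<open>free_rmod ground_alg S\<close> is the space of scalar functions on
  \<open>S\<close>.\<close>

definition ground_alg :: "('k::field, 'k) module" where
  "ground_alg = \<lparr>carrier = UNIV, mult = (*), one = 1, zero = 0, add = (+), smult = (*)\<rparr>"

lemma ground_alg_simps [simp]: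
  "carrier ground_alg = UNIV" "\<zero>\<^bsub>ground_alg\<^esub> = 0" "\<one>\<^bsub>ground_alg\<^esub> = 1" "x \<oplus>\<^bsub>ground_alg\<^esub> y = x + y"
  "x \<otimes>\<^bsub>ground_alg\<^esub> y = x * y" "c \<odot>\<^bsub>ground_alg\<^esub> x = c * x"
  by (simp_all add: ground_alg_def)

lemma module_ground_alg: "Module.module scalars (ground_alg :: ('k::field, 'k) module)"
proof (rule Module.moduleI)
  show "abelian_group (ground_alg :: ('k, 'k) module)"
  proof (rule abelian_groupI)
    show "\<exists>y \<in> carrier ground_alg. y \<oplus>\<^bsub>ground_alg\<^esub> x = \<zero>\<^bsub>ground_alg\<^esub>" for x :: 'k
      by (auto intro!: exI[of _ "-x"])
  qed (auto simp: algebra_simps)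
qed (auto simp: algebra_simps cring_from_type_algebra)

lemma finsum_ground_alg:
  fixes g :: "'b \<Rightarrow> 'k::field"
  assumes "finite B"
  shows "(\<Oplus>\<^bsub>ground_alg\<^esub> b \<in> B. g b) = (\<Sum>b \<in> B. g b)"
proof -
  interpret Module.module scalars "ground_alg :: ('k, 'k) module" by (rule module_ground_alg)
  show ?thesis using assms
  proof (induct B rule: finite_induct)
    case (insert a B)
    have "(\<Oplus>\<^bsub>ground_alg\<^esub> b \<in> insert a B. g b) = g a \<oplus>\<^bsub>ground_alg\<^esub> (\<Oplus>\<^bsub>ground_alg\<^esub> b \<in> B. g b)"
      by (rule M.finsum_insert) (use insert in auto)
    then show ?case using insert by simp
  qed simp
qed

lemma fd_algebra_ground_alg: "fd_algebra (ground_alg :: ('k::field, 'k) module)"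
proof -
  interpret M: Module.module scalars "ground_alg :: ('k, 'k) module" by (rule module_ground_alg)
  have "ring (ground_alg :: ('k, 'k) module)"
    by (rule ringI) (auto simp: algebra_simps M.M.abelian_group_axioms intro!: monoidI)
  moreover have "\<exists>c. x = (\<Oplus>\<^bsub>ground_alg\<^esub> b \<in> {1}. c b \<odot>\<^bsub>ground_alg\<^esub> b)" for x :: 'k
    by (rule exI[of _ "\<lambda>_. x"]) (simp add: finsum_ground_alg)
  ultimately show ?thesis
    unfolding fd_algebra_def fd_space_def using M.module_axioms module_ground_alg
    by (auto intro!: exI[of _ "{1}"] simp: algebra_simps)
qed

definition hom_space :: "('k::field, 'a) module \<Rightarrow> ('k, 'a, 'm) rmod \<Rightarrow> ('k, 'm \<Rightarrow> 'a) module" where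
  "hom_space A M = \<lparr>carrier = rhom A M (regular_rmod A), mult = undefined, one = undefined,
     zero = (\<lambda>x \<in> carrier M. \<zero>\<^bsub>A\<^esub>), add = (\<lambda>f g. \<lambda>x \<in> carrier M. f x \<oplus>\<^bsub>A\<^esub> g x),
     smult = (\<lambda>c f. \<lambda>x \<in> carrier M. c \<odot>\<^bsub>A\<^esub> f x)\<rparr>"

lemma hom_space_simps [simp]:
  "carrier (hom_space A M) = rhom A M (regular_rmod A)" "\<zero>\<^bsub>hom_space A M\<^esub> = (\<lambda>x \<in> carrier M. \<zero>\<^bsub>A\<^esub>)"
  "f \<oplus>\<^bsub>hom_space A M\<^esub> g = (\<lambda>x \<in> carrier M. f x \<oplus>\<^bsub>A\<^esub> g x)"
  "c \<odot>\<^bsub>hom_space A M\<^esub> f = (\<lambda>x \<in> carrier M. c \<odot>\<^bsub>A\<^esub> f x)"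
  by (simp_all add: hom_space_def)

text \<open>The left module structure of Hom(M, A); its dual is the right action on
  \<open>nakayama_mod A M\<close>.\<close>

definition lact :: "('k::field, 'a) module \<Rightarrow> ('k, 'a, 'm) rmod \<Rightarrow> 'a \<Rightarrow> ('m \<Rightarrow> 'a) \<Rightarrow> 'm \<Rightarrow> 'a" where
  "lact A M a f = (\<lambda>x \<in> carrier M. a \<otimes>\<^bsub>A\<^esub> f x)"

lemma nakayama_simps:
  "\<zero>\<^bsub>nakayama_mod A M\<^esub> = (\<lambda>f \<in> rhom A M (regular_rmod A). 0)"
  "\<phi> \<oplus>\<^bsub>nakayama_mod A M\<^esub> \<psi> = (\<lambda>f \<in> rhom A M (regular_rmod A). \<phi> f + \<psi> f)"
  "c \<odot>\<^bsub>nakayama_mod A M\<^esub> \<phi> = (\<lambda>f \<in> rhom A M (regular_rmod A). c * \<phi> f)"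
  "ract (nakayama_mod A M) \<phi> a = (\<lambda>f \<in> rhom A M (regular_rmod A). \<phi> (lact A M a f))"
  by (simp_all add: nakayama_mod_def Let_def lact_def)

lemma nakayama_carrier:
  "\<phi> \<in> carrier (nakayama_mod A M) \<longleftrightarrow> \<phi> \<in> extensional (rhom A M (regular_rmod A)) \<and>
     lin_on (hom_space A M) ground_alg (rhom A M (regular_rmod A)) \<phi>"
  by (simp add: nakayama_mod_def Let_def lin_on_def PiE_iff)

context fd_alg
begin

sublocale A: Module.module scalars A by (rule fd_algebraD[OF fd_algebra])

lemmas alg_simps = smult_carrier fd_algebraD(4,5)[OF fd_algebra] l_distr r_distr m_assoc
  A.smult_r_distr[simplified] A.smult_l_distr[simplified] A.smult_assoc1[simplified]

context
  fixes M :: "('k, 'a, 'm) rmod"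
  assumes M: "fd_rmod A M"
begin

abbreviation "HM \<equiv> rhom A M (regular_rmod A)"

lemma rhom_regI:
  assumes "\<And>x. x \<in> carrier M \<Longrightarrow> f x \<in> carrier A"
    and "\<And>x y. x \<in> carrier M \<Longrightarrow> y \<in> carrier M \<Longrightarrow> f (x \<oplus>\<^bsub>M\<^esub> y) = f x \<oplus>\<^bsub>A\<^esub> f y"
    and "\<And>x a. x \<in> carrier M \<Longrightarrow> a \<in> carrier A \<Longrightarrow> f (ract M x a) = f x \<otimes>\<^bsub>A\<^esub> a"
  shows "(\<lambda>x \<in> carrier M. f x) \<in> HM"
proof -
  interpret Mm: Module.module scalars M by (rule fd_rmodD[OF M])
  show ?thesis unfolding rhom_def using assms fd_rmodD(3)[OF M] by simp
qed

lemma rhom_regD: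
  assumes "f \<in> HM"
  shows "x \<in> carrier M \<Longrightarrow> f x \<in> carrier A"
    "x \<in> carrier M \<Longrightarrow> y \<in> carrier M \<Longrightarrow> f (x \<oplus>\<^bsub>M\<^esub> y) = f x \<oplus>\<^bsub>A\<^esub> f y"
    "x \<in> carrier M \<Longrightarrow> a \<in> carrier A \<Longrightarrow> f (ract M x a) = f x \<otimes>\<^bsub>A\<^esub> a"
    "f \<in> extensional (carrier M)" "x \<notin> carrier M \<Longrightarrow> f x = undefined"
    "lin_on M A (carrier M) f"
  using rhomD[OF assms] lin_on_rhom[OF M fd_rmod_regular assms subset_refl]
  by (auto simp: extensional_def lin_on_def)

lemma hom_space_zero: "(\<lambda>x \<in> carrier M. \<zero>\<^bsub>A\<^esub>) \<in> HM"
  by (rule rhom_regI) simp_all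

lemma hom_space_add: "f \<in> HM \<Longrightarrow> g \<in> HM \<Longrightarrow> (\<lambda>x \<in> carrier M. f x \<oplus>\<^bsub>A\<^esub> g x) \<in> HM"
  by (rule rhom_regI) (simp_all add: rhom_regD(1-3) alg_simps a_ac)

lemma hom_space_smult: "f \<in> HM \<Longrightarrow> (\<lambda>x \<in> carrier M. c \<odot>\<^bsub>A\<^esub> f x) \<in> HM"
  by (rule rhom_regI) (simp_all add: rhom_regD(1-3) alg_simps)

lemma lact_in: "a \<in> carrier A \<Longrightarrow> f \<in> HM \<Longrightarrow> lact A M a f \<in> HM"
  unfolding lact_def by (rule rhom_regI) (simp_all add: rhom_regD(1-3) alg_simps)

lemma lact_apply: "x \<in> carrier M \<Longrightarrow> lact A M a f x = a \<otimes>\<^bsub>A\<^esub> f x"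
  unfolding lact_def by simp

lemma module_hom_space: "Module.module scalars (hom_space A M)"
proof (rule Module.moduleI)
  show "cring (scalars :: 'k ring)" by (rule cring_from_type_algebra)
  have ext: "f = g" if "f \<in> HM" "g \<in> HM" "\<And>x. x \<in> carrier M \<Longrightarrow> f x = g x" for f g
    using extensionalityI[OF rhom_regD(4)[OF that(1)] rhom_regD(4)[OF that(2)]] that(3) by blast
  note cl = hom_space_zero hom_space_add hom_space_smult
  show "abelian_group (hom_space A M)"
  proof (rule abelian_groupI, unfold hom_space_simps)
    fix f g h assume f: "f \<in> HM"
    show "(\<lambda>x \<in> carrier M. (\<lambda>x \<in> carrier M. \<zero>\<^bsub>A\<^esub>) x \<oplus>\<^bsub>A\<^esub> f x) = f"
      by (rule ext[OF cl(2)[OF cl(1) f] f]) (simp add: rhom_regD(1)[OF f])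
    have m: "(\<lambda>x \<in> carrier M. \<ominus>\<^bsub>A\<^esub> f x) \<in> HM"
      by (rule rhom_regI) (simp_all add: rhom_regD(1-3)[OF f] minus_add l_minus)
    have "(\<lambda>x \<in> carrier M. (\<lambda>x \<in> carrier M. \<ominus>\<^bsub>A\<^esub> f x) x \<oplus>\<^bsub>A\<^esub> f x) = (\<lambda>x \<in> carrier M. \<zero>\<^bsub>A\<^esub>)"
      by (rule ext[OF cl(2)[OF m f] cl(1)]) (simp add: rhom_regD(1)[OF f] l_neg)
    with m show "\<exists>g \<in> HM. (\<lambda>x \<in> carrier M. g x \<oplus>\<^bsub>A\<^esub> f x) = (\<lambda>x \<in> carrier M. \<zero>\<^bsub>A\<^esub>)" by blast
    assume g: "g \<in> HM"
    show "(\<lambda>x \<in> carrier M. f x \<oplus>\<^bsub>A\<^esub> g x) \<in> HM" by (rule cl(2)[OF f g])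
    show "(\<lambda>x \<in> carrier M. f x \<oplus>\<^bsub>A\<^esub> g x) = (\<lambda>x \<in> carrier M. g x \<oplus>\<^bsub>A\<^esub> f x)"
      by (rule ext[OF cl(2)[OF f g] cl(2)[OF g f]]) (simp add: rhom_regD(1)[OF f] rhom_regD(1)[OF g] a_comm)
    assume h: "h \<in> HM"
    show "(\<lambda>x \<in> carrier M. (\<lambda>x \<in> carrier M. f x \<oplus>\<^bsub>A\<^esub> g x) x \<oplus>\<^bsub>A\<^esub> h x) =
      (\<lambda>x \<in> carrier M. f x \<oplus>\<^bsub>A\<^esub> (\<lambda>x \<in> carrier M. g x \<oplus>\<^bsub>A\<^esub> h x) x)"
      by (rule ext[OF cl(2)[OF cl(2)[OF f g] h] cl(2)[OF f cl(2)[OF g h]]])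
        (simp add: rhom_regD(1)[OF f] rhom_regD(1)[OF g] rhom_regD(1)[OF h] a_assoc)
  qed (rule cl(1))
  fix a b f assume "f \<in> carrier (hom_space A M)"
  then have f: "f \<in> HM" by simp
  show "a \<odot>\<^bsub>hom_space A M\<^esub> f \<in> carrier (hom_space A M)" using cl(3)[OF f] by simp
  show "(a \<oplus>\<^bsub>scalars\<^esub> b) \<odot>\<^bsub>hom_space A M\<^esub> f =
    a \<odot>\<^bsub>hom_space A M\<^esub> f \<oplus>\<^bsub>hom_space A M\<^esub> b \<odot>\<^bsub>hom_space A M\<^esub> f"
    by (simp add: restrict_def fun_eq_iff alg_simps rhom_regD(1)[OF f])
  show "(a \<otimes>\<^bsub>scalars\<^esub> b) \<odot>\<^bsub>hom_space A M\<^esub> f = a \<odot>\<^bsub>hom_space A M\<^esub> (b \<odot>\<^bsub>hom_space A M\<^esub> f)"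
    by (simp add: restrict_def fun_eq_iff alg_simps rhom_regD(1)[OF f])
  show "\<one>\<^bsub>scalars\<^esub> \<odot>\<^bsub>hom_space A M\<^esub> f = f"
    using A.smult_one by (simp add: restrict_def fun_eq_iff rhom_regD(1,5)[OF f])
  fix g assume "g \<in> carrier (hom_space A M)"
  then have g: "g \<in> HM" by simp
  show "a \<odot>\<^bsub>hom_space A M\<^esub> (f \<oplus>\<^bsub>hom_space A M\<^esub> g) =
    a \<odot>\<^bsub>hom_space A M\<^esub> f \<oplus>\<^bsub>hom_space A M\<^esub> a \<odot>\<^bsub>hom_space A M\<^esub> g"
    by (simp add: restrict_def fun_eq_iff alg_simps rhom_regD(1)[OF f] rhom_regD(1)[OF g])
qed

lemma lin_on_lact_left: "f \<in> HM \<Longrightarrow> lin_on A (hom_space A M) (carrier A) (\<lambda>a. lact A M a f)"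
  unfolding lin_on_def
  by (auto simp: lact_in) (auto simp: lact_def restrict_def fun_eq_iff alg_simps rhom_regD(1))

lemma lin_on_lact_right: "a \<in> carrier A \<Longrightarrow> lin_on (hom_space A M) (hom_space A M) HM (lact A M a)"
  unfolding lin_on_def
  by (auto simp: lact_in) (auto simp: lact_def restrict_def fun_eq_iff alg_simps rhom_regD(1))

lemma lin_on_eval: "x \<in> carrier M \<Longrightarrow> lin_on (hom_space A M) A HM (\<lambda>f. f x)"
  unfolding lin_on_def by (simp add: rhom_regD(1))

lemma lact_lact:
  "a \<in> carrier A \<Longrightarrow> b \<in> carrier A \<Longrightarrow> f \<in> HM \<Longrightarrow> lact A M a (lact A M b f) = lact A M (a \<otimes>\<^bsub>A\<^esub> b) f"
  unfolding lact_def by (simp add: restrict_def fun_eq_iff alg_simps rhom_regD(1))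

lemma lact_one: "f \<in> HM \<Longrightarrow> lact A M \<one>\<^bsub>A\<^esub> f = f"
  unfolding lact_def by (simp add: restrict_def fun_eq_iff rhom_regD(1,5))

lemma nakD:
  assumes "\<phi> \<in> carrier (nakayama_mod A M)"
  shows "f \<in> HM \<Longrightarrow> g \<in> HM \<Longrightarrow> \<phi> (\<lambda>x \<in> carrier M. f x \<oplus>\<^bsub>A\<^esub> g x) = \<phi> f + \<phi> g"
    "f \<in> HM \<Longrightarrow> \<phi> (\<lambda>x \<in> carrier M. c \<odot>\<^bsub>A\<^esub> f x) = c * \<phi> f"
    "f \<notin> HM \<Longrightarrow> \<phi> f = undefined" "lin_on (hom_space A M) ground_alg HM \<phi>"
    "\<phi> (\<lambda>x \<in> carrier M. \<zero>\<^bsub>A\<^esub>) = 0"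
  using assms lin_on_zero[OF module_hom_space module_ground_alg subsp_carrier[OF module_hom_space]]
  unfolding nakayama_carrier by (auto simp: lin_on_def extensional_def)

lemma nakI:
  assumes "\<And>f g. f \<in> HM \<Longrightarrow> g \<in> HM \<Longrightarrow> \<phi> (\<lambda>x \<in> carrier M. f x \<oplus>\<^bsub>A\<^esub> g x) = \<phi> f + \<phi> g"
    and "\<And>c f. f \<in> HM \<Longrightarrow> \<phi> (\<lambda>x \<in> carrier M. c \<odot>\<^bsub>A\<^esub> f x) = c * \<phi> f"
  shows "(\<lambda>f \<in> HM. \<phi> f) \<in> carrier (nakayama_mod A M)"
  unfolding nakayama_carrier lin_on_def
  using assms by (simp add: hom_space_add hom_space_smult)

lemma nak_lact:
  assumes "\<phi> \<in> carrier (nakayama_mod A M)" "f \<in> HM"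
  shows "a \<in> carrier A \<Longrightarrow> b \<in> carrier A \<Longrightarrow>
      \<phi> (lact A M (a \<oplus>\<^bsub>A\<^esub> b) f) = \<phi> (lact A M a f) + \<phi> (lact A M b f)"
    "a \<in> carrier A \<Longrightarrow> \<phi> (lact A M (c \<odot>\<^bsub>A\<^esub> a) f) = c * \<phi> (lact A M a f)"
    "g \<in> HM \<Longrightarrow> a \<in> carrier A \<Longrightarrow>
      \<phi> (lact A M a (\<lambda>x \<in> carrier M. f x \<oplus>\<^bsub>A\<^esub> g x)) = \<phi> (lact A M a f) + \<phi> (lact A M a g)"
    "a \<in> carrier A \<Longrightarrow> \<phi> (lact A M a (\<lambda>x \<in> carrier M. c \<odot>\<^bsub>A\<^esub> f x)) = c * \<phi> (lact A M a f)"
proof -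
  assume a: "a \<in> carrier A"
  show "b \<in> carrier A \<Longrightarrow> \<phi> (lact A M (a \<oplus>\<^bsub>A\<^esub> b) f) = \<phi> (lact A M a f) + \<phi> (lact A M b f)"
    using lin_on_lact_left[OF assms(2)] nakD(1)[OF assms(1), of "lact A M a f" "lact A M b f"]
      lact_in assms(2) a unfolding lin_on_def by simp
  show "\<phi> (lact A M (c \<odot>\<^bsub>A\<^esub> a) f) = c * \<phi> (lact A M a f)"
    using lin_on_lact_left[OF assms(2)] nakD(2)[OF assms(1), of "lact A M a f"]
      lact_in assms(2) a unfolding lin_on_def by simp
  show "g \<in> HM \<Longrightarrow> \<phi> (lact A M a (\<lambda>x \<in> carrier M. f x \<oplus>\<^bsub>A\<^esub> g x)) = \<phi> (lact A M a f) + \<phi> (lact A M a g)"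
    using lin_on_lact_right[OF a] nakD(1)[OF assms(1), of "lact A M a f" "lact A M a g"]
      lact_in assms(2) a unfolding lin_on_def by simp
  show "\<phi> (lact A M a (\<lambda>x \<in> carrier M. c \<odot>\<^bsub>A\<^esub> f x)) = c * \<phi> (lact A M a f)"
    using lin_on_lact_right[OF a] nakD(2)[OF assms(1), of "lact A M a f"]
      lact_in assms(2) a unfolding lin_on_def by simp
qed

lemma nak_ract_in:
  assumes "\<phi> \<in> carrier (nakayama_mod A M)" "a \<in> carrier A"
  shows "ract (nakayama_mod A M) \<phi> a \<in> carrier (nakayama_mod A M)"
  unfolding nakayama_simps by (rule nakI) (simp_all add: nak_lact(3,4)[OF assms(1)] assms(2))

lemma nak_ext:
  assumes "\<phi> \<in> carrier (nakayama_mod A M)" "\<psi> \<in> carrier (nakayama_mod A M)"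
    and "\<And>f. f \<in> HM \<Longrightarrow> \<phi> f = \<psi> f"
  shows "\<phi> = \<psi>"
proof
  fix f
  show "\<phi> f = \<psi> f"
    using nakD(3)[OF assms(1)] nakD(3)[OF assms(2)] assms(3) by (cases "f \<in> HM") simp_all
qed

lemma module_nakayama: "Module.module scalars (nakayama_mod A M)"
proof (rule Module.moduleI)
  show "cring (scalars :: 'k ring)" by (rule cring_from_type_algebra)
  let ?N = "nakayama_mod A M"
  have add: "\<phi> \<oplus>\<^bsub>?N\<^esub> \<psi> \<in> carrier ?N" if "\<phi> \<in> carrier ?N" "\<psi> \<in> carrier ?N" for \<phi> \<psi>
    unfolding nakayama_simps by (rule nakI) (simp_all add: nakD(1,2)[OF that(1)] nakD(1,2)[OF that(2)] algebra_simps)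
  have zero: "\<zero>\<^bsub>?N\<^esub> \<in> carrier ?N" unfolding nakayama_simps by (rule nakI) simp_all
  have sm: "c \<odot>\<^bsub>?N\<^esub> \<phi> \<in> carrier ?N" if "\<phi> \<in> carrier ?N" for \<phi> c
    unfolding nakayama_simps by (rule nakI) (simp_all add: nakD(1,2)[OF that] algebra_simps)
  show "abelian_group ?N"
  proof (rule abelian_groupI)
    fix \<phi> assume p: "\<phi> \<in> carrier ?N"
    show "\<exists>\<psi> \<in> carrier ?N. \<psi> \<oplus>\<^bsub>?N\<^esub> \<phi> = \<zero>\<^bsub>?N\<^esub>"
      by (rule bexI[OF _ sm[OF p, of "-1"]]) (simp add: nakayama_simps restrict_def fun_eq_iff)
    show "\<zero>\<^bsub>?N\<^esub> \<oplus>\<^bsub>?N\<^esub> \<phi> = \<phi>" using nakD(3)[OF p] by (simp add: nakayama_simps restrict_def fun_eq_iff)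
  qed (simp_all add: add zero, simp_all add: nakayama_simps restrict_def fun_eq_iff algebra_simps)
  show "\<one>\<^bsub>scalars\<^esub> \<odot>\<^bsub>?N\<^esub> \<phi> = \<phi>" if "\<phi> \<in> carrier ?N" for \<phi>
    using nakD(3)[OF that] by (simp add: nakayama_simps restrict_def fun_eq_iff)
  show "c \<odot>\<^bsub>?N\<^esub> \<phi> \<in> carrier ?N" if "\<phi> \<in> carrier ?N" for c \<phi> by (rule sm[OF that])
qed (simp_all add: nakayama_simps restrict_def fun_eq_iff algebra_simps)

end

end

lemma fd_space_scalar_functions:
  assumes "finite S"
  shows "fd_space (free_rmod (ground_alg :: ('k::field, 'k) module) S)"
  by (rule fd_alg.fd_space_free[OF fd_alg.intro[OF fd_algebra_ground_alg] assms])

text \<open>\<open>proj_mod_exists\<close> obtains the dual basis from the lifting property. In this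
  locale a projective module enters through its dual basis, which makes sense for elements of any
  type.\<close>

locale proj_mod = fd_alg A for A :: "('k::field, 'a) module" +
  fixes P :: "('k, 'a, 'm) rmod" and B :: "'m set" and F :: "'m \<Rightarrow> 'm \<Rightarrow> 'a"
  assumes P: "fd_rmod A P" and finB: "finite B" and BP: "B \<subseteq> carrier P"
    and F: "b \<in> B \<Longrightarrow> F b \<in> rhom A P (regular_rmod A)"
    and dual: "x \<in> carrier P \<Longrightarrow> x = (\<Oplus>\<^bsub>P\<^esub> b \<in> B. ract P b (F b x))"
begin

abbreviation "H \<equiv> rhom A P (regular_rmod A)"
abbreviation "NP \<equiv> nakayama_mod A P"

text \<open>Applying \<open>f\<close> to the dual basis expansion of x gives f(x) as the sum of the
  f(b) F_b(x): the functionals \<open>F b\<close> generate Hom(P, A) as a left module.\<close>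

lemma hom_expand:
  assumes f: "f \<in> H"
  shows "f = (\<Oplus>\<^bsub>hom_space A P\<^esub> b \<in> B. lact A P (f b) (F b))"
proof -
  interpret hs: Module.module scalars "hom_space A P" by (rule module_hom_space[OF P])
  have fb: "f b \<in> carrier A" if "b \<in> B" for b using rhom_regD(1)[OF P f] BP that by blast
  have l: "lact A P (f b) (F b) \<in> carrier (hom_space A P)" if "b \<in> B" for b
    using lact_in[OF P fb[OF that] F[OF that]] by simp
  have s: "(\<Oplus>\<^bsub>hom_space A P\<^esub> b \<in> B. lact A P (f b) (F b)) \<in> H"
    using hs.M.finsum_closed[of "\<lambda>b. lact A P (f b) (F b)" B] l by auto
  show ?thesis
  proof (rule extensionalityI[OF rhom_regD(4)[OF P f] rhom_regD(4)[OF P s]])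
    fix x assume x: "x \<in> carrier P"
    have t: "ract P b (F b x) \<in> carrier P" if "b \<in> B" for b
      using fd_rmodD(3)[OF P] rhom_regD(1)[OF P F[OF that] x] BP that by blast
    have "f x = f (\<Oplus>\<^bsub>P\<^esub> b \<in> B. ract P b (F b x))" using dual[OF x] by simp
    also have "\<dots> = (\<Oplus>\<^bsub>A\<^esub> b \<in> B. f (ract P b (F b x)))"
      by (rule lin_on_finsum[OF fd_rmodD(2)[OF P] A.module_axioms rhom_regD(6)[OF P f] finB t])
    also have "\<dots> = (\<Oplus>\<^bsub>A\<^esub> b \<in> B. lact A P (f b) (F b) x)"
    proof (rule finsum_cong')
      show "f (ract P b (F b x)) = lact A P (f b) (F b) x" if "b \<in> B" for b
        using rhom_regD(3)[OF P f subsetD[OF BP that] rhom_regD(1)[OF P F[OF that] x]]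
          lact_apply[OF P x] by simp
      show "(\<lambda>b. lact A P (f b) (F b) x) \<in> B \<rightarrow> carrier A"
        using l x rhom_regD(1)[OF P] by auto
    qed simp
    also have "\<dots> = (\<Oplus>\<^bsub>hom_space A P\<^esub> b \<in> B. lact A P (f b) (F b)) x"
      using lin_on_finsum[OF module_hom_space[OF P] A.module_axioms _ finB l, of "\<lambda>f. f x"]
        lin_on_eval[OF P x] by simp
    finally show "f x = (\<Oplus>\<^bsub>hom_space A P\<^esub> b \<in> B. lact A P (f b) (F b)) x" .
  qed
qed

lemma nak_expand:
  assumes p: "\<phi> \<in> carrier NP" and f: "f \<in> H"
  shows "\<phi> f = (\<Sum>b \<in> B. \<phi> (lact A P (f b) (F b)))"
proof -
  have l: "lact A P (f b) (F b) \<in> carrier (hom_space A P)" if "b \<in> B" for b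
    using lact_in[OF P _ F[OF that]] rhom_regD(1)[OF P f] BP that by auto
  have lp: "lin_on (hom_space A P) ground_alg (carrier (hom_space A P)) \<phi>" using nakD(4)[OF P p] by simp
  have "\<phi> f = \<phi> (\<Oplus>\<^bsub>hom_space A P\<^esub> b \<in> B. lact A P (f b) (F b))" using hom_expand[OF f] by simp
  also have "\<dots> = (\<Sum>b \<in> B. \<phi> (lact A P (f b) (F b)))"
    using lin_on_finsum[OF module_hom_space[OF P] module_ground_alg lp finB l]
      finsum_ground_alg[OF finB] by simp
  finally show ?thesis .
qed

text \<open>By \<open>nak_expand\<close> a functional is determined by its values on the multiples u
  F_b, where \<open>u\<close> runs through a finite generating set \<open>C\<close> of
  \<open>A\<close>. So the space embeds into the scalar functions on
  \<open>B \<times> C\<close>.\<close>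

lemma fd_space_nakayama: "fd_space NP"
proof -
  obtain C where C: "finite C" "C \<subseteq> carrier A"
    "\<And>x. x \<in> carrier A \<Longrightarrow> \<exists>c. x = (\<Oplus>\<^bsub>A\<^esub> b \<in> C. c b \<odot>\<^bsub>A\<^esub> b)"
    using fd_algebraD(2)[OF fd_algebra] unfolding fd_space_def by blast
  let ?L = "free_rmod (ground_alg :: ('k, 'k) module) (B \<times> C)"
  have L: "fd_space ?L" using finB C(1) by (intro fd_space_scalar_functions) simp
  define t :: "(('m \<Rightarrow> 'a) \<Rightarrow> 'k) \<Rightarrow> 'm \<times> 'a \<Rightarrow> 'k" where "t \<phi> = (\<lambda>(b, u) \<in> B \<times> C. \<phi> (lact A P u (F b)))" for \<phi>
  have mN: "Module.module scalars NP" by (rule module_nakayama[OF P])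
  have lF: "lact A P u (F b) \<in> H" if "b \<in> B" "u \<in> C" for b u
    using lact_in[OF P _ F] that C(2) by blast
  have lt: "lin_on NP ?L (carrier NP) t"
    unfolding lin_on_def
  proof (intro conjI ballI allI)
    show "t \<phi> \<in> carrier ?L" for \<phi> unfolding t_def free_rmod_def by (simp add: PiE_iff)
  qed (auto simp: t_def free_rmod_def nakayama_simps lF restrict_def fun_eq_iff)
  have inj: "inj_on t (carrier NP)"
  proof
    fix \<phi> \<psi> assume p: "\<phi> \<in> carrier NP" and q: "\<psi> \<in> carrier NP" and e: "t \<phi> = t \<psi>"
    have eq: "\<phi> (lact A P u (F b)) = \<psi> (lact A P u (F b))" if "b \<in> B" "u \<in> C" for b u
      using fun_cong[OF e, of "(b, u)"] that unfolding t_def by simp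
    have eq2: "\<phi> (lact A P a (F b)) = \<psi> (lact A P a (F b))" if b: "b \<in> B" and a: "a \<in> carrier A" for a b
    proof -
      obtain c where c: "a = (\<Oplus>\<^bsub>A\<^esub> u \<in> C. c u \<odot>\<^bsub>A\<^esub> u)" using C(3)[OF a] by blast
      have sum: "\<xi> (lact A P a (F b)) = (\<Sum>u \<in> C. c u * \<xi> (lact A P u (F b)))"
        if x: "\<xi> \<in> carrier NP" for \<xi>
      proof -
        have "lin_on A ground_alg (carrier A) (\<lambda>a. \<xi> (lact A P a (F b)))"
          unfolding lin_on_def using nak_lact(1,2)[OF P x F[OF b]] by simp
        from lin_on_finsum[OF A.module_axioms module_ground_alg this C(1), of "\<lambda>u. c u \<odot>\<^bsub>A\<^esub> u"]
        moreover have "c u \<odot>\<^bsub>A\<^esub> u \<in> carrier A" if "u \<in> C" for u using C(2) smult_carrier that by blast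
        ultimately have "\<xi> (lact A P a (F b)) = (\<Sum>u \<in> C. \<xi> (lact A P (c u \<odot>\<^bsub>A\<^esub> u) (F b)))"
          using c by (simp add: finsum_ground_alg[OF C(1)])
        then show ?thesis using nak_lact(2)[OF P x F[OF b]] C(2) by (simp add: subset_iff)
      qed
      show ?thesis unfolding sum[OF p] sum[OF q] using eq[OF b] by simp
    qed
    show "\<phi> = \<psi>"
    proof (rule nak_ext[OF P p q])
      fix f assume f: "f \<in> H"
      show "\<phi> f = \<psi> f"
        unfolding nak_expand[OF p f] nak_expand[OF q f]
        using eq2 rhom_regD(1)[OF P f] BP by (intro sum.cong) auto
    qed
  qed
  have sN: "subsp NP (carrier NP)" by (rule subsp_carrier[OF mN])
  let ?I = "?L\<lparr>carrier := t ` carrier NP\<rparr>"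
  have I: "fd_space ?I"
    by (rule fd_space_subsp[OF L subsp_image[OF mN module_fd_space[OF L] sN lt]])
  interpret N: Module.module scalars NP by (rule mN)
  have g: "inv_into (carrier NP) t (t \<phi>) = \<phi>" if "\<phi> \<in> carrier NP" for \<phi>
    using inj that by simp
  show ?thesis
  proof (rule fd_space_hom_image[OF I, where f = "inv_into (carrier NP) t"])
    show "inv_into (carrier NP) t ` carrier ?I = carrier NP" using inj by (simp add: inv_into_image_cancel)
    have "\<zero>\<^bsub>?L\<^esub> = t \<zero>\<^bsub>NP\<^esub>" using lin_on_zero[OF mN module_fd_space[OF L] sN lt] by simp
    then show "inv_into (carrier NP) t \<zero>\<^bsub>?I\<^esub> = \<zero>\<^bsub>NP\<^esub>" using g by simp
    fix x y c assume "x \<in> carrier ?I"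
    then obtain \<phi> where p: "\<phi> \<in> carrier NP" "x = t \<phi>" by auto
    have "c \<odot>\<^bsub>?L\<^esub> t \<phi> = t (c \<odot>\<^bsub>NP\<^esub> \<phi>)" using lt p unfolding lin_on_def by simp
    then show "inv_into (carrier NP) t (c \<odot>\<^bsub>?I\<^esub> x) = c \<odot>\<^bsub>NP\<^esub> inv_into (carrier NP) t x"
      using g p N.smult_closed[of c \<phi>] by simp
    assume "y \<in> carrier ?I"
    then obtain \<psi> where q: "\<psi> \<in> carrier NP" "y = t \<psi>" by auto
    have "t \<phi> \<oplus>\<^bsub>?L\<^esub> t \<psi> = t (\<phi> \<oplus>\<^bsub>NP\<^esub> \<psi>)" using lt p q unfolding lin_on_def by simp
    then show "inv_into (carrier NP) t (x \<oplus>\<^bsub>?I\<^esub> y) = inv_into (carrier NP) t x \<oplus>\<^bsub>NP\<^esub> inv_into (carrier NP) t y"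
      using g p q by simp
  qed
qed

lemma fd_rmod_nakayama: "fd_rmod A NP"
  unfolding fd_rmod_def
proof (intro conjI ballI allI fd_space_nakayama)
  fix \<phi> a assume p: "\<phi> \<in> carrier NP"
  show "ract NP \<phi> \<one>\<^bsub>A\<^esub> = \<phi>"
    using nakD(3)[OF P p] by (simp add: nakayama_simps restrict_def fun_eq_iff lact_one[OF P])
  assume a: "a \<in> carrier A"
  show "ract NP \<phi> a \<in> carrier NP" by (rule nak_ract_in[OF P p a])
  show "ract NP (\<phi> \<oplus>\<^bsub>NP\<^esub> \<psi>) a = ract NP \<phi> a \<oplus>\<^bsub>NP\<^esub> ract NP \<psi> a" for \<psi>
    using lact_in[OF P a] by (simp add: nakayama_simps restrict_def fun_eq_iff)
  show "ract NP (c \<odot>\<^bsub>NP\<^esub> \<phi>) a = c \<odot>\<^bsub>NP\<^esub> ract NP \<phi> a" for c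
    using lact_in[OF P a] by (simp add: nakayama_simps restrict_def fun_eq_iff)
  show "ract NP \<phi> (c \<odot>\<^bsub>A\<^esub> a) = c \<odot>\<^bsub>NP\<^esub> ract NP \<phi> a" for c
    using nak_lact(2)[OF P p _ a] by (simp add: nakayama_simps restrict_def fun_eq_iff)
  fix b assume b: "b \<in> carrier A"
  show "ract NP \<phi> (a \<oplus>\<^bsub>A\<^esub> b) = ract NP \<phi> a \<oplus>\<^bsub>NP\<^esub> ract NP \<phi> b"
    using nak_lact(1)[OF P p _ a b] by (simp add: nakayama_simps restrict_def fun_eq_iff)
  show "ract NP \<phi> (a \<otimes>\<^bsub>A\<^esub> b) = ract NP (ract NP \<phi> a) b"
    unfolding nakayama_simps
    by (rule restrict_ext) (simp add: lact_in[OF P b] lact_lact[OF P a b])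
qed

end

lemma (in fd_alg) proj_mod_exists:
  fixes P :: "('k, 'a) fmod"
  assumes "projective_rmod A P"
  shows "\<exists>B F. proj_mod A P B F"
proof -
  have P: "fd_rmod A P" using assms unfolding projective_rmod_def by blast
  show ?thesis
  proof (rule dual_basis[OF assms])
    fix B F assume "finite B" "B \<subseteq> carrier P"
      "\<And>b. b \<in> B \<Longrightarrow> F b \<in> rhom A P (regular_rmod A)"
      "\<And>x. x \<in> carrier P \<Longrightarrow> x = (\<Oplus>\<^bsub>P\<^esub> b \<in> B. ract P b (F b x))"
    then have "proj_mod A P B F"
      using P fd_alg_axioms by (intro proj_mod.intro proj_mod_axioms.intro)
    then show ?thesis by blast
  qed
qed

section \<open>Four-term exact sequences of complexes\<close>

definition ex4 ::
  "(int \<Rightarrow> ('k::field, 'm, 'w) module_scheme) \<Rightarrow> (int \<Rightarrow> 'm set) \<Rightarrow> (int \<Rightarrow> 'm \<Rightarrow> 'm) \<Rightarrow> (int \<Rightarrow> 'm \<Rightarrow> 'n) \<Rightarrow>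
   (int \<Rightarrow> ('k, 'n, 'x) module_scheme) \<Rightarrow> (int \<Rightarrow> 'n set) \<Rightarrow> (int \<Rightarrow> 'n \<Rightarrow> 'n) \<Rightarrow> (int \<Rightarrow> 'n \<Rightarrow> 'l) \<Rightarrow>
   (int \<Rightarrow> ('k, 'l, 'y) module_scheme) \<Rightarrow> (int \<Rightarrow> 'l set) \<Rightarrow> (int \<Rightarrow> 'l \<Rightarrow> 'l) \<Rightarrow> (int \<Rightarrow> 'l \<Rightarrow> 'o) \<Rightarrow>
   (int \<Rightarrow> ('k, 'o, 'z) module_scheme) \<Rightarrow> (int \<Rightarrow> 'o set) \<Rightarrow> (int \<Rightarrow> 'o \<Rightarrow> 'o) \<Rightarrow> bool" where
  "ex4 V1 U1 d1 f V2 U2 d2 g V3 U3 d3 h V4 U4 d4 \<longleftrightarrow>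
     vcpx V1 U1 d1 \<and> vcpx V2 U2 d2 \<and> vcpx V3 U3 d3 \<and> vcpx V4 U4 d4 \<and>
     (\<forall>i. lin_on (V1 i) (V2 i) (U1 i) (f i) \<and> lin_on (V2 i) (V3 i) (U2 i) (g i) \<and>
       lin_on (V3 i) (V4 i) (U3 i) (h i) \<and>
       (\<forall>x \<in> U1 i. f (i + 1) (d1 i x) = d2 i (f i x)) \<and>
       (\<forall>x \<in> U2 i. g (i + 1) (d2 i x) = d3 i (g i x)) \<and>
       (\<forall>x \<in> U3 i. h (i + 1) (d3 i x) = d4 i (h i x)) \<and>
       lker (V2 i) (U1 i) (f i) \<subseteq> {\<zero>\<^bsub>V1 i\<^esub>} \<and> f i ` U1 i = lker (V3 i) (U2 i) (g i) \<and>
       g i ` U2 i = lker (V4 i) (U3 i) (h i) \<and> h i ` U3 i = U4 i)"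

context
  fixes V1 :: "int \<Rightarrow> ('k::field, 'm, 'w) module_scheme" and U1 d1 f
    and V2 :: "int \<Rightarrow> ('k, 'n, 'x) module_scheme" and U2 d2 g
    and V3 :: "int \<Rightarrow> ('k, 'l, 'y) module_scheme" and U3 d3 h
    and V4 :: "int \<Rightarrow> ('k, 'o, 'z) module_scheme" and U4 d4
  assumes ex4: "ex4 V1 U1 d1 f V2 U2 d2 g V3 U3 d3 h V4 U4 d4"
begin

private abbreviation "K \<equiv> \<lambda>i. g i ` U2 i"

private lemma ex4D:
  "vcpx V1 U1 d1" "vcpx V2 U2 d2" "vcpx V3 U3 d3" "vcpx V4 U4 d4"
  "lin_on (V1 i) (V2 i) (U1 i) (f i)" "lin_on (V2 i) (V3 i) (U2 i) (g i)"
  "lin_on (V3 i) (V4 i) (U3 i) (h i)"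
  "x \<in> U1 i \<Longrightarrow> f (i + 1) (d1 i x) = d2 i (f i x)"
  "y \<in> U2 i \<Longrightarrow> g (i + 1) (d2 i y) = d3 i (g i y)"
  "z \<in> U3 i \<Longrightarrow> h (i + 1) (d3 i z) = d4 i (h i z)"
  "lker (V2 i) (U1 i) (f i) \<subseteq> {\<zero>\<^bsub>V1 i\<^esub>}" "f i ` U1 i = lker (V3 i) (U2 i) (g i)"
  "g i ` U2 i = lker (V4 i) (U3 i) (h i)" "h i ` U3 i = U4 i"
  using ex4 unfolding ex4_def by blast+

private lemma K_sub: "K i \<subseteq> U3 i"
  using ex4D(13)[of i] unfolding lker_def by blast

private lemma vcpx_K: "vcpx V3 K d3"
  unfolding vcpx_def
proof (intro allI conjI ballI)
  fix i
  show "fd_space (V3 i)" by (rule vcpxD[OF ex4D(3)])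
  show "subsp (V3 i) (K i)"
    by (rule subsp_image[OF vcpxD(2)[OF ex4D(2)] vcpxD(2)[OF ex4D(3)] vcpxD(3)[OF ex4D(2)] ex4D(6)])
  show "lin_on (V3 i) (V3 (i + 1)) (K i) (d3 i)"
    by (rule lin_on_subset[OF vcpxD(4)[OF ex4D(3)] K_sub])
  show "d3 i ` K i \<subseteq> K (i + 1)"
  proof
    fix w assume "w \<in> d3 i ` K i"
    then obtain y where "y \<in> U2 i" "w = d3 i (g i y)" by auto
    then show "w \<in> K (i + 1)" using ex4D(9)[of y i] vcpxD(5)[OF ex4D(2), of y i] by force
  qed
  show "d3 (i + 1) (d3 i x) = \<zero>\<^bsub>V3 (i + 1 + 1)\<^esub>" if "x \<in> K i" for x
    using vcpxD(6)[OF ex4D(3)] K_sub that by blast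
qed

private lemma ses1: "ses V1 U1 d1 f V2 U2 d2 g V3 K d3"
  unfolding ses_def using ex4D vcpx_K by simp

private lemma ses2: "ses V3 K d3 (\<lambda>i x. x) V3 U3 d3 h V4 U4 d4"
proof -
  have "lin_on (V3 i) (V3 i) (K i) (\<lambda>x. x)" for i
    using K_sub[of i] subspD(5)[OF vcpxD(3)[OF ex4D(3)], of _ i] unfolding lin_on_def by blast
  then show ?thesis
    unfolding ses_def using ex4D vcpx_K by (auto simp: lker_def)
qed

lemma ex4_vdim: "vdim (V1 i) (U1 i) + vdim (V3 i) (U3 i) = vdim (V2 i) (U2 i) + vdim (V4 i) (U4 i)"
  using ses_vdim[OF ses1, of i] ses_vdim[OF ses2, of i] by simp

private lemma K_right: "hdim V2 U2 d2 i = 0 \<Longrightarrow> hdim V1 U1 d1 (i + 1) = 0 \<Longrightarrow> hdim V3 K d3 i = 0"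
  by (rule ses_right[OF ses1])

private lemma K_left: "hdim V3 U3 d3 i = 0 \<Longrightarrow> hdim V4 U4 d4 (i - 1) = 0 \<Longrightarrow> hdim V3 K d3 i = 0"
  by (rule ses_left[OF ses2])

text \<open>A four-term exact sequence is glued from two short ones at the image \<open>K\<close> of
  \<open>g\<close>. Passing through both connecting maps shifts the degree by 2, which is why
  degrees two apart occur here and in \<open>ex4_fourth\<close>.\<close>

lemma ex4_first:
  "hdim V2 U2 d2 i = 0 \<Longrightarrow> hdim V3 U3 d3 (i - 1) = 0 \<Longrightarrow> hdim V4 U4 d4 (i - 2) = 0 \<Longrightarrow>
   hdim V1 U1 d1 i = 0"
  using ses_left[OF ses1, of i] K_left[of "i - 1"] by simp

lemma ex4_second:
  "hdim V1 U1 d1 i = 0 \<Longrightarrow> hdim V3 U3 d3 i = 0 \<Longrightarrow> hdim V4 U4 d4 (i - 1) = 0 \<Longrightarrow>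
   hdim V2 U2 d2 i = 0"
  using ses_mid[OF ses1, of i] K_left[of i] by simp

lemma ex4_third:
  "hdim V4 U4 d4 i = 0 \<Longrightarrow> hdim V2 U2 d2 i = 0 \<Longrightarrow> hdim V1 U1 d1 (i + 1) = 0 \<Longrightarrow>
   hdim V3 U3 d3 i = 0"
  using ses_mid[OF ses2, of i] K_right[of i] by simp

lemma ex4_fourth:
  "hdim V3 U3 d3 i = 0 \<Longrightarrow> hdim V2 U2 d2 (i + 1) = 0 \<Longrightarrow> hdim V1 U1 d1 (i + 2) = 0 \<Longrightarrow>
   hdim V4 U4 d4 i = 0"
  using ses_right[OF ses2, of i] K_right[of "i + 1"] by (simp add: algebra_simps)

end

section \<open>Star algebras in coordinates\<close>

datatype star_path = BX nat | BZ | BY nat | BA nat | BB nat | BC nat nat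

text \<open>
  A star algebra presented by coordinates: \<open>R i j\<close> says that \<open>a\<^sub>i b\<^sub>j\<close> is a relation, and
  \<open>co p u\<close> is the coefficient of the path \<open>p\<close> in \<open>u\<close>, where \<open>BX\<close>, \<open>BZ\<close>, \<open>BY\<close> are the trivial
  paths, \<open>BA\<close>, \<open>BB\<close> the arrows and \<open>BC i j\<close> is the path \<open>a\<^sub>i b\<^sub>j\<close>.
\<close>

definition star_basis :: "nat \<Rightarrow> nat \<Rightarrow> (nat \<Rightarrow> nat \<Rightarrow> bool) \<Rightarrow> star_path set" where
  "star_basis r s R = BX ` {1..r} \<union> {BZ} \<union> BY ` {1..s} \<union> BA ` {1..r} \<union> BB ` {1..s} \<union>
     {BC i j | i j. i \<in> {1..r} \<and> j \<in> {1..s} \<and> \<not> R i j}"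

lemma star_basis_iff [simp]:
  "BX i \<in> star_basis r s R \<longleftrightarrow> i \<in> {1..r}" "BZ \<in> star_basis r s R"
  "BY j \<in> star_basis r s R \<longleftrightarrow> j \<in> {1..s}" "BA i \<in> star_basis r s R \<longleftrightarrow> i \<in> {1..r}"
  "BB j \<in> star_basis r s R \<longleftrightarrow> j \<in> {1..s}"
  "BC i j \<in> star_basis r s R \<longleftrightarrow> i \<in> {1..r} \<and> j \<in> {1..s} \<and> \<not> R i j"
  by (auto simp: star_basis_def)

text \<open>\<open>co_ext\<close> and \<open>mk\<close> identify \<open>A\<close> with the
  coefficient functions supported on \<open>star_basis\<close>, so that identities in
  \<open>A\<close> reduce to a case distinction over the paths.\<close>

locale star_alg = fd_alg A for A :: "('k::field, 'a) module" +
  fixes r s :: nat and R :: "nat \<Rightarrow> nat \<Rightarrow> bool" and co :: "star_path \<Rightarrow> 'a \<Rightarrow> 'k"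
    and mk :: "(star_path \<Rightarrow> 'k) \<Rightarrow> 'a"
  assumes co_add: "u \<in> carrier A \<Longrightarrow> v \<in> carrier A \<Longrightarrow> co p (u \<oplus>\<^bsub>A\<^esub> v) = co p u + co p v"
    and co_smult: "u \<in> carrier A \<Longrightarrow> co p (c \<odot>\<^bsub>A\<^esub> u) = c * co p u"
    and co_out: "u \<in> carrier A \<Longrightarrow> p \<notin> star_basis r s R \<Longrightarrow> co p u = 0"
    and co_ext: "u \<in> carrier A \<Longrightarrow> v \<in> carrier A \<Longrightarrow> (\<And>p. co p u = co p v) \<Longrightarrow> u = v"
    and mk_closed [simp]: "mk h \<in> carrier A"
    and co_mk: "co p (mk h) = (if p \<in> star_basis r s R then h p else 0)"
    and co_mult: "u \<in> carrier A \<Longrightarrow> v \<in> carrier A \<Longrightarrow> co p (u \<otimes>\<^bsub>A\<^esub> v) =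
      (if p \<notin> star_basis r s R then 0 else case p of
         BX i \<Rightarrow> co (BX i) u * co (BX i) v
       | BZ \<Rightarrow> co BZ u * co BZ v
       | BY j \<Rightarrow> co (BY j) u * co (BY j) v
       | BA i \<Rightarrow> co (BX i) u * co (BA i) v + co (BA i) u * co BZ v
       | BB j \<Rightarrow> co BZ u * co (BB j) v + co (BB j) u * co (BY j) v
       | BC i j \<Rightarrow> co (BX i) u * co (BC i j) v + co (BA i) u * co (BB j) v + co (BC i j) u * co (BY j) v)"
    and co_one: "co p \<one>\<^bsub>A\<^esub> = (case p of BX i \<Rightarrow> if i \<in> {1..r} then 1 else 0 | BZ \<Rightarrow> 1
       | BY j \<Rightarrow> if j \<in> {1..s} then 1 else 0 | _ \<Rightarrow> 0)"
begin

text \<open>Idempotents and arrows are summed over sets of vertices. On M e_S, right multiplication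
  by \<open>aX S\<close> applies each a_i to its own component and adds the results;
  \<open>bY T\<close> sends M e_z to the sum of the M e_j with j in T.\<close>

definition eX where "eX S = mk (\<lambda>p. case p of BX i \<Rightarrow> if i \<in> S then 1 else 0 | _ \<Rightarrow> 0)"
definition eZ where "eZ = mk (\<lambda>p. case p of BZ \<Rightarrow> 1 | _ \<Rightarrow> 0)"
definition eY where "eY T = mk (\<lambda>p. case p of BY j \<Rightarrow> if j \<in> T then 1 else 0 | _ \<Rightarrow> 0)"
definition aX where "aX S = mk (\<lambda>p. case p of BA i \<Rightarrow> if i \<in> S then 1 else 0 | _ \<Rightarrow> 0)"
definition bY where "bY T = mk (\<lambda>p. case p of BB j \<Rightarrow> if j \<in> T then 1 else 0 | _ \<Rightarrow> 0)"

lemma elems_closed [simp]: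
  "eX S \<in> carrier A" "eZ \<in> carrier A" "eY T \<in> carrier A" "aX S \<in> carrier A" "bY T \<in> carrier A"
  by (simp_all add: eX_def eZ_def eY_def aX_def bY_def)

lemma co_zero [simp]: "co p \<zero>\<^bsub>A\<^esub> = 0"
  using co_smult[of "\<zero>\<^bsub>A\<^esub>" p 0] A.lmult_0[of "\<zero>\<^bsub>A\<^esub>"] by simp

lemma co_elems:
  "co p (eX S) = (case p of BX i \<Rightarrow> if i \<in> S \<and> i \<in> {1..r} then 1 else 0 | _ \<Rightarrow> 0)"
  "co p eZ = (case p of BZ \<Rightarrow> 1 | _ \<Rightarrow> 0)"
  "co p (eY T) = (case p of BY j \<Rightarrow> if j \<in> T \<and> j \<in> {1..s} then 1 else 0 | _ \<Rightarrow> 0)"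
  "co p (aX S) = (case p of BA i \<Rightarrow> if i \<in> S \<and> i \<in> {1..r} then 1 else 0 | _ \<Rightarrow> 0)"
  "co p (bY T) = (case p of BB j \<Rightarrow> if j \<in> T \<and> j \<in> {1..s} then 1 else 0 | _ \<Rightarrow> 0)"
  by (cases p; simp add: eX_def eZ_def eY_def aX_def bY_def co_mk)+

lemmas co_simps = co_add co_smult co_mult co_mk co_elems co_zero co_one

lemma elem_mult:
  "eX S \<otimes>\<^bsub>A\<^esub> eX S = eX S" "eZ \<otimes>\<^bsub>A\<^esub> eZ = eZ" "eY T \<otimes>\<^bsub>A\<^esub> eY T = eY T"
  "eX S \<otimes>\<^bsub>A\<^esub> aX S = aX S" "aX S \<otimes>\<^bsub>A\<^esub> eZ = aX S" "eZ \<otimes>\<^bsub>A\<^esub> bY T = bY T" "bY T \<otimes>\<^bsub>A\<^esub> eY T = bY T"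
  by (rule co_ext; simp add: co_simps split: star_path.split)+

lemma aX_bY_zero:
  assumes "\<And>i j. i \<in> S \<Longrightarrow> j \<in> T \<Longrightarrow> R i j"
  shows "aX S \<otimes>\<^bsub>A\<^esub> bY T = \<zero>\<^bsub>A\<^esub>"
  by (rule co_ext) (use assms in \<open>auto simp: co_simps split: star_path.split\<close>)

text \<open>u = u e says that \<open>u\<close> is a combination of paths ending at a vertex of
  \<open>e\<close>.\<close>

lemma right_ideal_eX:
  assumes "u \<in> carrier A" "u \<otimes>\<^bsub>A\<^esub> eX S = u" "p \<notin> BX ` (S \<inter> {1..r})"
  shows "co p u = 0"
proof -
  have "co p u = co p (u \<otimes>\<^bsub>A\<^esub> eX S)" using assms(2) by simp
  also have "\<dots> = 0" using assms(1,3) by (simp add: co_simps split: star_path.split) (auto split: if_splits)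
  finally show ?thesis .
qed

lemma right_ideal_eZ:
  assumes "u \<in> carrier A" "u \<otimes>\<^bsub>A\<^esub> eZ = u" "p \<notin> insert BZ (range BA)"
  shows "co p u = 0"
proof -
  have "co p u = co p (u \<otimes>\<^bsub>A\<^esub> eZ)" using assms(2) by simp
  also have "\<dots> = 0" using assms(1,3) by (auto simp: co_simps split: star_path.split)
  finally show ?thesis .
qed

lemma right_ideal_eY:
  assumes "u \<in> carrier A" "u \<otimes>\<^bsub>A\<^esub> eY T = u" "p \<notin> (\<Union>j \<in> T. {BY j, BB j} \<union> range (\<lambda>i. BC i j))"
  shows "co p u = 0"
proof -
  have "co p u = co p (u \<otimes>\<^bsub>A\<^esub> eY T)" using assms(2) by simp
  also have "\<dots> = 0" using assms(1,3) by (simp add: co_simps split: star_path.split) (auto split: if_splits)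
  finally show ?thesis .
qed

text \<open>For a projective \<open>M\<close> and the trivial path \<open>p\<close> at a vertex this
  is, at that vertex, the composite of the projection of M onto its top, the isomorphism of the top
  with the socle of \<nu>M, and the inclusion into \<nu>M. So its kernel is the radical of
  \<open>M\<close> and its image the socle of \<nu>M there; the lemmas below verify this for each
  kind of vertex.\<close>

definition eta_map :: "('k, 'a, 'm) rmod \<Rightarrow> star_path \<Rightarrow> 'm \<Rightarrow> ('m \<Rightarrow> 'a) \<Rightarrow> 'k" where
  "eta_map M p m = (\<lambda>f \<in> rhom A M (regular_rmod A). co p (f m))"

lemma lin_on_co: "lin_on A ground_alg (carrier A) (co p)"
  unfolding lin_on_def by (simp add: co_add co_smult)

end

locale star_proj = star_alg A r s R co mk + proj_mod A P B F
  for A :: "('k::field, 'a) module" and r s R co mk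
    and P :: "('k, 'a, 'm) rmod" and B :: "'m set" and F :: "'m \<Rightarrow> 'm \<Rightarrow> 'a"
begin

abbreviation "eta \<equiv> eta_map P"

lemmas eta_def = eta_map_def

lemmas fH = rhom_regD[OF P]
lemmas PD = fd_rmodD[OF P]
lemmas ND = fd_rmodD[OF fd_rmod_nakayama]

lemma eta_in: "m \<in> carrier P \<Longrightarrow> eta p m \<in> carrier NP"
  unfolding eta_def by (rule nakI[OF P]) (simp_all add: fH(1) co_add co_smult)

lemma lin_on_eta: "U \<subseteq> carrier P \<Longrightarrow> lin_on P NP U (eta p)"
proof -
  assume U: "U \<subseteq> carrier P"
  have fsm: "f (c \<odot>\<^bsub>P\<^esub> m) = c \<odot>\<^bsub>A\<^esub> f m" if "f \<in> H" "m \<in> carrier P" for f c m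
    using fH(6)[OF that(1)] that(2) unfolding lin_on_def by blast
  then show "lin_on P NP U (eta p)"
    unfolding lin_on_def
  proof (intro conjI ballI allI)
    fix x y c assume x: "x \<in> U"
    show "eta p x \<in> carrier NP" using eta_in U x by blast
    show "eta p (c \<odot>\<^bsub>P\<^esub> x) = c \<odot>\<^bsub>NP\<^esub> eta p x"
      unfolding eta_def nakayama_simps
      by (rule restrict_ext) (use x U in \<open>simp add: subset_iff fsm fH(1) co_smult\<close>)
    assume y: "y \<in> U"
    show "eta p (x \<oplus>\<^bsub>P\<^esub> y) = eta p x \<oplus>\<^bsub>NP\<^esub> eta p y"
      unfolding eta_def nakayama_simps
      by (rule restrict_ext) (use x y U in \<open>simp add: subset_iff fH(1,2) co_add\<close>)
  qed
qed

lemma eta_ract: "m \<in> carrier P \<Longrightarrow> a \<in> carrier A \<Longrightarrow> f \<in> H \<Longrightarrow> eta p (ract P m a) f = co p (f m \<otimes>\<^bsub>A\<^esub> a)"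
  unfolding eta_def by (simp add: fH(3))

lemma ract_eta:
  "m \<in> carrier P \<Longrightarrow> a \<in> carrier A \<Longrightarrow> f \<in> H \<Longrightarrow> ract NP (eta p m) a f = co p (a \<otimes>\<^bsub>A\<^esub> f m)"
  unfolding eta_def nakayama_simps by (simp add: lact_in[OF P] lact_apply[OF P])

lemma P_zero:
  assumes "x \<in> carrier P" "\<And>b. b \<in> B \<Longrightarrow> F b x = \<zero>\<^bsub>A\<^esub>"
  shows "x = \<zero>\<^bsub>P\<^esub>"
proof -
  interpret P: Module.module scalars P by (rule PD(2))
  have "ract P b (F b x) = \<zero>\<^bsub>P\<^esub>" if b: "b \<in> B" for b
    using PD(8)[of b "\<zero>\<^bsub>A\<^esub>" 0] P.lmult_0[of "ract P b \<zero>\<^bsub>A\<^esub>"] A.lmult_0[of "\<zero>\<^bsub>A\<^esub>"]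
      PD(3)[of b "\<zero>\<^bsub>A\<^esub>"] BP b assms(2)[OF b] by auto
  then have "(\<Oplus>\<^bsub>P\<^esub> b \<in> B. ract P b (F b x)) = (\<Oplus>\<^bsub>P\<^esub> b \<in> B. \<zero>\<^bsub>P\<^esub>)"
    by (intro P.M.finsum_cong') auto
  then show ?thesis using dual[OF assms(1)] by simp
qed

text \<open>If F_b(x) = q_b a for all \<open>b\<close>, then x = y a for y the sum of the b q_b:
  right divisibility by \<open>a\<close> is a condition on the coordinates.\<close>

lemma P_lift:
  assumes x: "x \<in> carrier P" and q: "\<And>b. b \<in> B \<Longrightarrow> \<exists>q \<in> carrier A. F b x = q \<otimes>\<^bsub>A\<^esub> a"
    and a: "a \<in> carrier A" and e: "e \<in> carrier A" "e \<otimes>\<^bsub>A\<^esub> e = e" "e \<otimes>\<^bsub>A\<^esub> a = a"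
  shows "\<exists>y \<in> mpart P e. x = ract P y a"
proof -
  interpret P: Module.module scalars P by (rule PD(2))
  obtain q where q: "\<And>b. b \<in> B \<Longrightarrow> q b \<in> carrier A \<and> F b x = q b \<otimes>\<^bsub>A\<^esub> a" using q by metis
  let ?y = "\<Oplus>\<^bsub>P\<^esub> b \<in> B. ract P b (q b)"
  have t: "ract P b (q b) \<in> carrier P" if "b \<in> B" for b using PD(3) BP q that by blast
  have y: "?y \<in> carrier P" using t by (intro P.M.finsum_closed) auto
  have "ract P ?y a = (\<Oplus>\<^bsub>P\<^esub> b \<in> B. ract P (ract P b (q b)) a)"
    by (rule lin_on_finsum[OF PD(2) PD(2) lin_on_ract[OF P a subset_refl] finB t])
  also have "\<dots> = (\<Oplus>\<^bsub>P\<^esub> b \<in> B. ract P b (F b x))"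
  proof (rule P.M.finsum_cong')
    show "ract P (ract P b (q b)) a = ract P b (F b x)" if b: "b \<in> B" for b
      using PD(6)[OF subsetD[OF BP b] _ a, of "q b"] q[OF b] by simp
    show "(\<lambda>b. ract P b (F b x)) \<in> B \<rightarrow> carrier P"
      using PD(3) BP fH(1)[OF F x] by auto
  qed simp
  finally have "ract P ?y a = x" using dual[OF x] by simp
  moreover have "ract P (ract P ?y e) a = ract P ?y a" using PD(6)[OF y e(1) a] e(3) by simp
  ultimately show ?thesis using mpart_ract[OF P e(1,1,2) y] by metis
qed

lemma F_part:
  assumes "b \<in> B" "x \<in> mpart P e" "e \<in> carrier A"
  shows "F b x \<in> carrier A" "F b x \<otimes>\<^bsub>A\<^esub> e = F b x"
  using assms(2) fH(1)[OF F[OF assms(1)], of x] fH(3)[OF F[OF assms(1)], of x e] assms(3)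
  unfolding mpart_def by auto

lemma eta_F: "b \<in> B \<Longrightarrow> eta p m (F b) = co p (F b m)"
  unfolding eta_def using F by simp

text \<open>
  A functional that only depends on the \<open>p\<close>-coefficients of the values, where \<open>p\<close> is the trivial
  path belonging to \<open>e\<close>, comes from an element of \<open>P e\<close>.
\<close>

lemma eta_surj:
  assumes p: "\<phi> \<in> mpart NP e" and e: "e \<in> carrier A" "e \<otimes>\<^bsub>A\<^esub> e = e"
    and dep: "\<And>u b. u \<in> carrier A \<Longrightarrow> b \<in> B \<Longrightarrow> \<phi> (lact A P (e \<otimes>\<^bsub>A\<^esub> u) (F b)) = co t u * \<phi> (lact A P e (F b))"
    and te: "\<And>u. u \<in> carrier A \<Longrightarrow> co t (u \<otimes>\<^bsub>A\<^esub> e) = co t u"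
  shows "\<exists>m \<in> mpart P e. \<phi> = eta t m"
proof -
  interpret P: Module.module scalars P by (rule PD(2))
  have pN: "\<phi> \<in> carrier NP" and pe: "ract NP \<phi> e = \<phi>" using p unfolding mpart_def by auto
  let ?c = "\<lambda>b. \<phi> (lact A P e (F b))"
  let ?m = "\<Oplus>\<^bsub>P\<^esub> b \<in> B. ?c b \<odot>\<^bsub>P\<^esub> b"
  have c: "?c b \<odot>\<^bsub>P\<^esub> b \<in> carrier P" if "b \<in> B" for b using that BP P.smult_closed by auto
  have m: "?m \<in> carrier P" using c by (intro P.M.finsum_closed) auto
  have me: "ract P ?m e \<in> mpart P e" by (rule mpart_ract[OF P e(1,1,2) m])
  have "\<phi> = eta t (ract P ?m e)"
  proof (rule nak_ext[OF P pN eta_in])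
    show "ract P ?m e \<in> carrier P" using PD(3)[OF m e(1)] .
    fix f assume f: "f \<in> H"
    have ef: "lact A P e f \<in> H" by (rule lact_in[OF P e(1) f])
    have fb: "f b \<in> carrier A" if "b \<in> B" for b using fH(1)[OF f] BP that by blast
    have "\<phi> f = \<phi> (lact A P e f)" using fun_cong[OF pe, of f] f by (simp add: nakayama_simps)
    also have "\<dots> = (\<Sum>b \<in> B. \<phi> (lact A P (e \<otimes>\<^bsub>A\<^esub> f b) (F b)))"
      using nak_expand[OF pN ef] lact_apply[OF P] BP by (simp add: subset_iff)
    also have "\<dots> = (\<Sum>b \<in> B. ?c b * co t (f b))" using dep fb by (intro sum.cong) auto
    also have "\<dots> = co t (f ?m)"
    proof -
      have "lin_on P A (carrier P) f" by (rule fH(6)[OF f])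
      then have "lin_on P ground_alg (carrier P) (\<lambda>x. co t (f x))"
        using lin_on_co unfolding lin_on_def by simp
      from lin_on_finsum[OF PD(2) module_ground_alg this finB c]
      have "co t (f ?m) = (\<Sum>b \<in> B. co t (f (?c b \<odot>\<^bsub>P\<^esub> b)))" by (simp add: finsum_ground_alg[OF finB])
      moreover have "co t (f (?c b \<odot>\<^bsub>P\<^esub> b)) = ?c b * co t (f b)" if b: "b \<in> B" for b
      proof -
        have "f (?c b \<odot>\<^bsub>P\<^esub> b) = ?c b \<odot>\<^bsub>A\<^esub> f b"
          using fH(6)[OF f] subsetD[OF BP b] unfolding lin_on_def by blast
        then show ?thesis using co_smult[OF fb[OF b]] by simp
      qed
      ultimately show ?thesis by simp
    qed
    also have "\<dots> = eta t (ract P ?m e) f"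
      using eta_ract[OF m e(1) f] te fH(1)[OF f m] by simp
    finally show "\<phi> f = eta t (ract P ?m e) f" .
  qed
  then show ?thesis using me by blast
qed

text \<open>\<open>g\<close> is applied to the coefficients \<open>f b\<close> in the expansion of
  \<open>f\<close> by the dual basis. The result is linear in \<open>f\<close> because evaluation at
  \<open>b\<close> is, although \<open>g\<close> is merely a linear map of \<open>A\<close>.\<close>

lemma induced_functional:
  assumes p: "\<phi> \<in> carrier NP" and g: "lin_on A A (carrier A) g"
  shows "(\<lambda>f \<in> H. \<Sum>b \<in> B. \<phi> (lact A P (g (f b)) (F b))) \<in> carrier NP"
proof (rule nakI[OF P])
  have Bc: "b \<in> carrier P" if "b \<in> B" for b using BP that by blast
  have gc: "g u \<in> carrier A" if "u \<in> carrier A" for u using g that unfolding lin_on_def by blast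
  have ga: "g (u \<oplus>\<^bsub>A\<^esub> v) = g u \<oplus>\<^bsub>A\<^esub> g v" "g (c \<odot>\<^bsub>A\<^esub> u) = c \<odot>\<^bsub>A\<^esub> g u"
    if "u \<in> carrier A" "v \<in> carrier A" for u v c using g that unfolding lin_on_def by auto
  fix f h c assume f: "f \<in> H"
  note fb = fH(1)[OF f Bc]
  have "\<phi> (lact A P (g ((\<lambda>x \<in> carrier P. c \<odot>\<^bsub>A\<^esub> f x) b)) (F b)) = c * \<phi> (lact A P (g (f b)) (F b))"
    if b: "b \<in> B" for b
    unfolding restrict_apply'[OF Bc[OF b]] ga(2)[OF fb[OF b] fb[OF b]]
    by (rule nak_lact(2)[OF P p F[OF b] gc[OF fb[OF b]]])
  then show "(\<Sum>b \<in> B. \<phi> (lact A P (g ((\<lambda>x \<in> carrier P. c \<odot>\<^bsub>A\<^esub> f x) b)) (F b))) =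
      c * (\<Sum>b \<in> B. \<phi> (lact A P (g (f b)) (F b)))"
    unfolding sum_distrib_left by (rule sum.cong[OF refl])
  assume h: "h \<in> H"
  note hb = fH(1)[OF h Bc]
  have "\<phi> (lact A P (g ((\<lambda>x \<in> carrier P. f x \<oplus>\<^bsub>A\<^esub> h x) b)) (F b)) =
      \<phi> (lact A P (g (f b)) (F b)) + \<phi> (lact A P (g (h b)) (F b))" if b: "b \<in> B" for b
    unfolding restrict_apply'[OF Bc[OF b]] ga(1)[OF fb[OF b] hb[OF b]]
    by (rule nak_lact(1)[OF P p F[OF b] gc[OF fb[OF b]] gc[OF hb[OF b]]])
  then show "(\<Sum>b \<in> B. \<phi> (lact A P (g ((\<lambda>x \<in> carrier P. f x \<oplus>\<^bsub>A\<^esub> h x) b)) (F b))) =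
      (\<Sum>b \<in> B. \<phi> (lact A P (g (f b)) (F b))) + (\<Sum>b \<in> B. \<phi> (lact A P (g (h b)) (F b)))"
    unfolding sum.distrib[symmetric] by (rule sum.cong[OF refl])
qed

text \<open>
  If \<open>g\<close> is a linear map with \<open>g (e' u) = g u\<close>, and \<open>\<phi> (g (a u) f) = \<phi> (e u f)\<close>, then the functional
  induced by \<open>g\<close> is a preimage of \<open>\<phi>\<close> under the right multiplication by \<open>a\<close>.
\<close>

lemma ract_surj:
  assumes p: "\<phi> \<in> mpart NP e" and e: "e \<in> carrier A" "e' \<in> carrier A" "a \<in> carrier A"
    and g: "lin_on A A (carrier A) g" and ge: "\<And>u. u \<in> carrier A \<Longrightarrow> g (e' \<otimes>\<^bsub>A\<^esub> u) = g u"
    and ga: "\<And>u b. u \<in> carrier A \<Longrightarrow> b \<in> B \<Longrightarrow>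
      \<phi> (lact A P (g (a \<otimes>\<^bsub>A\<^esub> u)) (F b)) = \<phi> (lact A P (e \<otimes>\<^bsub>A\<^esub> u) (F b))"
  shows "\<exists>\<psi> \<in> mpart NP e'. \<phi> = ract NP \<psi> a"
proof -
  have pN: "\<phi> \<in> carrier NP" and pe: "ract NP \<phi> e = \<phi>" using p unfolding mpart_def by auto
  let ?\<psi> = "\<lambda>f \<in> H. \<Sum>b \<in> B. \<phi> (lact A P (g (f b)) (F b))"
  have psi: "?\<psi> \<in> carrier NP" by (rule induced_functional[OF pN g])
  have Bc: "b \<in> carrier P" if "b \<in> B" for b using BP that by blast
  have "ract NP ?\<psi> e' = ?\<psi>"
  proof (rule nak_ext[OF P ND(3)[OF psi e(2)] psi])
    fix f assume f: "f \<in> H"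
    show "ract NP ?\<psi> e' f = ?\<psi> f"
      using f lact_in[OF P e(2) f] ge fH(1)[OF f] by (simp add: nakayama_simps lact_apply[OF P] Bc)
  qed
  then have "?\<psi> \<in> mpart NP e'" using psi unfolding mpart_def by simp
  moreover have "\<phi> = ract NP ?\<psi> a"
  proof (rule nak_ext[OF P pN ND(3)[OF psi e(3)]])
    fix f assume f: "f \<in> H"
    have "\<phi> f = \<phi> (lact A P e f)" using fun_cong[OF pe, of f] f by (simp add: nakayama_simps)
    also have "\<dots> = (\<Sum>b \<in> B. \<phi> (lact A P (e \<otimes>\<^bsub>A\<^esub> f b) (F b)))"
      using nak_expand[OF pN lact_in[OF P e(1) f]] by (simp add: lact_apply[OF P] Bc)
    also have "\<dots> = (\<Sum>b \<in> B. \<phi> (lact A P (g (a \<otimes>\<^bsub>A\<^esub> f b)) (F b)))"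
      using ga fH(1)[OF f Bc] by simp
    also have "\<dots> = ract NP ?\<psi> a f"
      using f lact_in[OF P e(3) f] by (simp add: nakayama_simps lact_apply[OF P] Bc)
    finally show "\<phi> f = ract NP ?\<psi> a f" .
  qed
  ultimately show ?thesis by blast
qed

text \<open>\<phi> a = 0 means that \<phi> vanishes on a Hom(P, A).\<close>

lemma nak_kill:
  assumes "\<phi> \<in> carrier NP" "ract NP \<phi> a = \<zero>\<^bsub>NP\<^esub>" "a \<in> carrier A" "w \<in> carrier A" "f \<in> H"
  shows "\<phi> (lact A P (a \<otimes>\<^bsub>A\<^esub> w) f) = 0"
  using fun_cong[OF assms(2), of "lact A P w f"] lact_in[OF P assms(4,5)] lact_lact[OF P assms(3-5)]
  by (simp add: nakayama_simps)

text \<open>No arrow ends at an x-vertex, so the coordinates of \<open>x\<close> are combinations of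
  trivial paths, and following these by the arrows a_i loses nothing.\<close>

lemma ract_aX_inj:
  assumes "x \<in> mpart P (eX S)" "ract P x (aX S) = \<zero>\<^bsub>P\<^esub>"
  shows "x = \<zero>\<^bsub>P\<^esub>"
proof (rule P_zero)
  show x: "x \<in> carrier P" using assms unfolding mpart_def by simp
  fix b assume b: "b \<in> B"
  note u = F_part[OF b assms(1) elems_closed(1)]
  have "F b x \<otimes>\<^bsub>A\<^esub> aX S = F b (ract P x (aX S))" using fH(3)[OF F[OF b] x] by simp
  also have "\<dots> = \<zero>\<^bsub>A\<^esub>"
    using assms(2) lin_on_zero[OF PD(2) A.module_axioms subsp_carrier[OF PD(2)] fH(6)[OF F[OF b]]] by simp
  finally have 0: "co (BA i) (F b x \<otimes>\<^bsub>A\<^esub> aX S) = 0" for i by simp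
  have X: "co (BX i) (F b x) = 0" if "i \<in> S \<inter> {1..r}" for i
    using 0[of i] that u(1) by (simp add: co_simps)
  show "F b x = \<zero>\<^bsub>A\<^esub>"
  proof (rule co_ext)
    show "co p (F b x) = co p \<zero>\<^bsub>A\<^esub>" for p
      using X right_ideal_eX[OF u, of p] by (cases "p \<in> BX ` (S \<inter> {1..r})") auto
  qed (use u in auto)
qed

lemma aX_factor:
  assumes "u \<in> carrier A" "\<And>p. p \<notin> BA ` S \<Longrightarrow> co p u = 0"
  shows "\<exists>q \<in> carrier A. u = q \<otimes>\<^bsub>A\<^esub> aX S"
proof (rule bexI[OF _ mk_closed], rule co_ext)
  let ?q = "mk (\<lambda>p. case p of BX i \<Rightarrow> co (BA i) u | _ \<Rightarrow> 0)"
  show "co p u = co p (?q \<otimes>\<^bsub>A\<^esub> aX S)" for p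
    using assms co_out[OF assms(1), of p] by (cases p) (auto simp: co_simps)
qed (use assms in auto)

text \<open>A coordinate of \<open>x\<close> is a combination of e_z and the a_i. Multiplication by
  b_j kills neither e_z nor an a_i with a_i b_j nonzero, so just the a_i with a_i b_j = 0 can
  occur.\<close>

lemma ker_bY:
  assumes x: "x \<in> mpart P eZ" and xb: "ract P x (bY {j}) = \<zero>\<^bsub>P\<^esub>" and j: "j \<in> {1..s}"
  shows "\<exists>y \<in> mpart P (eX {i \<in> {1..r}. R i j}). x = ract P y (aX {i \<in> {1..r}. R i j})"
proof (rule P_lift)
  show xP: "x \<in> carrier P" using x unfolding mpart_def by simp
  fix b assume b: "b \<in> B"
  note u = F_part[OF b x elems_closed(2)]
  have "F b x \<otimes>\<^bsub>A\<^esub> bY {j} = F b (ract P x (bY {j}))" using fH(3)[OF F[OF b] xP] by simp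
  also have "\<dots> = \<zero>\<^bsub>A\<^esub>"
    using xb lin_on_zero[OF PD(2) A.module_axioms subsp_carrier[OF PD(2)] fH(6)[OF F[OF b]]] by simp
  finally have 0: "co p (F b x \<otimes>\<^bsub>A\<^esub> bY {j}) = 0" for p by simp
  have Z: "co BZ (F b x) = 0" using 0[of "BB j"] u(1) j by (simp add: co_simps)
  have Ai: "co (BA i) (F b x) = 0" if "i \<in> {1..r}" "\<not> R i j" for i
    using 0[of "BC i j"] u(1) j that by (simp add: co_simps)
  show "\<exists>q \<in> carrier A. F b x = q \<otimes>\<^bsub>A\<^esub> aX {i \<in> {1..r}. R i j}"
  proof (rule aX_factor[OF u(1)])
    fix p assume "p \<notin> BA ` {i \<in> {1..r}. R i j}"
    then show "co p (F b x) = 0"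
      using Z Ai right_ideal_eZ[OF u, of p] co_out[OF u(1), of p] by (cases p) auto
  qed
qed (simp_all add: elem_mult)

lemma ker_eta_Z:
  assumes x: "x \<in> mpart P eZ" and x0: "eta BZ x = \<zero>\<^bsub>NP\<^esub>"
  shows "\<exists>y \<in> mpart P (eX {1..r}). x = ract P y (aX {1..r})"
proof (rule P_lift)
  show xP: "x \<in> carrier P" using x unfolding mpart_def by simp
  fix b assume b: "b \<in> B"
  note u = F_part[OF b x elems_closed(2)]
  have Z: "co BZ (F b x) = 0" using eta_F[OF b, of BZ x] x0 F[OF b] by (simp add: nakayama_simps)
  show "\<exists>q \<in> carrier A. F b x = q \<otimes>\<^bsub>A\<^esub> aX {1..r}"
  proof (rule aX_factor[OF u(1)])
    fix p assume "p \<notin> BA ` {1..r}"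
    then show "co p (F b x) = 0"
      using Z right_ideal_eZ[OF u, of p] co_out[OF u(1), of p] by (cases p) (auto simp: image_iff)
  qed
qed (simp_all add: elem_mult)

lemma ker_eta_Y:
  assumes x: "x \<in> mpart P (eY {j})" and x0: "eta (BY j) x = \<zero>\<^bsub>NP\<^esub>"
  shows "\<exists>y \<in> mpart P eZ. x = ract P y (bY {j})"
proof (rule P_lift)
  show xP: "x \<in> carrier P" using x unfolding mpart_def by simp
  fix b assume b: "b \<in> B"
  note u = F_part[OF b x elems_closed(3)]
  have Y: "co (BY j) (F b x) = 0" using eta_F[OF b, of "BY j" x] x0 F[OF b] by (simp add: nakayama_simps)
  \<comment> \<open>\<open>?q\<close> deletes the final arrow b_j from the paths ending at y_j; the
    trivial path does not occur because of \<open>Y\<close>.\<close>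
  let ?q = "mk (\<lambda>p. case p of BZ \<Rightarrow> co (BB j) (F b x) | BA i \<Rightarrow> co (BC i j) (F b x) | _ \<Rightarrow> 0)"
  have "F b x = ?q \<otimes>\<^bsub>A\<^esub> bY {j}"
  proof (rule co_ext)
    show "co p (F b x) = co p (?q \<otimes>\<^bsub>A\<^esub> bY {j})" for p
      using Y right_ideal_eY[OF u, of p] co_out[OF u(1), of p] by (cases p) (auto simp: co_simps)
  qed (use u in auto)
  then show "\<exists>q \<in> carrier A. F b x = q \<otimes>\<^bsub>A\<^esub> bY {j}" by (intro bexI[of _ ?q]) auto
qed (simp_all add: elem_mult)

lemma eta_X_inj:
  assumes x: "x \<in> mpart P (eX {i})" and x0: "eta (BX i) x = \<zero>\<^bsub>NP\<^esub>"
  shows "x = \<zero>\<^bsub>P\<^esub>"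
proof (rule P_zero)
  show xP: "x \<in> carrier P" using x unfolding mpart_def by simp
  fix b assume b: "b \<in> B"
  note u = F_part[OF b x elems_closed(1)]
  have X: "co (BX i) (F b x) = 0" using eta_F[OF b, of "BX i" x] x0 F[OF b] by (simp add: nakayama_simps)
  show "F b x = \<zero>\<^bsub>A\<^esub>"
  proof (rule co_ext)
    show "co p (F b x) = co p \<zero>\<^bsub>A\<^esub>" for p
      using X right_ideal_eX[OF u, of p] by (cases "p = BX i") auto
  qed (use u in auto)
qed

lemma eta_Y_surj:
  assumes p: "\<phi> \<in> mpart NP (eY {j})" and j: "j \<in> {1..s}"
  shows "\<exists>m \<in> mpart P (eY {j}). \<phi> = eta (BY j) m"
proof (rule eta_surj[OF p])
  fix u b assume u: "u \<in> carrier A" and b: "b \<in> B"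
  have "eY {j} \<otimes>\<^bsub>A\<^esub> u = co (BY j) u \<odot>\<^bsub>A\<^esub> eY {j}"
    by (rule co_ext) (use u j in \<open>auto simp: co_simps smult_carrier split: star_path.split\<close>)
  then show "\<phi> (lact A P (eY {j} \<otimes>\<^bsub>A\<^esub> u) (F b)) = co (BY j) u * \<phi> (lact A P (eY {j}) (F b))"
    using nak_lact(2)[OF P _ F[OF b]] p unfolding mpart_def by simp
qed (use j in \<open>auto simp: elem_mult co_simps\<close>)

lemma eta_Z_surj:
  assumes p: "\<phi> \<in> mpart NP eZ" and k: "ract NP \<phi> (bY {1..s}) = \<zero>\<^bsub>NP\<^esub>"
  shows "\<exists>m \<in> mpart P eZ. \<phi> = eta BZ m"
proof (rule eta_surj[OF p])
  have pN: "\<phi> \<in> carrier NP" using p unfolding mpart_def by simp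
  fix u b assume u: "u \<in> carrier A" and b: "b \<in> B"
  \<comment> \<open>\<open>?w\<close> is what remains of the paths b_j in \<open>u\<close> when this
    arrow is deleted. A functional killed by all b_j therefore sees only the coefficient of
    e_z.\<close>
  let ?w = "mk (\<lambda>p. case p of BY j \<Rightarrow> co (BB j) u | _ \<Rightarrow> 0)"
  have "eZ \<otimes>\<^bsub>A\<^esub> u = co BZ u \<odot>\<^bsub>A\<^esub> eZ \<oplus>\<^bsub>A\<^esub> bY {1..s} \<otimes>\<^bsub>A\<^esub> ?w"
    by (rule co_ext) (use u in \<open>auto simp: co_simps smult_carrier split: star_path.split\<close>)
  then show "\<phi> (lact A P (eZ \<otimes>\<^bsub>A\<^esub> u) (F b)) = co BZ u * \<phi> (lact A P eZ (F b))"
    using nak_lact(1,2)[OF P pN F[OF b]] nak_kill[OF pN k _ _ F[OF b]] smult_carrier by simp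
qed (auto simp: elem_mult co_simps)

lemma eta_X_surj:
  assumes p: "\<phi> \<in> mpart NP (eX {i})" and i: "i \<in> {1..r}" and k: "ract NP \<phi> (aX {i}) = \<zero>\<^bsub>NP\<^esub>"
  shows "\<exists>m \<in> mpart P (eX {i}). \<phi> = eta (BX i) m"
proof (rule eta_surj[OF p])
  have pN: "\<phi> \<in> carrier NP" using p unfolding mpart_def by simp
  fix u b assume u: "u \<in> carrier A" and b: "b \<in> B"
  \<comment> \<open>The paths in \<open>u\<close> that begin with a_i, with this arrow
    deleted.\<close>
  let ?w = "mk (\<lambda>p. case p of BZ \<Rightarrow> co (BA i) u | BB j \<Rightarrow> co (BC i j) u | _ \<Rightarrow> 0)"
  have "eX {i} \<otimes>\<^bsub>A\<^esub> u = co (BX i) u \<odot>\<^bsub>A\<^esub> eX {i} \<oplus>\<^bsub>A\<^esub> aX {i} \<otimes>\<^bsub>A\<^esub> ?w"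
    by (rule co_ext) (use u i in \<open>auto simp: co_simps co_out[OF u] smult_carrier split: star_path.split\<close>)
  then show "\<phi> (lact A P (eX {i} \<otimes>\<^bsub>A\<^esub> u) (F b)) = co (BX i) u * \<phi> (lact A P (eX {i}) (F b))"
    using nak_lact(1,2)[OF P pN F[OF b]] nak_kill[OF pN k _ _ F[OF b]] smult_carrier by simp
qed (use i in \<open>auto simp: elem_mult co_simps\<close>)

lemma ract_bY_surj:
  assumes p: "\<phi> \<in> mpart NP (eY T)"
  shows "\<exists>\<psi> \<in> mpart NP eZ. \<phi> = ract NP \<psi> (bY T)"
proof (rule ract_surj[OF p])
  \<comment> \<open>\<open>?g\<close> deletes a leading b_j with j in T; it turns
    \<open>bY T\<close> u back into e_T u.\<close>
  let ?g = "\<lambda>u. mk (\<lambda>p. case p of BY j \<Rightarrow> if j \<in> T then co (BB j) u else 0 | _ \<Rightarrow> 0)"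
  show "lin_on A A (carrier A) ?g"
    unfolding lin_on_def
    by (intro conjI ballI allI; (rule co_ext)?) (auto simp: co_simps smult_carrier split: star_path.split)
  fix u assume u: "u \<in> carrier A"
  show "?g (eZ \<otimes>\<^bsub>A\<^esub> u) = ?g u"
    by (rule co_ext) (use u in \<open>auto simp: co_simps split: star_path.split\<close>)
  have "?g (bY T \<otimes>\<^bsub>A\<^esub> u) = eY T \<otimes>\<^bsub>A\<^esub> u"
    by (rule co_ext) (use u in \<open>auto simp: co_simps split: star_path.split\<close>)
  then show "\<phi> (lact A P (?g (bY T \<otimes>\<^bsub>A\<^esub> u)) (F b)) = \<phi> (lact A P (eY T \<otimes>\<^bsub>A\<^esub> u) (F b))" for b by simp
qed auto

lemma ract_aX_surj:
  assumes p: "\<phi> \<in> mpart NP eZ" and i: "i \<in> {1..r}"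
    and k: "ract NP \<phi> (bY {j \<in> {1..s}. R i j}) = \<zero>\<^bsub>NP\<^esub>"
  shows "\<exists>\<psi> \<in> mpart NP (eX {i}). \<phi> = ract NP \<psi> (aX {i})"
proof (rule ract_surj[OF p])
  have pN: "\<phi> \<in> carrier NP" using p unfolding mpart_def by simp
  \<comment> \<open>\<open>?g\<close> deletes the leading arrow a_i. From a_i u it recovers e_z u up
    to the paths b_j with a_i b_j = 0, and by \<open>k\<close> the functional does not see
    those.\<close>
  let ?g = "\<lambda>u. mk (\<lambda>p. case p of BZ \<Rightarrow> co (BA i) u | BB j \<Rightarrow> co (BC i j) u | _ \<Rightarrow> 0)"
  show "lin_on A A (carrier A) ?g"
    unfolding lin_on_def
    by (intro conjI ballI allI; (rule co_ext)?) (auto simp: co_simps smult_carrier split: star_path.split)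
  fix u assume u: "u \<in> carrier A"
  show "?g (eX {i} \<otimes>\<^bsub>A\<^esub> u) = ?g u"
    by (rule co_ext) (use u i in \<open>auto simp: co_simps co_out[OF u] split: star_path.split\<close>)
  let ?w = "mk (\<lambda>p. case p of BY j \<Rightarrow> co (BB j) u | _ \<Rightarrow> 0)" and ?T = "{j \<in> {1..s}. R i j}"
  fix b assume b: "b \<in> B"
  have "eZ \<otimes>\<^bsub>A\<^esub> u = ?g (aX {i} \<otimes>\<^bsub>A\<^esub> u) \<oplus>\<^bsub>A\<^esub> bY ?T \<otimes>\<^bsub>A\<^esub> ?w"
    by (rule co_ext) (use u i in \<open>auto simp: co_simps split: star_path.split\<close>)
  then show "\<phi> (lact A P (?g (aX {i} \<otimes>\<^bsub>A\<^esub> u)) (F b)) = \<phi> (lact A P (eZ \<otimes>\<^bsub>A\<^esub> u) (F b))"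
    using nak_lact(1)[OF P pN F[OF b]] nak_kill[OF pN k _ _ F[OF b]] by simp
qed auto

end

section \<open>Dimension vectors and the Nakayama functor\<close>

context fd_alg
begin

lemma mpart_zero [simp]:
  assumes "fd_rmod A M"
  shows "mpart M \<zero>\<^bsub>A\<^esub> = {\<zero>\<^bsub>M\<^esub>}"
proof -
  interpret Mm: Module.module scalars M by (rule fd_rmodD[OF assms])
  have "ract M x \<zero>\<^bsub>A\<^esub> = \<zero>\<^bsub>M\<^esub>" if x: "x \<in> carrier M" for x
    using fd_rmodD(8)[OF assms x, of "\<zero>\<^bsub>A\<^esub>" 0] A.lmult_0[of "\<zero>\<^bsub>A\<^esub>"]
      Mm.lmult_0[of "ract M x \<zero>\<^bsub>A\<^esub>"] fd_rmodD(3)[OF assms x, of "\<zero>\<^bsub>A\<^esub>"] by simp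
  then show ?thesis unfolding mpart_def by auto
qed

text \<open>M (e + f) is the direct sum of M e and M f for orthogonal idempotents, and right
  multiplication by \<open>f\<close> is the projection; it commutes with the differentials.\<close>

lemma ses_idem:
  assumes C: "bounded_complex A C" and ef: "e \<in> carrier A" "f \<in> carrier A"
    and idem: "e \<otimes>\<^bsub>A\<^esub> e = e" "f \<otimes>\<^bsub>A\<^esub> f = f" "e \<otimes>\<^bsub>A\<^esub> f = \<zero>\<^bsub>A\<^esub>" "f \<otimes>\<^bsub>A\<^esub> e = \<zero>\<^bsub>A\<^esub>"
  shows "ses (cterm C) (cpart C e) (cdiff C) (\<lambda>i x. x)
    (cterm C) (cpart C (e \<oplus>\<^bsub>A\<^esub> f)) (cdiff C) (\<lambda>i x. ract (cterm C i) x f)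
    (cterm C) (cpart C f) (cdiff C)"
proof -
  have M: "fd_rmod A (cterm C i)" and d: "cdiff C i \<in> rhom A (cterm C i) (cterm C (i + 1))" for i
    using C unfolding bounded_complex_def by auto
  have g: "e \<oplus>\<^bsub>A\<^esub> f \<in> carrier A" using ef by simp
  have eg: "e \<otimes>\<^bsub>A\<^esub> (e \<oplus>\<^bsub>A\<^esub> f) = e" "f \<otimes>\<^bsub>A\<^esub> (e \<oplus>\<^bsub>A\<^esub> f) = f" "(e \<oplus>\<^bsub>A\<^esub> f) \<otimes>\<^bsub>A\<^esub> f = f"
    using ef idem by (simp_all add: r_distr l_distr)
  have part: "x \<in> carrier (cterm C i)" "ract (cterm C i) x h = x" if "x \<in> cpart C h i" for x h i
    using that unfolding cpart_def mpart_def by auto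
  have e_sub: "cpart C e i \<subseteq> cpart C (e \<oplus>\<^bsub>A\<^esub> f) i" for i
  proof
    fix x assume x: "x \<in> cpart C e i"
    show "x \<in> cpart C (e \<oplus>\<^bsub>A\<^esub> f) i"
      using mpart_ract[OF M ef(1) g eg(1) part(1)[OF x]] part(2)[OF x] unfolding cpart_def by simp
  qed
  have f_sub: "cpart C f i \<subseteq> cpart C (e \<oplus>\<^bsub>A\<^esub> f) i" for i
  proof
    fix x assume x: "x \<in> cpart C f i"
    show "x \<in> cpart C (e \<oplus>\<^bsub>A\<^esub> f) i"
      using mpart_ract[OF M ef(2) g eg(2) part(1)[OF x]] part(2)[OF x] unfolding cpart_def by simp
  qed
  show ?thesis
    unfolding ses_def
  proof (intro conjI allI ballI vcpx_cpart[OF C] ef g)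
    fix i
    let ?M = "cterm C i"
    interpret Mm: Module.module scalars ?M by (rule fd_rmodD[OF M])
    show "lin_on ?M ?M (cpart C e i) (\<lambda>x. x)" using part(1) unfolding lin_on_def by auto
    show "lin_on ?M ?M (cpart C (e \<oplus>\<^bsub>A\<^esub> f) i) (\<lambda>x. ract ?M x f)"
      by (rule lin_on_ract[OF M ef(2)]) (use part(1) in auto)
    show "ract (cterm C (i + 1)) (cdiff C i x) f = cdiff C i (ract ?M x f)"
      if "x \<in> cpart C (e \<oplus>\<^bsub>A\<^esub> f) i" for x
      using rhomD(3)[OF d part(1)[OF that] ef(2)] by simp
    show "lker ?M (cpart C e i) (\<lambda>x. x) \<subseteq> {\<zero>\<^bsub>?M\<^esub>}" by (auto simp: lker_def)
    show "(\<lambda>x. x) ` cpart C e i = lker ?M (cpart C (e \<oplus>\<^bsub>A\<^esub> f) i) (\<lambda>x. ract ?M x f)"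
    proof (intro equalityI subsetI)
      fix x assume "x \<in> (\<lambda>x. x) ` cpart C e i"
      then have x: "x \<in> cpart C e i" by simp
      have "ract ?M x f = ract ?M x (e \<otimes>\<^bsub>A\<^esub> f)"
        using fd_rmodD(6)[OF M part(1)[OF x] ef] part(2)[OF x] by simp
      also have "\<dots> = \<zero>\<^bsub>?M\<^esub>"
        using mpart_ract[OF M, of "\<zero>\<^bsub>A\<^esub>" "\<zero>\<^bsub>A\<^esub>" x i] mpart_zero[OF M] part(1)[OF x] idem(3) by simp
      finally show "x \<in> lker ?M (cpart C (e \<oplus>\<^bsub>A\<^esub> f) i) (\<lambda>x. ract ?M x f)"
        using x e_sub unfolding lker_def by auto
    next
      fix x assume "x \<in> lker ?M (cpart C (e \<oplus>\<^bsub>A\<^esub> f) i) (\<lambda>x. ract ?M x f)"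
      then have x: "x \<in> cpart C (e \<oplus>\<^bsub>A\<^esub> f) i" "ract ?M x f = \<zero>\<^bsub>?M\<^esub>" unfolding lker_def by auto
      have "x = ract ?M x e \<oplus>\<^bsub>?M\<^esub> ract ?M x f"
        using fd_rmodD(5)[OF M part(1)[OF x(1)] ef] part(2)[OF x(1)] by simp
      then have "ract ?M x e = x"
        using x(2) fd_rmodD(3)[OF M part(1)[OF x(1)] ef(1)] by simp
      then show "x \<in> (\<lambda>x. x) ` cpart C e i" using part(1)[OF x(1)] unfolding cpart_def mpart_def by simp
    qed
    show "(\<lambda>x. ract ?M x f) ` cpart C (e \<oplus>\<^bsub>A\<^esub> f) i = cpart C f i"
    proof (intro equalityI subsetI)
      fix y assume "y \<in> (\<lambda>x. ract ?M x f) ` cpart C (e \<oplus>\<^bsub>A\<^esub> f) i"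
      then show "y \<in> cpart C f i"
        using mpart_ract[OF M ef(2,2) idem(2) part(1)] unfolding cpart_def by auto
    next
      fix y assume y: "y \<in> cpart C f i"
      then show "y \<in> (\<lambda>x. ract ?M x f) ` cpart C (e \<oplus>\<^bsub>A\<^esub> f) i"
        using f_sub part(2)[OF y] by (metis (no_types, lifting) image_eqI subsetD)
    qed
  qed simp_all
qed

definition chi :: "('k, 'a, 'm) mod_complex \<Rightarrow> 'a \<Rightarrow> int" where
  "chi C e = echar (hd_part C e)"

definition pdim :: "('k, 'a, 'm) mod_complex \<Rightarrow> 'a \<Rightarrow> int \<Rightarrow> int" where
  "pdim C e i = int (vdim (cterm C i) (cpart C e i))"

lemma chi_pdim:
  assumes C: "bounded_complex A C" and n: "\<And>i. i \<le> -n \<or> i \<ge> n \<Longrightarrow> carrier (cterm C i) = {\<zero>\<^bsub>cterm C i\<^esub>}"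
    and "n \<ge> 0" and e: "e \<in> carrier A"
  shows "chi C e = (\<Sum>i = -n..n. esgn i * pdim C e i)"
proof -
  have M: "fd_rmod A (cterm C i)" for i using C unfolding bounded_complex_def by auto
  have z: "cpart C e i = {\<zero>\<^bsub>cterm C i\<^esub>}" if "i \<le> -n \<or> i \<ge> n" for i
    using n[OF that] ract_zero[OF M e, of i] unfolding cpart_def mpart_def by auto
  have "chi C e = echar (pdim C e)"
    unfolding chi_def hd_part_def pdim_def
    by (rule echar_hdim[OF vcpx_cpart[OF C e] z \<open>n \<ge> 0\<close>])
  also have "\<dots> = (\<Sum>i = -n..n. esgn i * pdim C e i)"
  proof (rule echar_eq)
    show "pdim C e i = 0" if "i < -n \<or> i > n" for i
      using z[of i] that vdim_zero[OF fd_rmodD(2)[OF M]] unfolding pdim_def by auto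
  qed
  finally show ?thesis .
qed

lemma nakayama_map_apply:
  "\<phi> \<in> carrier (nakayama_mod A M) \<Longrightarrow> g \<in> rhom A N (regular_rmod A) \<Longrightarrow>
   nakayama_map A M N u \<phi> g = \<phi> (compose (carrier M) g u)"
  unfolding nakayama_map_def by simp

lemma compose_rhom:
  assumes M: "fd_rmod A M" and N: "fd_rmod A N" and u: "u \<in> rhom A M N" and g: "g \<in> rhom A N (regular_rmod A)"
  shows "compose (carrier M) g u \<in> rhom A M (regular_rmod A)"
  unfolding compose_def
proof (rule rhom_regI[OF M])
  fix x assume x: "x \<in> carrier M"
  show "g (u x) \<in> carrier A" using rhomD(1)[OF g rhomD(1)[OF u x]] by simp
  show "g (u (x \<oplus>\<^bsub>M\<^esub> y)) = g (u x) \<oplus>\<^bsub>A\<^esub> g (u y)" if "y \<in> carrier M" for y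
    using rhomD(2)[OF g rhomD(1)[OF u x] rhomD(1)[OF u that]] rhomD(2)[OF u x that] by simp
  show "g (u (ract M x a)) = g (u x) \<otimes>\<^bsub>A\<^esub> a" if "a \<in> carrier A" for a
    using rhomD(3)[OF g rhomD(1)[OF u x] that] rhomD(3)[OF u x that] by simp
qed

lemma nakayama_map_rhom:
  assumes M: "fd_rmod A M" and N: "fd_rmod A N" and u: "u \<in> rhom A M N"
  shows "nakayama_map A M N u \<in> rhom A (nakayama_mod A M) (nakayama_mod A N)"
proof -
  note cr = compose_rhom[OF M N u]
  have c_add: "compose (carrier M) (\<lambda>x \<in> carrier N. f x \<oplus>\<^bsub>A\<^esub> g x) u =
      (\<lambda>x \<in> carrier M. compose (carrier M) f u x \<oplus>\<^bsub>A\<^esub> compose (carrier M) g u x)" for f g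
    unfolding compose_def by (rule restrict_ext) (simp add: rhomD(1)[OF u])
  have c_sm: "compose (carrier M) (\<lambda>x \<in> carrier N. c \<odot>\<^bsub>A\<^esub> f x) u =
      (\<lambda>x \<in> carrier M. c \<odot>\<^bsub>A\<^esub> compose (carrier M) f u x)" for c f
    unfolding compose_def by (rule restrict_ext) (simp add: rhomD(1)[OF u])
  have c_lact: "compose (carrier M) (lact A N a f) u = lact A M a (compose (carrier M) f u)" for a f
    unfolding compose_def lact_def by (rule restrict_ext) (simp add: rhomD(1)[OF u])
  have nm: "nakayama_map A M N u \<phi> = (\<lambda>g \<in> rhom A N (regular_rmod A). \<phi> (compose (carrier M) g u))"
    if "\<phi> \<in> carrier (nakayama_mod A M)" for \<phi> using that unfolding nakayama_map_def by simp
  interpret NM: Module.module scalars "nakayama_mod A M" by (rule module_nakayama[OF M])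
  show ?thesis
    unfolding rhom_def
  proof (intro CollectI conjI ballI)
    have "nakayama_map A M N u \<phi> \<in> carrier (nakayama_mod A N)" if p: "\<phi> \<in> carrier (nakayama_mod A M)" for \<phi>
      unfolding nm[OF p] by (rule nakI[OF N]) (simp_all add: c_add c_sm cr nakD(1,2)[OF M p])
    then show "nakayama_map A M N u \<in> carrier (nakayama_mod A M) \<rightarrow>\<^sub>E carrier (nakayama_mod A N)"
      by (auto simp: nakayama_map_def)
    fix \<phi> assume p: "\<phi> \<in> carrier (nakayama_mod A M)"
    show "nakayama_map A M N u (\<phi> \<oplus>\<^bsub>nakayama_mod A M\<^esub> \<psi>) =
        nakayama_map A M N u \<phi> \<oplus>\<^bsub>nakayama_mod A N\<^esub> nakayama_map A M N u \<psi>"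
      if q: "\<psi> \<in> carrier (nakayama_mod A M)" for \<psi>
      unfolding nm[OF p] nm[OF q] nm[OF NM.M.a_closed[OF p q]]
      unfolding nakayama_simps
      by (rule restrict_ext) (simp add: cr)
    show "nakayama_map A M N u (ract (nakayama_mod A M) \<phi> a) =
        ract (nakayama_mod A N) (nakayama_map A M N u \<phi>) a" if a: "a \<in> carrier A" for a
      unfolding nm[OF p] nm[OF nak_ract_in[OF M p a]]
      unfolding nakayama_simps
      by (rule restrict_ext) (simp add: cr lact_in[OF N a] c_lact)
  qed
qed

context
  fixes Q :: "('k, 'a) fcomplex"
  assumes Q: "projective_complex A Q"
begin

lemma projective_complexD:
  "bounded_complex A Q" "projective_rmod A (cterm Q i)" "fd_rmod A (cterm Q i)"
  "cdiff Q i \<in> rhom A (cterm Q i) (cterm Q (i + 1))"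
  using Q unfolding projective_complex_def bounded_complex_def by auto

lemma nakayama_fd_rmod: "fd_rmod A (nakayama_mod A (cterm Q i))"
proof -
  obtain B F where "proj_mod A (cterm Q i) B F" using proj_mod_exists[OF projective_complexD(2)] by blast
  then show ?thesis by (rule proj_mod.fd_rmod_nakayama)
qed

lemma nakayama_zero:
  assumes "carrier (cterm Q i) = {\<zero>\<^bsub>cterm Q i\<^esub>}"
  shows "carrier (nakayama_mod A (cterm Q i)) = {\<zero>\<^bsub>nakayama_mod A (cterm Q i)\<^esub>}"
proof -
  let ?M = "cterm Q i"
  note M = projective_complexD(3)[of i]
  interpret NM: Module.module scalars "nakayama_mod A ?M" by (rule module_nakayama[OF M])
  have f0: "f = (\<lambda>x \<in> carrier ?M. \<zero>\<^bsub>A\<^esub>)" if f: "f \<in> rhom A ?M (regular_rmod A)" for f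
  proof (rule extensionalityI[OF rhom_regD(4)[OF M f]])
    fix x assume "x \<in> carrier ?M"
    then have "x = \<zero>\<^bsub>?M\<^esub>" using assms by simp
    then show "f x = (\<lambda>x \<in> carrier ?M. \<zero>\<^bsub>A\<^esub>) x" using rhom_zero[OF M fd_rmod_regular f] assms by simp
  qed simp
  have "\<phi> = \<zero>\<^bsub>nakayama_mod A ?M\<^esub>" if p: "\<phi> \<in> carrier (nakayama_mod A ?M)" for \<phi>
  proof (rule nak_ext[OF M p NM.M.zero_closed])
    fix f assume f: "f \<in> rhom A ?M (regular_rmod A)"
    show "\<phi> f = \<zero>\<^bsub>nakayama_mod A ?M\<^esub> f" using f nakD(5)[OF M p] f0[OF f] by (simp add: nakayama_simps)
  qed
  then show ?thesis using NM.M.zero_closed by blast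
qed

lemma nakayama_complex_simps:
  "cterm (nakayama_complex A Q) i = nakayama_mod A (cterm Q i)"
  "cdiff (nakayama_complex A Q) i = nakayama_map A (cterm Q i) (cterm Q (i + 1)) (cdiff Q i)"
  by (simp_all add: nakayama_complex_def)

lemma bounded_nakayama_complex: "bounded_complex A (nakayama_complex A Q)"
  unfolding bounded_complex_def nakayama_complex_simps
proof (intro conjI allI ballI)
  fix i
  let ?M = "\<lambda>i. cterm Q i"
  note M = projective_complexD(3) and d = projective_complexD(4)
  show "fd_rmod A (nakayama_mod A (?M i))" by (rule nakayama_fd_rmod)
  show r: "nakayama_map A (?M i) (?M (i + 1)) (cdiff Q i) \<in> rhom A (nakayama_mod A (?M i)) (nakayama_mod A (?M (i + 1)))"
    for i by (rule nakayama_map_rhom[OF M M d])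
  fix \<phi> assume p: "\<phi> \<in> carrier (nakayama_mod A (?M i))"
  have dd: "cdiff Q (i + 1) (cdiff Q i x) = \<zero>\<^bsub>?M (i + 1 + 1)\<^esub>" if "x \<in> carrier (?M i)" for x
    using projective_complexD(1) that unfolding bounded_complex_def by blast
  show "nakayama_map A (?M (i + 1)) (?M (i + 1 + 1)) (cdiff Q (i + 1))
      (nakayama_map A (?M i) (?M (i + 1)) (cdiff Q i) \<phi>) = \<zero>\<^bsub>nakayama_mod A (?M (i + 1 + 1))\<^esub>" (is "?l = ?r")
  proof (rule nak_ext[OF M])
    show "?l \<in> carrier (nakayama_mod A (?M (i + 1 + 1)))" using rhomD(1)[OF r rhomD(1)[OF r p]] .
    interpret NM: Module.module scalars "nakayama_mod A (?M (i + 1 + 1))" by (rule module_nakayama[OF M])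
    show "?r \<in> carrier (nakayama_mod A (?M (i + 1 + 1)))" by (rule NM.M.zero_closed)
    fix g assume g: "g \<in> rhom A (?M (i + 1 + 1)) (regular_rmod A)"
    have c: "compose (carrier (?M i)) (compose (carrier (?M (i + 1))) g (cdiff Q (i + 1))) (cdiff Q i) =
        (\<lambda>x \<in> carrier (?M i). \<zero>\<^bsub>A\<^esub>)"
      unfolding compose_def
    proof (rule restrict_ext)
      fix x assume x: "x \<in> carrier (?M i)"
      show "(\<lambda>x \<in> carrier (?M (i + 1)). g (cdiff Q (i + 1) x)) (cdiff Q i x) = \<zero>\<^bsub>A\<^esub>"
        unfolding restrict_apply'[OF rhomD(1)[OF d x]] dd[OF x]
        using rhom_zero[OF M fd_rmod_regular g] by simp
    qed
    have "?l g = nakayama_map A (?M i) (?M (i + 1)) (cdiff Q i) \<phi> (compose (carrier (?M (i + 1))) g (cdiff Q (i + 1)))"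
      by (rule nakayama_map_apply[OF rhomD(1)[OF r p] g])
    also have "\<dots> = \<phi> (compose (carrier (?M i)) (compose (carrier (?M (i + 1))) g (cdiff Q (i + 1))) (cdiff Q i))"
      by (rule nakayama_map_apply[OF p compose_rhom[OF M M d g]])
    also have "\<dots> = 0" unfolding c by (rule nakD(5)[OF M p])
    also have "\<dots> = ?r g" unfolding nakayama_simps restrict_apply'[OF g] ..
    finally show "?l g = ?r g" .
  qed
next
  have "{i. \<not> is_zero_mod (nakayama_mod A (cterm Q i))} \<subseteq> {i. \<not> is_zero_mod (cterm Q i)}"
    using nakayama_zero unfolding is_zero_mod_def by blast
  then show "finite {i. \<not> is_zero_mod (nakayama_mod A (cterm Q i))}"
    using projective_complexD(1) finite_subset unfolding bounded_complex_def by blast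
qed

end

end

section \<open>The three exact sequences between a complex of projectives and its Nakayama
  image\<close>

context star_alg
begin

lemma star_proj_exists:
  fixes P :: "('k, 'a) fmod"
  assumes "projective_rmod A P"
  shows "\<exists>B F. star_proj A r s R co mk P B F"
  using proj_mod_exists[OF assms] star_alg_axioms by (auto simp: star_proj_def proj_mod_def)

context
  fixes Q :: "('k, 'a) fcomplex"
  assumes Q: "projective_complex A Q"
begin

private abbreviation "N \<equiv> nakayama_complex A Q"

private lemmas QD = projective_complexD[OF Q]
private lemmas Ns = nakayama_complex_simps[OF Q]
private lemmas bN = bounded_nakayama_complex[OF Q]
private lemmas ND = nakayama_fd_rmod[OF Q]

private lemma sp: "\<exists>B F. star_proj A r s R co mk (cterm Q i) B F"
  by (rule star_proj_exists[OF QD(2)])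

private lemma vQ: "e \<in> carrier A \<Longrightarrow> vcpx (cterm Q) (cpart Q e) (cdiff Q)"
  by (rule vcpx_cpart[OF QD(1)])

private lemma vN: "e \<in> carrier A \<Longrightarrow> vcpx (cterm N) (cpart N e) (cdiff N)"
  by (rule vcpx_cpart[OF bN])

private lemma dN: "cdiff N i \<in> rhom A (cterm N i) (cterm N (i + 1))"
  using bN unfolding bounded_complex_def by blast

private lemma part_carrier: "cpart C e i \<subseteq> carrier (cterm C i)"
  unfolding cpart_def mpart_def by auto

private lemma ract_diff:
  assumes "x \<in> carrier (cterm C i)" "a \<in> carrier A" "cdiff C i \<in> rhom A (cterm C i) (cterm C (i + 1))"
  shows "ract (cterm C (i + 1)) (cdiff C i x) a = cdiff C i (ract (cterm C i) x a)"
  using rhomD(3)[OF assms(3,1,2)] by simp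

private lemma lin_ract_Q: "a \<in> carrier A \<Longrightarrow> lin_on (cterm Q i) (cterm Q i) (cpart Q e i) (\<lambda>x. ract (cterm Q i) x a)"
  by (rule lin_on_ract[OF QD(3) _ part_carrier])

private lemma lin_ract_N: "a \<in> carrier A \<Longrightarrow> lin_on (cterm N i) (cterm N i) (cpart N e i) (\<lambda>x. ract (cterm N i) x a)"
  by (rule lin_on_ract[OF _ _ part_carrier]) (simp_all add: Ns ND)

private lemma lin_eta: "lin_on (cterm Q i) (cterm N i) (cpart Q e i) (eta_map (cterm Q i) p)"
proof -
  obtain B F where "star_proj A r s R co mk (cterm Q i) B F" using sp by blast
  then interpret star_proj A r s R co mk "cterm Q i" B F .
  show ?thesis unfolding Ns by (rule lin_on_eta[OF part_carrier])
qed

private lemma eta_diff: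
  assumes x: "x \<in> cpart Q e i"
  shows "eta_map (cterm Q (i + 1)) p (cdiff Q i x) = cdiff N i (eta_map (cterm Q i) p x)"
proof -
  have xc: "x \<in> carrier (cterm Q i)" by (rule subsetD[OF part_carrier x])
  obtain B F where "star_proj A r s R co mk (cterm Q i) B F" using sp by blast
  then interpret star_proj A r s R co mk "cterm Q i" B F .
  have e: "eta_map (cterm Q i) p x \<in> carrier (nakayama_mod A (cterm Q i))" by (rule eta_in[OF xc])
  show ?thesis
    unfolding Ns nakayama_map_def restrict_apply'[OF e]
    unfolding eta_map_def
  proof (rule restrict_ext)
    fix g assume g: "g \<in> rhom A (cterm Q (i + 1)) (regular_rmod A)"
    show "co p (g (cdiff Q i x)) =
      (\<lambda>f \<in> rhom A (cterm Q i) (regular_rmod A). co p (f x)) (compose (carrier (cterm Q i)) g (cdiff Q i))"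
      unfolding restrict_apply'[OF compose_rhom[OF QD(3,3,4) g]] using xc by (simp add: compose_def)
  qed
qed

text \<open>The radical of \<open>Q\<close> at y_j is the image of b_j, and its cokernel is the top.
  At the sink y_j all of \<nu>Q is socle, hence isomorphic to this top. The first map describes the
  kernel of b_j.\<close>

lemma ex4_Y:
  assumes j: "j \<in> {1..s}"
  defines "S \<equiv> {i \<in> {1..r}. R i j}"
  shows "ex4 (cterm Q) (cpart Q (eX S)) (cdiff Q) (\<lambda>i x. ract (cterm Q i) x (aX S))
    (cterm Q) (cpart Q eZ) (cdiff Q) (\<lambda>i x. ract (cterm Q i) x (bY {j}))
    (cterm Q) (cpart Q (eY {j})) (cdiff Q) (\<lambda>i. eta_map (cterm Q i) (BY j))
    (cterm N) (cpart N (eY {j})) (cdiff N)"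
  unfolding ex4_def
proof (intro conjI allI ballI vQ vN lin_ract_Q lin_eta elems_closed)
  fix i
  let ?M = "cterm Q i"
  obtain B F where "star_proj A r s R co mk ?M B F" using sp by blast
  then interpret star_proj A r s R co mk ?M B F .
  interpret Mm: Module.module scalars ?M by (rule PD(2))
  have pc: "x \<in> carrier ?M" "ract ?M x e = x" if "x \<in> cpart Q e i" for x e
    using that unfolding cpart_def mpart_def by auto
  show "ract (cterm Q (i + 1)) (cdiff Q i x) (aX S) = cdiff Q i (ract ?M x (aX S))" if "x \<in> cpart Q (eX S) i" for x
    using ract_diff[OF pc(1)[OF that] _ QD(4)] by simp
  show "ract (cterm Q (i + 1)) (cdiff Q i x) (bY {j}) = cdiff Q i (ract ?M x (bY {j}))" if "x \<in> cpart Q eZ i" for x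
    using ract_diff[OF pc(1)[OF that] _ QD(4)] by simp
  show "eta_map (cterm Q (i + 1)) (BY j) (cdiff Q i x) = cdiff N i (eta (BY j) x)" if "x \<in> cpart Q (eY {j}) i" for x
    by (rule eta_diff[OF that])
  show "lker ?M (cpart Q (eX S) i) (\<lambda>x. ract ?M x (aX S)) \<subseteq> {\<zero>\<^bsub>?M\<^esub>}"
    using ract_aX_inj unfolding lker_def cpart_def by blast
  show "(\<lambda>x. ract ?M x (aX S)) ` cpart Q (eX S) i = lker ?M (cpart Q eZ i) (\<lambda>x. ract ?M x (bY {j}))"
  proof (intro equalityI subsetI)
    fix y assume "y \<in> (\<lambda>x. ract ?M x (aX S)) ` cpart Q (eX S) i"
    then obtain x where x: "x \<in> cpart Q (eX S) i" "y = ract ?M x (aX S)" by auto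
    have "ract ?M y (bY {j}) = ract ?M x (aX S \<otimes>\<^bsub>A\<^esub> bY {j})" using PD(6)[OF pc(1)[OF x(1)]] x(2) by simp
    also have "aX S \<otimes>\<^bsub>A\<^esub> bY {j} = \<zero>\<^bsub>A\<^esub>" by (rule aX_bY_zero) (simp add: S_def)
    finally show "y \<in> lker ?M (cpart Q eZ i) (\<lambda>x. ract ?M x (bY {j}))"
      using mpart_ract[OF P _ _ elem_mult(5) pc(1)[OF x(1)]] x(2) mpart_zero[OF P]
        mpart_ract[OF P zero_closed zero_closed _ pc(1)[OF x(1)]] unfolding lker_def cpart_def by simp
  next
    fix y assume "y \<in> lker ?M (cpart Q eZ i) (\<lambda>x. ract ?M x (bY {j}))"
    then show "y \<in> (\<lambda>x. ract ?M x (aX S)) ` cpart Q (eX S) i"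
      using ker_bY[of y j] j unfolding lker_def cpart_def S_def by auto
  qed
  show "(\<lambda>x. ract ?M x (bY {j})) ` cpart Q eZ i = lker (cterm N i) (cpart Q (eY {j}) i) (eta (BY j))"
  proof (intro equalityI subsetI)
    fix y assume "y \<in> (\<lambda>x. ract ?M x (bY {j})) ` cpart Q eZ i"
    then obtain x where x: "x \<in> cpart Q eZ i" "y = ract ?M x (bY {j})" by auto
    have "eta (BY j) y = (\<lambda>f \<in> H. 0)"
      unfolding eta_def x(2)
      by (rule restrict_ext) (simp add: fH(1,3) pc(1)[OF x(1)] co_mult co_elems)
    then show "y \<in> lker (cterm N i) (cpart Q (eY {j}) i) (eta (BY j))"
      using mpart_ract[OF P _ _ elem_mult(7) pc(1)[OF x(1)]] x(2)
      unfolding lker_def cpart_def Ns nakayama_simps by simp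
  next
    fix y assume "y \<in> lker (cterm N i) (cpart Q (eY {j}) i) (eta (BY j))"
    then show "y \<in> (\<lambda>x. ract ?M x (bY {j})) ` cpart Q eZ i"
      using ker_eta_Y[of y j] unfolding lker_def cpart_def Ns by auto
  qed
  show "eta (BY j) ` cpart Q (eY {j}) i = cpart N (eY {j}) i"
  proof (intro equalityI subsetI)
    fix y assume "y \<in> eta (BY j) ` cpart Q (eY {j}) i"
    then obtain x where x: "x \<in> cpart Q (eY {j}) i" "y = eta (BY j) x" by auto
    note xc = pc(1)[OF x(1)]
    have "ract NP (eta (BY j) x) (eY {j}) = eta (BY j) x"
    proof (rule nak_ext[OF P ND(3)[OF eta_in[OF xc]] eta_in[OF xc]])
      show "ract NP (eta (BY j) x) (eY {j}) f = eta (BY j) x f" if "f \<in> H" for f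
        using ract_eta[OF xc _ that] that j fH(1)[OF that xc] by (simp add: co_mult co_elems eta_def)
    qed simp
    then show "y \<in> cpart N (eY {j}) i" using eta_in[OF xc] x(2) unfolding cpart_def mpart_def Ns by simp
  next
    fix y assume "y \<in> cpart N (eY {j}) i"
    then show "y \<in> eta (BY j) ` cpart Q (eY {j}) i"
      using eta_Y_surj[of y j] j unfolding cpart_def Ns by auto
  qed
qed

text \<open>The top of \<open>Q\<close> at z is Q e_z modulo the images of all a_i. It is isomorphic
  to the socle of \<nu>Q at z, which is the joint kernel of all b_j.\<close>

lemma ex4_Z:
  "ex4 (cterm Q) (cpart Q (eX {1..r})) (cdiff Q) (\<lambda>i x. ract (cterm Q i) x (aX {1..r}))
    (cterm Q) (cpart Q eZ) (cdiff Q) (\<lambda>i. eta_map (cterm Q i) BZ)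
    (cterm N) (cpart N eZ) (cdiff N) (\<lambda>i x. ract (cterm N i) x (bY {1..s}))
    (cterm N) (cpart N (eY {1..s})) (cdiff N)"
  unfolding ex4_def
proof (intro conjI allI ballI vQ vN lin_ract_Q lin_ract_N lin_eta elems_closed)
  fix i
  let ?M = "cterm Q i"
  obtain B F where "star_proj A r s R co mk ?M B F" using sp by blast
  then interpret star_proj A r s R co mk ?M B F .
  have pc: "x \<in> carrier ?M" "ract ?M x e = x" if "x \<in> cpart Q e i" for x e
    using that unfolding cpart_def mpart_def by auto
  have nc: "x \<in> carrier NP" "ract NP x e = x" if "x \<in> cpart N e i" for x e
    using that unfolding cpart_def mpart_def Ns by auto
  show "ract (cterm Q (i + 1)) (cdiff Q i x) (aX {1..r}) = cdiff Q i (ract ?M x (aX {1..r}))"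
    if "x \<in> cpart Q (eX {1..r}) i" for x
    using ract_diff[OF pc(1)[OF that] _ QD(4)] by simp
  show "eta_map (cterm Q (i + 1)) BZ (cdiff Q i x) = cdiff N i (eta BZ x)" if "x \<in> cpart Q eZ i" for x
    by (rule eta_diff[OF that])
  show "ract (cterm N (i + 1)) (cdiff N i x) (bY {1..s}) = cdiff N i (ract (cterm N i) x (bY {1..s}))"
    if "x \<in> cpart N eZ i" for x
    by (rule ract_diff[OF _ elems_closed(5) dN]) (rule subsetD[OF part_carrier that])
  show "lker ?M (cpart Q (eX {1..r}) i) (\<lambda>x. ract ?M x (aX {1..r})) \<subseteq> {\<zero>\<^bsub>?M\<^esub>}"
    using ract_aX_inj unfolding lker_def cpart_def by blast
  show "(\<lambda>x. ract ?M x (aX {1..r})) ` cpart Q (eX {1..r}) i = lker (cterm N i) (cpart Q eZ i) (eta BZ)"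
  proof (intro equalityI subsetI)
    fix y assume "y \<in> (\<lambda>x. ract ?M x (aX {1..r})) ` cpart Q (eX {1..r}) i"
    then obtain x where x: "x \<in> cpart Q (eX {1..r}) i" "y = ract ?M x (aX {1..r})" by auto
    have "eta BZ y = (\<lambda>f \<in> H. 0)"
      unfolding eta_def x(2)
      by (rule restrict_ext) (simp add: fH(1,3) pc(1)[OF x(1)] co_mult co_elems)
    then show "y \<in> lker (cterm N i) (cpart Q eZ i) (eta BZ)"
      using mpart_ract[OF P _ _ elem_mult(5) pc(1)[OF x(1)]] x(2)
      unfolding lker_def cpart_def Ns nakayama_simps by simp
  next
    fix y assume "y \<in> lker (cterm N i) (cpart Q eZ i) (eta BZ)"
    then show "y \<in> (\<lambda>x. ract ?M x (aX {1..r})) ` cpart Q (eX {1..r}) i"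
      using ker_eta_Z[of y] unfolding lker_def cpart_def Ns by auto
  qed
  show "eta BZ ` cpart Q eZ i = lker (cterm N i) (cpart N eZ i) (\<lambda>x. ract (cterm N i) x (bY {1..s}))"
  proof (intro equalityI subsetI)
    fix y assume "y \<in> eta BZ ` cpart Q eZ i"
    then obtain x where x: "x \<in> cpart Q eZ i" "y = eta BZ x" by auto
    note xc = pc(1)[OF x(1)]
    interpret NM: Module.module scalars NP by (rule ND(2))
    have "ract NP (eta BZ x) eZ = eta BZ x"
    proof (rule nak_ext[OF P ND(3)[OF eta_in[OF xc]] eta_in[OF xc]])
      show "ract NP (eta BZ x) eZ f = eta BZ x f" if "f \<in> H" for f
        using ract_eta[OF xc _ that] that fH(1)[OF that xc] by (simp add: co_mult co_elems eta_def)
    qed simp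
    moreover have "ract NP (eta BZ x) (bY {1..s}) = \<zero>\<^bsub>NP\<^esub>"
    proof (rule nak_ext[OF P ND(3)[OF eta_in[OF xc]] NM.M.zero_closed])
      show "ract NP (eta BZ x) (bY {1..s}) f = \<zero>\<^bsub>NP\<^esub> f" if "f \<in> H" for f
        using ract_eta[OF xc _ that] that fH(1)[OF that xc] by (simp add: co_mult co_elems nakayama_simps)
    qed simp
    ultimately show "y \<in> lker (cterm N i) (cpart N eZ i) (\<lambda>x. ract (cterm N i) x (bY {1..s}))"
      using eta_in[OF xc] x(2) unfolding lker_def cpart_def mpart_def Ns by simp
  next
    fix y assume "y \<in> lker (cterm N i) (cpart N eZ i) (\<lambda>x. ract (cterm N i) x (bY {1..s}))"
    then show "y \<in> eta BZ ` cpart Q eZ i"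
      using eta_Z_surj[of y] unfolding lker_def cpart_def Ns by auto
  qed
  show "(\<lambda>x. ract (cterm N i) x (bY {1..s})) ` cpart N eZ i = cpart N (eY {1..s}) i"
  proof (intro equalityI subsetI)
    fix y assume "y \<in> (\<lambda>x. ract (cterm N i) x (bY {1..s})) ` cpart N eZ i"
    then show "y \<in> cpart N (eY {1..s}) i"
      using mpart_ract[OF fd_rmod_nakayama _ _ elem_mult(7) nc(1)] unfolding cpart_def Ns by auto
  next
    fix y assume "y \<in> cpart N (eY {1..s}) i"
    then show "y \<in> (\<lambda>x. ract (cterm N i) x (bY {1..s})) ` cpart N eZ i"
      using ract_bY_surj[of y "{1..s}"] unfolding cpart_def Ns by auto
  qed
qed

text \<open>Dual to \<open>ex4_Y\<close>: at the source x_k all of \<open>Q\<close> is top, which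
  corresponds to the socle of \<nu>Q there, that is, to the kernel of a_k. The image of a_k is the
  joint kernel of the b_j with a_k b_j = 0.\<close>

lemma ex4_X:
  assumes k: "k \<in> {1..r}"
  defines "T \<equiv> {j \<in> {1..s}. R k j}"
  shows "ex4 (cterm Q) (cpart Q (eX {k})) (cdiff Q) (\<lambda>i. eta_map (cterm Q i) (BX k))
    (cterm N) (cpart N (eX {k})) (cdiff N) (\<lambda>i x. ract (cterm N i) x (aX {k}))
    (cterm N) (cpart N eZ) (cdiff N) (\<lambda>i x. ract (cterm N i) x (bY T))
    (cterm N) (cpart N (eY T)) (cdiff N)"
  unfolding ex4_def
proof (intro conjI allI ballI vQ vN lin_ract_Q lin_ract_N lin_eta elems_closed)
  fix i
  let ?M = "cterm Q i"
  obtain B F where "star_proj A r s R co mk ?M B F" using sp by blast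
  then interpret star_proj A r s R co mk ?M B F .
  interpret NM: Module.module scalars NP by (rule ND(2))
  have pc: "x \<in> carrier ?M" "ract ?M x e = x" if "x \<in> cpart Q e i" for x e
    using that unfolding cpart_def mpart_def by auto
  have nc: "x \<in> carrier NP" "ract NP x e = x" if "x \<in> cpart N e i" for x e
    using that unfolding cpart_def mpart_def Ns by auto
  show "eta_map (cterm Q (i + 1)) (BX k) (cdiff Q i x) = cdiff N i (eta (BX k) x)" if "x \<in> cpart Q (eX {k}) i" for x
    by (rule eta_diff[OF that])
  show "ract (cterm N (i + 1)) (cdiff N i x) (aX {k}) = cdiff N i (ract (cterm N i) x (aX {k}))"
    if "x \<in> cpart N (eX {k}) i" for x
    by (rule ract_diff[OF _ elems_closed(4) dN]) (rule subsetD[OF part_carrier that])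
  show "ract (cterm N (i + 1)) (cdiff N i x) (bY T) = cdiff N i (ract (cterm N i) x (bY T))"
    if "x \<in> cpart N eZ i" for x
    by (rule ract_diff[OF _ elems_closed(5) dN]) (rule subsetD[OF part_carrier that])
  show "lker (cterm N i) (cpart Q (eX {k}) i) (eta (BX k)) \<subseteq> {\<zero>\<^bsub>?M\<^esub>}"
    using eta_X_inj[of _ k] unfolding lker_def cpart_def Ns by blast
  show "eta (BX k) ` cpart Q (eX {k}) i = lker (cterm N i) (cpart N (eX {k}) i) (\<lambda>x. ract (cterm N i) x (aX {k}))"
  proof (intro equalityI subsetI)
    fix y assume "y \<in> eta (BX k) ` cpart Q (eX {k}) i"
    then obtain x where x: "x \<in> cpart Q (eX {k}) i" "y = eta (BX k) x" by auto
    note xc = pc(1)[OF x(1)]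
    have "ract NP (eta (BX k) x) (eX {k}) = eta (BX k) x"
    proof (rule nak_ext[OF P ND(3)[OF eta_in[OF xc]] eta_in[OF xc]])
      show "ract NP (eta (BX k) x) (eX {k}) f = eta (BX k) x f" if "f \<in> H" for f
        using ract_eta[OF xc _ that] that k fH(1)[OF that xc] by (simp add: co_mult co_elems eta_def)
    qed simp
    moreover have "ract NP (eta (BX k) x) (aX {k}) = \<zero>\<^bsub>NP\<^esub>"
    proof (rule nak_ext[OF P ND(3)[OF eta_in[OF xc]] NM.M.zero_closed])
      show "ract NP (eta (BX k) x) (aX {k}) f = \<zero>\<^bsub>NP\<^esub> f" if "f \<in> H" for f
        using ract_eta[OF xc _ that] that fH(1)[OF that xc] by (simp add: co_mult co_elems nakayama_simps)
    qed simp
    ultimately show "y \<in> lker (cterm N i) (cpart N (eX {k}) i) (\<lambda>x. ract (cterm N i) x (aX {k}))"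
      using eta_in[OF xc] x(2) unfolding lker_def cpart_def mpart_def Ns by simp
  next
    fix y assume "y \<in> lker (cterm N i) (cpart N (eX {k}) i) (\<lambda>x. ract (cterm N i) x (aX {k}))"
    then show "y \<in> eta (BX k) ` cpart Q (eX {k}) i"
      using eta_X_surj[of y k] k unfolding lker_def cpart_def Ns by auto
  qed
  show "(\<lambda>x. ract (cterm N i) x (aX {k})) ` cpart N (eX {k}) i = lker (cterm N i) (cpart N eZ i) (\<lambda>x. ract (cterm N i) x (bY T))"
  proof (intro equalityI subsetI)
    fix y assume "y \<in> (\<lambda>x. ract (cterm N i) x (aX {k})) ` cpart N (eX {k}) i"
    then obtain x where x: "x \<in> cpart N (eX {k}) i" "y = ract NP x (aX {k})" unfolding Ns by auto
    have "ract NP y (bY T) = ract NP x (aX {k} \<otimes>\<^bsub>A\<^esub> bY T)" using ND(6)[OF nc(1)[OF x(1)]] x(2) by simp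
    also have "aX {k} \<otimes>\<^bsub>A\<^esub> bY T = \<zero>\<^bsub>A\<^esub>" by (rule aX_bY_zero) (simp add: T_def)
    finally show "y \<in> lker (cterm N i) (cpart N eZ i) (\<lambda>x. ract (cterm N i) x (bY T))"
      using mpart_ract[OF fd_rmod_nakayama _ _ elem_mult(5) nc(1)[OF x(1)]] x(2) mpart_zero[OF fd_rmod_nakayama]
        mpart_ract[OF fd_rmod_nakayama zero_closed zero_closed _ nc(1)[OF x(1)]]
      unfolding lker_def cpart_def Ns by simp
  next
    fix y assume "y \<in> lker (cterm N i) (cpart N eZ i) (\<lambda>x. ract (cterm N i) x (bY T))"
    then show "y \<in> (\<lambda>x. ract (cterm N i) x (aX {k})) ` cpart N (eX {k}) i"
      using ract_aX_surj[of y k] k unfolding lker_def cpart_def Ns T_def by auto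
  qed
  show "(\<lambda>x. ract (cterm N i) x (bY T)) ` cpart N eZ i = cpart N (eY T) i"
  proof (intro equalityI subsetI)
    fix y assume "y \<in> (\<lambda>x. ract (cterm N i) x (bY T)) ` cpart N eZ i"
    then show "y \<in> cpart N (eY T) i"
      using mpart_ract[OF fd_rmod_nakayama _ _ elem_mult(7) nc(1)] unfolding cpart_def Ns by auto
  next
    fix y assume "y \<in> cpart N (eY T) i"
    then show "y \<in> (\<lambda>x. ract (cterm N i) x (bY T)) ` cpart N eZ i"
      using ract_bY_surj[of y T] unfolding cpart_def Ns by auto
  qed
qed

end

end

section \<open>Vanishing and Euler characteristics under the Nakayama functor\<close>

context star_alg
begin

lemma eX_empty: "eX {} = \<zero>\<^bsub>A\<^esub>" and eY_empty: "eY {} = \<zero>\<^bsub>A\<^esub>"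
  by (rule co_ext; simp add: co_elems split: star_path.split)+

lemma eX_insert: "k \<notin> S \<Longrightarrow> eX (insert k S) = eX S \<oplus>\<^bsub>A\<^esub> eX {k}"
  and eY_insert: "k \<notin> S \<Longrightarrow> eY (insert k S) = eY S \<oplus>\<^bsub>A\<^esub> eY {k}"
  by (rule co_ext; auto simp: co_simps split: star_path.split)+

lemma eX_orth: "S \<inter> S' = {} \<Longrightarrow> eX S \<otimes>\<^bsub>A\<^esub> eX S' = \<zero>\<^bsub>A\<^esub>"
  and eY_orth: "S \<inter> S' = {} \<Longrightarrow> eY S \<otimes>\<^bsub>A\<^esub> eY S' = \<zero>\<^bsub>A\<^esub>"
  by (rule co_ext; auto simp: co_simps split: star_path.split)+

lemma part_zero:
  assumes C: "bounded_complex A C"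
  shows "hd_part C \<zero>\<^bsub>A\<^esub> i = 0" "pdim C \<zero>\<^bsub>A\<^esub> i = 0"
proof -
  have M: "fd_rmod A (cterm C i)" for i using C unfolding bounded_complex_def by blast
  have z: "cpart C \<zero>\<^bsub>A\<^esub> i = {\<zero>\<^bsub>cterm C i\<^esub>}" for i unfolding cpart_def by (rule mpart_zero[OF M])
  show p: "pdim C \<zero>\<^bsub>A\<^esub> i = 0" for i unfolding pdim_def z using vdim_zero[OF fd_rmodD(2)[OF M]] by simp
  note v = vcpx_cpart[OF C zero_closed]
  show "hd_part C \<zero>\<^bsub>A\<^esub> i = 0"
    using vdim_vcpx[OF v, of i] p[of i] hdim_nonneg[OF v, of i] unfolding hd_part_def hdim_def pdim_def by simp
qed

lemma sum_part:
  assumes C: "bounded_complex A C" and S: "finite S"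
  shows "(\<And>k. k \<in> S \<Longrightarrow> hd_part C (eX {k}) i = 0) \<Longrightarrow> hd_part C (eX S) i = 0"
    "(\<And>k. k \<in> S \<Longrightarrow> hd_part C (eY {k}) i = 0) \<Longrightarrow> hd_part C (eY S) i = 0"
    "pdim C (eX S) i = (\<Sum>k \<in> S. pdim C (eX {k}) i)" "pdim C (eY S) i = (\<Sum>k \<in> S. pdim C (eY {k}) i)"
  using S
proof (induct S rule: finite_induct)
  case empty
  { case 1 show ?case using part_zero[OF C] by (simp add: eX_empty)
  next case 2 show ?case using part_zero[OF C] by (simp add: eY_empty)
  next case 3 show ?case using part_zero[OF C] by (simp add: eX_empty)
  next case 4 show ?case using part_zero[OF C] by (simp add: eY_empty) }
next
  case (insert k S)
  have o: "S \<inter> {k} = {}" "{k} \<inter> S = {}" using insert by auto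
  note sx = ses_idem[OF C elems_closed(1,1) elem_mult(1,1) eX_orth[OF o(1)] eX_orth[OF o(2)], folded eX_insert[OF insert(2)]]
  note sy = ses_idem[OF C elems_closed(3,3) elem_mult(3,3) eY_orth[OF o(1)] eY_orth[OF o(2)], folded eY_insert[OF insert(2)]]
  { case 1 then show ?case using ses_mid[OF sx, of i] insert(3) unfolding hd_part_def by simp
  next case 2 then show ?case using ses_mid[OF sy, of i] insert(4) unfolding hd_part_def by simp
  next case 3 show ?case using ses_vdim[OF sx, of i] insert(5) insert(1,2) unfolding pdim_def by simp
  next case 4 show ?case using ses_vdim[OF sy, of i] insert(6) insert(1,2) unfolding pdim_def by simp }
qed

definition videm :: "star_vertex \<Rightarrow> 'a" where
  "videm v = (case v of VX i \<Rightarrow> eX {i} | VZ \<Rightarrow> eZ | VY j \<Rightarrow> eY {j})"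

definition svert :: "star_vertex set" where
  "svert = VX ` {1..r} \<union> {VZ} \<union> VY ` {1..s}"

lemma svert_iff [simp]: "VX i \<in> svert \<longleftrightarrow> i \<in> {1..r}" "VZ \<in> svert" "VY j \<in> svert \<longleftrightarrow> j \<in> {1..s}"
  by (auto simp: svert_def)

lemma videm_closed [simp]: "videm v \<in> carrier A" and videm_idem [simp]: "videm v \<otimes>\<^bsub>A\<^esub> videm v = videm v"
  by (simp_all add: videm_def elem_mult split: star_vertex.split)

text \<open>The condition H^i(C) = 0, tested vertex by vertex because the idempotents of the
  vertices sum to 1.\<close>

definition vanish_at :: "('k, 'a, 'm) mod_complex \<Rightarrow> int \<Rightarrow> bool" where
  "vanish_at C i \<longleftrightarrow> (\<forall>v \<in> svert. hd_part C (videm v) i = 0)"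

lemma vanish_atD:
  assumes "vanish_at C i"
  shows "k \<in> {1..r} \<Longrightarrow> hd_part C (eX {k}) i = 0" "hd_part C eZ i = 0"
    "k \<in> {1..s} \<Longrightarrow> hd_part C (eY {k}) i = 0"
proof -
  have "hd_part C (videm v) i = 0" if "v \<in> svert" for v using assms that unfolding vanish_at_def by blast
  from this[of "VX k"] this[of VZ] this[of "VY k"]
  show "k \<in> {1..r} \<Longrightarrow> hd_part C (eX {k}) i = 0" "hd_part C eZ i = 0"
    "k \<in> {1..s} \<Longrightarrow> hd_part C (eY {k}) i = 0"
    by (simp_all add: videm_def)
qed

lemma vanish_atI:
  assumes "\<And>k. k \<in> {1..r} \<Longrightarrow> hd_part C (eX {k}) i = 0" "hd_part C eZ i = 0"
    "\<And>k. k \<in> {1..s} \<Longrightarrow> hd_part C (eY {k}) i = 0"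
  shows "vanish_at C i"
  using assms unfolding vanish_at_def svert_def videm_def by auto

lemma vanish_sum:
  assumes "bounded_complex A C" "vanish_at C i"
  shows "S \<subseteq> {1..r} \<Longrightarrow> hd_part C (eX S) i = 0" "S \<subseteq> {1..s} \<Longrightarrow> hd_part C (eY S) i = 0"
proof -
  show "S \<subseteq> {1..r} \<Longrightarrow> hd_part C (eX S) i = 0"
    by (rule sum_part(1)[OF assms(1) finite_subset[OF _ finite_atLeastAtMost]])
      (auto intro!: vanish_atD(1)[OF assms(2)])
  show "S \<subseteq> {1..s} \<Longrightarrow> hd_part C (eY S) i = 0"
    by (rule sum_part(2)[OF assms(1) finite_subset[OF _ finite_atLeastAtMost]])
      (auto intro!: vanish_atD(3)[OF assms(2)])
qed

context
  fixes Q :: "('k, 'a) fcomplex"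
  assumes Q: "projective_complex A Q"
begin

private abbreviation "NQ \<equiv> nakayama_complex A Q"

private lemmas bQQ = projective_complexD(1)[OF Q]
private lemmas bNQ = bounded_nakayama_complex[OF Q]

text \<open>The loss of two degrees comes from the sequence at y_j, where \<nu>Q is the fourth term
  and a part of \<open>Q\<close> the first. The vertices are treated in the order y, z, x, since the
  sequence at z involves \<nu>Q at the y_j and the one at x_k involves \<nu>Q at z and at the
  y_j.\<close>

theorem nakayama_vanish_below:
  assumes v: "\<And>i. i < 2 \<Longrightarrow> vanish_at Q i" and i: "i < 0"
  shows "vanish_at NQ i"
proof -
  have Y: "hd_part NQ (eY {j}) i = 0" if j: "j \<in> {1..s}" "i < 0" for j i
  proof -
    have "hd_part Q (eX {i \<in> {1..r}. R i j}) (i + 2) = 0"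
      by (rule vanish_sum[OF bQQ v]) (use j in auto)
    moreover have "hd_part Q eZ (i + 1) = 0" "hd_part Q (eY {j}) i = 0"
      using vanish_atD(2)[OF v, of "i + 1"] vanish_atD(3)[OF v, of i j] j by simp_all
    ultimately show ?thesis using ex4_fourth[OF ex4_Y[OF Q j(1)], of i] unfolding hd_part_def by simp
  qed
  have YT: "hd_part NQ (eY T) i = 0" if "T \<subseteq> {1..s}" "i < 0" for T i
    by (rule sum_part(2)[OF bNQ finite_subset[OF that(1) finite_atLeastAtMost]])
      (use that Y in auto)
  have Z: "hd_part NQ eZ i = 0" if "i < 0" for i
    using ex4_third[OF ex4_Z[OF Q], of i] vanish_atD[OF v] vanish_sum[OF bQQ v] YT that
    unfolding hd_part_def by auto
  show ?thesis
  proof (rule vanish_atI[OF _ Z[OF i] Y[OF _ i]])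
    fix k assume k: "k \<in> {1..r}"
    have "hd_part NQ (eY {j \<in> {1..s}. R k j}) (i - 1) = 0" by (rule YT) (use i in auto)
    then show "hd_part NQ (eX {k}) i = 0"
      using ex4_second[OF ex4_X[OF Q k], of i] vanish_atD[OF v] Z[OF i] k i
      unfolding hd_part_def by auto
  qed
qed

text \<open>The same sequences read from \<nu>Q to \<open>Q\<close>, now in the order x, z, y; the
  two degrees are lost at x_k.\<close>

theorem nakayama_vanish_above:
  assumes v: "\<And>i. i > 0 \<Longrightarrow> vanish_at NQ i" and i: "i > 2"
  shows "vanish_at Q i"
proof -
  have X: "hd_part Q (eX {k}) i = 0" if k: "k \<in> {1..r}" "i > 2" for k i
  proof -
    have "hd_part NQ (eY {j \<in> {1..s}. R k j}) (i - 2) = 0"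
      by (rule vanish_sum[OF bNQ v]) (use k in auto)
    then show ?thesis
      using ex4_first[OF ex4_X[OF Q k(1)], of i] vanish_atD[OF v, of i] vanish_atD[OF v, of "i - 1"] k
      unfolding hd_part_def by auto
  qed
  have XS: "hd_part Q (eX S) i = 0" if "S \<subseteq> {1..r}" "i > 2" for S i
    by (rule sum_part(1)[OF bQQ finite_subset[OF that(1) finite_atLeastAtMost]])
      (use that X in auto)
  have Z: "hd_part Q eZ i = 0" if "i > 2" for i
    using ex4_second[OF ex4_Z[OF Q], of i] vanish_atD[OF v, of i] vanish_sum[OF bNQ v, of "i - 1"] XS[of "{1..r}" i] that
    unfolding hd_part_def by auto
  show ?thesis
  proof (rule vanish_atI[OF X[OF _ i] Z[OF i]])
    fix j assume j: "j \<in> {1..s}"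
    have "hd_part Q (eX {i \<in> {1..r}. R i j}) (i + 1) = 0" by (rule XS) (use i in auto)
    then show "hd_part Q (eY {j}) i = 0"
      using ex4_third[OF ex4_Y[OF Q j], of i] vanish_atD(3)[OF v, of i j] Z[OF i] j i
      unfolding hd_part_def by auto
  qed
qed

text \<open>The sequences are exact in every degree, so these are alternating sums of the identities
  \<open>ex4_vdim\<close> for the terms; \<open>chi_pdim\<close> allows terms in place of
  cohomology.\<close>

theorem nakayama_chi:
  shows "j \<in> {1..s} \<Longrightarrow> chi NQ (eY {j}) = chi Q (eY {j}) - chi Q eZ + (\<Sum>i | i \<in> {1..r} \<and> R i j. chi Q (eX {i}))"
    "chi NQ eZ = (\<Sum>j \<in> {1..s}. chi NQ (eY {j})) + chi Q eZ - (\<Sum>i \<in> {1..r}. chi Q (eX {i}))"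
    "k \<in> {1..r} \<Longrightarrow> chi NQ (eX {k}) = chi Q (eX {k}) + chi NQ eZ - (\<Sum>j | j \<in> {1..s} \<and> R k j. chi NQ (eY {j}))"
proof -
  obtain n where n: "n \<ge> 0" "\<And>i. i \<le> -n \<or> i \<ge> n \<Longrightarrow> carrier (cterm Q i) = {\<zero>\<^bsub>cterm Q i\<^esub>}"
    using hd_part_bounded[OF bQQ] by blast
  have n': "carrier (cterm NQ i) = {\<zero>\<^bsub>cterm NQ i\<^esub>}" if "i \<le> -n \<or> i \<ge> n" for i
    using nakayama_zero[OF Q n(2)[OF that]] by (simp add: nakayama_complex_simps[OF Q])
  have cQ: "chi Q e = (\<Sum>i = -n..n. esgn i * pdim Q e i)" if "e \<in> carrier A" for e
    by (rule chi_pdim[OF bQQ n(2) n(1) that])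
  have cN: "chi NQ e = (\<Sum>i = -n..n. esgn i * pdim NQ e i)" if "e \<in> carrier A" for e
    by (rule chi_pdim[OF bNQ n' n(1) that])
  have QX: "chi Q (eX S) = (\<Sum>k \<in> S. chi Q (eX {k}))" if "finite S" for S
    unfolding cQ[OF elems_closed(1)] sum_part(3)[OF bQQ that] sum_distrib_left by (rule sum.swap)
  have NY: "chi NQ (eY S) = (\<Sum>k \<in> S. chi NQ (eY {k}))" if "finite S" for S
    unfolding cN[OF elems_closed(3)] sum_part(4)[OF bNQ that] sum_distrib_left by (rule sum.swap)
  show "chi NQ (eY {j}) = chi Q (eY {j}) - chi Q eZ + (\<Sum>i | i \<in> {1..r} \<and> R i j. chi Q (eX {i}))"
    if j: "j \<in> {1..s}"
  proof -
    let ?S = "{i \<in> {1..r}. R i j}"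
    have p: "pdim NQ (eY {j}) i = pdim Q (eY {j}) i - pdim Q eZ i + pdim Q (eX ?S) i" for i
      using ex4_vdim[OF ex4_Y[OF Q j], of i] unfolding pdim_def by simp
    have "chi NQ (eY {j}) = chi Q (eY {j}) - chi Q eZ + chi Q (eX ?S)"
      by (simp add: cQ cN p sum_subtractf sum.distrib algebra_simps)
    then show ?thesis using QX[of ?S] by simp
  qed
  show "chi NQ eZ = (\<Sum>j \<in> {1..s}. chi NQ (eY {j})) + chi Q eZ - (\<Sum>i \<in> {1..r}. chi Q (eX {i}))"
  proof -
    have p: "pdim NQ eZ i = pdim NQ (eY {1..s}) i + pdim Q eZ i - pdim Q (eX {1..r}) i" for i
      using ex4_vdim[OF ex4_Z[OF Q], of i] unfolding pdim_def by simp
    have "chi NQ eZ = chi NQ (eY {1..s}) + chi Q eZ - chi Q (eX {1..r})"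
      by (simp add: cQ cN p sum_subtractf sum.distrib algebra_simps)
    then show ?thesis using QX[of "{1..r}"] NY[of "{1..s}"] by simp
  qed
  show "chi NQ (eX {k}) = chi Q (eX {k}) + chi NQ eZ - (\<Sum>j | j \<in> {1..s} \<and> R k j. chi NQ (eY {j}))"
    if k: "k \<in> {1..r}"
  proof -
    let ?T = "{j \<in> {1..s}. R k j}"
    have p: "pdim NQ (eX {k}) i = pdim Q (eX {k}) i + pdim NQ eZ i - pdim NQ (eY ?T) i" for i
      using ex4_vdim[OF ex4_X[OF Q k], of i] unfolding pdim_def by simp
    have "chi NQ (eX {k}) = chi Q (eX {k}) + chi NQ eZ - chi NQ (eY ?T)"
      by (simp add: cQ cN p sum_subtractf sum.distrib algebra_simps)
    then show ?thesis using NY[of ?T] by simp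
  qed
qed

end

text \<open>
  The dimension vector of \<open>\<nu>\<^sub>2\<^sup>-\<^sup>1\<close> of an object with dimension vector \<open>w\<close>.
\<close>

definition cox :: "(star_vertex \<Rightarrow> int) \<Rightarrow> star_vertex \<Rightarrow> int" where
  "cox w = (let x = (\<lambda>k. w (VX k) - w VZ + (\<Sum>j | j \<in> {1..s} \<and> R k j. w (VY j)));
      z = w VZ - (\<Sum>j \<in> {1..s}. w (VY j)) + (\<Sum>k \<in> {1..r}. x k)
    in (\<lambda>v. case v of VX k \<Rightarrow> if k \<in> {1..r} then x k else 0 | VZ \<Rightarrow> z
        | VY j \<Rightarrow> if j \<in> {1..s} then w (VY j) + z - (\<Sum>i | i \<in> {1..r} \<and> R i j. x i) else 0))"

text \<open>Set to 0 outside the quiver, so that dimension vectors can be compared as functions on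
  the whole type.\<close>

definition chivec :: "('k, 'a, 'm) mod_complex \<Rightarrow> star_vertex \<Rightarrow> int" where
  "chivec C v = (if v \<in> svert then chi C (videm v) else 0)"

text \<open>The system is triangular: the values of \<open>b\<close> at the x_k come from
  \<open>a\<close>, the value at z also from these, and the values at the y_j from all of them. So
  \<open>cox a\<close> is its only solution.\<close>

lemma cox_eqI:
  assumes X: "\<And>k. k \<in> {1..r} \<Longrightarrow> b (VX k) = a (VX k) - a VZ + (\<Sum>j | j \<in> {1..s} \<and> R k j. a (VY j))"
    and Z: "b VZ = a VZ - (\<Sum>j \<in> {1..s}. a (VY j)) + (\<Sum>k \<in> {1..r}. b (VX k))"
    and Y: "\<And>j. j \<in> {1..s} \<Longrightarrow> b (VY j) = a (VY j) + b VZ - (\<Sum>i | i \<in> {1..r} \<and> R i j. b (VX i))"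
    and out: "\<And>v. v \<notin> svert \<Longrightarrow> b v = 0"
  shows "b = cox a"
proof
  fix v
  have x: "(\<Sum>i \<in> S. a (VX i) - a VZ + (\<Sum>j | j \<in> {1..s} \<and> R i j. a (VY j))) = (\<Sum>i \<in> S. b (VX i))"
    if "S \<subseteq> {1..r}" for S
    by (rule sum.cong[OF refl]) (use that X in auto)
  show "b v = cox a v"
    unfolding cox_def Let_def x[OF subset_refl] x[OF Collect_restrict] Z[symmetric]
    using X Y out[of v] by (cases v) auto
qed

text \<open>\<open>nakayama_chi\<close> computes \<nu>Q from \<open>Q\<close> in the order y, z, x.
  Solved for \<open>Q\<close>, the same equations run in the order x, z, y, and this is
  \<open>cox\<close>.\<close>

lemma chivec_nakayama:
  assumes "projective_complex A Q"
  shows "chivec Q = cox (chivec (nakayama_complex A Q))"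
proof (rule cox_eqI)
  let ?N = "nakayama_complex A Q"
  have cv: "chivec C (VX k) = (if k \<in> {1..r} then chi C (eX {k}) else 0)" "chivec C VZ = chi C eZ"
    "chivec C (VY k) = (if k \<in> {1..s} then chi C (eY {k}) else 0)" for k and C :: "('k, 'a, 'z) mod_complex"
    by (simp_all add: chivec_def videm_def)
  have SX: "(\<Sum>i | i \<in> {1..r} \<and> R i j. chivec Q (VX i)) = (\<Sum>i | i \<in> {1..r} \<and> R i j. chi Q (eX {i}))" for j
    by (rule sum.cong) (auto simp: cv)
  have SY: "(\<Sum>j | j \<in> {1..s} \<and> R k j. chivec ?N (VY j)) = (\<Sum>j | j \<in> {1..s} \<and> R k j. chi ?N (eY {j}))" for k
    by (rule sum.cong) (auto simp: cv)
  note e = nakayama_chi[OF assms]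
  show "chivec Q (VX k) = chivec ?N (VX k) - chivec ?N VZ + (\<Sum>j | j \<in> {1..s} \<and> R k j. chivec ?N (VY j))"
    if "k \<in> {1..r}" for k unfolding SY using e(3)[OF that] that by (simp add: cv)
  show "chivec Q VZ = chivec ?N VZ - (\<Sum>j \<in> {1..s}. chivec ?N (VY j)) + (\<Sum>k \<in> {1..r}. chivec Q (VX k))"
    using e(2) by (simp add: cv)
  show "chivec Q (VY j) = chivec ?N (VY j) + chivec Q VZ - (\<Sum>i | i \<in> {1..r} \<and> R i j. chivec Q (VX i))"
    if "j \<in> {1..s}" for j unfolding SX using e(1)[OF that] that by (simp add: cv)
qed (simp add: chivec_def)

text \<open>\<open>Q\<close> is a projective model of D[-2] and \<nu>Q represents C, so degree i of
  \<open>D\<close> is degree i + 2 of \<open>Q\<close>. Vanishing in negative degrees is passed back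
  from \<open>D\<close> to \<open>C\<close>, vanishing in positive degrees forward from
  \<open>C\<close> to \<open>D\<close>.\<close>

theorem nu_inv_step:
  assumes nu: "nu_inv A 2 C D"
  shows "chivec D = cox (chivec C)"
    "\<lbrakk>\<And>i. i < 0 \<Longrightarrow> vanish_at D i\<rbrakk> \<Longrightarrow> i < 0 \<Longrightarrow> vanish_at C i"
    "\<lbrakk>\<And>i. i > 0 \<Longrightarrow> vanish_at C i\<rbrakk> \<Longrightarrow> i > 0 \<Longrightarrow> vanish_at D i"
    "bounded_complex A D"
proof -
  have D: "bounded_complex A D" using nu unfolding nu_inv_def by blast
  have "derived_nakayama A (shift_complex (- int 2) D) C" using nu unfolding nu_inv_def by blast
  then have "\<exists>P Z f. projective_complex A P \<and> derived_iso A P (shift_complex (-2) D) \<and>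
      bounded_complex A Z \<and> quasi_iso A (nakayama_complex A P) Z f \<and> derived_iso A Z C"
    unfolding derived_nakayama_def by simp
  then obtain Q Z f where Q: "projective_complex A Q" "derived_iso A Q (shift_complex (-2) D)"
    and Z: "bounded_complex A Z" "quasi_iso A (nakayama_complex A Q) Z f" "derived_iso A Z C" by blast
  let ?N = "nakayama_complex A Q"
  have hQ: "hd_part Q (videm v) i = hd_part D (videm v) (i - 2)" for v i
    using derived_iso_hd_part[OF Q(2) videm_closed videm_idem] hd_part_shift[OF D videm_closed] by simp
  have hN: "hd_part ?N (videm v) i = hd_part C (videm v) i" for v i
    using quasi_iso_hd_part[OF bounded_nakayama_complex[OF Q(1)] Z(1,2) videm_closed videm_idem]
      derived_iso_hd_part[OF Z(3) videm_closed videm_idem] by simp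
  have vQ: "vanish_at Q i \<longleftrightarrow> vanish_at D (i - 2)" for i unfolding vanish_at_def hQ ..
  have vN: "vanish_at ?N i \<longleftrightarrow> vanish_at C i" for i unfolding vanish_at_def hN ..
  show "\<lbrakk>\<And>i. i < 0 \<Longrightarrow> vanish_at D i\<rbrakk> \<Longrightarrow> i < 0 \<Longrightarrow> vanish_at C i"
    using nakayama_vanish_below[OF Q(1)] unfolding vQ vN by simp
  show "\<lbrakk>\<And>i. i > 0 \<Longrightarrow> vanish_at C i\<rbrakk> \<Longrightarrow> i > 0 \<Longrightarrow> vanish_at D i"
    using nakayama_vanish_above[OF Q(1), of "i + 2"] unfolding vQ vN by simp
  show "bounded_complex A D" by (rule D)
  have cN: "chi ?N (videm v) = chi C (videm v)" for v
    unfolding chi_def using hN by (simp add: echar_def)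
  have cQ: "chi Q (videm v) = chi D (videm v)" for v
  proof -
    have "(\<Sum>i | hd_part D (videm v) (i - 2) \<noteq> 0. esgn i * hd_part D (videm v) (i - 2)) =
        (\<Sum>i | hd_part D (videm v) i \<noteq> 0. esgn i * hd_part D (videm v) i)"
      by (rule sum.reindex_bij_witness[of _ "\<lambda>i. i + 2" "\<lambda>i. i - 2"]) (auto simp: esgn_def)
    then show ?thesis unfolding chi_def echar_def hQ .
  qed
  show "chivec D = cox (chivec C)"
    using chivec_nakayama[OF Q(1)] unfolding chivec_def cN cQ .
qed

end

section \<open>Indecomposable projectives and injectives\<close>

text \<open>A subspace \<open>W\<close> of largest dimension among those that avoid \<open>m\<close>
  is a complement of the line spanned by \<open>m\<close>; \<open>l\<close> is the coefficient of
  \<open>m\<close> in the decomposition.\<close>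

lemma linear_functional_exists:
  fixes V :: "('k::field, 'm, 'z) module_scheme"
  assumes V: "fd_space V" and m: "m \<in> carrier V" "m \<noteq> \<zero>\<^bsub>V\<^esub>"
  shows "\<exists>l. lin_on V ground_alg (carrier V) l \<and> l m = 1"
proof -
  have mV: "Module.module scalars V" by (rule module_fd_space[OF V])
  interpret V: Module.module scalars V by (rule mV)
  have sc: "c \<odot>\<^bsub>V\<^esub> x \<in> carrier V" if "x \<in> carrier V" for c x using V.smult_closed[of c x] that by simp
  have sa: "a \<odot>\<^bsub>V\<^esub> (b \<odot>\<^bsub>V\<^esub> x) = (a * b) \<odot>\<^bsub>V\<^esub> x" "a \<odot>\<^bsub>V\<^esub> x \<oplus>\<^bsub>V\<^esub> b \<odot>\<^bsub>V\<^esub> x = (a + b) \<odot>\<^bsub>V\<^esub> x"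
    "1 \<odot>\<^bsub>V\<^esub> x = x" "0 \<odot>\<^bsub>V\<^esub> x = \<zero>\<^bsub>V\<^esub>" if "x \<in> carrier V" for a b x
    using V.smult_assoc1[of a b x] V.smult_l_distr[of a b x] V.smult_one[of x] V.lmult_0[of x] that by simp_all
  have sd: "c \<odot>\<^bsub>V\<^esub> (x \<oplus>\<^bsub>V\<^esub> y) = c \<odot>\<^bsub>V\<^esub> x \<oplus>\<^bsub>V\<^esub> c \<odot>\<^bsub>V\<^esub> y" if "x \<in> carrier V" "y \<in> carrier V" for c x y
    using V.smult_r_distr[of c x y] that by simp
  define good where "good W \<longleftrightarrow> subsp V W \<and> m \<notin> W" for W
  have "good {\<zero>\<^bsub>V\<^esub>}"
    using m V.smult_r_null unfolding good_def subsp_def by simp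
  moreover have "vdim V W \<le> vdim V (carrier V)" if "good W" for W
    using vdim_mono[OF V _ subsp_carrier[OF mV]] that unfolding good_def subsp_def by blast
  ultimately obtain W where W: "good W" and max: "\<And>W'. good W' \<Longrightarrow> vdim V W' \<le> vdim V W"
    using ex_has_greatest_nat[of good "{\<zero>\<^bsub>V\<^esub>}" "vdim V" "Suc (vdim V (carrier V))"]
    by (auto simp: less_Suc_eq_le)
  have sW: "subsp V W" "m \<notin> W" using W unfolding good_def by auto
  note WD = subspD[OF sW(1)]
  have decomp: "\<exists>w \<in> W. \<exists>c. x = w \<oplus>\<^bsub>V\<^esub> c \<odot>\<^bsub>V\<^esub> m" if x: "x \<in> carrier V" for x
  proof (rule ccontr)
    assume no: "\<not> ?thesis"
    \<comment> \<open>If \<open>x\<close> had no decomposition, adjoining it to \<open>W\<close>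
      would give a strictly larger subspace that still avoids \<open>m\<close>.\<close>
    let ?W = "{w \<oplus>\<^bsub>V\<^esub> c \<odot>\<^bsub>V\<^esub> x | w c. w \<in> W}"
    have in1: "w \<oplus>\<^bsub>V\<^esub> c \<odot>\<^bsub>V\<^esub> x \<in> ?W" if "w \<in> W" for w c using that by blast
    have sub: "subsp V ?W"
      unfolding subsp_def
    proof (intro conjI ballI allI)
      show "?W \<subseteq> carrier V" using WD(5) sc[OF x] by auto
      show "\<zero>\<^bsub>V\<^esub> \<in> ?W" using in1[OF WD(2), of 0] sa(4)[OF x] by simp
      fix a b c assume "a \<in> ?W"
      then obtain w p where a: "a = w \<oplus>\<^bsub>V\<^esub> p \<odot>\<^bsub>V\<^esub> x" "w \<in> W" by blast
      show "c \<odot>\<^bsub>V\<^esub> a \<in> ?W"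
        using in1[OF WD(4)[OF a(2)], of c "c * p"] a sd[OF WD(5)[OF a(2)] sc[OF x]] sa(1)[OF x] by simp
      assume "b \<in> ?W"
      then obtain v q where b: "b = v \<oplus>\<^bsub>V\<^esub> q \<odot>\<^bsub>V\<^esub> x" "v \<in> W" by blast
      have "a \<oplus>\<^bsub>V\<^esub> b = (w \<oplus>\<^bsub>V\<^esub> v) \<oplus>\<^bsub>V\<^esub> (p \<odot>\<^bsub>V\<^esub> x \<oplus>\<^bsub>V\<^esub> q \<odot>\<^bsub>V\<^esub> x)"
        using a b WD(5) sc[OF x] by (simp add: V.M.a_ac)
      then show "a \<oplus>\<^bsub>V\<^esub> b \<in> ?W"
        using in1[OF WD(3)[OF a(2) b(2)], of "p + q"] sa(2)[OF x] by simp
    qed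
    have "m \<notin> ?W"
    proof
      assume "m \<in> ?W"
      then obtain w c where e: "m = w \<oplus>\<^bsub>V\<^esub> c \<odot>\<^bsub>V\<^esub> x" "w \<in> W" by blast
      have c: "c \<noteq> 0"
      proof
        assume "c = 0"
        then have "m = w" using e sa(4)[OF x] WD(5)[OF e(2)] by simp
        then show False using e(2) sW(2) by simp
      qed
      have wm: "(-1) \<odot>\<^bsub>V\<^esub> w \<oplus>\<^bsub>V\<^esub> m = c \<odot>\<^bsub>V\<^esub> x"
      proof -
        have "(-1) \<odot>\<^bsub>V\<^esub> w \<oplus>\<^bsub>V\<^esub> m = ((-1) \<odot>\<^bsub>V\<^esub> w \<oplus>\<^bsub>V\<^esub> 1 \<odot>\<^bsub>V\<^esub> w) \<oplus>\<^bsub>V\<^esub> c \<odot>\<^bsub>V\<^esub> x"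
          using e WD(5)[OF e(2)] sc sc[OF x] sa(3)[OF WD(5)[OF e(2)]] by (simp add: V.M.a_assoc)
        then show ?thesis using sa(2,4)[OF WD(5)[OF e(2)]] sc[OF x] by simp
      qed
      have "x = inverse c \<odot>\<^bsub>V\<^esub> (c \<odot>\<^bsub>V\<^esub> x)" using c sa(1,3)[OF x] by simp
      also have "\<dots> = inverse c \<odot>\<^bsub>V\<^esub> ((-1) \<odot>\<^bsub>V\<^esub> w) \<oplus>\<^bsub>V\<^esub> inverse c \<odot>\<^bsub>V\<^esub> m"
        unfolding wm[symmetric] by (rule sd[OF sc[OF WD(5)[OF e(2)]] m(1)])
      finally show False using no WD(4)[OF WD(4)[OF e(2)]] by blast
    qed
    then have "good ?W" using sub unfolding good_def by blast
    moreover have "W \<subseteq> ?W"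
    proof
      fix w assume w: "w \<in> W"
      show "w \<in> ?W" using in1[OF w, of 0] sa(4)[OF x] WD(5)[OF w] by simp
    qed
    ultimately have "vdim V W = vdim V ?W" using max[of ?W] vdim_mono[OF V sW(1) sub] by simp
    then have "W = ?W" using vdim_eq_imp_eq[OF V sW(1) sub \<open>W \<subseteq> ?W\<close>] by simp
    moreover have "x \<in> ?W" using in1[OF WD(2), of 1] sa(3)[OF x] x by simp
    ultimately have "x \<in> W" by simp
    moreover have "x = x \<oplus>\<^bsub>V\<^esub> 0 \<odot>\<^bsub>V\<^esub> m" using sa(4)[OF m(1)] x by simp
    ultimately show False using no by blast
  qed
  have uniq: "c = c'" if e: "w \<oplus>\<^bsub>V\<^esub> c \<odot>\<^bsub>V\<^esub> m = w' \<oplus>\<^bsub>V\<^esub> c' \<odot>\<^bsub>V\<^esub> m" and w: "w \<in> W" "w' \<in> W" for w w' c c'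
  proof (rule ccontr)
    assume ne: "c \<noteq> c'"
    let ?d = "(-1) \<odot>\<^bsub>V\<^esub> w \<oplus>\<^bsub>V\<^esub> w'"
    have d: "?d \<in> W" by (rule WD(3)[OF WD(4)[OF w(1)] w(2)])
    note wc = WD(5)[OF w(1)] WD(5)[OF w(2)]
    have "(-1) \<odot>\<^bsub>V\<^esub> w \<oplus>\<^bsub>V\<^esub> (w \<oplus>\<^bsub>V\<^esub> c \<odot>\<^bsub>V\<^esub> m) = ((-1) \<odot>\<^bsub>V\<^esub> w \<oplus>\<^bsub>V\<^esub> 1 \<odot>\<^bsub>V\<^esub> w) \<oplus>\<^bsub>V\<^esub> c \<odot>\<^bsub>V\<^esub> m"
      using wc sc m(1) sa(3)[OF wc(1)] by (simp add: V.M.a_assoc)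
    then have "c \<odot>\<^bsub>V\<^esub> m = ?d \<oplus>\<^bsub>V\<^esub> c' \<odot>\<^bsub>V\<^esub> m"
      using e sa(2,4)[OF wc(1)] sc[OF m(1)] sc[OF wc(1)] wc by (simp add: V.M.a_assoc)
    then have "c \<odot>\<^bsub>V\<^esub> m \<oplus>\<^bsub>V\<^esub> (- c') \<odot>\<^bsub>V\<^esub> m = ?d \<oplus>\<^bsub>V\<^esub> (c' \<odot>\<^bsub>V\<^esub> m \<oplus>\<^bsub>V\<^esub> (- c') \<odot>\<^bsub>V\<^esub> m)"
      using sc[OF m(1)] WD(5)[OF d] by (simp add: V.M.a_assoc)
    then have "(c - c') \<odot>\<^bsub>V\<^esub> m = ?d" using sa(2,4)[OF m(1)] WD(5)[OF d] by simp
    then have "inverse (c - c') \<odot>\<^bsub>V\<^esub> ((c - c') \<odot>\<^bsub>V\<^esub> m) \<in> W" using WD(4)[OF d] by simp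
    then have "m \<in> W" using sa(1,3)[OF m(1)] ne by simp
    then show False using sW(2) by simp
  qed
  define l where "l x = (THE c. \<exists>w \<in> W. x = w \<oplus>\<^bsub>V\<^esub> c \<odot>\<^bsub>V\<^esub> m)" for x
  have l: "l (w \<oplus>\<^bsub>V\<^esub> c \<odot>\<^bsub>V\<^esub> m) = c" if "w \<in> W" for w c
    unfolding l_def by (rule the_equality) (use that uniq in blast)+
  have "l m = 1" using l[OF WD(2), of 1] sa(3)[OF m(1)] m(1) by simp
  moreover have "lin_on V ground_alg (carrier V) l"
    unfolding lin_on_def
  proof (intro conjI ballI allI)
    fix x y c assume x: "x \<in> carrier V"
    obtain w a where x': "w \<in> W" "x = w \<oplus>\<^bsub>V\<^esub> a \<odot>\<^bsub>V\<^esub> m" using decomp[OF x] by blast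
    have "c \<odot>\<^bsub>V\<^esub> x = c \<odot>\<^bsub>V\<^esub> w \<oplus>\<^bsub>V\<^esub> (c * a) \<odot>\<^bsub>V\<^esub> m"
      using x' sd[OF WD(5)[OF x'(1)] sc[OF m(1)]] sa(1)[OF m(1)] by simp
    then show "l (c \<odot>\<^bsub>V\<^esub> x) = c \<odot>\<^bsub>ground_alg\<^esub> l x"
      using l[OF WD(4)[OF x'(1)]] l[OF x'(1)] x'(2) by simp
    assume y: "y \<in> carrier V"
    obtain v b where y': "v \<in> W" "y = v \<oplus>\<^bsub>V\<^esub> b \<odot>\<^bsub>V\<^esub> m" using decomp[OF y] by blast
    have "x \<oplus>\<^bsub>V\<^esub> y = (w \<oplus>\<^bsub>V\<^esub> v) \<oplus>\<^bsub>V\<^esub> (a \<odot>\<^bsub>V\<^esub> m \<oplus>\<^bsub>V\<^esub> b \<odot>\<^bsub>V\<^esub> m)"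
      using x' y' WD(5) sc[OF m(1)] by (simp add: V.M.a_ac)
    then have "x \<oplus>\<^bsub>V\<^esub> y = (w \<oplus>\<^bsub>V\<^esub> v) \<oplus>\<^bsub>V\<^esub> (a + b) \<odot>\<^bsub>V\<^esub> m" using sa(2)[OF m(1)] by simp
    then show "l (x \<oplus>\<^bsub>V\<^esub> y) = l x \<oplus>\<^bsub>ground_alg\<^esub> l y"
      using l[OF WD(3)[OF x'(1) y'(1)]] l[OF x'(1)] l[OF y'(1)] x'(2) y'(2) by simp
  qed simp
  ultimately show ?thesis by blast
qed

lemma stalk_simps:
  "cterm (stalk_complex M) i = (if i = 0 then M else M\<lparr>carrier := {\<zero>\<^bsub>M\<^esub>}\<rparr>)"
  "cdiff (stalk_complex M) i = (\<lambda>x \<in> carrier (cterm (stalk_complex M) i). \<zero>\<^bsub>M\<^esub>)"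
  by (simp_all add: stalk_complex_def Let_def)

context fd_alg
begin

lemma fd_rmod_zero:
  assumes M: "fd_rmod A M"
  shows "fd_rmod A (M\<lparr>carrier := {\<zero>\<^bsub>M\<^esub>}\<rparr>)"
proof -
  interpret Mm: Module.module scalars M by (rule fd_rmodD[OF M])
  show ?thesis
    by (rule fd_rmod_hom_image[OF fd_algebra M, where f = "\<lambda>x. \<zero>\<^bsub>M\<^esub>"])
      (use Mm.smult_r_null Mm.M.zero_closed ract_zero[OF M] in \<open>auto simp del: Mm.M.zero_closed\<close>)
qed

lemma bounded_stalk:
  assumes M: "fd_rmod A M"
  shows "bounded_complex A (stalk_complex M)"
proof -
  interpret Mm: Module.module scalars M by (rule fd_rmodD[OF M])
  have "{i. \<not> is_zero_mod (cterm (stalk_complex M) i)} \<subseteq> {0}"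
    by (auto simp: stalk_simps is_zero_mod_def)
  then have "finite {i. \<not> is_zero_mod (cterm (stalk_complex M) i)}" by (rule finite_subset) simp
  moreover have "fd_rmod A (cterm (stalk_complex M) i)" for i
    using M fd_rmod_zero[OF M] by (simp add: stalk_simps)
  moreover have "cdiff (stalk_complex M) i \<in> rhom A (cterm (stalk_complex M) i) (cterm (stalk_complex M) (i + 1))" for i
    unfolding rhom_def stalk_simps
    using fd_rmodD(3)[OF M] ract_zero[OF M] by (auto simp: PiE_iff)
  moreover have "cdiff (stalk_complex M) (i + 1) (cdiff (stalk_complex M) i x) = \<zero>\<^bsub>cterm (stalk_complex M) (i + 1 + 1)\<^esub>"
    if "x \<in> carrier (cterm (stalk_complex M) i)" for i x
    using that by (auto simp: stalk_simps)
  ultimately show ?thesis unfolding bounded_complex_def by blast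
qed

lemma hd_part_stalk:
  assumes M: "fd_rmod A M" and e: "e \<in> carrier A"
  shows "hd_part (stalk_complex M) e i = (if i = 0 then int (vdim M (mpart M e)) else 0)"
proof -
  let ?C = "stalk_complex M"
  interpret Mm: Module.module scalars M by (rule fd_rmodD[OF M])
  have cp: "cpart ?C e i = (if i = 0 then mpart M e else {\<zero>\<^bsub>M\<^esub>})" for i
    unfolding cpart_def stalk_simps mpart_def using ract_zero[OF M e] by auto
  have z: "\<zero>\<^bsub>M\<^esub> \<in> mpart M e" unfolding mpart_def using ract_zero[OF M e] by simp
  have d: "cdiff ?C i x = \<zero>\<^bsub>M\<^esub>" if "x \<in> cpart ?C e i" for i x
    using that unfolding cpart_def mpart_def stalk_simps by auto
  have cyc: "vcyc (cterm ?C) (cpart ?C e) (cdiff ?C) i = cpart ?C e i"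
    unfolding vcyc_def lker_def by (auto simp: d stalk_simps(1))
  have "cpart ?C e (i - 1) \<noteq> {}" using z unfolding cp by auto
  then have bd: "vbd (cpart ?C e) (cdiff ?C) i = {\<zero>\<^bsub>M\<^esub>}"
    unfolding vbd_def by (auto simp: d image_iff)
  have vz: "vdim M {\<zero>\<^bsub>M\<^esub>} = 0" "vdim (M\<lparr>carrier := {\<zero>\<^bsub>M\<^esub>}\<rparr>) {\<zero>\<^bsub>M\<^esub>} = 0"
    using vdim_zero[OF fd_rmodD(2)[OF M]] vdim_zero[OF fd_rmodD(2)[OF fd_rmod_zero[OF M]]] by simp_all
  show ?thesis
    unfolding hd_part_def hdim_def cyc bd unfolding cp using vz by (simp add: stalk_simps)
qed

lemma chi_stalk:
  assumes M: "fd_rmod A M" and e: "e \<in> carrier A"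
  shows "chi (stalk_complex M) e = int (vdim M (mpart M e))"
proof -
  have "chi (stalk_complex M) e = (\<Sum>i = -0..0. esgn i * hd_part (stalk_complex M) e i)"
    unfolding chi_def by (rule echar_eq) (auto simp: hd_part_stalk[OF M e])
  then show ?thesis by (simp add: hd_part_stalk[OF M e] esgn_def)
qed

text \<open>The stalk complex of a projective has zero modules outside degree 0, and they have to be
  projective too.\<close>

lemma projective_zero:
  assumes P: "projective_rmod A P"
  shows "projective_rmod A (P\<lparr>carrier := {\<zero>\<^bsub>P\<^esub>}\<rparr>)"
proof -
  let ?Z = "P\<lparr>carrier := {\<zero>\<^bsub>P\<^esub>}\<rparr>"
  have fP: "fd_rmod A P" using P unfolding projective_rmod_def by blast
  have Z: "fd_rmod A ?Z" by (rule fd_rmod_zero[OF fP])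
  show ?thesis
    unfolding projective_rmod_def
  proof (intro conjI allI ballI impI Z)
    fix M N :: "('k, 'a) fmod" and g f
    assume g: "g \<in> rhom A M N" and f: "f \<in> rhom A ?Z N" and M: "fd_rmod A M" and N: "fd_rmod A N"
    interpret Mm: Module.module scalars M by (rule fd_rmodD[OF M])
    interpret Zm: Module.module scalars ?Z by (rule fd_rmodD[OF Z])
    have zz: "\<zero>\<^bsub>P\<^esub> \<oplus>\<^bsub>P\<^esub> \<zero>\<^bsub>P\<^esub> = \<zero>\<^bsub>P\<^esub>" using Zm.M.l_zero[of "\<zero>\<^bsub>P\<^esub>"] by simp
    let ?h = "\<lambda>x \<in> carrier ?Z. \<zero>\<^bsub>M\<^esub>"
    have "?h \<in> rhom A ?Z M"
      unfolding rhom_def using ract_zero[OF fP] ract_zero[OF M] zz by (auto simp: PiE_iff)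
    moreover have "g (?h x) = f x" if "x \<in> carrier ?Z" for x
      using that rhom_zero[OF M N g] rhom_zero[OF Z N f] by simp
    ultimately show "\<exists>h \<in> rhom A ?Z M. \<forall>x \<in> carrier ?Z. g (h x) = f x" by blast
  qed
qed

lemma projective_stalk:
  assumes P: "projective_rmod A P"
  shows "projective_complex A (stalk_complex P)"
proof -
  have fP: "fd_rmod A P" using P unfolding projective_rmod_def by blast
  show ?thesis
    unfolding projective_complex_def using bounded_stalk[OF fP] P projective_zero[OF P] by (simp add: stalk_simps)
qed

end

lemma fd_rmod_sub:
  assumes M: "fd_rmod A M" and U: "subsp M U"
    and cl: "\<And>x a. x \<in> U \<Longrightarrow> a \<in> carrier A \<Longrightarrow> ract M x a \<in> U"
  shows "fd_rmod A (M\<lparr>carrier := U\<rparr>)"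
proof -
  have "fd_space (M\<lparr>carrier := U\<rparr>)" by (rule fd_space_subsp[OF fd_rmodD(1)[OF M] U])
  then show ?thesis
    unfolding fd_rmod_def using cl subspD(5)[OF U] fd_rmodD(4-9)[OF M] by simp
qed

lemma (in fd_alg) rsubmod_subsp:
  assumes M: "fd_rmod A M" and U: "rsubmod A M U"
  shows "subsp M U"
proof -
  have "c \<odot>\<^bsub>M\<^esub> x \<in> U" if x: "x \<in> U" for c x
  proof -
    have "ract M x (c \<odot>\<^bsub>A\<^esub> \<one>\<^bsub>A\<^esub>) \<in> U" using U x smult_carrier[OF one_closed] unfolding rsubmod_def by blast
    moreover have "x \<in> carrier M" using U x unfolding rsubmod_def by blast
    ultimately show ?thesis using ract_scalar[OF M, of x c] by simp
  qed
  then show ?thesis using U unfolding rsubmod_def subsp_def by blast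
qed

text \<open>For an idempotent \<open>e\<close> this is the right ideal e A; the indecomposable
  projectives are obtained as copies of it.\<close>

definition (in fd_alg) rideal :: "'a \<Rightarrow> ('k, 'a, 'a) rmod" where
  "rideal e = (regular_rmod A)\<lparr>carrier := {u \<in> carrier A. e \<otimes>\<^bsub>A\<^esub> u = u}\<rparr>"

lemma (in fd_alg) rideal_simps [simp]:
  "carrier (rideal e) = {u \<in> carrier A. e \<otimes>\<^bsub>A\<^esub> u = u}" "\<zero>\<^bsub>rideal e\<^esub> = \<zero>\<^bsub>A\<^esub>" "add (rideal e) = add A"
  "smult (rideal e) = smult A" "ract (rideal e) = mult A"
  by (simp_all add: rideal_def)

lemma (in fd_alg) fd_rmod_rideal:
  assumes e: "e \<in> carrier A"
  shows "fd_rmod A (rideal e)"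
  unfolding rideal_def
proof (rule fd_rmod_sub[OF fd_rmod_regular])
  show "subsp (regular_rmod A) {u \<in> carrier A. e \<otimes>\<^bsub>A\<^esub> u = u}"
    unfolding subsp_def using e by (simp add: r_distr alg_simps)
qed (use e in \<open>simp add: m_assoc[symmetric]\<close>)

section \<open>The indecomposable projectives and simple submodules\<close>

context star_alg
begin

definition tvp :: "star_vertex \<Rightarrow> star_path" where
  "tvp v = (case v of VX i \<Rightarrow> BX i | VZ \<Rightarrow> BZ | VY j \<Rightarrow> BY j)"

text \<open>Between two vertices there is at most one nonzero path, so every corner e_v A e_u has
  dimension at most 1; \<open>None\<close> marks the zero corners.\<close>

definition spath :: "star_vertex \<Rightarrow> star_vertex \<Rightarrow> star_path option" where
  "spath v u = (case v of
     VX i \<Rightarrow> (case u of VX k \<Rightarrow> if i = k then Some (BX i) else None | VZ \<Rightarrow> Some (BA i)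
       | VY j \<Rightarrow> if R i j then None else Some (BC i j))
   | VZ \<Rightarrow> (case u of VX k \<Rightarrow> None | VZ \<Rightarrow> Some BZ | VY j \<Rightarrow> Some (BB j))
   | VY j \<Rightarrow> (case u of VY k \<Rightarrow> if j = k then Some (BY j) else None | _ \<Rightarrow> None))"

text \<open>The dimension vector of the indecomposable projective e_v A.\<close>

definition sdim :: "star_vertex \<Rightarrow> star_vertex \<Rightarrow> int" where
  "sdim v u = (if v \<in> svert \<and> u \<in> svert \<and> spath v u \<noteq> None then 1 else 0)"

definition bas :: "star_path \<Rightarrow> 'a" where
  "bas p = mk (\<lambda>q. if q = p then 1 else 0)"

lemma bas_closed [simp]: "bas p \<in> carrier A"
  by (simp add: bas_def)

lemma co_bas: "co q (bas p) = (if q = p \<and> p \<in> star_basis r s R then 1 else 0)"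
  by (simp add: bas_def co_mk)

lemma co_videm: "v \<in> svert \<Longrightarrow> co q (videm v) = (if q = tvp v then 1 else 0)"
  by (cases v; cases q) (auto simp: videm_def tvp_def co_elems)

lemma tvp_basis: "v \<in> svert \<Longrightarrow> tvp v \<in> star_basis r s R"
  by (cases v) (auto simp: tvp_def)

lemma co_tvp_mult:
  "u \<in> carrier A \<Longrightarrow> w \<in> carrier A \<Longrightarrow> co (tvp v) (u \<otimes>\<^bsub>A\<^esub> w) = co (tvp v) u * co (tvp v) w"
  using co_out[of u "tvp v"] by (cases v) (auto simp: tvp_def co_mult)

lemma spath_basis: "v \<in> svert \<Longrightarrow> u \<in> svert \<Longrightarrow> spath v u = Some p \<Longrightarrow> p \<in> star_basis r s R"
  by (cases v; cases u) (auto simp: spath_def split: if_splits)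

lemma co_corner:
  assumes "v \<in> svert" "u \<in> svert" "w \<in> carrier A" "videm v \<otimes>\<^bsub>A\<^esub> w = w" "w \<otimes>\<^bsub>A\<^esub> videm u = w"
    and "spath v u \<noteq> Some q"
  shows "co q w = 0"
proof -
  have "co q w = co q (videm v \<otimes>\<^bsub>A\<^esub> w \<otimes>\<^bsub>A\<^esub> videm u)" using assms(4,5) by simp
  also have "\<dots> = 0"
    using assms(1-3,6) by (cases q; cases v; cases u) (auto simp: spath_def co_mult co_videm tvp_def split: if_splits)
  finally show ?thesis .
qed

lemma corner_elem:
  assumes "v \<in> svert" "u \<in> svert" "w \<in> carrier A" "videm v \<otimes>\<^bsub>A\<^esub> w = w" "w \<otimes>\<^bsub>A\<^esub> videm u = w"
  shows "spath v u = None \<Longrightarrow> w = \<zero>\<^bsub>A\<^esub>" "spath v u = Some p \<Longrightarrow> w = co p w \<odot>\<^bsub>A\<^esub> bas p"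
proof -
  show "w = \<zero>\<^bsub>A\<^esub>" if "spath v u = None"
    by (rule co_ext) (use assms(3) co_corner[OF assms] that in auto)
  show "w = co p w \<odot>\<^bsub>A\<^esub> bas p" if p: "spath v u = Some p"
  proof (rule co_ext)
    fix q
    show "co q w = co q (co p w \<odot>\<^bsub>A\<^esub> bas p)"
      using co_corner[OF assms, of q] p spath_basis[OF assms(1,2) p] by (cases "q = p") (auto simp: co_simps co_bas)
  qed (use assms(3) smult_carrier in auto)
qed

lemma corner_bas:
  assumes "v \<in> svert" "u \<in> svert" "spath v u = Some p"
  shows "videm v \<otimes>\<^bsub>A\<^esub> bas p = bas p" "bas p \<otimes>\<^bsub>A\<^esub> videm u = bas p"
proof -
  have "co q (videm v \<otimes>\<^bsub>A\<^esub> bas p) = co q (bas p) \<and> co q (bas p \<otimes>\<^bsub>A\<^esub> videm u) = co q (bas p)" for q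
    using assms spath_basis[OF assms]
    by (cases v; cases u; cases q) (auto simp: spath_def co_mult co_videm co_bas tvp_def split: if_splits)
  then show "videm v \<otimes>\<^bsub>A\<^esub> bas p = bas p" "bas p \<otimes>\<^bsub>A\<^esub> videm u = bas p" by (auto intro!: co_ext)
qed

lemma spath_refl: "spath v v = Some (tvp v)"
  by (cases v) (auto simp: spath_def tvp_def)

lemma bas_tvp: "v \<in> svert \<Longrightarrow> bas (tvp v) = videm v"
  by (rule co_ext) (simp_all add: co_bas co_videm tvp_basis)

text \<open>There are no cycles, so e_v A e_v, the endomorphism ring of e_v A, is the field.\<close>

lemma corner_refl:
  assumes v: "v \<in> svert" and w: "w \<in> carrier A" "w \<otimes>\<^bsub>A\<^esub> videm v = w"
  shows "videm v \<otimes>\<^bsub>A\<^esub> w = co (tvp v) w \<odot>\<^bsub>A\<^esub> videm v"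
proof -
  have "videm v \<otimes>\<^bsub>A\<^esub> w = co (tvp v) (videm v \<otimes>\<^bsub>A\<^esub> w) \<odot>\<^bsub>A\<^esub> bas (tvp v)"
    by (rule corner_elem(2)[OF v v _ _ _ spath_refl]) (use w in \<open>simp_all add: m_assoc[symmetric]\<close>, simp add: m_assoc)
  then show ?thesis using bas_tvp[OF v] v w by (simp add: co_tvp_mult co_videm)
qed

text \<open>What is used about e_v A once it has been copied to \<open>nat \<Rightarrow> 'k\<close>:
  a generator \<open>p0\<close>, a homomorphism to \<open>A\<close> that sends it to e_v, and the
  dimensions of its parts.\<close>

definition proj_gen :: "star_vertex \<Rightarrow> ('k, 'a) fmod \<Rightarrow> (nat \<Rightarrow> 'k) \<Rightarrow> bool" where
  "proj_gen v P p0 \<longleftrightarrow> projective_rmod A P \<and> indecomposable_rmod A P \<and> p0 \<in> mpart P (videm v) \<and>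
     (\<forall>x \<in> carrier P. \<exists>u \<in> carrier A. x = ract P p0 u) \<and>
     (\<exists>f \<in> rhom A P (regular_rmod A). f p0 = videm v) \<and>
     (\<forall>u \<in> svert. int (vdim P (mpart P (videm u))) = sdim v u)"

theorem proj_gen_exists:
  assumes v: "v \<in> svert"
  shows "\<exists>P p0. proj_gen v P p0"
proof -
  let ?e = "videm v"
  let ?L = "rideal ?e"
  have L: "fd_rmod A ?L" by (rule fd_rmod_rideal[OF videm_closed])
  obtain f :: "'a \<Rightarrow> nat \<Rightarrow> 'k" where f: "inj_on f (carrier ?L)"
    using coordinates_exist[OF fd_rmodD(1)[OF L]] by blast
  let ?P = "rmod_copy ?L f"
  note cs = rmod_copy_simps[OF f]
  have P: "fd_rmod A ?P" by (rule fd_rmod_copy[OF fd_algebra L f])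
  interpret Pm: Module.module scalars ?P by (rule fd_rmodD[OF P])
  have eL: "?e \<in> carrier ?L" by simp
  have gen: "ract ?P (f ?e) u = f u" if "u \<in> carrier ?L" for u using cs(5)[OF eL] that by simp
  have p0: "f ?e \<in> mpart ?P ?e" unfolding mpart_def using gen[OF eL] eL cs(1) by blast
  have gen': "\<exists>u \<in> carrier A. x = ract ?P (f ?e) u" if x: "x \<in> carrier ?P" for x
  proof -
    obtain u where u: "u \<in> carrier ?L" "x = f u" using x cs(1) by auto
    then show ?thesis using gen[OF u(1)] by (intro bexI[of _ u]) auto
  qed
  have proj: "projective_rmod A ?P"
    unfolding projective_rmod_def
  proof (intro conjI allI ballI impI P)
    fix M N :: "('k, 'a) fmod" and g h
    assume g: "g \<in> rhom A M N" and h: "h \<in> rhom A ?P N" and M: "fd_rmod A M" and N: "fd_rmod A N"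
      and sur: "g ` carrier M = carrier N"
    have fe: "f ?e \<in> carrier ?P" using eL cs(1) by blast
    \<comment> \<open>\<open>x\<close> lies over the image of the generator e_v, and the lift sends
      e_v u to x u.\<close>
    obtain x where x: "x \<in> carrier M" "g x = h (f ?e)" using rhomD(1)[OF h fe] sur by (metis imageE)
    let ?i = "inv_into (carrier ?L) f"
    define k where "k = (\<lambda>y \<in> carrier ?P. ract M x (?i y))"
    have kf: "k (f u) = ract M x u" if "u \<in> carrier ?L" for u
      unfolding k_def using that cs(1) inv_into_f_f[OF f that] by auto
    have "k \<in> rhom A ?P M"
      unfolding rhom_def
    proof (intro CollectI conjI ballI)
      show "k \<in> carrier ?P \<rightarrow>\<^sub>E carrier M"
        unfolding PiE_iff using kf fd_rmodD(3)[OF M x(1)] by (auto simp: cs(1)) (simp add: k_def cs(1))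
      fix y assume "y \<in> carrier ?P"
      then obtain u where u: "u \<in> carrier ?L" "y = f u" using cs(1) by auto
      interpret Lm: Module.module scalars ?L by (rule fd_rmodD[OF L])
      show "k (y \<oplus>\<^bsub>?P\<^esub> z) = k y \<oplus>\<^bsub>M\<^esub> k z" if "z \<in> carrier ?P" for z
      proof -
        obtain w where w: "w \<in> carrier ?L" "z = f w" using \<open>z \<in> carrier ?P\<close> cs(1) by auto
        show ?thesis unfolding u(2) w(2) cs(3)[OF u(1) w(1)] kf[OF u(1)] kf[OF w(1)] kf[OF Lm.M.a_closed[OF u(1) w(1)]]
          using fd_rmodD(5)[OF M x(1), of u w] u(1) w(1) by simp
      qed
      show "k (ract ?P y a) = ract M (k y) a" if a: "a \<in> carrier A" for a
        unfolding u(2) cs(5)[OF u(1)] kf[OF u(1)] kf[OF fd_rmodD(3)[OF L u(1) a]]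
        using fd_rmodD(6)[OF M x(1), of u a] u(1) a by simp
    qed
    moreover have "g (k y) = h y" if y: "y \<in> carrier ?P" for y
    proof -
      obtain u where u: "u \<in> carrier ?L" "y = f u" using y cs(1) by auto
      have uA: "u \<in> carrier A" using u(1) by simp
      have "g (k y) = ract N (h (f ?e)) u" using kf[OF u(1)] u(2) rhomD(3)[OF g x(1) uA] x(2) by simp
      also have "\<dots> = h y" using rhomD(3)[OF h fe uA] gen[OF u(1)] u(2) by simp
      finally show ?thesis .
    qed
    ultimately show "\<exists>k \<in> rhom A ?P M. \<forall>y \<in> carrier ?P. g (k y) = h y" by blast
  qed
  \<comment> \<open>An element with nonzero coefficient at the trivial path generates the module:
    multiplied by e_v it becomes a nonzero multiple of e_v. A submodule containing it is everything,
    so one that meets it in 0 is zero.\<close>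
  have full: "V = {\<zero>\<^bsub>?P\<^esub>}"
    if U: "rsubmod A ?P U" and V: "rsubmod A ?P V" and UV: "U \<inter> V = {\<zero>\<^bsub>?P\<^esub>}"
      and u: "u \<in> carrier ?L" "f u \<in> U" and c: "co (tvp v) u \<noteq> 0" for U V u
  proof -
    have uA: "u \<in> carrier A" "?e \<otimes>\<^bsub>A\<^esub> u = u" using u(1) by simp_all
    let ?c = "co (tvp v) u"
    have "ract ?P (f u) ?e \<in> U" using U u(2) videm_closed unfolding rsubmod_def by blast
    then have "f (u \<otimes>\<^bsub>A\<^esub> ?e) \<in> U" using cs(5)[OF u(1), of ?e] by simp
    moreover have "u \<otimes>\<^bsub>A\<^esub> ?e = ?c \<odot>\<^bsub>A\<^esub> ?e"
      using corner_refl[OF v, of "u \<otimes>\<^bsub>A\<^esub> ?e"] uA v by (simp add: m_assoc co_tvp_mult co_videm m_assoc[symmetric])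
    ultimately have "f (?c \<odot>\<^bsub>A\<^esub> ?e) \<in> U" by simp
    then have "?c \<odot>\<^bsub>?P\<^esub> f ?e \<in> U" using cs(4)[OF eL, of ?c] by simp
    then have "inverse ?c \<odot>\<^bsub>?P\<^esub> (?c \<odot>\<^bsub>?P\<^esub> f ?e) \<in> U" by (rule subspD(4)[OF rsubmod_subsp[OF P U]])
    moreover have "f ?e \<in> carrier ?P" using eL cs(1) by blast
    ultimately have "f ?e \<in> U"
      using Pm.smult_assoc1[of "inverse ?c" ?c "f ?e"] Pm.smult_one[of "f ?e"] c by simp
    then have "carrier ?P \<subseteq> U" using U gen' unfolding rsubmod_def by blast
    then show ?thesis using UV V unfolding rsubmod_def by blast
  qed
  have nz: "\<not> is_zero_mod ?P"
  proof
    assume "is_zero_mod ?P"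
    then have "f ?e = f \<zero>\<^bsub>A\<^esub>" using eL cs(1,2) unfolding is_zero_mod_def by auto
    moreover have "\<zero>\<^bsub>A\<^esub> \<in> carrier ?L" by simp
    ultimately have "?e = \<zero>\<^bsub>A\<^esub>" using inj_onD[OF f _ eL] by blast
    then show False using co_videm[OF v, of "tvp v"] by simp
  qed
  have indec: "indecomposable_rmod A ?P"
    unfolding indecomposable_rmod_def
  proof (intro conjI allI impI nz)
    fix U V assume U: "rsubmod A ?P U" and V: "rsubmod A ?P V" and UV: "U \<inter> V = {\<zero>\<^bsub>?P\<^esub>}"
      and sum: "U <+>\<^bsub>?P\<^esub> V = carrier ?P"
    have "f ?e \<in> U <+>\<^bsub>?P\<^esub> V" unfolding sum using eL cs(1) by blast
    then obtain u' v' where e: "u' \<in> U" "v' \<in> V" "f ?e = u' \<oplus>\<^bsub>?P\<^esub> v'" unfolding set_add_def' by auto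
    have "u' \<in> carrier ?P" "v' \<in> carrier ?P" using e U V unfolding rsubmod_def by auto
    then obtain u w where u: "u \<in> carrier ?L" "u' = f u" and w: "w \<in> carrier ?L" "v' = f w" using cs(1) by auto
    interpret Lm: Module.module scalars ?L by (rule fd_rmodD[OF L])
    have "f ?e = f (u \<oplus>\<^bsub>?L\<^esub> w)" using e(3) cs(3)[OF u(1) w(1)] u w by simp
    then have "?e = u \<oplus>\<^bsub>?L\<^esub> w" by (rule inj_onD[OF f _ eL Lm.M.a_closed[OF u(1) w(1)]])
    \<comment> \<open>The trivial-path coefficients of the two components of e_v add up to 1, so one
      of them is nonzero.\<close>
    then have "co (tvp v) u + co (tvp v) w = 1" using co_videm[OF v, of "tvp v"] u(1) w(1) by (simp add: co_add)
    then have "co (tvp v) u \<noteq> 0 \<or> co (tvp v) w \<noteq> 0" by auto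
    then show "U = {\<zero>\<^bsub>?P\<^esub>} \<or> V = {\<zero>\<^bsub>?P\<^esub>}"
      using full[OF U V UV u(1)] full[OF V U _ w(1)] UV e u w by (auto simp: Int_commute)
  qed
  have dim: "int (vdim ?P (mpart ?P (videm u))) = sdim v u" if u: "u \<in> svert" for u
  proof -
    have mp: "f w \<in> mpart ?P (videm u) \<longleftrightarrow> w \<otimes>\<^bsub>A\<^esub> videm u = w" if w: "w \<in> carrier ?L" for w
    proof -
      have "w \<otimes>\<^bsub>A\<^esub> videm u \<in> carrier ?L" using w by (simp add: m_assoc[symmetric])
      then show ?thesis
        unfolding mpart_def using cs(1) cs(5)[OF w, of "videm u"] w inj_onD[OF f] by auto
    qed
    show ?thesis
    proof (cases "spath v u")
      case None
      have "mpart ?P (videm u) = {\<zero>\<^bsub>?P\<^esub>}"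
      proof
        show "mpart ?P (videm u) \<subseteq> {\<zero>\<^bsub>?P\<^esub>}"
        proof
          fix x assume x: "x \<in> mpart ?P (videm u)"
          then obtain w where w: "w \<in> carrier ?L" "x = f w" using cs(1) unfolding mpart_def by auto
          then have "w = \<zero>\<^bsub>A\<^esub>" using corner_elem(1)[OF v u _ _ _ None] mp[OF w(1)] x by simp
          then show "x \<in> {\<zero>\<^bsub>?P\<^esub>}" using w cs(2) by simp
        qed
        show "{\<zero>\<^bsub>?P\<^esub>} \<subseteq> mpart ?P (videm u)" unfolding mpart_def using ract_zero[OF P] by simp
      qed
      then show ?thesis using vdim_zero[OF fd_rmodD(2)[OF P]] None by (simp add: sdim_def)
    next
      case (Some p)
      have bL: "bas p \<in> carrier ?L" using corner_bas(1)[OF v u Some] by simp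
      have cb: "c \<odot>\<^bsub>A\<^esub> bas p \<in> carrier ?L" for c using corner_bas(1)[OF v u Some] by (simp add: alg_simps)
      have "mpart ?P (videm u) = range (\<lambda>c. c \<odot>\<^bsub>?P\<^esub> f (bas p))"
      proof
        show "mpart ?P (videm u) \<subseteq> range (\<lambda>c. c \<odot>\<^bsub>?P\<^esub> f (bas p))"
        proof
          fix x assume x: "x \<in> mpart ?P (videm u)"
          then obtain w where w: "w \<in> carrier ?L" "x = f w" using cs(1) unfolding mpart_def by auto
          then have "w = co p w \<odot>\<^bsub>A\<^esub> bas p" using corner_elem(2)[OF v u _ _ _ Some] mp[OF w(1)] x by simp
          then have "x = co p w \<odot>\<^bsub>?P\<^esub> f (bas p)" using w cs(4)[OF bL, of "co p w"] by simp
          then show "x \<in> range (\<lambda>c. c \<odot>\<^bsub>?P\<^esub> f (bas p))" by blast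
        qed
        show "range (\<lambda>c. c \<odot>\<^bsub>?P\<^esub> f (bas p)) \<subseteq> mpart ?P (videm u)"
        proof
          fix x assume "x \<in> range (\<lambda>c. c \<odot>\<^bsub>?P\<^esub> f (bas p))"
          then obtain c where "x = f (c \<odot>\<^bsub>A\<^esub> bas p)" using cs(4)[OF bL] by auto
          then show "x \<in> mpart ?P (videm u)" using mp[OF cb] corner_bas(2)[OF v u Some] by (simp add: alg_simps)
        qed
      qed
      moreover have "f (bas p) \<noteq> \<zero>\<^bsub>?P\<^esub>"
      proof
        assume "f (bas p) = \<zero>\<^bsub>?P\<^esub>"
        moreover have "\<zero>\<^bsub>A\<^esub> \<in> carrier ?L" by simp
        ultimately have "bas p = \<zero>\<^bsub>A\<^esub>" using inj_onD[OF f _ bL] cs(2) by simp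
        then show False using co_bas[of p p] spath_basis[OF v u Some] by simp
      qed
      moreover have "f (bas p) \<in> carrier ?P" using bL cs(1) by blast
      ultimately show ?thesis
        using vdim_span1[OF fd_rmodD(2)[OF P], of "f (bas p)"] Some v u by (simp add: sdim_def)
    qed
  qed
  have coord: "\<exists>h \<in> rhom A ?P (regular_rmod A). h (f ?e) = ?e"
  proof (rule bexI)
    let ?h = "\<lambda>y \<in> carrier ?P. inv_into (carrier ?L) f y"
    have hf: "?h (f u) = u" if "u \<in> carrier ?L" for u
      using that cs(1) inv_into_f_f[OF f that] by auto
    show "?h (f ?e) = ?e" by (rule hf[OF eL])
    show "?h \<in> rhom A ?P (regular_rmod A)"
    proof (rule rhom_regI[OF P])
      fix x assume "x \<in> carrier ?P"
      then obtain u where u: "u \<in> carrier ?L" "x = f u" using cs(1) by auto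
      have i: "inv_into (carrier ?L) f (f u) = u" if "u \<in> carrier ?L" for u by (rule inv_into_f_f[OF f that])
      show "inv_into (carrier ?L) f x \<in> carrier A" using i[OF u(1)] u by simp
      interpret Lm: Module.module scalars ?L by (rule fd_rmodD[OF L])
      show "inv_into (carrier ?L) f (x \<oplus>\<^bsub>?P\<^esub> y) = inv_into (carrier ?L) f x \<oplus>\<^bsub>A\<^esub> inv_into (carrier ?L) f y"
        if y: "y \<in> carrier ?P" for y
      proof -
        obtain w where w: "w \<in> carrier ?L" "y = f w" using y cs(1) by auto
        show ?thesis unfolding u(2) w(2) cs(3)[OF u(1) w(1)] i[OF u(1)] i[OF w(1)] i[OF Lm.M.a_closed[OF u(1) w(1)]]
          by simp
      qed
      show "inv_into (carrier ?L) f (ract ?P x a) = inv_into (carrier ?L) f x \<otimes>\<^bsub>A\<^esub> a" if a: "a \<in> carrier A" for a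
        unfolding u(2) cs(5)[OF u(1)] i[OF u(1)] i[OF fd_rmodD(3)[OF L u(1) a]] by simp
    qed
  qed
  show ?thesis unfolding proj_gen_def using proj indec p0 gen' coord dim by blast
qed

lemma unit_decomp:
  assumes M: "fd_rmod A M" and x: "x \<in> carrier M"
    and z: "\<And>v. v \<in> svert \<Longrightarrow> ract M x (videm v) = \<zero>\<^bsub>M\<^esub>"
  shows "x = \<zero>\<^bsub>M\<^esub>"
proof -
  interpret Mm: Module.module scalars M by (rule fd_rmodD[OF M])
  have z0: "ract M x \<zero>\<^bsub>A\<^esub> = \<zero>\<^bsub>M\<^esub>"
    using mpart_ract[OF M zero_closed zero_closed _ x] mpart_zero[OF M] by simp
  have X: "S \<subseteq> {1..r} \<Longrightarrow> ract M x (eX S) = \<zero>\<^bsub>M\<^esub>" if "finite S" for S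
    using that
  proof (induct S rule: finite_induct)
    case (insert k S)
    then show ?case
      using z[of "VX k"] eX_insert[of k S] fd_rmodD(5)[OF M x, of "eX S" "eX {k}"] by (simp add: videm_def)
  qed (simp add: eX_empty z0)
  have Y: "S \<subseteq> {1..s} \<Longrightarrow> ract M x (eY S) = \<zero>\<^bsub>M\<^esub>" if "finite S" for S
    using that
  proof (induct S rule: finite_induct)
    case (insert k S)
    then show ?case
      using z[of "VY k"] eY_insert[of k S] fd_rmodD(5)[OF M x, of "eY S" "eY {k}"] by (simp add: videm_def)
  qed (simp add: eY_empty z0)
  have "\<one>\<^bsub>A\<^esub> = eX {1..r} \<oplus>\<^bsub>A\<^esub> (eZ \<oplus>\<^bsub>A\<^esub> eY {1..s})"
    by (rule co_ext) (auto simp: co_simps split: star_path.split)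
  then have "x = ract M x (eX {1..r} \<oplus>\<^bsub>A\<^esub> (eZ \<oplus>\<^bsub>A\<^esub> eY {1..s}))" using fd_rmodD(7)[OF M x] by simp
  also have "\<dots> = \<zero>\<^bsub>M\<^esub>"
    using fd_rmodD(5)[OF M x] X[of "{1..r}"] Y[of "{1..s}"] z[of VZ] by (simp add: videm_def)
  finally show ?thesis .
qed

text \<open>The element \<open>m\<close> spans a simple submodule at \<open>v\<close>. It is sought
  against the direction of the arrows: a nonzero element at some y_j is killed by all arrows; if M
  has none, an element at z is; if there is none either, an element at some x_i.\<close>

lemma socle_exists:
  assumes M: "fd_rmod A M" and nz: "\<not> is_zero_mod M"
  shows "\<exists>v \<in> svert. \<exists>m \<in> carrier M. m \<noteq> \<zero>\<^bsub>M\<^esub> \<and>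
    (\<forall>u \<in> carrier A. ract M m u = co (tvp v) u \<odot>\<^bsub>M\<^esub> m)"
proof -
  interpret Mm: Module.module scalars M by (rule fd_rmodD[OF M])
  obtain x where x: "x \<in> carrier M" "x \<noteq> \<zero>\<^bsub>M\<^esub>" using nz Mm.M.zero_closed unfolding is_zero_mod_def by blast
  note r3 = fd_rmodD(3)[OF M]
  have z0: "ract M x \<zero>\<^bsub>A\<^esub> = \<zero>\<^bsub>M\<^esub>" if "x \<in> carrier M" for x
    using mpart_ract[OF M zero_closed zero_closed _ that] mpart_zero[OF M] by simp
  \<comment> \<open>\<open>e\<close> splits e_v u into a multiple of e_v and a remainder that begins
    with arrows \<open>a\<close>, which \<open>y\<close> kills by \<open>k\<close>.\<close>
  have socle: "ract M (ract M y (videm v)) u = co (tvp v) u \<odot>\<^bsub>M\<^esub> ract M y (videm v)"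
    if y: "y \<in> carrier M" and v: "v \<in> svert" and u: "u \<in> carrier A" and a: "a \<in> carrier A" "w \<in> carrier A"
      and e: "videm v \<otimes>\<^bsub>A\<^esub> u = co (tvp v) u \<odot>\<^bsub>A\<^esub> videm v \<oplus>\<^bsub>A\<^esub> a \<otimes>\<^bsub>A\<^esub> w" and k: "ract M y a = \<zero>\<^bsub>M\<^esub>"
    for y v u a w
  proof -
    have "ract M (ract M y (videm v)) u = ract M y (videm v \<otimes>\<^bsub>A\<^esub> u)"
      using fd_rmodD(6)[OF M y videm_closed u] by simp
    also have "\<dots> = co (tvp v) u \<odot>\<^bsub>M\<^esub> ract M y (videm v) \<oplus>\<^bsub>M\<^esub> ract M (ract M y a) w"
      unfolding e using a fd_rmodD(5)[OF M y] fd_rmodD(8)[OF M y videm_closed] fd_rmodD(6)[OF M y a] smult_carrier by simp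
    also have "\<dots> = co (tvp v) u \<odot>\<^bsub>M\<^esub> ract M y (videm v)"
      using k ract_zero[OF M a(2)] r3[OF y videm_closed] Mm.smult_closed[of "co (tvp v) u" "ract M y (videm v)"] by simp
    finally show ?thesis .
  qed
  show ?thesis
  proof (cases "\<exists>y \<in> carrier M. \<exists>j \<in> {1..s}. ract M y (eY {j}) \<noteq> \<zero>\<^bsub>M\<^esub>")
    case True
    then obtain y j where y: "y \<in> carrier M" "j \<in> {1..s}" "ract M y (eY {j}) \<noteq> \<zero>\<^bsub>M\<^esub>" by blast
    have "ract M (ract M y (videm (VY j))) u = co (tvp (VY j)) u \<odot>\<^bsub>M\<^esub> ract M y (videm (VY j))"
      if u: "u \<in> carrier A" for u
    proof (rule socle[OF y(1) _ u zero_closed zero_closed _ z0[OF y(1)]])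
      show "videm (VY j) \<otimes>\<^bsub>A\<^esub> u = co (tvp (VY j)) u \<odot>\<^bsub>A\<^esub> videm (VY j) \<oplus>\<^bsub>A\<^esub> \<zero>\<^bsub>A\<^esub> \<otimes>\<^bsub>A\<^esub> \<zero>\<^bsub>A\<^esub>"
        by (rule co_ext) (use u y(2) in \<open>auto simp: videm_def tvp_def co_simps smult_carrier split: star_path.split\<close>)
    qed (use y in simp)
    then show ?thesis using y r3[OF y(1)] by (intro bexI[of _ "VY j"] bexI[of _ "ract M y (eY {j})"]) (auto simp: videm_def)
  next
    case False
    then have nY: "ract M y (eY {j}) = \<zero>\<^bsub>M\<^esub>" if "y \<in> carrier M" "j \<in> {1..s}" for y j using that by blast
    show ?thesis
    proof (cases "\<exists>y \<in> carrier M. ract M y eZ \<noteq> \<zero>\<^bsub>M\<^esub>")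
      case True
      then obtain y where y: "y \<in> carrier M" "ract M y eZ \<noteq> \<zero>\<^bsub>M\<^esub>" by blast
      have k: "ract M y (bY {1..s}) = \<zero>\<^bsub>M\<^esub>"
      proof (rule unit_decomp[OF M r3[OF y(1) elems_closed(5)]])
        fix v assume v: "v \<in> svert"
        have "bY {1..s} \<otimes>\<^bsub>A\<^esub> videm v = \<zero>\<^bsub>A\<^esub>" if "\<nexists>j. v = VY j"
          by (rule co_ext) (use that v in \<open>auto simp: co_mult co_videm tvp_def co_elems split: star_path.split star_vertex.split\<close>)
        moreover have "ract M (ract M y (bY {1..s})) (videm v) = ract M y (bY {1..s} \<otimes>\<^bsub>A\<^esub> videm v)"
          using fd_rmodD(6)[OF M y(1) elems_closed(5) videm_closed] by simp
        ultimately show "ract M (ract M y (bY {1..s})) (videm v) = \<zero>\<^bsub>M\<^esub>"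
          using nY[OF r3[OF y(1) elems_closed(5)]] v z0[OF y(1)]
          by (cases "\<exists>j. v = VY j") (auto simp: videm_def)
      qed
      have "ract M (ract M y (videm VZ)) u = co (tvp VZ) u \<odot>\<^bsub>M\<^esub> ract M y (videm VZ)" if u: "u \<in> carrier A" for u
      proof (rule socle[OF y(1) _ u elems_closed(5) mk_closed _ k])
        show "videm VZ \<otimes>\<^bsub>A\<^esub> u = co (tvp VZ) u \<odot>\<^bsub>A\<^esub> videm VZ \<oplus>\<^bsub>A\<^esub>
            bY {1..s} \<otimes>\<^bsub>A\<^esub> mk (\<lambda>p. case p of BY j \<Rightarrow> co (BB j) u | _ \<Rightarrow> 0)"
          by (rule co_ext) (use u in \<open>auto simp: videm_def tvp_def co_simps smult_carrier split: star_path.split\<close>)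
      qed simp
      then show ?thesis using y r3[OF y(1)] by (intro bexI[of _ VZ] bexI[of _ "ract M y eZ"]) (auto simp: videm_def)
    next
      case False
      then have nZ: "ract M y eZ = \<zero>\<^bsub>M\<^esub>" if "y \<in> carrier M" for y using that by blast
      obtain i where i: "i \<in> {1..r}" "ract M x (eX {i}) \<noteq> \<zero>\<^bsub>M\<^esub>"
      proof (rule ccontr)
        assume a: "\<not> thesis"
        have "x = \<zero>\<^bsub>M\<^esub>"
        proof (rule unit_decomp[OF M x(1)])
          fix v assume "v \<in> svert"
          then show "ract M x (videm v) = \<zero>\<^bsub>M\<^esub>"
            using nY[OF x(1)] nZ[OF x(1)] a that by (cases v) (auto simp: videm_def)
        qed
        then show False using x(2) by simp
      qed
      have k: "ract M x (aX {i}) = \<zero>\<^bsub>M\<^esub>"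
      proof (rule unit_decomp[OF M r3[OF x(1) elems_closed(4)]])
        fix v assume v: "v \<in> svert"
        have "aX {i} \<otimes>\<^bsub>A\<^esub> videm v = \<zero>\<^bsub>A\<^esub>" if "v \<noteq> VZ"
          by (rule co_ext) (use that v in \<open>auto simp: co_mult co_videm tvp_def co_elems split: star_path.split star_vertex.split\<close>)
        moreover have "ract M (ract M x (aX {i})) (videm v) = ract M x (aX {i} \<otimes>\<^bsub>A\<^esub> videm v)"
          using fd_rmodD(6)[OF M x(1) elems_closed(4) videm_closed] by simp
        ultimately show "ract M (ract M x (aX {i})) (videm v) = \<zero>\<^bsub>M\<^esub>"
          using nZ[OF r3[OF x(1) elems_closed(4)]] z0[OF x(1)]
          by (cases "v = VZ") (auto simp: videm_def)
      qed
      have "ract M (ract M x (videm (VX i))) u = co (tvp (VX i)) u \<odot>\<^bsub>M\<^esub> ract M x (videm (VX i))" if u: "u \<in> carrier A" for u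
      proof (rule socle[OF x(1) _ u elems_closed(4) mk_closed _ k])
        show "videm (VX i) \<otimes>\<^bsub>A\<^esub> u = co (tvp (VX i)) u \<odot>\<^bsub>A\<^esub> videm (VX i) \<oplus>\<^bsub>A\<^esub>
            aX {i} \<otimes>\<^bsub>A\<^esub> mk (\<lambda>p. case p of BZ \<Rightarrow> co (BA i) u | BB j \<Rightarrow> co (BC i j) u | _ \<Rightarrow> 0)"
          by (rule co_ext) (use u i in \<open>auto simp: videm_def tvp_def co_simps co_out[OF u] smult_carrier split: star_path.split\<close>)
      qed (use i in simp)
      then show ?thesis using i r3[OF x(1)] by (intro bexI[of _ "VX i"] bexI[of _ "ract M x (eX {i})"]) (auto simp: videm_def)
    qed
  qed
qed

end

section \<open>Indecomposable injectives and the return of orbits to projectives\<close>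

context star_alg
begin

text \<open>
  Let \<open>m \<in> J\<close> span a simple submodule at \<open>v\<close>, and let \<open>m\<^sub>0\<close> be the socle element of \<open>\<nu>P\<^sub>v\<close>.  As \<open>J\<close>
  is injective, \<open>m\<^sub>0 \<mapsto> m\<close> extends to \<open>k: \<nu>P\<^sub>v \<rightarrow> J\<close>.  A linear functional on \<open>J\<close> that is \<open>1\<close> on \<open>m\<close>
  induces \<open>\<theta>: J \<rightarrow> \<nu>P\<^sub>v\<close> with \<open>\<theta> m = m\<^sub>0\<close>; since every nonzero submodule of \<open>\<nu>P\<^sub>v\<close> contains \<open>m\<^sub>0\<close>, the
  endomorphism \<open>\<theta> k\<close> is bijective and \<open>k\<close> splits.
\<close>

theorem injective_dims:
  fixes J :: "('k, 'a) fmod"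
  assumes J: "injective_rmod A J" "indecomposable_rmod A J"
  shows "\<exists>v \<in> svert. \<forall>P p0. proj_gen v P p0 \<longrightarrow>
    (\<forall>u \<in> svert. vdim J (mpart J (videm u)) = vdim (nakayama_mod A P) (mpart (nakayama_mod A P) (videm u)))"
proof -
  have fJ: "fd_rmod A J" using J(1) unfolding injective_rmod_def by blast
  interpret Jm: Module.module scalars J by (rule fd_rmodD[OF fJ])
  have Jsc: "c \<odot>\<^bsub>J\<^esub> x \<in> carrier J" if "x \<in> carrier J" for c x using Jm.smult_closed[of c x] that by simp
  have "\<not> is_zero_mod J" using J(2) unfolding indecomposable_rmod_def by blast
  from socle_exists[OF fJ this] obtain v m where v: "v \<in> svert" and m: "m \<in> carrier J" "m \<noteq> \<zero>\<^bsub>J\<^esub>"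
    and mu: "\<And>u. u \<in> carrier A \<Longrightarrow> ract J m u = co (tvp v) u \<odot>\<^bsub>J\<^esub> m" by blast
  obtain l where l: "lin_on J ground_alg (carrier J) l" "l m = 1"
    using linear_functional_exists[OF fd_rmodD(1)[OF fJ] m] by blast
  let ?t = "tvp v" and ?e = "videm v"
  show ?thesis
  proof (rule bexI[OF _ v], intro allI impI)
    fix P :: "('k, 'a) fmod" and p0 assume PG: "proj_gen v P p0"
    have pP: "projective_rmod A P" and p0e: "p0 \<in> carrier P" "ract P p0 ?e = p0"
      and gen: "\<And>x. x \<in> carrier P \<Longrightarrow> \<exists>u \<in> carrier A. x = ract P p0 u"
      using PG unfolding proj_gen_def mpart_def by auto
    obtain f1 where f1: "f1 \<in> rhom A P (regular_rmod A)" "f1 p0 = ?e"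
      using PG unfolding proj_gen_def by blast
    obtain B F where "star_proj A r s R co mk P B F" using star_proj_exists[OF pP] by blast
    then interpret star_proj A r s R co mk P B F .
    note fP = P and fN = fd_rmod_nakayama
    interpret Nm: Module.module scalars NP by (rule ND(2))
    have Nsc: "c \<odot>\<^bsub>NP\<^esub> x \<in> carrier NP" if "x \<in> carrier NP" for c x using Nm.smult_closed[of c x] that by simp
    have fp0: "f p0 \<in> carrier A" "f p0 \<otimes>\<^bsub>A\<^esub> ?e = f p0" if f: "f \<in> H" for f
      using fH(1)[OF f p0e(1)] fH(3)[OF f p0e(1) videm_closed[of v], unfolded p0e(2)] by simp_all
    have f_det: "f = f'" if f: "f \<in> H" "f' \<in> H" and eq: "f p0 = f' p0" for f f'
    proof (rule extensionalityI[OF fH(4)[OF f(1)] fH(4)[OF f(2)]])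
      fix x assume "x \<in> carrier P"
      then obtain u where "u \<in> carrier A" "x = ract P p0 u" using gen by blast
      then show "f x = f' x" using fH(3)[OF f(1) p0e(1)] fH(3)[OF f(2) p0e(1)] eq by simp
    qed
    \<comment> \<open>Evaluation at the generator \<open>p0\<close> identifies Hom(P, A) with A e_v.
      Since e_v A e_v is the field, multiplying any f' by f(p0) gives a multiple of
      \<open>f\<close>.\<close>
    have lact_gen: "lact A P (f p0) f' = (\<lambda>x \<in> carrier P. co ?t (f' p0) \<odot>\<^bsub>A\<^esub> f x)"
      if f: "f \<in> H" and f': "f' \<in> H" for f f'
    proof (rule f_det[OF lact_in[OF proj_mod.P[OF proj_mod_axioms] fp0(1)[OF f] f']])
      show "(\<lambda>x \<in> carrier P. co ?t (f' p0) \<odot>\<^bsub>A\<^esub> f x) \<in> H"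
        by (rule hom_space_smult[OF proj_mod.P[OF proj_mod_axioms] f])
      have "f p0 \<otimes>\<^bsub>A\<^esub> f' p0 = f p0 \<otimes>\<^bsub>A\<^esub> (?e \<otimes>\<^bsub>A\<^esub> f' p0)"
        using fp0[OF f] fp0(1)[OF f'] by (simp add: m_assoc[symmetric])
      also have "\<dots> = co ?t (f' p0) \<odot>\<^bsub>A\<^esub> f p0"
        using corner_refl[OF v fp0[OF f']] fp0[OF f] by (simp add: alg_simps)
      finally show "lact A P (f p0) f' p0 = (\<lambda>x \<in> carrier P. co ?t (f' p0) \<odot>\<^bsub>A\<^esub> f x) p0"
        using p0e(1) lact_apply[OF proj_mod.P[OF proj_mod_axioms] p0e(1)] by simp
    qed
    define m0 where "m0 = eta ?t p0"
    have m0: "m0 \<in> carrier NP" unfolding m0_def by (rule eta_in[OF p0e(1)])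
    have m0u: "ract NP m0 u = co ?t u \<odot>\<^bsub>NP\<^esub> m0" if u: "u \<in> carrier A" for u
    proof (rule nak_ext[OF proj_mod.P[OF proj_mod_axioms] ND(3)[OF m0 u] Nsc[OF m0]])
      show "ract NP m0 u f = (co ?t u \<odot>\<^bsub>NP\<^esub> m0) f" if f: "f \<in> H" for f
        unfolding m0_def ract_eta[OF p0e(1) u f] using co_tvp_mult[OF u fp0(1)[OF f]] f
        by (simp add: nakayama_simps eta_def)
    qed
    \<comment> \<open>If \<phi> is nonzero, choosing \<open>f\<close> with \<phi> f nonzero gives a
      multiple of \<phi> that is a nonzero multiple of \<open>m0\<close>: the line spanned by
      \<open>m0\<close> is essential.\<close>
    have ess: "ract NP \<phi> (f p0) = \<phi> f \<odot>\<^bsub>NP\<^esub> m0" if p: "\<phi> \<in> carrier NP" and f: "f \<in> H" for \<phi> f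
    proof (rule nak_ext[OF proj_mod.P[OF proj_mod_axioms] ND(3)[OF p fp0(1)[OF f]] Nsc[OF m0]])
      fix f' assume f': "f' \<in> H"
      have "ract NP \<phi> (f p0) f' = \<phi> (\<lambda>x \<in> carrier P. co ?t (f' p0) \<odot>\<^bsub>A\<^esub> f x)"
        using f' lact_gen[OF f f'] by (simp add: nakayama_simps)
      also have "\<dots> = co ?t (f' p0) * \<phi> f" by (rule nakD(2)[OF proj_mod.P[OF proj_mod_axioms] p f])
      finally show "ract NP \<phi> (f p0) f' = (\<phi> f \<odot>\<^bsub>NP\<^esub> m0) f'"
        using f' by (simp add: nakayama_simps m0_def eta_def)
    qed
    have kernel: "\<phi> = \<zero>\<^bsub>NP\<^esub>"
      if p: "\<phi> \<in> carrier NP" and z: "h \<phi> = \<zero>\<^bsub>W\<^esub>" and W: "fd_rmod A W" and h: "h \<in> rhom A NP W"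
        and hm: "h m0 \<noteq> \<zero>\<^bsub>W\<^esub>" for \<phi> h and W :: "('k, 'a, 'w) rmod"
    proof (rule nak_ext[OF proj_mod.P[OF proj_mod_axioms] p Nm.M.zero_closed])
      fix f assume f: "f \<in> H"
      interpret Wm: Module.module scalars W by (rule fd_rmodD[OF W])
      have hc: "h m0 \<in> carrier W" by (rule rhomD(1)[OF h m0])
      have "\<phi> f \<odot>\<^bsub>W\<^esub> h m0 = h (\<phi> f \<odot>\<^bsub>NP\<^esub> m0)" by (rule rhom_smult[OF fN W h m0, symmetric])
      also have "\<dots> = ract W (h \<phi>) (f p0)" unfolding ess[OF p f, symmetric] by (rule rhomD(3)[OF h p fp0(1)[OF f]])
      also have "\<dots> = \<zero>\<^bsub>W\<^esub>" unfolding z by (rule ract_zero[OF W fp0(1)[OF f]])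
      finally have 0: "\<phi> f \<odot>\<^bsub>W\<^esub> h m0 = \<zero>\<^bsub>W\<^esub>" .
      have "\<phi> f = 0"
      proof (rule ccontr)
        assume ne: "\<phi> f \<noteq> 0"
        have "h m0 = inverse (\<phi> f) \<odot>\<^bsub>W\<^esub> (\<phi> f \<odot>\<^bsub>W\<^esub> h m0)"
          using Wm.smult_assoc1[of "inverse (\<phi> f)" "\<phi> f" "h m0"] Wm.smult_one[of "h m0"] hc ne by simp
        also have "\<dots> = \<zero>\<^bsub>W\<^esub>" unfolding 0 using Wm.smult_r_null[of "inverse (\<phi> f)"] by simp
        finally show False using hm by simp
      qed
      then show "\<phi> f = \<zero>\<^bsub>NP\<^esub> f" using f by (simp add: nakayama_simps)
    qed
    \<comment> \<open>Injectivity of \<open>J\<close> speaks of modules in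
      \<open>nat \<Rightarrow> 'k\<close>, so \<nu>P_v is replaced by a copy there.\<close>
    obtain c :: "(((nat \<Rightarrow> 'k) \<Rightarrow> 'a) \<Rightarrow> 'k) \<Rightarrow> nat \<Rightarrow> 'k" where c: "inj_on c (carrier NP)"
      using coordinates_exist[OF fd_space_nakayama] by blast
    let ?N = "rmod_copy NP c"
    note cs = rmod_copy_simps[OF c]
    have N: "fd_rmod A ?N" by (rule fd_rmod_copy[OF fd_algebra fN c])
    let ?S = "range (\<lambda>b. c (b \<odot>\<^bsub>NP\<^esub> m0))"
    have Sc: "c (b \<odot>\<^bsub>NP\<^esub> m0) \<in> ?S" for b by blast
    have Nsm: "a \<odot>\<^bsub>NP\<^esub> (b \<odot>\<^bsub>NP\<^esub> m0) = (a * b) \<odot>\<^bsub>NP\<^esub> m0" "a \<odot>\<^bsub>NP\<^esub> m0 \<oplus>\<^bsub>NP\<^esub> b \<odot>\<^bsub>NP\<^esub> m0 = (a + b) \<odot>\<^bsub>NP\<^esub> m0" for a b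
      using Nm.smult_assoc1[of a b m0] Nm.smult_l_distr[of a b m0] m0 by simp_all
    have Jsm: "a \<odot>\<^bsub>J\<^esub> (b \<odot>\<^bsub>J\<^esub> m) = (a * b) \<odot>\<^bsub>J\<^esub> m" "a \<odot>\<^bsub>J\<^esub> m \<oplus>\<^bsub>J\<^esub> b \<odot>\<^bsub>J\<^esub> m = (a + b) \<odot>\<^bsub>J\<^esub> m" for a b
      using Jm.smult_assoc1[of a b m] Jm.smult_l_distr[of a b m] m(1) by simp_all
    have Sract: "ract ?N (c (b \<odot>\<^bsub>NP\<^esub> m0)) a = c ((b * co ?t a) \<odot>\<^bsub>NP\<^esub> m0)" if a: "a \<in> carrier A" for a b
      using cs(5)[OF Nsc[OF m0]] ND(9)[OF m0 a] m0u[OF a] Nsm(1) by simp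
    have Sadd: "c (a \<odot>\<^bsub>NP\<^esub> m0) \<oplus>\<^bsub>?N\<^esub> c (b \<odot>\<^bsub>NP\<^esub> m0) = c ((a + b) \<odot>\<^bsub>NP\<^esub> m0)" for a b
      using cs(3)[OF Nsc[OF m0] Nsc[OF m0]] Nsm(2) by simp
    have m0f1: "m0 f1 = 1" using f1 co_videm[OF v, of ?t] unfolding m0_def eta_def by simp
    have m0_nz: "m0 \<noteq> \<zero>\<^bsub>NP\<^esub>"
      using m0f1 f1(1) by (auto simp: nakayama_simps)
    let ?M = "?N\<lparr>carrier := ?S\<rparr>"
    have SN: "?S \<subseteq> carrier ?N" using Nsc[OF m0] cs(1) by blast
    have M: "fd_rmod A ?M"
    proof (rule fd_rmod_sub[OF N])
      have "\<zero>\<^bsub>?N\<^esub> = c (0 \<odot>\<^bsub>NP\<^esub> m0)" using Nm.lmult_0[OF m0] cs(2) by simp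
      moreover have "a \<odot>\<^bsub>?N\<^esub> c (b \<odot>\<^bsub>NP\<^esub> m0) = c ((a * b) \<odot>\<^bsub>NP\<^esub> m0)" for a b
        using cs(4)[OF Nsc[OF m0]] Nsm(1) by simp
      ultimately show "subsp ?N ?S" unfolding subsp_def using SN Sadd by auto
      show "ract ?N x a \<in> ?S" if "x \<in> ?S" "a \<in> carrier A" for x a using that Sract by auto
    qed
    have incl: "(\<lambda>x \<in> ?S. x) \<in> rhom A ?M ?N"
      unfolding rhom_def using SN fd_rmodD(3)[OF M] Sadd Sract by auto
    \<comment> \<open>\<open>q\<close> sends b m0 to b m; evaluation at \<open>f1\<close> recovers
      the scalar \<open>b\<close> because m0(f1) = 1.\<close>
    define q where "q = (\<lambda>x \<in> ?S. inv_into (carrier NP) c x f1 \<odot>\<^bsub>J\<^esub> m)"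
    have qc: "q (c (b \<odot>\<^bsub>NP\<^esub> m0)) = b \<odot>\<^bsub>J\<^esub> m" for b
      unfolding q_def using Sc[of b] inv_into_f_f[OF c Nsc[OF m0]] f1(1) m0f1 by (simp add: nakayama_simps)
    have q: "q \<in> rhom A ?M J"
      unfolding rhom_def
    proof (intro CollectI conjI ballI)
      show "q \<in> carrier ?M \<rightarrow>\<^sub>E carrier J" unfolding PiE_iff using qc Jsc[OF m(1)] by (auto simp: q_def)
      fix x assume "x \<in> carrier ?M"
      then obtain a where x: "x = c (a \<odot>\<^bsub>NP\<^esub> m0)" by auto
      show "q (x \<oplus>\<^bsub>?M\<^esub> y) = q x \<oplus>\<^bsub>J\<^esub> q y" if y': "y \<in> carrier ?M" for y
      proof -
        obtain b where y: "y = c (b \<odot>\<^bsub>NP\<^esub> m0)" using y' by auto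
        show ?thesis unfolding x y using Sadd qc Jsm(2) by simp
      qed
      show "q (ract ?M x u) = ract J (q x) u" if u: "u \<in> carrier A" for u
        unfolding x using Sract[OF u] qc fd_rmodD(9)[OF fJ m(1) u] mu[OF u] Jsm(1) by simp
    qed
    have inj_ext: "\<exists>h \<in> rhom A N' J. \<forall>x \<in> carrier M'. h (g x) = f x"
      if "fd_rmod A M'" "fd_rmod A N'" "g \<in> rhom A M' N'" "f \<in> rhom A M' J" "inj_on g (carrier M')"
      for M' N' :: "('k, 'a) fmod" and g f
      using J(1) that unfolding injective_rmod_def by blast
    obtain h where h: "h \<in> rhom A ?N J" "\<And>x. x \<in> carrier ?M \<Longrightarrow> h ((\<lambda>x \<in> ?S. x) x) = q x"
      using inj_ext[OF M N incl q] by (auto simp: inj_on_def)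
    define k where "k = (\<lambda>\<phi> \<in> carrier NP. h (c \<phi>))"
    have kc: "k \<phi> = h (c \<phi>)" if "\<phi> \<in> carrier NP" for \<phi> unfolding k_def using that by simp
    have cN: "c \<phi> \<in> carrier ?N" if "\<phi> \<in> carrier NP" for \<phi> using that cs(1) by blast
    have k: "k \<in> rhom A NP J"
      unfolding rhom_def
    proof (intro CollectI conjI ballI)
      show "k \<in> carrier NP \<rightarrow>\<^sub>E carrier J" unfolding k_def using rhomD(1)[OF h(1) cN] by auto
      fix \<phi> assume p: "\<phi> \<in> carrier NP"
      show "k (\<phi> \<oplus>\<^bsub>NP\<^esub> \<psi>) = k \<phi> \<oplus>\<^bsub>J\<^esub> k \<psi>" if q: "\<psi> \<in> carrier NP" for \<psi>
        unfolding kc[OF p] kc[OF q] kc[OF Nm.M.a_closed[OF p q]] cs(3)[OF p q, symmetric]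
        by (rule rhomD(2)[OF h(1) cN[OF p] cN[OF q]])
      show "k (ract NP \<phi> u) = ract J (k \<phi>) u" if u: "u \<in> carrier A" for u
        unfolding kc[OF p] kc[OF ND(3)[OF p u]] cs(5)[OF p, symmetric] by (rule rhomD(3)[OF h(1) cN[OF p] u])
    qed
    have km0: "k m0 = m"
    proof -
      have 1: "1 \<odot>\<^bsub>NP\<^esub> m0 = m0" "1 \<odot>\<^bsub>J\<^esub> m = m" using Nm.smult_one[OF m0] Jm.smult_one[OF m(1)] by simp_all
      have "c m0 \<in> ?S" using Sc[of 1] 1 by simp
      then show ?thesis using h(2)[of "c m0"] qc[of 1] 1 kc[OF m0] by simp
    qed
    have k_ker: "\<phi> = \<zero>\<^bsub>NP\<^esub>" if "\<phi> \<in> carrier NP" "k \<phi> = \<zero>\<^bsub>J\<^esub>" for \<phi>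
      by (rule kernel[OF that fJ k]) (simp add: km0 m(2))
    \<comment> \<open>The homomorphism that corresponds to the restriction of \<open>l\<close> to J
      e_v under the isomorphism of Hom(J, \<nu>P_v) with the dual of J e_v.\<close>
    define th where "th = (\<lambda>x \<in> carrier J. \<lambda>f \<in> H. l (ract J x (f p0)))"
    have l_add: "l (x \<oplus>\<^bsub>J\<^esub> y) = l x + l y" and l_sm: "l (b \<odot>\<^bsub>J\<^esub> x) = b * l x"
      if "x \<in> carrier J" "y \<in> carrier J" for x y b using l(1) that unfolding lin_on_def by simp_all
    have thc: "th x = (\<lambda>f \<in> H. l (ract J x (f p0)))" if "x \<in> carrier J" for x unfolding th_def using that by simp
    have th_in: "th x \<in> carrier NP" if x: "x \<in> carrier J" for x
      unfolding thc[OF x]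
    proof (rule nakI[OF proj_mod.P[OF proj_mod_axioms]])
      fix f g b assume f: "f \<in> H"
      note xf = fd_rmodD(3)[OF fJ x fp0(1)[OF f]]
      show "l (ract J x ((\<lambda>x \<in> carrier P. b \<odot>\<^bsub>A\<^esub> f x) p0)) = b * l (ract J x (f p0))"
        using fd_rmodD(8)[OF fJ x fp0(1)[OF f]] l_sm[OF xf xf] p0e(1) by simp
      assume g: "g \<in> H"
      show "l (ract J x ((\<lambda>x \<in> carrier P. f x \<oplus>\<^bsub>A\<^esub> g x) p0)) = l (ract J x (f p0)) + l (ract J x (g p0))"
        using fd_rmodD(5)[OF fJ x fp0(1)[OF f] fp0(1)[OF g]] l_add[OF xf fd_rmodD(3)[OF fJ x fp0(1)[OF g]]] p0e(1) by simp
    qed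
    have th: "th \<in> rhom A J NP"
      unfolding rhom_def
    proof (intro CollectI conjI ballI)
      show "th \<in> carrier J \<rightarrow>\<^sub>E carrier NP" unfolding PiE_iff using th_in by (auto simp: th_def)
      fix x assume x: "x \<in> carrier J"
      show "th (x \<oplus>\<^bsub>J\<^esub> y) = th x \<oplus>\<^bsub>NP\<^esub> th y" if y: "y \<in> carrier J" for y
        unfolding thc[OF x] thc[OF y] thc[OF Jm.M.a_closed[OF x y]] nakayama_simps
      proof (rule restrict_ext)
        fix f assume f: "f \<in> H"
        note xf = fd_rmodD(3)[OF fJ x fp0(1)[OF f]] and yf = fd_rmodD(3)[OF fJ y fp0(1)[OF f]]
        show "l (ract J (x \<oplus>\<^bsub>J\<^esub> y) (f p0)) =
            (\<lambda>f \<in> H. l (ract J x (f p0))) f + (\<lambda>f \<in> H. l (ract J y (f p0))) f"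
          using fd_rmodD(4)[OF fJ x y fp0(1)[OF f]] l_add[OF xf yf] f by simp
      qed
      show "th (ract J x u) = ract NP (th x) u" if u: "u \<in> carrier A" for u
        unfolding thc[OF x] thc[OF fd_rmodD(3)[OF fJ x u]] nakayama_simps
      proof (rule restrict_ext)
        fix f assume f: "f \<in> H"
        show "l (ract J (ract J x u) (f p0)) = (\<lambda>f \<in> H. l (ract J x (f p0))) (lact A P u f)"
          using lact_in[OF proj_mod.P[OF proj_mod_axioms] u f] lact_apply[OF proj_mod.P[OF proj_mod_axioms] p0e(1)]
            fd_rmodD(6)[OF fJ x u fp0(1)[OF f]] by simp
      qed
    qed
    have th_m: "th m = m0"
      unfolding thc[OF m(1)] m0_def eta_def
      by (rule restrict_ext) (use mu[OF fp0(1)] l_sm[OF m(1) m(1)] l(2) in simp)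
    define kap where "kap = (\<lambda>\<phi> \<in> carrier NP. th (k \<phi>))"
    have rc: "kap \<phi> = th (k \<phi>)" if "\<phi> \<in> carrier NP" for \<phi> unfolding kap_def using that by simp
    have kJ: "k \<phi> \<in> carrier J" if "\<phi> \<in> carrier NP" for \<phi> by (rule rhomD(1)[OF k that])
    have kap: "kap \<in> rhom A NP NP"
      unfolding rhom_def
    proof (intro CollectI conjI ballI)
      show "kap \<in> carrier NP \<rightarrow>\<^sub>E carrier NP" unfolding kap_def using th_in[OF kJ] by auto
      fix \<phi> assume p: "\<phi> \<in> carrier NP"
      show "kap (\<phi> \<oplus>\<^bsub>NP\<^esub> \<psi>) = kap \<phi> \<oplus>\<^bsub>NP\<^esub> kap \<psi>" if q: "\<psi> \<in> carrier NP" for \<psi>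
        unfolding rc[OF p] rc[OF q] rc[OF Nm.M.a_closed[OF p q]] rhomD(2)[OF k p q]
        by (rule rhomD(2)[OF th kJ[OF p] kJ[OF q]])
      show "kap (ract NP \<phi> u) = ract NP (kap \<phi>) u" if u: "u \<in> carrier A" for u
        unfolding rc[OF p] rc[OF ND(3)[OF p u]] rhomD(3)[OF k p u] by (rule rhomD(3)[OF th kJ[OF p] u])
    qed
    have kap_ker: "\<phi> = \<zero>\<^bsub>NP\<^esub>" if "\<phi> \<in> carrier NP" "kap \<phi> = \<zero>\<^bsub>NP\<^esub>" for \<phi>
      by (rule kernel[OF that fN kap]) (simp add: rc[OF m0] km0 th_m m0_nz)
    have sNP: "subsp NP (carrier NP)" by (rule subsp_carrier[OF ND(2)])
    have lr: "lin_on NP NP (carrier NP) kap" by (rule lin_on_rhom[OF fN fN kap subset_refl])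
    have "vdim NP (kap ` carrier NP) = vdim NP (carrier NP)"
      by (rule vdim_inj_image[OF ND(1,2) sNP lr]) (use kap_ker in \<open>auto simp: lker_def\<close>)
    moreover have "kap ` carrier NP \<subseteq> carrier NP" using rhomD(1)[OF kap] by auto
    ultimately have kap_surj: "kap ` carrier NP = carrier NP"
      using vdim_eq_imp_eq[OF ND(1) subsp_image[OF ND(2,2) sNP lr] sNP] by blast
    let ?U = "k ` carrier NP" and ?V = "lker NP (carrier J) th"
    have sJ: "subsp J (carrier J)" by (rule subsp_carrier[OF fd_rmodD(2)[OF fJ]])
    have lk: "lin_on NP J (carrier NP) k" by (rule lin_on_rhom[OF fN fJ k subset_refl])
    have lt: "lin_on J NP (carrier J) th" by (rule lin_on_rhom[OF fJ fN th subset_refl])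
    have sU: "subsp J ?U" by (rule subsp_image[OF ND(2) fd_rmodD(2)[OF fJ] sNP lk])
    have sV: "subsp J ?V" by (rule subsp_lker[OF fd_rmodD(2)[OF fJ] ND(2) sJ lt])
    have U: "rsubmod A J ?U"
    proof -
      have "ract J x a \<in> ?U" if "x \<in> ?U" "a \<in> carrier A" for x a
        using that rhomD(3)[OF k _ that(2), symmetric] ND(3) by auto
      then show ?thesis unfolding rsubmod_def using subspD(1-3)[OF sU] by blast
    qed
    have V: "rsubmod A J ?V"
    proof -
      have "ract J x a \<in> ?V" if "x \<in> ?V" "a \<in> carrier A" for x a
        using that fd_rmodD(3)[OF fJ] rhomD(3)[OF th _ that(2)] ract_zero[OF fN that(2)] unfolding lker_def by auto
      then show ?thesis unfolding rsubmod_def using subspD(1-3)[OF sV] by blast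
    qed
    have UV: "?U \<inter> ?V = {\<zero>\<^bsub>J\<^esub>}"
    proof (intro equalityI subsetI)
      fix x assume "x \<in> ?U \<inter> ?V"
      then obtain \<phi> where p: "\<phi> \<in> carrier NP" "x = k \<phi>" "th x = \<zero>\<^bsub>NP\<^esub>" unfolding lker_def by auto
      then have "\<phi> = \<zero>\<^bsub>NP\<^esub>" using kap_ker rc by simp
      then show "x \<in> {\<zero>\<^bsub>J\<^esub>}" using p(2) rhom_zero[OF fN fJ k] by simp
    qed (use subspD(2)[OF sU] subspD(2)[OF sV] in auto)
    have sum: "?U <+>\<^bsub>J\<^esub> ?V = carrier J"
    proof (intro equalityI subsetI)
      fix x assume "x \<in> ?U <+>\<^bsub>J\<^esub> ?V"
      then obtain a b where "a \<in> ?U" "b \<in> ?V" "x = a \<oplus>\<^bsub>J\<^esub> b" unfolding set_add_def' by auto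
      then show "x \<in> carrier J" using subspD(5)[OF sU] subspD(5)[OF sV] by simp
    next
      fix x assume x: "x \<in> carrier J"
      obtain \<phi> where p: "\<phi> \<in> carrier NP" "th x = kap \<phi>" using kap_surj th_in[OF x] by blast
      have "th (x \<ominus>\<^bsub>J\<^esub> k \<phi>) = th x \<ominus>\<^bsub>NP\<^esub> th (k \<phi>)"
        by (rule lin_on_diff[OF fd_rmodD(2)[OF fJ] ND(2) sJ lt x kJ[OF p(1)]])
      also have "\<dots> = \<zero>\<^bsub>NP\<^esub>" using p rc[OF p(1)] th_in[OF x] Nm.M.r_neg[OF th_in[OF x]] unfolding a_minus_def by simp
      finally have "x \<ominus>\<^bsub>J\<^esub> k \<phi> \<in> ?V" using x kJ[OF p(1)] unfolding lker_def by simp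
      moreover have "x = k \<phi> \<oplus>\<^bsub>J\<^esub> (x \<ominus>\<^bsub>J\<^esub> k \<phi>)"
        using x kJ[OF p(1)] unfolding a_minus_def by (simp add: Jm.M.a_lcomm Jm.M.r_neg)
      ultimately show "x \<in> ?U <+>\<^bsub>J\<^esub> ?V" using p(1) unfolding set_add_def' by blast
    qed
    have "?U = {\<zero>\<^bsub>J\<^esub>} \<or> ?V = {\<zero>\<^bsub>J\<^esub>}" using J(2) U V UV sum unfolding indecomposable_rmod_def by blast
    moreover have "m \<in> ?U" using km0 m0 by force
    \<comment> \<open>Of the two complementary summands the image of \<open>k\<close> contains
      \<open>m\<close>, so it is the kernel of \<open>th\<close> that vanishes.\<close>
    ultimately have V0: "?V = {\<zero>\<^bsub>J\<^esub>}" using m(2) by blast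
    have UJ: "?U = carrier J"
    proof
      show "carrier J \<subseteq> ?U"
      proof
        fix x assume "x \<in> carrier J"
        then have "x \<in> ?U <+>\<^bsub>J\<^esub> ?V" using sum by simp
        then obtain a where "a \<in> ?U" "x = a \<oplus>\<^bsub>J\<^esub> \<zero>\<^bsub>J\<^esub>" unfolding set_add_def' V0 by auto
        then show "x \<in> ?U" using subspD(5)[OF sU] by simp
      qed
    qed (use subspD(1)[OF sU] in auto)
    show "\<forall>u \<in> svert. vdim J (mpart J (videm u)) = vdim NP (mpart NP (videm u))"
    proof
      fix u
      have sub: "mpart NP (videm u) \<subseteq> carrier NP" unfolding mpart_def by auto
      have im: "k ` mpart NP (videm u) = mpart J (videm u)"
      proof (intro equalityI subsetI)
        fix x assume "x \<in> k ` mpart NP (videm u)"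
        then obtain \<phi> where p: "\<phi> \<in> carrier NP" "ract NP \<phi> (videm u) = \<phi>" "x = k \<phi>" unfolding mpart_def by auto
        show "x \<in> mpart J (videm u)"
          using rhomD(3)[OF k p(1) videm_closed, of u] p kJ[OF p(1)] unfolding mpart_def by simp
      next
        fix x assume x: "x \<in> mpart J (videm u)"
        then obtain \<phi> where p: "\<phi> \<in> carrier NP" "x = k \<phi>" using UJ unfolding mpart_def by auto
        have "k (ract NP \<phi> (videm u)) = x"
          using rhomD(3)[OF k p(1) videm_closed, of u] p(2) x unfolding mpart_def by simp
        moreover have "ract NP \<phi> (videm u) \<in> mpart NP (videm u)"
          by (rule mpart_ract[OF fN videm_closed videm_closed videm_idem p(1)])
        ultimately show "x \<in> k ` mpart NP (videm u)" by blast
      qed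
      show "vdim J (mpart J (videm u)) = vdim NP (mpart NP (videm u))"
        unfolding im[symmetric]
        by (rule vdim_inj_image[OF ND(1) fd_rmodD(2)[OF fJ] subsp_mpart[OF fN videm_closed] lin_on_subset[OF lk sub]])
          (use k_ker sub in \<open>auto simp: lker_def\<close>)
    qed
  qed
qed

lemma chivec_proj_gen:
  assumes "proj_gen v P p0"
  shows "chivec (stalk_complex P) = sdim v"
proof
  fix u
  have "fd_rmod A P" using assms unfolding proj_gen_def projective_rmod_def by blast
  then have c: "chi (stalk_complex P) (videm u) = int (vdim P (mpart P (videm u)))"
    by (rule chi_stalk[OF _ videm_closed])
  show "chivec (stalk_complex P) u = sdim v u"
  proof (cases "u \<in> svert")
    case True
    then show ?thesis using assms c unfolding chivec_def proj_gen_def by simp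
  next
    case False
    then show ?thesis unfolding chivec_def sdim_def by simp
  qed
qed

lemma vanish_stalk:
  assumes "fd_rmod A M" "i \<noteq> 0"
  shows "vanish_at (stalk_complex M) i"
  unfolding vanish_at_def using hd_part_stalk[OF assms(1) videm_closed] assms(2) by simp

text \<open>The inverse of \<nu>_2 takes \<nu>P to P[2], and the even shift does not change Euler
  characteristics. The assumption on dimensions lets \<open>J\<close> stand for \<nu>P.\<close>

lemma nakayama_stalk_cox:
  fixes P J :: "('k, 'a) fmod"
  assumes P: "projective_rmod A P" and J: "fd_rmod A J"
    and d: "\<And>u. u \<in> svert \<Longrightarrow>
      vdim J (mpart J (videm u)) = vdim (nakayama_mod A P) (mpart (nakayama_mod A P) (videm u))"
  shows "chivec (stalk_complex P) = cox (chivec (stalk_complex J))"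
proof -
  let ?Q = "stalk_complex P"
  let ?N = "nakayama_complex A ?Q"
  have Q: "projective_complex A ?Q" by (rule projective_stalk[OF P])
  have fP: "fd_rmod A P" using P unfolding projective_rmod_def by blast
  have c0: "cterm ?Q 0 = P" "carrier (cterm ?Q i) = {\<zero>\<^bsub>cterm ?Q i\<^esub>}" if "i \<noteq> 0" for i
    using that by (simp_all add: stalk_complex_def Let_def)
  have n0: "carrier (cterm ?N i) = {\<zero>\<^bsub>cterm ?N i\<^esub>}" if "i \<noteq> 0" for i
    using nakayama_zero[OF Q c0(2)[OF that]] by (simp add: nakayama_complex_simps[OF Q])
  have "chi ?N (videm u) = chi (stalk_complex J) (videm u)" if u: "u \<in> svert" for u
  proof -
    have "chi ?N (videm u) = (\<Sum>i = -1..1. esgn i * pdim ?N (videm u) i)"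
      by (rule chi_pdim[OF bounded_nakayama_complex[OF Q] _ _ videm_closed]) (use n0 in auto)
    also have "\<dots> = (\<Sum>i \<in> {0}. esgn i * pdim ?N (videm u) i)"
    proof (rule sum.mono_neutral_right)
      have M: "fd_rmod A (cterm ?N i)" for i
        using bounded_nakayama_complex[OF Q] unfolding bounded_complex_def by blast
      have "cpart ?N (videm u) i = {\<zero>\<^bsub>cterm ?N i\<^esub>}" if "i \<noteq> 0" for i
        using n0[OF that] ract_zero[OF M videm_closed, of i] unfolding cpart_def mpart_def by auto
      then have "pdim ?N (videm u) i = 0" if "i \<noteq> 0" for i
        using that vdim_zero[OF fd_rmodD(2)[OF M]] unfolding pdim_def by simp
      then show "\<forall>i \<in> {-1..1} - {0}. esgn i * pdim ?N (videm u) i = 0" by simp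
    qed auto
    also have "\<dots> = int (vdim J (mpart J (videm u)))"
      unfolding d[OF u] by (simp add: pdim_def cpart_def esgn_def nakayama_complex_simps[OF Q] c0(1)[of 1])
    also have "\<dots> = chi (stalk_complex J) (videm u)"
      using chi_stalk[OF J videm_closed] by simp
    finally show ?thesis .
  qed
  then have "chivec ?N = chivec (stalk_complex J)" unfolding chivec_def by auto
  then show ?thesis using chivec_nakayama[OF Q] by simp
qed

lemma chivec_nonneg:
  assumes C: "bounded_complex A C" and v: "\<And>i. i \<noteq> 0 \<Longrightarrow> vanish_at C i"
  shows "chivec C u \<ge> 0"
proof (cases "u \<in> svert")
  case True
  have "chi C (videm u) = (\<Sum>i = -0..0. esgn i * hd_part C (videm u) i)"
    unfolding chi_def by (rule echar_eq) (use v True in \<open>auto simp: vanish_at_def\<close>)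
  then show ?thesis
    using hdim_nonneg[OF vcpx_cpart[OF C videm_closed], of u 0] True by (simp add: chivec_def esgn_def hd_part_def)
qed (simp add: chivec_def)

lemma nu_inv_funpow:
  assumes "(nu_inv A 2 ^^ n) C D"
  shows "chivec D = (cox ^^ n) (chivec C)"
    "(\<And>i. i < 0 \<Longrightarrow> vanish_at D i) \<Longrightarrow> i < 0 \<Longrightarrow> vanish_at C i"
proof -
  have "chivec D = (cox ^^ n) (chivec C) \<and> ((\<forall>i < 0. vanish_at D i) \<longrightarrow> (\<forall>i < 0. vanish_at C i))"
    using assms
  proof (induction n arbitrary: D)
    case (Suc n)
    then obtain E where E: "(nu_inv A 2 ^^ n) C E" "nu_inv A 2 E D" by auto
    show ?case using Suc.IH[OF E(1)] nu_inv_step(1,2)[OF E(2)] by auto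
  qed simp
  then show "chivec D = (cox ^^ n) (chivec C)"
    "(\<And>i. i < 0 \<Longrightarrow> vanish_at D i) \<Longrightarrow> i < 0 \<Longrightarrow> vanish_at C i" by blast+
qed

text \<open>\<open>n\<close> steps lead from P_v to an indecomposable injective, and one further
  application of \<open>cox\<close> leads to the vector of some P_w; hence the exponent
  \<open>Suc n\<close>.\<close>

theorem representation_finite_cox:
  assumes rf: "n_representation_finite 2 A" and v: "v \<in> svert"
  shows "\<exists>n. \<exists>w \<in> svert. (cox ^^ Suc n) (sdim v) = sdim w" "cox (sdim v) u \<ge> 0"
proof -
  obtain P :: "('k, 'a) fmod" and p0 where P: "proj_gen v P p0" using proj_gen_exists[OF v] by blast
  have pP: "projective_rmod A P" "indecomposable_rmod A P" using P unfolding proj_gen_def by auto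
  have fP: "fd_rmod A P" using pP unfolding projective_rmod_def by blast
  obtain n D and J :: "('k, 'a) fmod" where D: "(nu_inv A 2 ^^ n) (stalk_complex P) D"
    and J: "injective_rmod A J" "indecomposable_rmod A J" "derived_iso A D (stalk_complex J)"
    using rf pP unfolding n_representation_finite_def by blast
  have fJ: "fd_rmod A J" using J(1) unfolding injective_rmod_def by blast
  obtain w where w: "w \<in> svert" "\<And>P p0 u. proj_gen w P p0 \<Longrightarrow> u \<in> svert \<Longrightarrow>
      vdim J (mpart J (videm u)) = vdim (nakayama_mod A P) (mpart (nakayama_mod A P) (videm u))"
    using injective_dims[OF J(1,2)] by blast
  obtain W :: "('k, 'a) fmod" and w0 where W: "proj_gen w W w0" using proj_gen_exists[OF w(1)] by blast
  have pW: "projective_rmod A W" using W unfolding proj_gen_def by blast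
  have JW: "cox (chivec (stalk_complex J)) = sdim w"
    using nakayama_stalk_cox[OF pW fJ w(2)[OF W]] chivec_proj_gen[OF W] by simp
  have hJ: "hd_part D (videm u) = hd_part (stalk_complex J) (videm u)" for u
    by (rule ext, rule derived_iso_hd_part[OF J(3) videm_closed videm_idem])
  have "chivec D = chivec (stalk_complex J)" unfolding chivec_def chi_def hJ ..
  then have c: "(cox ^^ Suc n) (sdim v) = sdim w"
    using nu_inv_funpow(1)[OF D] chivec_proj_gen[OF P] JW by simp
  then show "\<exists>n. \<exists>w \<in> svert. (cox ^^ Suc n) (sdim v) = sdim w" using w(1) by blast
  \<comment> \<open>For n = 0 the vector \<open>cox (sdim v)\<close> is itself that of a projective.
    Otherwise it belongs to the next object \<open>E\<close> of the orbit, which has no cohomology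
    in positive degrees because P_v has none, and none in negative degrees because \<open>J\<close>
    has none.\<close>
  show "cox (sdim v) u \<ge> 0"
  proof (cases n)
    case 0
    then show ?thesis using c by (simp add: sdim_def)
  next
    case (Suc m)
    then obtain E where E: "nu_inv A 2 (stalk_complex P) E" "(nu_inv A 2 ^^ m) E D"
      using D relpowp_Suc_E2[of m "nu_inv A 2" "stalk_complex P" D] by auto
    have "vanish_at D i" if "i < 0" for i
      using vanish_stalk[OF fJ, of i] that unfolding vanish_at_def hJ by simp
    then have neg: "vanish_at E i" if "i < 0" for i using nu_inv_funpow(2)[OF E(2)] that by blast
    have pos: "vanish_at E i" if "i > 0" for i
      by (rule nu_inv_step(3)[OF E(1) _ that]) (use vanish_stalk[OF fP] in simp)
    have "chivec E u \<ge> 0"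
      by (rule chivec_nonneg[OF nu_inv_step(4)[OF E(1)]]) (use neg pos in \<open>metis linorder_neqE\<close>)
    then show ?thesis using nu_inv_step(1)[OF E(1)] chivec_proj_gen[OF P] by simp
  qed
qed

end

section \<open>Finite orbits of the Coxeter transformation\<close>

text \<open>After \<open>Suc (n v)\<close> steps the orbit of \<open>g v\<close> continues as the
  orbit of another \<open>g w\<close>, so the initial segments of the orbits up to
  \<open>n v\<close> together contain everything.\<close>

lemma funpow_cycle_finite:
  assumes "finite V" and H: "\<And>v. v \<in> V \<Longrightarrow> \<exists>n. \<exists>w \<in> V. (f ^^ Suc n) (g v) = g w"
  shows "\<exists>S. finite S \<and> (\<forall>v \<in> V. \<forall>m. (f ^^ m) (g v) \<in> S)"
proof -
  obtain n where n: "\<And>v. v \<in> V \<Longrightarrow> \<exists>w \<in> V. (f ^^ Suc (n v)) (g v) = g w" using H by metis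
  define S where "S = (\<Union>v \<in> V. (\<lambda>k. (f ^^ k) (g v)) ` {..n v})"
  have "(f ^^ m) (g v) \<in> S" if "v \<in> V" for m v
    using that
  proof (induction m arbitrary: v rule: less_induct)
    case (less m)
    show ?case
    proof (cases "m \<le> n v")
      case True
      then show ?thesis using less.prems unfolding S_def by auto
    next
      case False
      then obtain k where k: "m = k + Suc (n v)" by (metis add.commute le_iff_add not_less_eq_eq)
      obtain w where w: "w \<in> V" "(f ^^ Suc (n v)) (g v) = g w" using n[OF less.prems] by blast
      have "(f ^^ m) (g v) = (f ^^ k) (g w)" unfolding k funpow_add o_apply w(2) ..
      then show ?thesis using less.IH[OF _ w(1), of k] k by simp
    qed
  qed
  moreover have "finite S" unfolding S_def using assms(1) by simp
  ultimately show ?thesis by blast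
qed

text \<open>As |t| > 2, a norm that increases once increases for ever, which a finite range
  excludes. So the norms decrease weakly; at a minimum three consecutive norms agree, and |t| |u_k|
  \<le> 2 |u_k| forces u_k = 0.\<close>

lemma recurrence_zero:
  fixes u :: "nat \<Rightarrow> complex"
  assumes fin: "finite (range u)" and rec: "\<And>m. u (Suc (Suc m)) = t * u (Suc m) - u m" and t: "norm t > 2"
  shows "u 0 = 0"
proof -
  have lower: "norm (u (Suc (Suc m))) \<ge> norm t * norm (u (Suc m)) - norm (u m)" for m
    unfolding rec norm_mult[symmetric] by (rule norm_triangle_ineq2)
  have fin': "finite (range (\<lambda>m. norm (u m)))" using finite_imageI[OF fin, of norm] by (simp add: image_image)
  have dec: "norm (u (Suc m)) \<le> norm (u m)" for m
  proof (rule ccontr)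
    assume a: "\<not> ?thesis"
    have "norm (u (m + k)) < norm (u (Suc (m + k)))" for k
    proof (induction k)
      case (Suc k)
      have "2 * norm (u (Suc (m + k))) \<le> norm t * norm (u (Suc (m + k)))" using t by (intro mult_right_mono) auto
      then show ?case using lower[of "m + k"] Suc by simp
    qed (use a in simp)
    then have "strict_mono (\<lambda>k. norm (u (m + k)))" unfolding strict_mono_Suc_iff by simp
    then have "infinite (range (\<lambda>k. norm (u (m + k))))"
      by (intro range_inj_infinite strict_mono_imp_inj_on)
    moreover have "range (\<lambda>k. norm (u (m + k))) \<subseteq> range (\<lambda>m. norm (u m))" by auto
    ultimately show False using fin' finite_subset by blast
  qed
  obtain k where k: "\<And>m. norm (u k) \<le> norm (u m)"
  proof -
    have "Min (range (\<lambda>m. norm (u m))) \<in> range (\<lambda>m. norm (u m))" by (rule Min_in[OF fin']) auto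
    then obtain k where "Min (range (\<lambda>m. norm (u m))) = norm (u k)" by auto
    moreover have "Min (range (\<lambda>m. norm (u m))) \<le> norm (u m)" for m by (rule Min_le[OF fin']) simp
    ultimately show thesis by (intro that[of k]) simp
  qed
  have eq: "norm (u (Suc k)) = norm (u k)" "norm (u (Suc (Suc k))) = norm (u k)"
    using k[of "Suc k"] k[of "Suc (Suc k)"] dec[of k] dec[of "Suc k"] by auto
  have "norm t * norm (u k) \<le> 2 * norm (u k)" using lower[of k] eq by simp
  then have "norm (u k) \<le> 0" using t mult_strict_right_mono[of 2 "norm t" "norm (u k)"] by linarith
  then have z: "u k = 0" "u (Suc k) = 0" using eq(1) by simp_all
  \<comment> \<open>The recurrence solved for its oldest term carries the two zeros back; with
    truncated subtraction the claim becomes stationary once index 0 is reached.\<close>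
  have "u (k - m) = 0 \<and> u (Suc (k - m)) = 0" for m
  proof (induction m)
    case (Suc m)
    show ?case
    proof (cases "m < k")
      case True
      then have "Suc (k - Suc m) = k - m" by simp
      then show ?thesis using rec[of "k - Suc m"] Suc by simp
    qed (use Suc in simp)
  qed (use z in simp)
  from this[of k] show ?thesis by simp
qed

text \<open>The characteristic polynomial has the double root -1, so u_m = (-1)^m (u_0 - m d) with d
  = u_1 + u_0; a finite range forces d = 0.\<close>

lemma recurrence_alternate:
  fixes u :: "nat \<Rightarrow> complex"
  assumes fin: "finite (range u)" and rec: "\<And>m. u (Suc (Suc m)) = - 2 * u (Suc m) - u m"
  shows "u 1 = - u 0"
proof (rule ccontr)
  let ?d = "u 1 + u 0"
  assume "u 1 \<noteq> - u 0"
  then have d: "norm ?d > 0" by (simp add: add_eq_0_iff2)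
  have step: "u (Suc m) = - u m + (- 1) ^ m * ?d" for m
  proof (induction m)
    case (Suc m)
    then show ?case by (simp add: rec algebra_simps)
  qed simp
  have e: "u m = (- 1) ^ m * (u 0 - of_nat m * ?d)" for m
  proof (induction m)
    case (Suc m)
    show ?case unfolding step[of m] by (subst Suc) (simp add: algebra_simps)
  qed simp
  have n: "norm (u m) = norm (u 0 - of_nat m * ?d)" for m
    using arg_cong[OF e[of m], of norm] by (simp only: norm_mult norm_power norm_minus_cancel norm_one power_one mult_1)
  have "finite (range (\<lambda>m. norm (u m)))" using finite_imageI[OF fin, of norm] by (simp add: image_image)
  then have B: "norm (u m) \<le> Max (range (\<lambda>m. norm (u m)))" for m by (rule Max_ge) simp
  obtain m :: nat where m: "real m * norm ?d > Max (range (\<lambda>m. norm (u m))) + norm (u 0)" using reals_Archimedean3[OF d] by blast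
  have "real m * norm ?d - norm (u 0) \<le> norm (u m)"
    unfolding n using norm_triangle_ineq2[of "of_nat m * ?d" "u 0"] by (simp add: norm_mult norm_minus_commute)
  then show False using m B[of m] by simp
qed

section \<open>Weighted coordinate sums along the orbits\<close>

context star_alg
begin

lemma cox_VX_sum:
  fixes p :: "nat \<Rightarrow> complex"
  shows "(\<Sum>k \<in> {1..r}. p k * of_int (cox w (VX k))) = (\<Sum>k \<in> {1..r}. p k * of_int (w (VX k)))
    - (\<Sum>k \<in> {1..r}. p k) * of_int (w VZ)
    + (\<Sum>j \<in> {1..s}. (\<Sum>k | k \<in> {1..r} \<and> R k j. p k) * of_int (w (VY j)))"
proof -
  have "(\<Sum>k \<in> {1..r}. p k * of_int (cox w (VX k))) = (\<Sum>k \<in> {1..r}. p k * of_int (w (VX k))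
      - p k * of_int (w VZ) + (\<Sum>j | j \<in> {1..s} \<and> R k j. p k * of_int (w (VY j))))"
    by (rule sum.cong[OF refl]) (simp add: cox_def Let_def algebra_simps sum_distrib_left)
  also have "\<dots> = (\<Sum>k \<in> {1..r}. p k * of_int (w (VX k))) - (\<Sum>k \<in> {1..r}. p k) * of_int (w VZ)
      + (\<Sum>k \<in> {1..r}. \<Sum>j | j \<in> {1..s} \<and> R k j. p k * of_int (w (VY j)))"
    by (simp add: sum.distrib sum_subtractf sum_distrib_right)
  also have "(\<Sum>k \<in> {1..r}. \<Sum>j | j \<in> {1..s} \<and> R k j. p k * of_int (w (VY j))) =
      (\<Sum>j \<in> {1..s}. \<Sum>k | k \<in> {1..r} \<and> R k j. p k * of_int (w (VY j)))"
    by (rule sum.swap_restrict) auto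
  finally show ?thesis by (simp add: sum_distrib_right)
qed

lemma cox_VX:
  "k \<in> {1..r} \<Longrightarrow> cox w (VX k) = w (VX k) - w VZ + (\<Sum>j | j \<in> {1..s} \<and> R k j. w (VY j))"
  by (simp add: cox_def Let_def)

lemma cox_VY:
  assumes "j \<in> {1..s}"
  shows "cox w (VY j) = w (VY j) + cox w VZ - (\<Sum>i | i \<in> {1..r} \<and> R i j. cox w (VX i))"
proof -
  have "(\<Sum>i | i \<in> {1..r} \<and> R i j. w (VX i) - w VZ + (\<Sum>j | j \<in> {1..s} \<and> R i j. w (VY j))) =
      (\<Sum>i | i \<in> {1..r} \<and> R i j. cox w (VX i))" for j
    by (rule sum.cong[OF refl]) (simp add: cox_def Let_def)
  then show ?thesis
    using assms unfolding cox_def[of w] Let_def by simp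
qed

lemma cox_VY_sum:
  fixes t :: "nat \<Rightarrow> complex"
  shows "(\<Sum>j \<in> {1..s}. t j * of_int (cox w (VY j))) = (\<Sum>j \<in> {1..s}. t j * of_int (w (VY j)))
    + (\<Sum>j \<in> {1..s}. t j) * of_int (cox w VZ)
    - (\<Sum>k \<in> {1..r}. (\<Sum>j | j \<in> {1..s} \<and> R k j. t j) * of_int (cox w (VX k)))"
proof -
  have "(\<Sum>j \<in> {1..s}. t j * of_int (cox w (VY j))) = (\<Sum>j \<in> {1..s}. t j * of_int (w (VY j))
      + t j * of_int (cox w VZ) - (\<Sum>k | k \<in> {1..r} \<and> R k j. t j * of_int (cox w (VX k))))"
    by (intro sum.cong[OF refl]) (simp add: cox_VY algebra_simps sum_distrib_left)
  also have "\<dots> = (\<Sum>j \<in> {1..s}. t j * of_int (w (VY j))) + (\<Sum>j \<in> {1..s}. t j) * of_int (cox w VZ)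
      - (\<Sum>j \<in> {1..s}. \<Sum>k | k \<in> {1..r} \<and> R k j. t j * of_int (cox w (VX k)))"
    by (simp add: sum.distrib sum_subtractf sum_distrib_right)
  also have "(\<Sum>j \<in> {1..s}. \<Sum>k | k \<in> {1..r} \<and> R k j. t j * of_int (cox w (VX k))) =
      (\<Sum>k \<in> {1..r}. \<Sum>j | j \<in> {1..s} \<and> R k j. t j * of_int (cox w (VX k)))"
    by (rule sum.swap_restrict[symmetric]) auto
  finally show ?thesis by (simp add: sum_distrib_right)
qed

lemma cox_VZ: "cox w VZ = w VZ - (\<Sum>j \<in> {1..s}. w (VY j)) + (\<Sum>k \<in> {1..r}. cox w (VX k))"
proof -
  have "(\<Sum>k \<in> {1..r}. w (VX k) - w VZ + (\<Sum>j | j \<in> {1..s} \<and> R k j. w (VY j))) = (\<Sum>k \<in> {1..r}. cox w (VX k))"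
    by (rule sum.cong[OF refl]) (simp add: cox_def Let_def)
  then show ?thesis by (simp add: cox_def[of w] Let_def)
qed

text \<open>\<open>cox\<close> sums over relations, while the edges of the graph are the
  non-relations. For weights with total 0 the two sums differ only in sign, which brings in the
  adjacency matrix.\<close>

lemma sum_not_R:
  fixes p :: "nat \<Rightarrow> complex"
  shows "(\<Sum>k | k \<in> {1..r} \<and> R k j. p k) = (\<Sum>k \<in> {1..r}. p k) - (\<Sum>k | k \<in> {1..r} \<and> \<not> R k j. p k)"
    "(\<Sum>k | k \<in> {1..s} \<and> R i k. p k) = (\<Sum>k \<in> {1..s}. p k) - (\<Sum>k | k \<in> {1..s} \<and> \<not> R i k. p k)"
proof -
  have *: "(\<Sum>k | k \<in> S \<and> Q k. p k) = sum p S - (\<Sum>k | k \<in> S \<and> \<not> Q k. p k)" if "finite S" for S Q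
    using sum.Int_Diff[OF that, of p "Collect Q"] by (simp add: Int_def set_diff_eq)
  show "(\<Sum>k | k \<in> {1..r} \<and> R k j. p k) = (\<Sum>k \<in> {1..r}. p k) - (\<Sum>k | k \<in> {1..r} \<and> \<not> R k j. p k)"
    "(\<Sum>k | k \<in> {1..s} \<and> R i k. p k) = (\<Sum>k \<in> {1..s}. p k) - (\<Sum>k | k \<in> {1..s} \<and> \<not> R i k. p k)"
    by (rule *, simp)+
qed

end

text \<open>The numerical consequences of 2-representation-finiteness from which the conditions on
  r, s and the degrees are derived.\<close>

locale cox_cyclic = star_alg A r s R co mk for A :: "('k::field, 'a) module" and r s R co mk +
  assumes rpos: "r \<ge> 1" and spos: "s \<ge> 1"
    and cycle: "v \<in> svert \<Longrightarrow> \<exists>n. \<exists>w \<in> svert. (cox ^^ Suc n) (sdim v) = sdim w"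
    and cox_nonneg: "v \<in> svert \<Longrightarrow> cox (sdim v) u \<ge> 0"
begin

lemma finite_svert [simp]: "finite svert"
  by (simp add: svert_def)

lemma sdim_apply:
  "v \<in> svert \<Longrightarrow> u \<in> svert \<Longrightarrow> sdim v u = (if spath v u \<noteq> None then 1 else 0)"
  by (simp add: sdim_def)

lemma finite_orbit_range:
  assumes "v \<in> svert"
  shows "finite (range (\<lambda>m. L ((cox ^^ m) (sdim v))))"
proof -
  obtain S where "finite S" "\<forall>v \<in> svert. \<forall>m. (cox ^^ m) (sdim v) \<in> S"
    using funpow_cycle_finite[OF finite_svert cycle] by blast
  then have "range (\<lambda>m. L ((cox ^^ m) (sdim v))) \<subseteq> L ` S" using assms by blast
  then show ?thesis using \<open>finite S\<close> finite_subset by blast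
qed

lemma functional_zero:
  fixes L :: "(star_vertex \<Rightarrow> int) \<Rightarrow> complex"
  assumes "v \<in> svert" and "\<And>w. L (cox (cox w)) = t * L (cox w) - L w" and "norm t > 2"
  shows "L (sdim v) = 0"
proof -
  have "(\<lambda>m. L ((cox ^^ m) (sdim v))) 0 = 0"
    by (rule recurrence_zero[OF finite_orbit_range[OF assms(1)] _ assms(3)]) (simp add: assms(2))
  then show ?thesis by simp
qed

lemma functional_alternate:
  fixes L :: "(star_vertex \<Rightarrow> int) \<Rightarrow> complex"
  assumes "v \<in> svert" and "\<And>w. L (cox (cox w)) = - 2 * L (cox w) - L w"
  shows "L (cox (sdim v)) = - L (sdim v)"
proof -
  have "(\<lambda>m. L ((cox ^^ m) (sdim v))) 1 = - (\<lambda>m. L ((cox ^^ m) (sdim v))) 0"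
    by (rule recurrence_alternate[OF finite_orbit_range[OF assms(1)]]) (simp add: assms(2))
  then show ?thesis by simp
qed

text \<open>With the weights \<open>p\<close> and \<open>t\<close> one step of \<open>cox\<close>
  reads a' = a - \<theta> c and c' = c + \<theta> a'; the entry at z drops out because both weights
  have total 0. Eliminating one functional gives a recurrence with factor 2 - \<theta>^2, whose
  absolute value exceeds 2. At the projectives of x_i and y_j the functionals take the values p_i
  and t_j.\<close>

theorem balanced_eigenvector_zero:
  fixes p t :: "nat \<Rightarrow> complex"
  assumes p0: "(\<Sum>i \<in> {1..r}. p i) = 0" and t0: "(\<Sum>j \<in> {1..s}. t j) = 0"
    and p: "\<And>i. i \<in> {1..r} \<Longrightarrow> (\<Sum>j | j \<in> {1..s} \<and> \<not> R i j. t j) = of_real \<theta> * p i"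
    and t: "\<And>j. j \<in> {1..s} \<Longrightarrow> (\<Sum>i | i \<in> {1..r} \<and> \<not> R i j. p i) = of_real \<theta> * t j"
    and th: "\<theta> > 2"
  shows "i \<in> {1..r} \<Longrightarrow> p i = 0" "j \<in> {1..s} \<Longrightarrow> t j = 0"
proof -
  let ?t = "2 - (of_real \<theta>)\<^sup>2 :: complex"
  define a where "a w = (\<Sum>k \<in> {1..r}. p k * of_int (w (VX k)))" for w
  define c where "c w = (\<Sum>j \<in> {1..s}. t j * of_int (w (VY j)))" for w
  have a: "a (cox w) = a w - of_real \<theta> * c w" for w
  proof -
    have "(\<Sum>j \<in> {1..s}. (\<Sum>k | k \<in> {1..r} \<and> R k j. p k) * of_int (w (VY j))) =
        (\<Sum>j \<in> {1..s}. - (of_real \<theta> * (t j * of_int (w (VY j)))))"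
    proof (rule sum.cong[OF refl])
      fix j assume j: "j \<in> {1..s}"
      show "(\<Sum>k | k \<in> {1..r} \<and> R k j. p k) * of_int (w (VY j)) = - (of_real \<theta> * (t j * of_int (w (VY j))))"
        unfolding sum_not_R p0 t[OF j] by simp
    qed
    then show ?thesis unfolding a_def c_def cox_VX_sum p0 by (simp add: sum_negf sum_distrib_left)
  qed
  have c: "c (cox w) = c w + of_real \<theta> * a (cox w)" for w
  proof -
    have "(\<Sum>k \<in> {1..r}. (\<Sum>j | j \<in> {1..s} \<and> R k j. t j) * of_int (cox w (VX k))) =
        (\<Sum>k \<in> {1..r}. - (of_real \<theta> * (p k * of_int (cox w (VX k)))))"
    proof (rule sum.cong[OF refl])
      fix k assume k: "k \<in> {1..r}"
      show "(\<Sum>j | j \<in> {1..s} \<and> R k j. t j) * of_int (cox w (VX k)) = - (of_real \<theta> * (p k * of_int (cox w (VX k))))"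
        unfolding sum_not_R t0 p[OF k] by simp
    qed
    then show ?thesis unfolding a_def c_def cox_VY_sum t0 by (simp add: sum_negf sum_distrib_left)
  qed
  have nt: "norm ?t > 2"
  proof -
    have "\<theta>\<^sup>2 > 4" using th power_strict_mono[of 2 \<theta> 2] by simp
    moreover have "norm (of_real (2 - \<theta>\<^sup>2) :: complex) = \<bar>2 - \<theta>\<^sup>2\<bar>" by (rule norm_of_real)
    ultimately show ?thesis by simp
  qed
  have ra: "a (cox (cox w)) = ?t * a (cox w) - a w" and rc: "c (cox (cox w)) = ?t * c (cox w) - c w" for w
    unfolding c a by (simp_all add: algebra_simps power2_eq_square)
  have za: "a (sdim v) = 0" and zc: "c (sdim v) = 0" if "v \<in> svert" for v
    by (rule functional_zero[of v a ?t, OF that ra nt], rule functional_zero[of v c ?t, OF that rc nt])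
  show t_z: "t j = 0" if j: "j \<in> {1..s}" for j
  proof -
    have "c (sdim (VY j)) = (\<Sum>k \<in> {1..s}. if k = j then t k else 0)"
      unfolding c_def by (rule sum.cong[OF refl]) (use j in \<open>simp add: sdim_apply spath_def\<close>)
    then show ?thesis using zc[of "VY j"] j by simp
  qed
  show "p i = 0" if i: "i \<in> {1..r}" for i
  proof -
    have "a (sdim (VX i)) = (\<Sum>k \<in> {1..r}. if k = i then p k else 0)"
      unfolding a_def by (rule sum.cong[OF refl]) (use i in \<open>simp add: sdim_apply spath_def\<close>)
    then show ?thesis using za[of "VX i"] i by simp
  qed
qed

end

text \<open>\<open>a\<close>, \<open>b\<close>, \<open>c\<close> stand for the sum over the x_k, the
  entry at z and the sum over the y_j. For r d = s e one step has the characteristic polynomial (X -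
  1)(X^2 - t X + 1). In the proof the defect of the recurrence comes out as (r d - s e) times
  \<open>a1\<close> or \<open>b1\<close>.\<close>

lemma coxeter_recurrence:
  fixes r s d e :: complex
  assumes "r * d = s * e"
    and "a1 = a0 - r * b0 + (r - e) * c0" "b1 = b0 - c0 + a1" "c1 = c0 + s * b1 - (s - d) * a1"
    and "a2 = a1 - r * b1 + (r - e) * c1" "b2 = b1 - c1 + a2" "c2 = c1 + s * b2 - (s - d) * a2"
    and "a3 = a2 - r * b2 + (r - e) * c2" "b3 = b2 - c2 + a3"
    and "t = 2 - (r + s + d * e - r * d)"
  shows "a3 - a2 = t * (a2 - a1) - (a1 - a0)" "b3 - b2 = t * (b2 - b1) - (b1 - b0)"
proof -
  have c0: "c0 = c1 - s * b1 + (s - d) * a1" and b0: "b0 = b1 - a1 + c0" using assms(4,3) by simp_all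
  have da: "a1 - a0 = (r - e) * c0 - r * b0" "a2 - a1 = (r - e) * c1 - r * b1" "a3 - a2 = (r - e) * c2 - r * b2"
    using assms(2,5,8) by (simp_all add: algebra_simps)
  have db: "b1 - b0 = a1 - c0" "b2 - b1 = a2 - c1" "b3 - b2 = a3 - c2"
    using assms(3,6,9) by (simp_all add: algebra_simps)
  have a3: "a3 = a2 + ((r - e) * c2 - r * b2)" using da(3) by (simp add: algebra_simps)
  have a2: "a2 = a1 + ((r - e) * c1 - r * b1)" using da(2) by (simp add: algebra_simps)
  have c2: "c2 = c1 + s * b2 - (s - d) * a2" and b2: "b2 = a2 - c1 + b1" using assms(6,7) by simp_all
  have "(a3 - a2) - (t * (a2 - a1) - (a1 - a0)) = (r * d - s * e) * a1"
    unfolding da c2 b2 b0 unfolding c0 unfolding a2 assms(10) by (simp add: algebra_simps)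
  then show "a3 - a2 = t * (a2 - a1) - (a1 - a0)" using assms(1) by simp
  have "(b3 - b2) - (t * (b2 - b1) - (b1 - b0)) = (r * d - s * e) * b1"
    unfolding db unfolding a3 c2 b2 unfolding c0 unfolding a2 assms(10) by (simp add: algebra_simps)
  then show "b3 - b2 = t * (b2 - b1) - (b1 - b0)" using assms(1) by simp
qed

lemma double_count_degrees:
  fixes r s :: nat
  assumes D: "\<And>i. i \<in> {1..r} \<Longrightarrow> card {j \<in> {1..s}. \<not> R i j} = d"
    and E: "\<And>j. j \<in> {1..s} \<Longrightarrow> card {i \<in> {1..r}. \<not> R i j} = e"
  shows "r * d = s * e"
proof -
  have "r * d = (\<Sum>i \<in> {1..r}. \<Sum>j | j \<in> {1..s} \<and> \<not> R i j. 1)" using D by simp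
  also have "\<dots> = (\<Sum>j \<in> {1..s}. \<Sum>i | i \<in> {1..r} \<and> \<not> R i j. 1)" by (rule sum.swap_restrict) auto
  also have "\<dots> = s * e" using E by simp
  finally show ?thesis .
qed

text \<open>For d \<ge> 1 the balance gives e \<ge> 1, so \<open>d\<close> and \<open>e\<close> are
  both at most d e \<le> 4, and each of the sixteen pairs leaves a linear problem in
  \<open>r\<close> and \<open>s\<close>. For d = 0 also e = 0, and r + s \<le> 3.\<close>

lemma small_semiregular_cases:
  fixes r s d e :: int
  assumes "r \<ge> 1" "s \<ge> 1" "0 \<le> d" "d \<le> s" "0 \<le> e" "e < r" and bal: "r * d = s * e"
    and N: "r + s + d * e - r * d \<le> 3" and small: "d * e \<le> 4"
  shows "s = 1 \<and> r = 1 \<or> d = 0 \<and> e = 0 \<and> (r = 1 \<and> s = 2 \<or> r = 2 \<and> s = 1) \<or> r = 2 \<and> s = 2 \<and> d = 1 \<and> e = 1"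
proof (cases "d = 0")
  case True
  then have "e = 0" using bal assms(2) by simp
  then show ?thesis using True N assms by auto
next
  case False
  then have d: "d \<ge> 1" using assms by simp
  have "e \<noteq> 0" using False bal assms(1) by auto
  then have e: "e \<ge> 1" using assms by simp
  have "d \<le> d * e" "e \<le> d * e" using d e by simp_all
  then have "d = 1 \<or> d = 2 \<or> d = 3 \<or> d = 4" "e = 1 \<or> e = 2 \<or> e = 3 \<or> e = 4" using d e small by linarith+
  then show ?thesis using assms(1-4,6-9) by (elim disjE) (hypsubst, presburger)+
qed

section \<open>Coordinate sums in the semi-regular case\<close>

context cox_cyclic
begin

definition xsum :: "(star_vertex \<Rightarrow> int) \<Rightarrow> complex" where
  "xsum w = (\<Sum>k \<in> {1..r}. of_int (w (VX k)))"

definition ysum :: "(star_vertex \<Rightarrow> int) \<Rightarrow> complex" where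
  "ysum w = (\<Sum>j \<in> {1..s}. of_int (w (VY j)))"

definition zval :: "(star_vertex \<Rightarrow> int) \<Rightarrow> complex" where
  "zval w = of_int (w VZ)"

lemma zval_cox: "zval (cox w) = zval w - ysum w + xsum (cox w)"
  using arg_cong[OF cox_VZ[of w], of complex_of_int] by (simp add: zval_def xsum_def ysum_def)

context
  fixes d e :: nat
  assumes D: "\<And>i. i \<in> {1..r} \<Longrightarrow> card {j \<in> {1..s}. \<not> R i j} = d"
    and E: "\<And>j. j \<in> {1..s} \<Longrightarrow> card {i \<in> {1..r}. \<not> R i j} = e"
begin

lemma degree_balance: "r * d = s * e"
  by (rule double_count_degrees[of r s R d e]) (rule D E, assumption)+

lemma degree_le: "d \<le> s" "e \<le> r"
proof -
  have *: "card {k \<in> {1..n}. P k} \<le> n" for n and P :: "nat \<Rightarrow> bool"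
    using card_mono[of "{1..n}" "{k \<in> {1..n}. P k}"] by fastforce
  show "d \<le> s" "e \<le> r" using D[of 1] E[of 1] rpos spos *[of s] *[of r] by fastforce+
qed

lemma card_R: "i \<in> {1..r} \<Longrightarrow> int (card {j \<in> {1..s}. R i j}) = int s - int d"
  "j \<in> {1..s} \<Longrightarrow> int (card {i \<in> {1..r}. R i j}) = int r - int e"
proof -
  have *: "int (card {k \<in> S. P k}) = int (card S) - int (card {k \<in> S. \<not> P k})" if "finite S" for S :: "nat set" and P
  proof -
    have diff_eq: "{k \<in> S. \<not> P k} = S - {k \<in> S. P k}" by auto
    show ?thesis using card_Diff_subset[of "{k \<in> S. P k}" S] card_mono[OF that, of "{k \<in> S. P k}"] that
      by (simp add: diff_eq)
  qed
  show "i \<in> {1..r} \<Longrightarrow> int (card {j \<in> {1..s}. R i j}) = int s - int d" using *[of "{1..s}" "R i"] D by simp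
  show "j \<in> {1..s} \<Longrightarrow> int (card {i \<in> {1..r}. R i j}) = int r - int e" using *[of "{1..r}" "\<lambda>i. R i j"] E by simp
qed

lemma xsum_cox: "xsum (cox w) = xsum w - of_nat r * zval w + (of_nat r - of_nat e) * ysum w"
proof -
  have "(\<Sum>j \<in> {1..s}. (\<Sum>k | k \<in> {1..r} \<and> R k j. 1) * complex_of_int (w (VY j))) =
      (\<Sum>j \<in> {1..s}. (of_nat r - of_nat e) * complex_of_int (w (VY j)))"
  proof (rule sum.cong[OF refl])
    fix j assume j: "j \<in> {1..s}"
    show "(\<Sum>k | k \<in> {1..r} \<and> R k j. 1) * complex_of_int (w (VY j)) = (of_nat r - of_nat e) * complex_of_int (w (VY j))"
      using arg_cong[OF card_R(2)[OF j], of complex_of_int] by simp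
  qed
  then show ?thesis using cox_VX_sum[of "\<lambda>_. 1" w] by (simp add: xsum_def ysum_def zval_def sum_distrib_left)
qed

lemma ysum_cox: "ysum (cox w) = ysum w + of_nat s * zval (cox w) - (of_nat s - of_nat d) * xsum (cox w)"
proof -
  have "(\<Sum>k \<in> {1..r}. (\<Sum>j | j \<in> {1..s} \<and> R k j. 1) * complex_of_int (cox w (VX k))) =
      (\<Sum>k \<in> {1..r}. (of_nat s - of_nat d) * complex_of_int (cox w (VX k)))"
  proof (rule sum.cong[OF refl])
    fix k assume k: "k \<in> {1..r}"
    show "(\<Sum>j | j \<in> {1..s} \<and> R k j. 1) * complex_of_int (cox w (VX k)) = (of_nat s - of_nat d) * complex_of_int (cox w (VX k))"
      using arg_cong[OF card_R(1)[OF k], of complex_of_int] by simp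
  qed
  then show ?thesis using cox_VY_sum[of "\<lambda>_. 1" w] by (simp add: xsum_def ysum_def zval_def sum_distrib_left)
qed

private abbreviation "en \<equiv> int r + int s + int d * int e - int r * int d"

lemma sum_recurrence:
  fixes w
  defines "t \<equiv> complex_of_int (2 - en)"
  shows "xsum (cox (cox (cox w))) - xsum (cox (cox w)) = t * (xsum (cox (cox w)) - xsum (cox w)) - (xsum (cox w) - xsum w)"
    "zval (cox (cox (cox w))) - zval (cox (cox w)) = t * (zval (cox (cox w)) - zval (cox w)) - (zval (cox w) - zval w)"
proof -
  have b: "of_nat r * of_nat d = of_nat s * (of_nat e :: complex)"
    using arg_cong[OF degree_balance, of "of_nat :: nat \<Rightarrow> complex"] by simp
  note c = coxeter_recurrence[OF b xsum_cox[of w] zval_cox[of w] ysum_cox[of w] xsum_cox[of "cox w"] zval_cox[of "cox w"]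
    ysum_cox[of "cox w"] xsum_cox[of "cox (cox w)"] zval_cox[of "cox (cox w)"] refl]
  have t: "t = 2 - (of_nat r + of_nat s + of_nat d * of_nat e - of_nat r * of_nat d)" unfolding t_def by simp
  show "xsum (cox (cox (cox w))) - xsum (cox (cox w)) = t * (xsum (cox (cox w)) - xsum (cox w)) - (xsum (cox w) - xsum w)"
    unfolding t by (rule c)
  show "zval (cox (cox (cox w))) - zval (cox (cox w)) = t * (zval (cox (cox w)) - zval (cox w)) - (zval (cox w) - zval w)"
    unfolding t by (rule c)
qed

lemma sdim_Y: "j \<in> {1..s} \<Longrightarrow> xsum (sdim (VY j)) = 0" "j \<in> {1..s} \<Longrightarrow> zval (sdim (VY j)) = 0"
  "j \<in> {1..s} \<Longrightarrow> ysum (sdim (VY j)) = 1"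
proof -
  assume j: "j \<in> {1..s}"
  show "xsum (sdim (VY j)) = 0" "zval (sdim (VY j)) = 0"
    by (simp_all add: xsum_def zval_def sdim_def spath_def)
  have "ysum (sdim (VY j)) = (\<Sum>k \<in> {1..s}. if k = j then 1 else 0)"
    unfolding ysum_def by (rule sum.cong[OF refl]) (use j in \<open>simp add: sdim_apply spath_def\<close>)
  then show "ysum (sdim (VY j)) = 1" using j by simp
qed

lemma sdim_Z: "xsum (sdim VZ) = 0" "zval (sdim VZ) = 1" "ysum (sdim VZ) = of_nat s"
proof -
  show "xsum (sdim VZ) = 0" "zval (sdim VZ) = 1"
    by (simp_all add: xsum_def zval_def sdim_def spath_def)
  have "ysum (sdim VZ) = (\<Sum>k \<in> {1..s}. 1)"
    unfolding ysum_def by (rule sum.cong[OF refl]) (simp add: sdim_apply spath_def)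
  then show "ysum (sdim VZ) = of_nat s" by simp
qed

text \<open>If |2 - en| > 2, one step changes neither \<open>xsum\<close> nor \<open>zval\<close> at
  the projective of y_1. But \<open>zval\<close> changes by the new \<open>xsum\<close> minus the
  old \<open>ysum\<close>, and there this is -1.\<close>

theorem coxeter_trace_bounds: "0 \<le> en" "en \<le> 4"
proof -
  have "\<bar>2 - en\<bar> \<le> 2"
  proof (rule ccontr)
    assume a: "\<not> ?thesis"
    have nt: "norm (complex_of_int (2 - en)) > 2" unfolding norm_of_int using a by linarith
    have Y: "VY 1 \<in> svert" using spos by simp
    have x: "xsum (cox (sdim (VY 1))) - xsum (sdim (VY 1)) = 0"
      by (rule functional_zero[OF Y _ nt, of "\<lambda>w. xsum (cox w) - xsum w"]) (rule sum_recurrence(1))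
    have z: "zval (cox (sdim (VY 1))) - zval (sdim (VY 1)) = 0"
      by (rule functional_zero[OF Y _ nt, of "\<lambda>w. zval (cox w) - zval w"]) (rule sum_recurrence(2))
    show False using x z zval_cox[of "sdim (VY 1)"] sdim_Y[of 1] spos by simp
  qed
  then show "0 \<le> en" "en \<le> 4" by simp_all
qed

text \<open>For en = 4 the recurrence has the double root -1, so \<open>xsum\<close> and
  \<open>zval\<close> return to their values after two steps. The resulting equations at the
  projectives of y_1 and z determine \<open>e\<close>, \<open>r\<close> and
  \<open>d\<close>.\<close>

lemma coxeter_trace_eq_4:
  assumes N: "en = 4"
  shows "r = 4 \<and> s = 4"
proof -
  have t: "complex_of_int (2 - en) = - 2" unfolding N by simp
  have per: "xsum (cox (cox (sdim v))) = xsum (sdim v)" "zval (cox (cox (sdim v))) = zval (sdim v)" if v: "v \<in> svert" for v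
    using functional_alternate[OF v, of "\<lambda>w. xsum (cox w) - xsum w"]
      functional_alternate[OF v, of "\<lambda>w. zval (cox w) - zval w"] sum_recurrence[unfolded t] by simp_all
  have Y: "VY 1 \<in> svert" using spos by simp
  let ?r = "of_nat r :: complex" and ?s = "of_nat s :: complex" and ?d = "of_nat d :: complex" and ?e = "of_nat e :: complex"
  have x1: "xsum (cox (sdim (VY 1))) = ?r - ?e" using xsum_cox[of "sdim (VY 1)"] sdim_Y[of 1] spos by simp
  have z1: "zval (cox (sdim (VY 1))) = ?r - ?e - 1" using zval_cox[of "sdim (VY 1)"] sdim_Y[of 1] spos x1 by simp
  have y1: "ysum (cox (sdim (VY 1))) = 1 + ?s * (?r - ?e - 1) - (?s - ?d) * (?r - ?e)"
    using ysum_cox[of "sdim (VY 1)"] sdim_Y[of 1] spos x1 z1 by simp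
  have "zval (cox (sdim (VY 1))) = ysum (cox (sdim (VY 1)))"
    using zval_cox[of "cox (sdim (VY 1))"] per[OF Y] sdim_Y[of 1] spos by simp
  then have "complex_of_int (int r - int e - 1) =
      of_int (1 + int s * (int r - int e - 1) - (int s - int d) * (int r - int e))"
    unfolding y1 z1 by simp
  then have i1: "int r - int e - 1 = 1 + int s * (int r - int e - 1) - (int s - int d) * (int r - int e)"
    unfolding of_int_eq_iff .
  have "complex_of_int 0 = of_int (int r - int e - int r * (int r - int e - 1)
      + (int r - int e) * (1 + int s * (int r - int e - 1) - (int s - int d) * (int r - int e)))"
    using xsum_cox[of "cox (sdim (VY 1))"] per(1)[OF Y] sdim_Y[of 1] spos x1 z1 y1 by simp
  then have i2: "0 = int r - int e - int r * (int r - int e - 1) + (int r - int e) * (int r - int e - 1)"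
    unfolding of_int_eq_iff i1[symmetric] .
  have e2: "int e = 2" using i1 N by (simp add: algebra_simps)
  have r4: "int r = 4" using i2 unfolding e2 by (simp add: algebra_simps)
  have "int s = 2 * int d" using arg_cong[OF degree_balance, of int] r4 e2 by simp
  then have nat: "r = 4" "e = 2" "s = 2 * d" using r4 e2 by linarith+
  then have c: "?r = 4" "?e = 2" "?s = 2 * ?d" by simp_all
  \<comment> \<open>The orbit of the projective at y_1 leaves \<open>d\<close> free, with s = 2 d;
    the orbit of the one at z settles it.\<close>
  have X: "xsum (cox (sdim VZ)) = 4 * ?d - 4"
    using xsum_cox[of "sdim VZ"] sdim_Z c by (simp add: algebra_simps)
  have Z: "zval (cox (sdim VZ)) = 2 * ?d - 3"
    using zval_cox[of "sdim VZ"] sdim_Z X c(3) by (simp add: algebra_simps)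
  have Y': "ysum (cox (sdim VZ)) = 0"
    using ysum_cox[of "sdim VZ"] sdim_Z X Z c(3) by (simp add: algebra_simps)
  have "0 = 4 * ?d - 4 - 4 * (2 * ?d - 3)"
    using xsum_cox[of "cox (sdim VZ)"] per(1)[of VZ] sdim_Z X Z Y' c by simp
  then have "?d = 2" by (simp add: algebra_simps)
  then have "of_nat d = (of_nat 2 :: complex)" by simp
  then have "d = 2" unfolding of_nat_eq_iff .
  then show ?thesis using nat by simp
qed

text \<open>Nonnegativity of these entries yields e < r and excludes r = 1, s = 2.\<close>

lemma cox_sdim_Y:
  assumes j: "j \<in> {1..s}"
  shows "cox (sdim (VY j)) VZ = int r - int e - 1"
    "k \<in> {1..s} \<Longrightarrow> k \<noteq> j \<Longrightarrow>
      cox (sdim (VY j)) (VY k) = int r - int e - 1 - int (card {i \<in> {1..r}. R i j \<and> R i k})"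
proof -
  have y: "sdim (VY j) (VY k) = (if k = j then 1 else 0)" for k
    using j by (auto simp: sdim_def spath_def)
  have o: "sdim (VY j) (VX k) = 0" "sdim (VY j) VZ = 0" for k by (simp_all add: sdim_def spath_def)
  have x: "cox (sdim (VY j)) (VX k) = (if R k j then 1 else 0)" if "k \<in> {1..r}" for k
  proof -
    have "(\<Sum>l | l \<in> {1..s} \<and> R k l. sdim (VY j) (VY l)) = (if R k j then 1 else 0)"
      unfolding y using j by (simp add: sum.delta)
    then show ?thesis unfolding cox_VX[OF that] o by simp
  qed
  have c: "(\<Sum>k \<in> S. if R k j then 1 else 0) = int (card {k \<in> S. R k j})" if "finite S" for S
    using that by (simp add: sum.If_cases Int_def)
  have "(\<Sum>k \<in> {1..r}. cox (sdim (VY j)) (VX k)) = (\<Sum>k \<in> {1..r}. if R k j then 1 else 0)"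
    by (rule sum.cong[OF refl x])
  also have "\<dots> = int r - int e" unfolding c[OF finite_atLeastAtMost] by (rule card_R(2)[OF j])
  finally have X: "(\<Sum>k \<in> {1..r}. cox (sdim (VY j)) (VX k)) = int r - int e" .
  have "(\<Sum>l \<in> {1..s}. sdim (VY j) (VY l)) = 1" unfolding y using j by simp
  then show z: "cox (sdim (VY j)) VZ = int r - int e - 1" unfolding cox_VZ X o by simp
  show "cox (sdim (VY j)) (VY k) = int r - int e - 1 - int (card {i \<in> {1..r}. R i j \<and> R i k})"
    if k: "k \<in> {1..s}" "k \<noteq> j"
  proof -
    have "(\<Sum>i | i \<in> {1..r} \<and> R i k. cox (sdim (VY j)) (VX i)) = (\<Sum>i \<in> {i \<in> {1..r}. R i k}. if R i j then 1 else 0)"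
      by (rule sum.cong[OF refl x]) simp
    also have "\<dots> = int (card {i \<in> {i \<in> {1..r}. R i k}. R i j})" by (rule c) simp
    also have "{i \<in> {i \<in> {1..r}. R i k}. R i j} = {i \<in> {1..r}. R i j \<and> R i k}" by blast
    finally show ?thesis unfolding cox_VY[OF k(1)] z y using k(2) by simp
  qed
qed

lemma R_all:
  assumes "e = 0" "i \<in> {1..r}" "j \<in> {1..s}"
  shows "R i j"
proof -
  have "{i \<in> {1..r}. \<not> R i j} = {}"
    using E[OF assms(3)] assms(1) card_0_eq[of "{i \<in> {1..r}. \<not> R i j}"] by simp
  then show ?thesis using assms(2) by blast
qed

theorem degree_product_gt_4: "d * e > 4 \<longleftrightarrow> (r, s) \<noteq> (1, 1) \<and> (r, s) \<noteq> (4, 4)"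
proof
  assume big: "d * e > 4"
  show "(r, s) \<noteq> (1, 1) \<and> (r, s) \<noteq> (4, 4)"
  proof (intro conjI notI)
    assume "(r, s) = (1, 1)"
    then have "d * e \<le> 1 * 1" using degree_le mult_le_mono[of d 1 e 1] by simp
    then show False using big by simp
  next
    assume rs: "(r, s) = (4, 4)"
    then have de: "d = e" using degree_balance by simp
    \<comment> \<open>With r = s = 4 and d = e the upper bound reads (e - 2)^2 \<le> 0, so d e =
      4.\<close>
    have "int 4 + int 4 + int e * int e - int 4 * int e \<le> 4" using coxeter_trace_bounds(2) rs de by simp
    then have "(int e - 2)\<^sup>2 \<le> 0" by (simp add: power2_eq_square algebra_simps)
    then have "int e - 2 = 0" by simp
    then have "e = 2" by linarith
    then show False using big de by simp
  qed
next
  assume ne: "(r, s) \<noteq> (1, 1) \<and> (r, s) \<noteq> (4, 4)"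
  show "d * e > 4"
  proof (rule ccontr)
    assume small: "\<not> ?thesis"
    have "en \<noteq> 4"
    proof
      assume "en = 4"
      from coxeter_trace_eq_4[OF this] show False using ne by simp
    qed
    then have N: "en \<le> 3" using coxeter_trace_bounds(2) by simp
    have "int r - int e - 1 \<ge> 0" using cox_sdim_Y(1)[of 1] cox_nonneg[of "VY 1" VZ] spos by simp
    then have er: "int e < int r" by simp
    have bal: "int r * int d = int s * int e" using arg_cong[OF degree_balance, of int] by simp
    have sm: "int d * int e \<le> 4" 
    proof -
      have "int (d * e) \<le> int 4" unfolding of_nat_le_iff using small by simp
      then show ?thesis by simp
    qed
    have "int s = 1 \<and> int r = 1 \<or> int d = 0 \<and> int e = 0 \<and> (int r = 1 \<and> int s = 2 \<or> int r = 2 \<and> int s = 1) \<or>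
        int r = 2 \<and> int s = 2 \<and> int d = 1 \<and> int e = 1"
      by (rule small_semiregular_cases[OF _ _ _ _ _ er bal N sm]) (use rpos spos degree_le in simp_all)
    then have "r = 1 \<and> s = 2 \<and> e = 0 \<or> r = 2 \<and> s = 1 \<and> d = 0 \<or> r = 2 \<and> s = 2 \<and> d = 1 \<and> e = 1"
      using ne by (elim disjE conjE) simp_all
    then consider (1) "r = 1" "s = 2" "e = 0" | (2) "r = 2" "s = 1" "d = 0" | (3) "r = 2" "s = 2" "d = 1" "e = 1"
      by blast
    \<comment> \<open>In each case \<open>cox\<close> of a projective has an entry -1: for (1) at
      y_2 starting from y_1, for (2) at x_2 starting from x_1, for (3) at z starting from z.\<close>
    then show False
    proof cases
      case 1
      have j: "1 \<in> {1..s}" "2 \<in> {1..s}" using 1 by auto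
      have i: "1 \<in> {1..r}" using rpos by simp
      have "{i \<in> {1..r}. R i 1 \<and> R i 2} = {1}"
      proof -
        have "{1..r} = {1}" unfolding 1(1) by simp
        then show ?thesis using R_all[OF 1(3) i j(1)] R_all[OF 1(3) i j(2)] by blast
      qed
      then have "cox (sdim (VY 1)) (VY 2) = int r - int e - 1 - 1"
        using cox_sdim_Y(2)[OF j] by simp
      moreover have "int r = 1" "int e = 0" using 1 by simp_all
      moreover have "cox (sdim (VY 1)) (VY 2) \<ge> 0" by (rule cox_nonneg) (use j in simp)
      ultimately show False by linarith
    next
      case 2
      have b: "1 \<in> {1..r}" "2 \<in> {1..r}" "1 \<in> {1..s}" using 2 by simp_all
      have "e = 0" using degree_balance 2 by simp
      then have R1: "R 1 j" if "j \<in> {1..s}" for j using R_all b(1) that by blast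
      have "(\<Sum>j | j \<in> {1..s} \<and> R 2 j. sdim (VX 1) (VY j)) = 0"
        by (rule sum.neutral) (use R1 in \<open>simp add: sdim_def spath_def\<close>)
      moreover have "sdim (VX 1) (VX 2) = 0" "sdim (VX 1) VZ = 1" using b by (simp_all add: sdim_def spath_def)
      ultimately have "cox (sdim (VX 1)) (VX 2) = -1" unfolding cox_VX[OF b(2)] by simp
      moreover have "cox (sdim (VX 1)) (VX 2) \<ge> 0" by (rule cox_nonneg) (use b in simp)
      ultimately show False by simp
    next
      case 3
      have w: "sdim VZ (VX k) = 0" "sdim VZ VZ = 1" "sdim VZ (VY k) = (if k \<in> {1..s} then 1 else 0)" for k
        by (auto simp: sdim_def spath_def)
      have x: "cox (sdim VZ) (VX k) = int s - int d - 1" if "k \<in> {1..r}" for k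
      proof -
        have "(\<Sum>j | j \<in> {1..s} \<and> R k j. sdim VZ (VY j)) = (\<Sum>j | j \<in> {1..s} \<and> R k j. 1)"
          by (rule sum.cong[OF refl]) (simp add: w)
        then show ?thesis unfolding cox_VX[OF that] using card_R(1)[OF that] by (simp add: w)
      qed
      have "(\<Sum>k \<in> {1..r}. cox (sdim VZ) (VX k)) = (\<Sum>k \<in> {1..r}. int s - int d - 1)"
        by (rule sum.cong[OF refl x])
      moreover have "(\<Sum>j \<in> {1..s}. sdim VZ (VY j)) = (\<Sum>j \<in> {1..s}. 1)"
        by (rule sum.cong[OF refl]) (simp add: w)
      ultimately have "cox (sdim VZ) VZ = 1 - int s + int r * (int s - int d - 1)"
        unfolding cox_VZ by (simp add: w)
      moreover have "int r * (int s - int d - 1) = 0" "int s = 2" using 3 by simp_all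
      moreover have "cox (sdim VZ) VZ \<ge> 0" by (rule cox_nonneg) simp
      ultimately show False by linarith
    qed
  qed
qed

end

end

section \<open>Spectra of graphs\<close>

text \<open>The list repeats roots according to multiplicity, so its two largest entries give a
  quadratic divisor also when they coincide. Multiplicity of eigenvalues is used in this form
  below.\<close>

lemma sorted_roots_two:
  fixes p :: "real poly"
  defines "L \<equiv> rev (sorted_list_of_multiset (proots p))"
  assumes p: "p \<noteq> 0" and len: "length L \<ge> 2"
  shows "[:- (L ! 0), 1:] * [:- (L ! 1), 1:] dvd p" "L ! 1 \<le> L ! 0"
proof -
  have m: "mset L = proots p" unfolding L_def by simp
  obtain x y l where L: "L = x # y # l" using len by (cases L rule: remdups_adj.cases) auto
  have sub: "add_mset x {#y#} \<subseteq># proots p" unfolding m[symmetric] L by simp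
  show "[:- (L ! 0), 1:] * [:- (L ! 1), 1:] dvd p"
  proof (cases "x = y")
    case True
    have "count (proots p) x \<ge> 2" using mset_subset_eq_count[OF sub, of x] True by simp
    then have "[:- x, 1:] ^ 2 dvd p" using p by (simp add: order_divides)
    then show ?thesis using True by (simp add: L power2_eq_square)
  next
    case False
    have "count (proots p) x \<ge> 1" "count (proots p) y \<ge> 1"
      using mset_subset_eq_count[OF sub, of x] mset_subset_eq_count[OF sub, of y] False by simp_all
    then have "poly p x = 0" "poly p y = 0" using p by (auto simp: order_root)
    then obtain q where q: "p = [:- x, 1:] * q" unfolding poly_eq_0_iff_dvd by blast
    have "poly q y = 0" using \<open>poly p y = 0\<close> False unfolding q by simp
    then have "[:- y, 1:] dvd q" by (simp add: poly_eq_0_iff_dvd)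
    then have "[:- x, 1:] * [:- y, 1:] dvd [:- x, 1:] * q" by (rule mult_dvd_mono[OF dvd_refl])
    moreover have "L ! 0 = x" "L ! 1 = y" unfolding L by simp_all
    ultimately show ?thesis unfolding q by (simp only:)
  qed
  have "sorted (rev L)" unfolding L_def by simp
  then have "sorted_wrt (\<lambda>a b. b \<le> a) L" by (simp add: sorted_wrt_rev)
  then show "L ! 1 \<le> L ! 0" unfolding L by simp
qed

lemma sorted_roots_head:
  fixes p :: "real poly"
  defines "L \<equiv> rev (sorted_list_of_multiset (proots p))"
  assumes p: "p \<noteq> 0"
  shows "L \<noteq> [] \<and> L ! 0 > c \<longleftrightarrow> (\<exists>x > c. poly p x = 0)"
proof -
  have "set L = {x. poly p x = 0}" using p unfolding L_def by simp
  then have root: "poly p x = 0 \<longleftrightarrow> x \<in> set L" for x by simp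
  have sorted: "sorted_wrt (\<lambda>a b. b \<le> a) L" unfolding L_def by (simp add: sorted_wrt_rev)
  show ?thesis
  proof (cases L)
    case Nil
    then show ?thesis unfolding root by simp
  next
    case (Cons y l)
    have le: "x \<le> y" if "x \<in> set L" for x using sorted that unfolding Cons by auto
    have "y \<in> set L" unfolding Cons by simp
    then have "c < y \<longleftrightarrow> (\<exists>x > c. x \<in> set L)" using le order.strict_trans2 by blast
    moreover have "L \<noteq> []" "L ! 0 = y" unfolding Cons by simp_all
    ultimately show ?thesis unfolding root by simp
  qed
qed

text \<open>The divisor counts algebraic multiplicity. A Schur decomposition with \<open>a\<close>
  and \<open>b\<close> in front on the diagonal gives a 2-dimensional invariant subspace, also for a
  = b: \<open>v\<close> is an eigenvector, and \<open>w\<close> is one modulo \<open>v\<close>. They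
  are the first two columns of the transforming matrix \<open>P\<close>.\<close>

lemma two_eigenvalues_schur:
  fixes A :: "complex mat"
  assumes A: "A \<in> carrier_mat n n" and dvd: "[:- a, 1:] * [:- b, 1:] dvd char_poly A"
  shows "\<exists>v w c. v \<in> carrier_vec n \<and> w \<in> carrier_vec n \<and> A *\<^sub>v v = a \<cdot>\<^sub>v v \<and> A *\<^sub>v w = c \<cdot>\<^sub>v v + b \<cdot>\<^sub>v w \<and>
    (\<forall>x y. x \<cdot>\<^sub>v v + y \<cdot>\<^sub>v w = 0\<^sub>v n \<longrightarrow> x = 0 \<and> y = 0)"
proof -
  obtain q where q: "char_poly A = [:- a, 1:] * [:- b, 1:] * q" using dvd by blast
  obtain as where as: "Polynomial.smult (lead_coeff q) (\<Prod>x \<leftarrow> as. [:- x, 1:]) = q"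
    using fundamental_theorem_algebra_factorized[of q] by blast
  have deg: "degree (char_poly A) = n" "coeff (char_poly A) n = 1" using degree_monic_char_poly[OF A] by simp_all
  then have "lead_coeff (char_poly A) = 1" by simp
  then have "lead_coeff q = 1" unfolding q lead_coeff_mult by simp
  then have as': "(\<Prod>x \<leftarrow> as. [:- x, 1:]) = q" using as by simp
  have es: "char_poly A = (\<Prod>x \<leftarrow> a # b # as. [:- x, 1:])"
    unfolding list.map prod_list.Cons as' q by (rule mult.assoc)
  obtain B P Q where S: "schur_decomposition A (a # b # as) = (B, P, Q)" by (metis prod_cases3)
  have w: "similar_mat_wit A B P Q" "upper_triangular B" "diag_mat B = a # b # as"
    using schur_decomposition[OF A es S] by simp_all
  have c: "P * Q = 1\<^sub>m n" "Q * P = 1\<^sub>m n" "A = P * B * Q"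
    "B \<in> carrier_mat n n" "P \<in> carrier_mat n n" "Q \<in> carrier_mat n n"
    using similar_mat_witD2[OF A w(1)] by simp_all
  have len: "n = Suc (Suc (length as))" using arg_cong[OF w(3), of length] c(4) by (simp add: diag_mat_def)
  have B: "B $$ (0, 0) = a" "B $$ (1, 1) = b" "\<And>i. i < n \<Longrightarrow> i > 0 \<Longrightarrow> B $$ (i, 0) = 0" "\<And>i. i < n \<Longrightarrow> i > 1 \<Longrightarrow> B $$ (i, 1) = 0"
  proof -
    have d: "diag_mat B ! k = B $$ (k, k)" if "k < n" for k using that c(4) by (simp add: diag_mat_def)
    show "B $$ (0, 0) = a" "B $$ (1, 1) = b" using d[of 0] d[of 1] len unfolding w(3) by simp_all
    show "\<And>i. i < n \<Longrightarrow> i > 0 \<Longrightarrow> B $$ (i, 0) = 0" "\<And>i. i < n \<Longrightarrow> i > 1 \<Longrightarrow> B $$ (i, 1) = 0"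
      using w(2) c(4) by (auto simp: upper_triangular_def)
  qed
  have AP: "A * P = P * B"
  proof -
    have "A * P = P * B * (Q * P)" unfolding c(3) using c(4-6) by (simp add: assoc_mult_mat[of _ n n _ n _ n])
    then show ?thesis using c(2,4,5) by simp
  qed
  let ?v = "P *\<^sub>v unit_vec n 0" and ?w = "P *\<^sub>v unit_vec n 1"
  have mv: "A *\<^sub>v (P *\<^sub>v unit_vec n k) = P *\<^sub>v (B *\<^sub>v unit_vec n k)" for k
    using AP A c(4,5) assoc_mult_mat_vec[of A n n P n "unit_vec n k"] assoc_mult_mat_vec[of P n n B n "unit_vec n k"] by simp
  have Bu: "(B *\<^sub>v unit_vec n k) $ i = B $$ (i, k)" if "i < n" "k < n" for i k
    using that c(4) by (simp add: mult_mat_vec_def)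
  have B0: "B *\<^sub>v unit_vec n 0 = a \<cdot>\<^sub>v unit_vec n 0"
  proof (rule eq_vecI)
    fix i assume "i < dim_vec (a \<cdot>\<^sub>v unit_vec n 0)"
    then show "(B *\<^sub>v unit_vec n 0) $ i = (a \<cdot>\<^sub>v unit_vec n 0) $ i"
      using Bu[of i 0] B len by (cases "i = 0") simp_all
  qed (use c(4) in simp)
  have B1: "B *\<^sub>v unit_vec n 1 = B $$ (0, 1) \<cdot>\<^sub>v unit_vec n 0 + b \<cdot>\<^sub>v unit_vec n 1"
  proof (rule eq_vecI)
    fix i assume "i < dim_vec (B $$ (0, 1) \<cdot>\<^sub>v unit_vec n 0 + b \<cdot>\<^sub>v unit_vec n 1)"
    then show "(B *\<^sub>v unit_vec n 1) $ i = (B $$ (0, 1) \<cdot>\<^sub>v unit_vec n 0 + b \<cdot>\<^sub>v unit_vec n 1) $ i"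
      using Bu[of i 1] B len by (cases "i = 0"; cases "i = 1") simp_all
  qed (use c(4) in simp)
  have "A *\<^sub>v ?v = a \<cdot>\<^sub>v ?v" unfolding mv B0 using c(5) by (simp add: mult_mat_vec)
  moreover have "A *\<^sub>v ?w = B $$ (0, 1) \<cdot>\<^sub>v ?v + b \<cdot>\<^sub>v ?w"
    unfolding mv B1 using c(5) by (simp add: mult_add_distrib_mat_vec[of _ n n] mult_mat_vec)
  moreover have "x = 0 \<and> y = 0" if "x \<cdot>\<^sub>v ?v + y \<cdot>\<^sub>v ?w = 0\<^sub>v n" for x y
  proof -
    let ?u = "x \<cdot>\<^sub>v unit_vec n 0 + y \<cdot>\<^sub>v unit_vec n 1 :: complex vec"
    have "P *\<^sub>v ?u = 0\<^sub>v n" using that c(5) by (simp add: mult_add_distrib_mat_vec[of _ n n] mult_mat_vec)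
    then have "(Q * P) *\<^sub>v ?u = 0\<^sub>v n" using c(5,6) assoc_mult_mat_vec[of Q n n P n ?u] by (simp add: scalar_prod_def vec_eq_iff)
    then have u: "?u = 0\<^sub>v n" unfolding c(2) by simp
    show ?thesis using arg_cong[OF u, of "\<lambda>v. vec_index v 0"] arg_cong[OF u, of "\<lambda>v. vec_index v 1"] len by simp
  qed
  moreover have "?v \<in> carrier_vec n" "?w \<in> carrier_vec n" using c(5) by simp_all
  ultimately show ?thesis by blast
qed

lemma adjacency_mat_mult:
  fixes f :: "'v \<Rightarrow> complex"
  assumes vs: "distinct vs" "set vs = fst G" and k: "k < length vs"
  shows "(map_mat of_real (adjacency_mat G vs) *\<^sub>v vec (length vs) (\<lambda>k. f (vs ! k))) $ k =
    (\<Sum>u \<in> {u \<in> fst G. {vs ! k, u} \<in> snd G}. f u)"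
proof -
  have "(map_mat of_real (adjacency_mat G vs) *\<^sub>v vec (length vs) (\<lambda>k. f (vs ! k))) $ k =
      (\<Sum>l \<in> {0..<length vs}. (if {vs ! k, vs ! l} \<in> snd G then 1 else 0) * f (vs ! l))"
    using k by (simp add: adjacency_mat_def mult_mat_vec_def scalar_prod_def if_distrib cong: if_cong)
  also have "\<dots> = (\<Sum>u \<in> fst G. (if {vs ! k, u} \<in> snd G then 1 else 0) * f u)"
    using sum.reindex_bij_betw[OF bij_betw_nth[OF vs(1) refl refl], of "\<lambda>u. (if {vs ! k, u} \<in> snd G then 1 else 0) * f u"]
    unfolding vs(2) lessThan_atLeast0 .
  also have "\<dots> = (\<Sum>u \<in> {u \<in> fst G. {vs ! k, u} \<in> snd G}. f u)"
  proof -
    have "finite (fst G)" unfolding vs(2)[symmetric] by simp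
    then show ?thesis by (simp add: sum.inter_filter if_distrib[of "\<lambda>x. x * _"] cong: if_cong)
  qed
  finally show ?thesis .
qed

lemma vec_of_fun:
  assumes vs: "distinct vs" and v: "v \<in> carrier_vec (length vs)"
  obtains f where "v = vec (length vs) (\<lambda>k. f (vs ! k))"
proof
  show "v = vec (length vs) (\<lambda>k. (\<lambda>u. v $ inv_into {..<length vs} ((!) vs) u) (vs ! k))"
  proof (rule eq_vecI)
    fix i assume "i < dim_vec (vec (length vs) (\<lambda>k. (\<lambda>u. v $ inv_into {..<length vs} ((!) vs) u) (vs ! k)))"
    then show "v $ i = vec (length vs) (\<lambda>k. (\<lambda>u. v $ inv_into {..<length vs} ((!) vs) u) (vs ! k)) $ i"
      using inv_into_f_f[OF inj_on_nth[OF vs], of "{..<length vs}" i] by simp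
  qed (use v in simp)
qed

section \<open>Large eigenvalues of semi-regular bipartite graphs\<close>

locale semiregular_bipartite =
  fixes r s d e :: nat and R :: "nat \<Rightarrow> nat \<Rightarrow> bool"
  assumes rpos: "r \<ge> 1" and spos: "s \<ge> 1"
    and D: "\<And>i. i \<in> {1..r} \<Longrightarrow> card {j \<in> {1..s}. \<not> R i j} = d"
    and E: "\<And>j. j \<in> {1..s} \<Longrightarrow> card {i \<in> {1..r}. \<not> R i j} = e"
    and balanced: "\<And>p t \<theta>. (\<Sum>i \<in> {1..r}. p i) = (0 :: complex) \<Longrightarrow> (\<Sum>j \<in> {1..s}. t j) = (0 :: complex) \<Longrightarrow>
      (\<And>i. i \<in> {1..r} \<Longrightarrow> (\<Sum>j | j \<in> {1..s} \<and> \<not> R i j. t j) = of_real \<theta> * p i) \<Longrightarrow>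
      (\<And>j. j \<in> {1..s} \<Longrightarrow> (\<Sum>i | i \<in> {1..r} \<and> \<not> R i j. p i) = of_real \<theta> * t j) \<Longrightarrow> \<theta> > 2 \<Longrightarrow>
      (\<forall>i \<in> {1..r}. p i = 0) \<and> (\<forall>j \<in> {1..s}. t j = 0)"
begin

definition graph :: "star_vertex ugraph" where
  "graph = (VX ` {1..r} \<union> VY ` {1..s}, {{VX i, VY j} | i j. i \<in> {1..r} \<and> j \<in> {1..s} \<and> \<not> R i j})"

lemma balance: "r * d = s * e"
  by (rule double_count_degrees[of r s R d e]) (rule D E, assumption)+

text \<open>By double counting, the mean values on the two sides satisfy the same equations with the
  degrees in place of the neighbour sums, so subtracting them leaves a balanced eigenvector. The
  constants \<open>cx\<close> and \<open>cy\<close> are there for the second Schur vector, an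
  eigenvector only up to a multiple of the first.\<close>

lemma eigen_mod_constants:
  fixes x y :: "nat \<Rightarrow> complex"
  assumes X: "\<And>i. i \<in> {1..r} \<Longrightarrow> (\<Sum>j | j \<in> {1..s} \<and> \<not> R i j. y j) = of_real \<theta> * x i + cx"
    and Y: "\<And>j. j \<in> {1..s} \<Longrightarrow> (\<Sum>i | i \<in> {1..r} \<and> \<not> R i j. x i) = of_real \<theta> * y j + cy"
    and th: "\<theta> > 2"
  shows "\<exists>\<alpha> \<beta>. (\<forall>i \<in> {1..r}. x i = \<alpha>) \<and> (\<forall>j \<in> {1..s}. y j = \<beta>)"
proof -
  define mx where "mx = (\<Sum>i \<in> {1..r}. x i) / of_nat r"
  define my where "my = (\<Sum>j \<in> {1..s}. y j) / of_nat s"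
  have sx: "(\<Sum>i \<in> {1..r}. x i) = of_nat r * mx" and sy: "(\<Sum>j \<in> {1..s}. y j) = of_nat s * my"
    using rpos spos unfolding mx_def my_def by simp_all
  have b: "of_nat r * of_nat d = (of_nat s * of_nat e :: complex)"
    using arg_cong[OF balance, of "of_nat :: nat \<Rightarrow> complex"] by simp
  have "of_real \<theta> * (of_nat r * mx) + of_nat r * cx = (\<Sum>i \<in> {1..r}. of_real \<theta> * x i + cx)"
    unfolding sx[symmetric] by (simp add: sum.distrib sum_distrib_left)
  also have "\<dots> = (\<Sum>i \<in> {1..r}. \<Sum>j | j \<in> {1..s} \<and> \<not> R i j. y j)"
    by (rule sum.cong[OF refl X[symmetric]])
  also have "\<dots> = (\<Sum>j \<in> {1..s}. \<Sum>i | i \<in> {1..r} \<and> \<not> R i j. y j)" by (rule sum.swap_restrict) auto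
  also have "\<dots> = (\<Sum>j \<in> {1..s}. of_nat e * y j)"
  proof (rule sum.cong[OF refl])
    show "(\<Sum>i | i \<in> {1..r} \<and> \<not> R i j. y j) = of_nat e * y j" if "j \<in> {1..s}" for j
      using E[OF that] by simp
  qed
  also have "\<dots> = of_nat e * (of_nat s * my)" unfolding sy[symmetric] by (rule sum_distrib_left[symmetric])
  also have "\<dots> = (of_nat s * of_nat e) * my" by simp
  also have "\<dots> = of_nat r * (of_nat d * my)" unfolding b[symmetric] by simp
  finally have "of_nat r * (of_real \<theta> * mx + cx) = of_nat r * (of_nat d * my)" by (simp add: algebra_simps)
  then have mX: "of_real \<theta> * mx + cx = of_nat d * my" using rpos by simp
  have "of_real \<theta> * (of_nat s * my) + of_nat s * cy = (\<Sum>j \<in> {1..s}. of_real \<theta> * y j + cy)"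
    unfolding sy[symmetric] by (simp add: sum.distrib sum_distrib_left)
  also have "\<dots> = (\<Sum>j \<in> {1..s}. \<Sum>i | i \<in> {1..r} \<and> \<not> R i j. x i)"
    by (rule sum.cong[OF refl Y[symmetric]])
  also have "\<dots> = (\<Sum>i \<in> {1..r}. \<Sum>j | j \<in> {1..s} \<and> \<not> R i j. x i)" by (rule sum.swap_restrict) auto
  also have "\<dots> = (\<Sum>i \<in> {1..r}. of_nat d * x i)"
  proof (rule sum.cong[OF refl])
    show "(\<Sum>j | j \<in> {1..s} \<and> \<not> R i j. x i) = of_nat d * x i" if "i \<in> {1..r}" for i
      using D[OF that] by simp
  qed
  also have "\<dots> = of_nat d * (of_nat r * mx)" unfolding sx[symmetric] by (rule sum_distrib_left[symmetric])
  also have "\<dots> = (of_nat r * of_nat d) * mx" by simp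
  also have "\<dots> = of_nat s * (of_nat e * mx)" unfolding b by simp
  finally have "of_nat s * (of_real \<theta> * my + cy) = of_nat s * (of_nat e * mx)" by (simp add: algebra_simps)
  then have mY: "of_real \<theta> * my + cy = of_nat e * mx" using spos by simp
  have "(\<forall>i \<in> {1..r}. x i - mx = 0) \<and> (\<forall>j \<in> {1..s}. y j - my = 0)"
  proof (rule balanced[OF _ _ _ _ th])
    show "(\<Sum>i \<in> {1..r}. x i - mx) = 0" "(\<Sum>j \<in> {1..s}. y j - my) = 0" unfolding sum_subtractf sx sy by simp_all
    show "(\<Sum>j | j \<in> {1..s} \<and> \<not> R i j. y j - my) = of_real \<theta> * (x i - mx)" if i: "i \<in> {1..r}" for i
    proof -
      have "(\<Sum>j | j \<in> {1..s} \<and> \<not> R i j. y j - my) = of_real \<theta> * x i + cx - of_nat d * my"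
        unfolding sum_subtractf X[OF i] using D[OF i] by simp
      then show ?thesis unfolding mX[symmetric] by (simp add: algebra_simps)
    qed
    show "(\<Sum>i | i \<in> {1..r} \<and> \<not> R i j. x i - mx) = of_real \<theta> * (y j - my)" if j: "j \<in> {1..s}" for j
    proof -
      have "(\<Sum>i | i \<in> {1..r} \<and> \<not> R i j. x i - mx) = of_real \<theta> * y j + cy - of_nat e * mx"
        unfolding sum_subtractf Y[OF j] using E[OF j] by simp
      then show ?thesis unfolding mY[symmetric] by (simp add: algebra_simps)
    qed
  qed
  then show ?thesis by auto
qed

lemma nbr_sum:
  fixes f :: "star_vertex \<Rightarrow> complex"
  shows "i \<in> {1..r} \<Longrightarrow> (\<Sum>u \<in> {u \<in> fst graph. {VX i, u} \<in> snd graph}. f u) = (\<Sum>j | j \<in> {1..s} \<and> \<not> R i j. f (VY j))"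
    "j \<in> {1..s} \<Longrightarrow> (\<Sum>u \<in> {u \<in> fst graph. {VY j, u} \<in> snd graph}. f u) = (\<Sum>i | i \<in> {1..r} \<and> \<not> R i j. f (VX i))"
proof -
  assume i: "i \<in> {1..r}"
  have "{u \<in> fst graph. {VX i, u} \<in> snd graph} = VY ` {j \<in> {1..s}. \<not> R i j}"
    using i by (auto simp: graph_def doubleton_eq_iff)
  then show "(\<Sum>u \<in> {u \<in> fst graph. {VX i, u} \<in> snd graph}. f u) = (\<Sum>j | j \<in> {1..s} \<and> \<not> R i j. f (VY j))"
    by (simp add: sum.reindex inj_on_def)
next
  assume j: "j \<in> {1..s}"
  have "{u \<in> fst graph. {VY j, u} \<in> snd graph} = VX ` {i \<in> {1..r}. \<not> R i j}"
    using j by (auto simp: graph_def doubleton_eq_iff)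
  then show "(\<Sum>u \<in> {u \<in> fst graph. {VY j, u} \<in> snd graph}. f u) = (\<Sum>i | i \<in> {1..r} \<and> \<not> R i j. f (VX i))"
    by (simp add: sum.reindex inj_on_def)
qed

context
  fixes vs assumes vs: "distinct vs" "set vs = fst graph"
begin

private abbreviation "n \<equiv> length vs"
private abbreviation "A \<equiv> adjacency_mat graph vs"
private abbreviation "AC \<equiv> map_mat complex_of_real A"
private abbreviation "V f \<equiv> vec n (\<lambda>k. f (vs ! k))"

lemma A_carrier: "A \<in> carrier_mat n n" "AC \<in> carrier_mat n n" by (simp_all add: adjacency_mat_def)

lemma char_poly_AC: "char_poly AC = map_poly of_real (char_poly A)"
  by (rule of_real_hom.char_poly_hom[OF A_carrier(1)])

lemma V_eq_iff: "V f = V g \<longleftrightarrow> (\<forall>u \<in> fst graph. f u = g u)"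
  unfolding vs(2)[symmetric] by (auto simp: vec_eq_iff set_conv_nth)

lemma V_simps: "a \<cdot>\<^sub>v V f = V (\<lambda>u. a * f u)" "V f + V g = V (\<lambda>u. f u + g u)" "0\<^sub>v n = V (\<lambda>u. 0)"
  for a :: complex and f g :: "star_vertex \<Rightarrow> complex"
  by (rule eq_vecI, simp_all)+

lemma eigen_eqD:
  assumes "AC *\<^sub>v V f = V g"
  shows "i \<in> {1..r} \<Longrightarrow> (\<Sum>j | j \<in> {1..s} \<and> \<not> R i j. f (VY j)) = g (VX i)"
    "j \<in> {1..s} \<Longrightarrow> (\<Sum>i | i \<in> {1..r} \<and> \<not> R i j. f (VX i)) = g (VY j)"
proof -
  have *: "(\<Sum>u \<in> {u \<in> fst graph. {v, u} \<in> snd graph}. f u) = g v" if v: "v \<in> fst graph" for v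
  proof -
    obtain k where k: "k < n" "vs ! k = v" using v unfolding vs(2)[symmetric] in_set_conv_nth by blast
    show ?thesis using adjacency_mat_mult[OF vs k(1), of f] k unfolding assms by simp
  qed
  show "i \<in> {1..r} \<Longrightarrow> (\<Sum>j | j \<in> {1..s} \<and> \<not> R i j. f (VY j)) = g (VX i)"
    using *[of "VX i"] nbr_sum(1)[of i f] by (simp add: graph_def)
  show "j \<in> {1..s} \<Longrightarrow> (\<Sum>i | i \<in> {1..r} \<and> \<not> R i j. f (VX i)) = g (VY j)"
    using *[of "VY j"] nbr_sum(2)[of j f] by (simp add: graph_def)
qed

text \<open>Both Schur vectors are constant on each side. On such vectors the adjacency matrix acts
  with zero diagonal, so its trace there is 0, which cannot be a + b.\<close>

lemma not_two_large:
  assumes "a > 2" "b > 2" shows "\<not> [:- a, 1:] * [:- b, 1:] dvd char_poly A"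
proof
  assume dvd: "[:- a, 1:] * [:- b, 1:] dvd char_poly A"
  interpret mp: map_poly_comm_ring_hom "of_real :: real \<Rightarrow> complex" ..
  from dvd obtain q where "char_poly A = [:- a, 1:] * [:- b, 1:] * q" unfolding dvd_def by blast
  then have "char_poly AC = map_poly of_real ([:- a, 1:] * [:- b, 1:] * q)" unfolding char_poly_AC by simp
  also have "\<dots> = map_poly of_real [:- a, 1:] * map_poly of_real [:- b, 1:] * map_poly of_real q"
    unfolding mp.hom_mult ..
  also have "map_poly of_real [:- a, 1:] = [:- complex_of_real a, 1:]" by simp
  also have "map_poly of_real [:- b, 1:] = [:- complex_of_real b, 1:]" by simp
  finally have "[:- of_real a, 1:] * [:- of_real b, 1:] dvd char_poly AC" unfolding dvd_def by blast
  from two_eigenvalues_schur[OF A_carrier(2) this] obtain v w c where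
    v: "v \<in> carrier_vec n" "AC *\<^sub>v v = of_real a \<cdot>\<^sub>v v" and w: "w \<in> carrier_vec n" "AC *\<^sub>v w = c \<cdot>\<^sub>v v + of_real b \<cdot>\<^sub>v w"
    and ind: "\<And>x y. x \<cdot>\<^sub>v v + y \<cdot>\<^sub>v w = 0\<^sub>v n \<Longrightarrow> x = 0 \<and> y = 0" by blast
  obtain f where f: "v = V f" using vec_of_fun[OF vs(1) v(1)] by blast
  obtain g where g: "w = V g" using vec_of_fun[OF vs(1) w(1)] by blast
  have "AC *\<^sub>v V f = V (\<lambda>u. of_real a * f u)" using v(2) unfolding f V_simps .
  note F = eigen_eqD[OF this]
  have "AC *\<^sub>v V g = V (\<lambda>u. c * f u + of_real b * g u)" 
    using w(2) unfolding f g V_simps(1) V_simps(2)[of "\<lambda>u. c * f u" "\<lambda>u. of_real b * g u"] .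
  note G = eigen_eqD[OF this]
  obtain a1 b1 where ab1: "\<And>i. i \<in> {1..r} \<Longrightarrow> f (VX i) = a1" "\<And>j. j \<in> {1..s} \<Longrightarrow> f (VY j) = b1"
    using eigen_mod_constants[of "\<lambda>j. f (VY j)" a "\<lambda>i. f (VX i)" 0 0] F assms(1) by auto
  obtain a2 b2 where ab2: "\<And>i. i \<in> {1..r} \<Longrightarrow> g (VX i) = a2" "\<And>j. j \<in> {1..s} \<Longrightarrow> g (VY j) = b2"
  proof -
    have "\<exists>\<alpha> \<beta>. (\<forall>i \<in> {1..r}. g (VX i) = \<alpha>) \<and> (\<forall>j \<in> {1..s}. g (VY j) = \<beta>)"
    proof (rule eigen_mod_constants[OF _ _ assms(2)])
      show "(\<Sum>j | j \<in> {1..s} \<and> \<not> R i j. g (VY j)) = of_real b * g (VX i) + c * a1" if "i \<in> {1..r}" for i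
        unfolding G(1)[OF that] ab1(1)[OF that] by simp
      show "(\<Sum>i | i \<in> {1..r} \<and> \<not> R i j. g (VX i)) = of_real b * g (VY j) + c * b1" if "j \<in> {1..s}" for j
        unfolding G(2)[OF that] ab1(2)[OF that] by simp
    qed
    then show thesis using that by blast
  qed
  have one: "1 \<in> {1..r}" "1 \<in> {1..s}" using rpos spos by simp_all
  have cd: "(\<Sum>j | j \<in> {1..s} \<and> \<not> R 1 j. h (VY j)) = of_nat d * q" if "\<And>j. j \<in> {1..s} \<Longrightarrow> h (VY j) = q" for h and q :: complex
  proof -
    have "(\<Sum>j | j \<in> {1..s} \<and> \<not> R 1 j. h (VY j)) = (\<Sum>j | j \<in> {1..s} \<and> \<not> R 1 j. q)"
      by (rule sum.cong[OF refl]) (use that in blast)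
    then show ?thesis using D[OF one(1)] by simp
  qed
  have ce: "(\<Sum>i | i \<in> {1..r} \<and> \<not> R i 1. h (VX i)) = of_nat e * q" if "\<And>i. i \<in> {1..r} \<Longrightarrow> h (VX i) = q" for h and q :: complex
  proof -
    have "(\<Sum>i | i \<in> {1..r} \<and> \<not> R i 1. h (VX i)) = (\<Sum>i | i \<in> {1..r} \<and> \<not> R i 1. q)"
      by (rule sum.cong[OF refl]) (use that in blast)
    then show ?thesis using E[OF one(2)] by simp
  qed
  have eqs: "of_nat d * b1 = of_real a * a1" "of_nat e * a1 = of_real a * b1"
    "of_nat d * b2 = c * a1 + of_real b * a2" "of_nat e * a2 = c * b1 + of_real b * b2"
    using trans[OF cd[of f, OF ab1(2), symmetric] F(1)[OF one(1)]] trans[OF ce[of f, OF ab1(1), symmetric] F(2)[OF one(2)]]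
      trans[OF cd[of g, OF ab2(2), symmetric] G(1)[OF one(1)]] trans[OF ce[of g, OF ab2(1), symmetric] G(2)[OF one(2)]]
    unfolding ab1(1)[OF one(1)] ab1(2)[OF one(2)] ab2(1)[OF one(1)] ab2(2)[OF one(2)] by blast+
  \<comment> \<open>a1 b2 - a2 b1 is the determinant of the two vectors in terms of their constants;
    the trace argument takes the form that a + b times this determinant is 0.\<close>
  have "(of_real a + of_real b) * (a1 * b2 - a2 * b1) = (of_real a * a1) * b2 - (of_real a * b1) * a2
      + a1 * (c * b1 + of_real b * b2) - b1 * (c * a1 + of_real b * a2)" by (simp add: algebra_simps)
  also have "\<dots> = 0" unfolding eqs[symmetric] by (simp add: algebra_simps)
  finally have "(of_real a + of_real b) * (a1 * b2 - a2 * b1) = 0" .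
  moreover have "complex_of_real a + of_real b \<noteq> 0" using assms unfolding of_real_add[symmetric] of_real_eq_0_iff by simp
  ultimately have D0: "a1 * b2 = a2 * b1" by simp
  have lin: "x * a1 + y * a2 = 0 \<Longrightarrow> x * b1 + y * b2 = 0 \<Longrightarrow> x = 0 \<and> y = 0" for x y
  proof (rule ind)
    assume z: "x * a1 + y * a2 = 0" "x * b1 + y * b2 = 0"
    show "x \<cdot>\<^sub>v v + y \<cdot>\<^sub>v w = 0\<^sub>v n"
      unfolding f g V_simps(1,3) V_simps(2)[of "\<lambda>u. x * f u" "\<lambda>u. y * g u"]
        V_eq_iff[of "\<lambda>u. x * f u + y * g u" "\<lambda>u. 0"]
      using z ab1 ab2 by (auto simp: graph_def)
  qed
  \<comment> \<open>As the determinant is 0, the coefficient pairs (a2, -a1) and (b2, -b1) give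
    linear relations between \<open>v\<close> and \<open>w\<close>, so all four constants
    vanish.\<close>
  have "a2 = 0 \<and> - a1 = 0" by (rule lin) (use D0 in \<open>simp_all add: algebra_simps\<close>)
  moreover have "b2 = 0 \<and> - b1 = 0" by (rule lin) (use D0 in \<open>simp_all add: algebra_simps\<close>)
  ultimately show False using lin[of 1 0] by simp
qed

text \<open>An eigenvector for an eigenvalue above 2 is constant on each side, and on such vectors
  the square of the adjacency matrix is multiplication by d e.\<close>

lemma large_root_iff: "(\<exists>x > 2. poly (char_poly A) x = 0) \<longleftrightarrow> d * e > 4"
proof
  assume "\<exists>x > 2. poly (char_poly A) x = 0"
  then obtain x where x: "x > 2" "poly (char_poly A) x = 0" by blast
  have "poly (char_poly AC) (of_real x) = 0" unfolding char_poly_AC using x(2) by simp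
  then have "eigenvalue AC (of_real x)" using eigenvalue_root_char_poly[OF A_carrier(2)] by blast
  then obtain v where v: "v \<in> carrier_vec n" "v \<noteq> 0\<^sub>v n" "AC *\<^sub>v v = of_real x \<cdot>\<^sub>v v"
    unfolding eigenvalue_def eigenvector_def using A_carrier(2) by auto
  obtain f where f: "v = V f" using vec_of_fun[OF vs(1) v(1)] by blast
  have "AC *\<^sub>v V f = V (\<lambda>u. of_real x * f u)" using v(3) unfolding f V_simps .
  note F = eigen_eqD[OF this]
  obtain a1 b1 where ab: "\<And>i. i \<in> {1..r} \<Longrightarrow> f (VX i) = a1" "\<And>j. j \<in> {1..s} \<Longrightarrow> f (VY j) = b1"
    using eigen_mod_constants[of "\<lambda>j. f (VY j)" x "\<lambda>i. f (VX i)" 0 0] F x(1) by auto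
  have one: "1 \<in> {1..r}" "1 \<in> {1..s}" using rpos spos by simp_all
  have "(\<Sum>j | j \<in> {1..s} \<and> \<not> R 1 j. f (VY j)) = (\<Sum>j | j \<in> {1..s} \<and> \<not> R 1 j. b1)"
    by (rule sum.cong[OF refl]) (use ab in blast)
  then have 1: "of_nat d * b1 = of_real x * a1" using F(1)[OF one(1)] ab(1)[OF one(1)] D[OF one(1)] by simp
  have "(\<Sum>i | i \<in> {1..r} \<and> \<not> R i 1. f (VX i)) = (\<Sum>i | i \<in> {1..r} \<and> \<not> R i 1. a1)"
    by (rule sum.cong[OF refl]) (use ab in blast)
  then have 2: "of_nat e * a1 = of_real x * b1" using F(2)[OF one(2)] ab(2)[OF one(2)] E[OF one(2)] by simp
  have "a1 \<noteq> 0 \<or> b1 \<noteq> 0"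
  proof (rule ccontr)
    assume "\<not> ?thesis"
    then have "V f = 0\<^sub>v n" unfolding V_simps(3) V_eq_iff[of f "\<lambda>u. 0"] using ab by (auto simp: graph_def)
    then show False using v(2) unfolding f by simp
  qed
  moreover have "of_nat (d * e) * a1 = of_real (x\<^sup>2) * a1" "of_nat (d * e) * b1 = of_real (x\<^sup>2) * b1"
  proof -
    have "of_nat (d * e) * a1 = of_nat d * (of_real x * b1)" using 2 by simp
    also have "\<dots> = of_real x * (of_nat d * b1)" by simp
    finally show "of_nat (d * e) * a1 = of_real (x\<^sup>2) * a1" unfolding 1 by (simp add: power2_eq_square)
    have "of_nat (d * e) * b1 = of_nat e * (of_nat d * b1)" by simp
    also have "\<dots> = of_real x * (of_nat e * a1)" unfolding 1 by simp
    finally show "of_nat (d * e) * b1 = of_real (x\<^sup>2) * b1" unfolding 2 by (simp add: power2_eq_square)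
  qed
  ultimately have "complex_of_real (of_nat (d * e)) = of_real (x\<^sup>2)" by auto
  then have "of_nat (d * e) = x\<^sup>2" unfolding of_real_eq_iff .
  moreover have "x\<^sup>2 > 2\<^sup>2" using x(1) by (intro power_strict_mono) auto
  ultimately have "real (d * e) > 4" by simp
  then show "d * e > 4" by linarith
next
  assume de: "d * e > 4"
  let ?x = "sqrt (real (d * e))"
  \<comment> \<open>The constants sqrt d on the x-side and sqrt e on the y-side give the eigenvalue
    sqrt (d e), because d sqrt e = sqrt (d e) sqrt d, and likewise with \<open>d\<close> and
    \<open>e\<close> exchanged.\<close>
  let ?f = "\<lambda>u. case u of VX i \<Rightarrow> sqrt (real d) | _ \<Rightarrow> sqrt (real e)"
  let ?F = "\<lambda>u. complex_of_real (?f u)"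
  have "AC *\<^sub>v V ?F = of_real ?x \<cdot>\<^sub>v V ?F"
  proof (rule eq_vecI)
    fix k assume "k < dim_vec (of_real ?x \<cdot>\<^sub>v V ?F)"
    then have k: "k < n" by simp
    then have "vs ! k \<in> fst graph" unfolding vs(2)[symmetric] by simp
    then consider i where "vs ! k = VX i" "i \<in> {1..r}" | j where "vs ! k = VY j" "j \<in> {1..s}"
      unfolding graph_def by auto
    then have "(\<Sum>u \<in> {u \<in> fst graph. {vs ! k, u} \<in> snd graph}. ?F u) = of_real ?x * ?F (vs ! k)"
    proof cases
      case 1
      have "real d * sqrt (real e) = ?x * sqrt (real d)" by (simp add: real_sqrt_mult)
      then have "complex_of_real (real d * sqrt (real e)) = of_real (?x * sqrt (real d))" by simp
      then show ?thesis unfolding 1(1) nbr_sum(1)[OF 1(2)] using D[OF 1(2)] by simp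
    next
      case 2
      have "real e * sqrt (real d) = ?x * sqrt (real e)" by (simp add: real_sqrt_mult)
      then have "complex_of_real (real e * sqrt (real d)) = of_real (?x * sqrt (real e))" by simp
      then show ?thesis unfolding 2(1) nbr_sum(2)[OF 2(2)] using E[OF 2(2)] by simp
    qed
    then show "(AC *\<^sub>v V ?F) $ k = (of_real ?x \<cdot>\<^sub>v V ?F) $ k"
      unfolding adjacency_mat_mult[OF vs k, of ?F] using k by simp
  qed (use A_carrier in simp)
  moreover have "V ?F \<noteq> 0\<^sub>v n"
  proof
    assume "V ?F = 0\<^sub>v n"
    then have "V ?F = V (\<lambda>u. 0)" unfolding V_simps(3) .
    moreover have "VX 1 \<in> fst graph" using rpos by (simp add: graph_def)
    ultimately have "?F (VX 1) = 0" 
      unfolding V_eq_iff[of ?F "\<lambda>u. 0"] by blast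
    then show False using de by simp
  qed
  ultimately have "eigenvalue AC (of_real ?x)"
    unfolding eigenvalue_def eigenvector_def using A_carrier(2) by (intro exI[of _ "V ?F"]) auto
  then have "poly (map_poly of_real (char_poly A)) (complex_of_real ?x) = 0"
    using eigenvalue_root_char_poly[OF A_carrier(2)] unfolding char_poly_AC by blast
  then have "poly (char_poly A) ?x = 0" by simp
  moreover have "?x > 2"
  proof (rule real_less_rsqrt)
    have "real (d * e) > real 4" using de by (simp only: of_nat_less_iff)
    then show "2\<^sup>2 < real (d * e)" by simp
  qed
  ultimately show "\<exists>x > 2. poly (char_poly A) x = 0" by blast
qed

lemma char_poly_nz: "char_poly A \<noteq> 0"
  using degree_monic_char_poly[OF A_carrier(1)] by auto

end

theorem reflexive_salem:
  "reflexive_graph graph" "salem_graph graph \<longleftrightarrow> d * e > 4"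
proof -
  define vs where "vs = (SOME vs. distinct vs \<and> set vs = fst graph)"
  have "finite (fst graph)" by (simp add: graph_def)
  then have "\<exists>vs. distinct vs \<and> set vs = fst graph" using finite_distinct_list by blast
  then have vs: "distinct vs" "set vs = fst graph" unfolding vs_def by (rule someI2_ex, simp)+
  have L: "graph_eigenvalues graph = rev (sorted_list_of_multiset (proots (char_poly (adjacency_mat graph vs))))"
    unfolding graph_eigenvalues_def vs_def Let_def ..
  note nz = char_poly_nz[OF vs]
  show refl: "reflexive_graph graph"
    unfolding reflexive_graph_def
  proof (intro impI, rule ccontr)
    assume l: "2 \<le> length (graph_eigenvalues graph)" and g: "\<not> graph_eigenvalues graph ! 1 \<le> 2"
    note two = sorted_roots_two[OF nz l[unfolded L], folded L]
    show False using not_two_large[OF vs _ _ ] two g by force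
  qed
  have "bipartite_graph graph"
    unfolding bipartite_graph_def
  proof (rule exI[of _ "VX ` {1..r}"], rule exI[of _ "VY ` {1..s}"], intro conjI ballI)
    fix u assume "u \<in> snd graph"
    then obtain i j where "u = {VX i, VY j}" "i \<in> {1..r}" "j \<in> {1..s}" unfolding graph_def by auto
    then show "\<exists>v \<in> VX ` {1..r}. \<exists>w \<in> VY ` {1..s}. u = {v, w}" by blast
  qed (auto simp: graph_def)
  then show "salem_graph graph \<longleftrightarrow> d * e > 4"
    unfolding salem_graph_def using refl sorted_roots_head[OF nz, of 2, folded L] large_root_iff[OF vs] by blast
qed

end

section \<open>The path algebra of the star quiver\<close>

fun star_path_of :: "star_path \<Rightarrow> (star_vertex, star_arrow) path" where
  "star_path_of (BX i) = (VX i, [])"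
| "star_path_of BZ = (VZ, [])"
| "star_path_of (BY j) = (VY j, [])"
| "star_path_of (BA i) = (VX i, [ArrA i])"
| "star_path_of (BB j) = (VZ, [ArrB j])"
| "star_path_of (BC i j) = (VX i, [ArrA i, ArrB j])"

lemma inj_star_path_of: "inj star_path_of"
proof (rule injI)
  show "p = q" if "star_path_of p = star_path_of q" for p q
    using that by (cases p; cases q) simp_all
qed

lemma star_quiver_simps:
  "verts (star_quiver r s) = VX ` {1..r} \<union> {VZ} \<union> VY ` {1..s}"
  "arcs (star_quiver r s) = ArrA ` {1..r} \<union> ArrB ` {1..s}"
  "tail (star_quiver r s) (ArrA i) = VX i" "tail (star_quiver r s) (ArrB j) = VZ"
  "head (star_quiver r s) (ArrA i) = VZ" "head (star_quiver r s) (ArrB j) = VY j"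
  by (simp_all add: star_quiver_def)

lemma tail_star_eq:
  "tail (star_quiver r s) e = VX i \<longleftrightarrow> e = ArrA i" "tail (star_quiver r s) e \<noteq> VY j"
  "tail (star_quiver r s) e = VZ \<longleftrightarrow> (\<exists>j. e = ArrB j)"
  by (cases e; simp add: star_quiver_simps)+

abbreviation "full_basis r s \<equiv> star_basis r s (\<lambda>_ _. False)"

text \<open>No arrow starts at a y-vertex and every a_i ends at z, so a path has at most two
  arrows.\<close>

lemma quiver_paths_star: "quiver_paths (star_quiver r s) = star_path_of ` full_basis r s"
proof (intro equalityI subsetI)
  fix \<pi> assume "\<pi> \<in> quiver_paths (star_quiver r s)"
  then obtain u p v where \<pi>: "\<pi> = (u, p)" and w: "pre_digraph.awalk (star_quiver r s) u p v"
    unfolding quiver_paths_def by auto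
  have u: "u \<in> verts (star_quiver r s)" and p: "set p \<subseteq> arcs (star_quiver r s)"
    and c: "pre_digraph.cas (star_quiver r s) u p v"
    using w unfolding pre_digraph.awalk_def by auto
  note cs = pre_digraph.cas.simps
  show "\<pi> \<in> star_path_of ` full_basis r s"
  proof (cases p)
    case Nil
    from u consider i where "u = VX i" "i \<in> {1..r}" | "u = VZ" | j where "u = VY j" "j \<in> {1..s}"
      by (auto simp: star_quiver_simps)
    then show ?thesis
    proof cases
      case 1 then show ?thesis using Nil \<pi> by (intro image_eqI[of _ _ "BX i"]) simp_all
    next case 2 then show ?thesis using Nil \<pi> by (intro image_eqI[of _ _ "BZ"]) simp_all
    next case 3 then show ?thesis using Nil \<pi> by (intro image_eqI[of _ _ "BY j"]) simp_all
    qed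
  next
    case (Cons a q)
    have a: "a \<in> arcs (star_quiver r s)" "tail (star_quiver r s) a = u"
      and cq: "pre_digraph.cas (star_quiver r s) (head (star_quiver r s) a) q v"
      using c p unfolding Cons by (simp_all add: cs)
    show ?thesis
    proof (cases a)
      case (ArrB j)
      have "q = []"
      proof (cases q)
        case (Cons b q')
        then show ?thesis using cq ArrB tail_star_eq(2)[of r s b j] by (simp add: cs star_quiver_simps)
      qed
      then show ?thesis using ArrB a \<pi> Cons by (intro image_eqI[of _ _ "BB j"]) (auto simp: star_quiver_simps)
    next
      case (ArrA i)
      show ?thesis
      proof (cases q)
        case Nil
        then show ?thesis using ArrA a \<pi> Cons by (intro image_eqI[of _ _ "BA i"]) (auto simp: star_quiver_simps)
      next
        case (Cons b q')
        have b: "b \<in> arcs (star_quiver r s)" "tail (star_quiver r s) b = VZ"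
          and cq': "pre_digraph.cas (star_quiver r s) (head (star_quiver r s) b) q' v"
          using cq p ArrA unfolding \<open>p = a # q\<close> Cons by (simp_all add: cs star_quiver_simps)
        obtain j where j: "b = ArrB j" using b(2) unfolding tail_star_eq by blast
        have "q' = []"
        proof (cases q')
          case (Cons b' q'')
          then show ?thesis using cq' j tail_star_eq(2)[of r s b' j] by (simp add: cs star_quiver_simps)
        qed
        then show ?thesis using ArrA j a b \<pi> \<open>p = a # q\<close> Cons
          by (intro image_eqI[of _ _ "BC i j"]) (auto simp: star_quiver_simps)
      qed
    qed
  qed
next
  fix \<pi> assume "\<pi> \<in> star_path_of ` full_basis r s"
  then obtain p where p: "p \<in> full_basis r s" "\<pi> = star_path_of p" by blast
  define v where "v = (case p of BX i \<Rightarrow> VX i | BZ \<Rightarrow> VZ | BY j \<Rightarrow> VY j | BA i \<Rightarrow> VZ | BB j \<Rightarrow> VY j | BC i j \<Rightarrow> VY j)"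
  have "pre_digraph.awalk (star_quiver r s) (fst \<pi>) (snd \<pi>) v"
    using p unfolding v_def pre_digraph.awalk_def
    by (cases p) (auto simp: star_quiver_simps pre_digraph.cas.simps)
  then show "\<pi> \<in> quiver_paths (star_quiver r s)" unfolding quiver_paths_def by (cases \<pi>) auto
qed

lemma finite_full_basis: "finite (full_basis r s)"
proof -
  have "{BC i j | i j. i \<in> {1..r} \<and> j \<in> {1..s} \<and> \<not> False} = (\<lambda>(i, j). BC i j) ` ({1..r} \<times> {1..s})" by auto
  then show ?thesis unfolding star_basis_def by simp
qed

section \<open>The quotient of the path algebra by an admissible ideal\<close>

locale admissible_star =
  fixes r s :: nat and I :: "((star_vertex, star_arrow) path \<Rightarrow> 'k::field) set"
  assumes adm: "admissible_ideal (star_quiver r s) I"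
    and fd: "fd_algebra (bound_quiver_algebra (star_quiver r s) I)"
begin

abbreviation PA :: "('k, (star_vertex, star_arrow) path \<Rightarrow> 'k) module" where
  "PA \<equiv> path_algebra (star_quiver r s)"

abbreviation QA where "QA \<equiv> bound_quiver_algebra (star_quiver r s) I"

definition rel :: "nat \<Rightarrow> nat \<Rightarrow> bool" where
  "rel i j \<longleftrightarrow> path_elem (VX i, [ArrA i, ArrB j]) \<in> I"

sublocale I: ideal I PA using adm unfolding admissible_ideal_def by blast

lemma PA_simps:
  "\<zero>\<^bsub>PA\<^esub> = (\<lambda>\<pi>. 0)" "f \<oplus>\<^bsub>PA\<^esub> g = (\<lambda>\<pi>. f \<pi> + g \<pi>)" "c \<odot>\<^bsub>PA\<^esub> f = (\<lambda>\<pi>. c * f \<pi>)"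
  by (simp_all add: path_algebra_def)

lemma PA_carrier: "f \<in> carrier PA \<longleftrightarrow> (\<forall>\<pi>. f \<pi> \<noteq> 0 \<longrightarrow> \<pi> \<in> star_path_of ` full_basis r s)"
proof -
  have fin: "finite {\<pi>. f \<pi> \<noteq> 0}" if "{\<pi>. f \<pi> \<noteq> 0} \<subseteq> star_path_of ` full_basis r s"
    using that finite_full_basis finite_subset by blast
  have sub: "{\<pi>. f \<pi> \<noteq> 0} \<subseteq> S \<longleftrightarrow> (\<forall>\<pi>. f \<pi> \<noteq> 0 \<longrightarrow> \<pi> \<in> S)" for S by blast
  have "carrier PA = {f. finite {\<pi>. f \<pi> \<noteq> 0} \<and> {\<pi>. f \<pi> \<noteq> 0} \<subseteq> star_path_of ` full_basis r s}"
    by (simp add: path_algebra_def quiver_paths_star)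
  then show ?thesis using fin unfolding sub[symmetric] by blast
qed

lemma PA_smult: "f \<in> carrier PA \<Longrightarrow> c \<odot>\<^bsub>PA\<^esub> f \<in> carrier PA"
  unfolding PA_carrier PA_simps by auto

lemma PA_outside: "f \<in> carrier PA \<Longrightarrow> \<pi> \<notin> star_path_of ` full_basis r s \<Longrightarrow> f \<pi> = 0"
  unfolding PA_carrier by blast

lemma PA_ext:
  assumes "f \<in> carrier PA" "g \<in> carrier PA" "\<And>p. p \<in> full_basis r s \<Longrightarrow> f (star_path_of p) = g (star_path_of p)"
  shows "f = g"
proof
  fix \<pi>
  show "f \<pi> = g \<pi>"
  proof (cases "\<pi> \<in> star_path_of ` full_basis r s")
    case True then show ?thesis using assms(3) by blast
  next
    case False then show ?thesis using PA_outside[OF assms(1)] PA_outside[OF assms(2)] by simp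
  qed
qed

lemma PA_mult:
  "(f \<otimes>\<^bsub>PA\<^esub> g) (star_path_of p) = (let F = f \<circ> star_path_of; G = g \<circ> star_path_of in case p of
     BX i \<Rightarrow> F (BX i) * G (BX i) | BZ \<Rightarrow> F BZ * G BZ | BY j \<Rightarrow> F (BY j) * G (BY j)
   | BA i \<Rightarrow> F (BX i) * G (BA i) + F (BA i) * G BZ
   | BB j \<Rightarrow> F BZ * G (BB j) + F (BB j) * G (BY j)
   | BC i j \<Rightarrow> F (BX i) * G (BC i j) + F (BA i) * G (BB j) + F (BC i j) * G (BY j))"
  by (cases p)
    (simp_all add: path_algebra_def Let_def pre_digraph.awalk_verts.simps star_quiver_simps sum.atMost_Suc)

lemma PA_one: "p \<in> full_basis r s \<Longrightarrow>
  \<one>\<^bsub>PA\<^esub> (star_path_of p) = (case p of BX i \<Rightarrow> 1 | BZ \<Rightarrow> 1 | BY j \<Rightarrow> 1 | _ \<Rightarrow> 0)"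
  by (cases p) (simp_all add: path_algebra_def star_quiver_simps)

definition of_coeffs :: "(star_path \<Rightarrow> 'k) \<Rightarrow> (star_vertex, star_arrow) path \<Rightarrow> 'k" where
  "of_coeffs h \<pi> = (if \<pi> \<in> star_path_of ` full_basis r s then h (inv_into UNIV star_path_of \<pi>) else 0)"

lemma of_coeffs: "of_coeffs h \<in> carrier PA" "p \<in> full_basis r s \<Longrightarrow> of_coeffs h (star_path_of p) = h p"
  by (auto simp: PA_carrier of_coeffs_def inv_f_f[OF inj_star_path_of])

lemma path_elem_coeffs:
  assumes "p \<in> full_basis r s"
  shows "path_elem (star_path_of p) = of_coeffs (\<lambda>q. if q = p then 1 else 0)"
    and "path_elem (star_path_of p) \<in> carrier PA"
proof -
  show "path_elem (star_path_of p) = of_coeffs (\<lambda>q. if q = p then 1 else 0)"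
  proof (rule ext)
    fix \<pi>
    show "path_elem (star_path_of p) \<pi> = of_coeffs (\<lambda>q. if q = p then 1 else 0) \<pi>"
      using assms inj_star_path_of[THEN injD]
      by (auto simp: path_elem_def of_coeffs_def inv_f_f[OF inj_star_path_of])
  qed
  then show "path_elem (star_path_of p) \<in> carrier PA" using of_coeffs(1) by simp
qed

lemmas I_add = additive_subgroup.a_closed[OF I.additive_subgroup_axioms]

lemma I_short:
  assumes "f \<in> I" "p \<in> full_basis r s" "\<And>i j. p \<noteq> BC i j"
  shows "f (star_path_of p) = 0"
proof -
  have "f \<in> arrow_ideal_power (star_quiver r s) 2" using assms(1) adm unfolding admissible_ideal_def by blast
  then have z: "length q < 2 \<Longrightarrow> f (u, q) = 0" for u q unfolding arrow_ideal_power_def by blast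
  show ?thesis
  proof (cases p)
    case (BC i j)
    then show ?thesis using assms(3) by blast
  qed (simp_all add: z)
qed

text \<open>
  Multiplying \<open>f \<in> I\<close> from both sides with trivial paths isolates a single path, so an admissible
  ideal is spanned by the paths it contains.
\<close>

lemma I_isolate:
  assumes f: "f \<in> I" and ij: "i \<in> {1..r}" "j \<in> {1..s}" and nz: "f (VX i, [ArrA i, ArrB j]) \<noteq> 0"
  shows "rel i j"
proof -
  \<comment> \<open>The factor \<open>?c\<close> in \<open>x\<close> normalises the isolated path to
    coefficient 1.\<close>
  let ?c = "inverse (f (VX i, [ArrA i, ArrB j]))"
  define x :: "(star_vertex, star_arrow) path \<Rightarrow> 'k" where "x = (\<lambda>\<pi>. if \<pi> = (VX i, []) then ?c else 0)"
  define y :: "(star_vertex, star_arrow) path \<Rightarrow> 'k" where "y = (\<lambda>\<pi>. if \<pi> = (VY j, []) then 1 else 0)"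
  have "(VX i, []) \<in> star_path_of ` full_basis r s" "(VY j, []) \<in> star_path_of ` full_basis r s"
    using ij by (auto intro: image_eqI[of _ _ "BX i"] image_eqI[of _ _ "BY j"])
  then have xy: "x \<in> carrier PA" "y \<in> carrier PA" unfolding PA_carrier x_def y_def by auto
  have fC: "f \<in> carrier PA" using f by (rule I.Icarr)
  have "x \<otimes>\<^bsub>PA\<^esub> f \<otimes>\<^bsub>PA\<^esub> y \<in> I" by (rule I.I_r_closed[OF I.I_l_closed[OF f xy(1)] xy(2)])
  moreover have "x \<otimes>\<^bsub>PA\<^esub> f \<otimes>\<^bsub>PA\<^esub> y = path_elem (VX i, [ArrA i, ArrB j])"
  proof (rule PA_ext)
    show "path_elem (VX i, [ArrA i, ArrB j]) \<in> carrier PA" using path_elem_coeffs(2)[of "BC i j"] ij by simp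
    show "x \<otimes>\<^bsub>PA\<^esub> f \<otimes>\<^bsub>PA\<^esub> y \<in> carrier PA" by (rule I.m_closed[OF I.m_closed[OF xy(1) fC] xy(2)])
    show "(x \<otimes>\<^bsub>PA\<^esub> f \<otimes>\<^bsub>PA\<^esub> y) (star_path_of p) = path_elem (VX i, [ArrA i, ArrB j]) (star_path_of p)" for p
    proof (cases p)
      case (BC k l)
      have "(x \<otimes>\<^bsub>PA\<^esub> f) (star_path_of (BC k l)) = (if k = i then ?c * f (star_path_of (BC i l)) else 0)"
        unfolding PA_mult Let_def by (simp add: x_def)
      then show ?thesis unfolding BC PA_mult[of "x \<otimes>\<^bsub>PA\<^esub> f"] Let_def using nz by (simp add: y_def path_elem_def)
    next
      case (BY l)
      have "(x \<otimes>\<^bsub>PA\<^esub> f) (star_path_of (BY l)) = 0" unfolding PA_mult Let_def by (simp add: x_def)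
      then show ?thesis unfolding BY PA_mult[of "x \<otimes>\<^bsub>PA\<^esub> f"] Let_def by (simp add: y_def path_elem_def)
    next
      case (BB l)
      have "(x \<otimes>\<^bsub>PA\<^esub> f) (star_path_of (BB l)) = 0" unfolding PA_mult Let_def by (simp add: x_def)
      then show ?thesis unfolding BB PA_mult[of "x \<otimes>\<^bsub>PA\<^esub> f"] Let_def by (simp add: y_def path_elem_def)
    next
      case (BX k)
      show ?thesis unfolding BX PA_mult[of "x \<otimes>\<^bsub>PA\<^esub> f"] Let_def by (simp add: y_def path_elem_def)
    next
      case BZ
      show ?thesis unfolding BZ PA_mult[of "x \<otimes>\<^bsub>PA\<^esub> f"] Let_def by (simp add: y_def path_elem_def)
    next
      case (BA k)
      show ?thesis unfolding BA PA_mult[of "x \<otimes>\<^bsub>PA\<^esub> f"] Let_def by (simp add: y_def path_elem_def)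
    qed
  qed
  ultimately show ?thesis unfolding rel_def by simp
qed

text \<open>Elements of \<open>I\<close> have no short paths by \<open>I_short\<close> and only
  relations by \<open>I_isolate\<close>. Conversely, an \<open>f\<close> supported on relations is a
  finite sum of multiples of paths in \<open>I\<close>, built up by induction over a set of
  relations.\<close>

lemma I_iff: "f \<in> I \<longleftrightarrow> f \<in> carrier PA \<and> (\<forall>p \<in> star_basis r s rel. f (star_path_of p) = 0)"
proof (intro iffI conjI ballI)
  assume f: "f \<in> I"
  show "f \<in> carrier PA" using f by (rule I.Icarr)
  show "f (star_path_of p) = 0" if p: "p \<in> star_basis r s rel" for p
  proof (cases p)
    case (BC i j)
    then have "i \<in> {1..r}" "j \<in> {1..s}" "\<not> rel i j" using p by simp_all
    then show ?thesis using I_isolate[OF f] BC by auto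
  qed (use p in \<open>auto intro!: I_short[OF f] simp del: star_path_of.simps\<close>)
next
  assume f: "f \<in> carrier PA \<and> (\<forall>p \<in> star_basis r s rel. f (star_path_of p) = 0)"
  define S where "S = full_basis r s - star_basis r s rel"
  have fin: "finite S" unfolding S_def using finite_full_basis by blast
  \<comment> \<open>A ring ideal is closed under scalars because c g = (c 1) g.\<close>
  have sm: "c \<odot>\<^bsub>PA\<^esub> g \<in> I" if g: "g \<in> I" for c g
  proof -
    have "(c \<odot>\<^bsub>PA\<^esub> \<one>\<^bsub>PA\<^esub>) \<otimes>\<^bsub>PA\<^esub> g \<in> I" by (rule I.I_l_closed[OF g PA_smult]) simp
    moreover have "(c \<odot>\<^bsub>PA\<^esub> \<one>\<^bsub>PA\<^esub>) \<otimes>\<^bsub>PA\<^esub> g = c \<odot>\<^bsub>PA\<^esub> (\<one>\<^bsub>PA\<^esub> \<otimes>\<^bsub>PA\<^esub> g)"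
      by (simp add: path_algebra_def fun_eq_iff sum_distrib_left mult.assoc)
    ultimately show ?thesis using I.Icarr[OF g] by simp
  qed
  have "of_coeffs (\<lambda>q. if q \<in> T then h q else 0) \<in> I" if "finite T" "T \<subseteq> S" for T h
    using that
  proof induction
    case empty
    have "of_coeffs (\<lambda>q. if q \<in> {} then h q else 0) = \<zero>\<^bsub>PA\<^esub>" by (simp add: of_coeffs_def PA_simps fun_eq_iff)
    then show ?case by simp
  next
    case (insert p T)
    have p: "p \<in> full_basis r s" "p \<notin> star_basis r s rel" using insert unfolding S_def by auto
    then obtain i j where ij: "p = BC i j" "rel i j" by (cases p) auto
    have "path_elem (star_path_of p) \<in> I" using ij unfolding rel_def by simp
    have "h p \<odot>\<^bsub>PA\<^esub> path_elem (star_path_of p) \<oplus>\<^bsub>PA\<^esub> of_coeffs (\<lambda>q. if q \<in> T then h q else 0) \<in> I"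
      by (rule I_add[OF sm[OF \<open>path_elem (star_path_of p) \<in> I\<close>] insert.IH]) (use insert in simp)
    moreover have "h p \<odot>\<^bsub>PA\<^esub> path_elem (star_path_of p) \<oplus>\<^bsub>PA\<^esub> of_coeffs (\<lambda>q. if q \<in> T then h q else 0) =
        of_coeffs (\<lambda>q. if q \<in> insert p T then h q else 0)"
      unfolding path_elem_coeffs(1)[OF p(1)] PA_simps using insert(2) by (auto simp: of_coeffs_def fun_eq_iff)
    ultimately show ?case by simp
  qed
  from this[OF fin subset_refl, of "\<lambda>p. f (star_path_of p)"]
  have "of_coeffs (\<lambda>q. if q \<in> S then f (star_path_of q) else 0) \<in> I" .
  moreover have "of_coeffs (\<lambda>q. if q \<in> S then f (star_path_of q) else 0) = f"
    by (rule PA_ext[OF of_coeffs(1)]) (use f in \<open>auto simp: of_coeffs(2) S_def\<close>)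
  ultimately show "f \<in> I" by simp
qed

abbreviation coset where "coset f \<equiv> I +>\<^bsub>PA\<^esub> f"

lemma star_basis_full: "p \<in> star_basis r s rel \<Longrightarrow> p \<in> full_basis r s"
  by (cases p) simp_all

lemma mem_coset: "g \<in> coset f \<longleftrightarrow> (\<exists>h \<in> I. g = h \<oplus>\<^bsub>PA\<^esub> f)"
  unfolding a_r_coset_def' by blast

lemma coset_eqI:
  assumes f: "f \<in> carrier PA" "g \<in> carrier PA" and eq: "\<And>p. p \<in> star_basis r s rel \<Longrightarrow> f (star_path_of p) = g (star_path_of p)"
  shows "coset f = coset g"
proof -
  have sub: "coset f \<subseteq> coset g" if f: "f \<in> carrier PA" "g \<in> carrier PA"
    and eq: "\<And>p. p \<in> star_basis r s rel \<Longrightarrow> f (star_path_of p) = g (star_path_of p)" for f g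
  proof
    fix k assume "k \<in> coset f"
    then obtain h where h: "h \<in> I" "k = h \<oplus>\<^bsub>PA\<^esub> f" unfolding mem_coset by blast
    have "(\<lambda>\<pi>. h \<pi> + f \<pi> - g \<pi>) \<in> I"
      unfolding I_iff
    proof
      show "(\<lambda>\<pi>. h \<pi> + f \<pi> - g \<pi>) \<in> carrier PA"
        unfolding PA_carrier
        using PA_outside[OF I.Icarr[OF h(1)]] PA_outside[OF f(1)] PA_outside[OF f(2)] by fastforce
      show "\<forall>p \<in> star_basis r s rel. h (star_path_of p) + f (star_path_of p) - g (star_path_of p) = 0"
        using h(1) eq unfolding I_iff by simp
    qed
    then show "k \<in> coset g" unfolding mem_coset h(2) PA_simps by (intro bexI[of _ "\<lambda>\<pi>. h \<pi> + f \<pi> - g \<pi>"]) auto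
  qed
  show ?thesis using sub[OF f eq] sub[OF f(2,1) eq[symmetric]] by blast
qed

text \<open>A coefficient of an arbitrarily chosen representative; by \<open>qco_coset\<close> the
  choice does not matter, since elements of \<open>I\<close> vanish on the paths in
  \<open>star_basis r s rel\<close>.\<close>

definition qco :: "star_path \<Rightarrow> ((star_vertex, star_arrow) path \<Rightarrow> 'k) set \<Rightarrow> 'k" where
  "qco p C = (if p \<in> star_basis r s rel then (SOME f. f \<in> C) (star_path_of p) else 0)"

lemma qco_coset: "qco p (coset f) = (if p \<in> star_basis r s rel then f (star_path_of p) else 0)"
proof -
  have "\<zero>\<^bsub>PA\<^esub> \<oplus>\<^bsub>PA\<^esub> f \<in> coset f" 
    unfolding mem_coset using additive_subgroup.zero_closed[OF I.additive_subgroup_axioms] by blast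
  then have "(SOME g. g \<in> coset f) \<in> coset f" by (rule someI[of "\<lambda>g. g \<in> coset f"])
  then obtain h where h: "h \<in> I" "(SOME g. g \<in> coset f) = h \<oplus>\<^bsub>PA\<^esub> f" unfolding mem_coset by blast
  show ?thesis using h(1) unfolding qco_def h(2) PA_simps I_iff by simp
qed

lemma QA_simps:
  "carrier QA = a_rcosets\<^bsub>PA\<^esub> I" "mult QA = rcoset_mult PA I" "\<one>\<^bsub>QA\<^esub> = coset \<one>\<^bsub>PA\<^esub>" "add QA = set_add PA"
  "c \<odot>\<^bsub>QA\<^esub> C = I <+>\<^bsub>PA\<^esub> ((\<lambda>f. c \<odot>\<^bsub>PA\<^esub> f) ` C)"
  by (simp_all add: bound_quiver_algebra_def Let_def ring.extend_def module.fields_def FactRing_def)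

lemma QA_carrier: "C \<in> carrier QA \<longleftrightarrow> (\<exists>f \<in> carrier PA. C = coset f)"
  unfolding QA_simps(1) A_RCOSETS_def' by blast

lemma mem_QA_smult: "g \<in> c \<odot>\<^bsub>QA\<^esub> C \<longleftrightarrow> (\<exists>h \<in> I. \<exists>f \<in> C. g = h \<oplus>\<^bsub>PA\<^esub> (c \<odot>\<^bsub>PA\<^esub> f))"
  unfolding QA_simps(5) set_add_def' by simp

lemma QA_smult:
  assumes f: "f \<in> carrier PA"
  shows "c \<odot>\<^bsub>QA\<^esub> coset f = coset (c \<odot>\<^bsub>PA\<^esub> f)"
proof -
  have sm: "(\<lambda>\<pi>. c * h \<pi>) \<in> I" if "h \<in> I" for h
    using that PA_smult[of h c] unfolding I_iff PA_simps by simp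
  have 1: "g \<in> coset (c \<odot>\<^bsub>PA\<^esub> f)" if g: "g \<in> c \<odot>\<^bsub>QA\<^esub> coset f" for g
  proof -
    obtain h f' where h: "h \<in> I" "f' \<in> coset f" "g = h \<oplus>\<^bsub>PA\<^esub> (c \<odot>\<^bsub>PA\<^esub> f')"
      using g unfolding mem_QA_smult by (elim bexE)
    obtain k where k: "k \<in> I" "f' = k \<oplus>\<^bsub>PA\<^esub> f" using h(2) unfolding mem_coset by (elim bexE)
    have hk: "h \<in> I" "k \<in> I" "g = h \<oplus>\<^bsub>PA\<^esub> (c \<odot>\<^bsub>PA\<^esub> (k \<oplus>\<^bsub>PA\<^esub> f))"
      using h k by simp_all
    have "h \<oplus>\<^bsub>PA\<^esub> (\<lambda>\<pi>. c * k \<pi>) \<in> I" by (rule I_add[OF hk(1) sm[OF hk(2)]])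
    then show ?thesis unfolding mem_coset hk(3) by (rule bexI[rotated]) (simp add: PA_simps algebra_simps)
  qed
  have 2: "g \<in> c \<odot>\<^bsub>QA\<^esub> coset f" if g: "g \<in> coset (c \<odot>\<^bsub>PA\<^esub> f)" for g
  proof -
    obtain h where h: "h \<in> I" "g = h \<oplus>\<^bsub>PA\<^esub> (c \<odot>\<^bsub>PA\<^esub> f)" using g unfolding mem_coset by (elim bexE)
    have "\<zero>\<^bsub>PA\<^esub> \<oplus>\<^bsub>PA\<^esub> f \<in> coset f"
      unfolding mem_coset using additive_subgroup.zero_closed[OF I.additive_subgroup_axioms] by blast
    then have "f \<in> coset f" by (simp add: PA_simps)
    then show ?thesis unfolding mem_QA_smult using h by (intro bexI)
  qed
  show ?thesis
  proof
    show "c \<odot>\<^bsub>QA\<^esub> coset f \<subseteq> coset (c \<odot>\<^bsub>PA\<^esub> f)" using 1 by (rule subsetI)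
    show "coset (c \<odot>\<^bsub>PA\<^esub> f) \<subseteq> c \<odot>\<^bsub>QA\<^esub> coset f" using 2 by (rule subsetI)
  qed
qed

definition qmk :: "(star_path \<Rightarrow> 'k) \<Rightarrow> ((star_vertex, star_arrow) path \<Rightarrow> 'k) set" where
  "qmk h = coset (of_coeffs h)"

text \<open>By \<open>I_iff\<close> the cosets of the paths outside \<open>I\<close> form a basis of
  the quotient, and its multiplication table is that of the path algebra with the paths in
  \<open>I\<close> dropped.\<close>

theorem star_alg: "star_alg QA r s rel qco qmk"
proof (unfold_locales)
  show "fd_algebra QA" by (rule fd)
next
  fix u v p assume u: "u \<in> carrier QA" and v: "v \<in> carrier QA"
  obtain f where f: "f \<in> carrier PA" "u = coset f" using u unfolding QA_carrier by (elim bexE)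
  obtain g where g: "g \<in> carrier PA" "v = coset g" using v unfolding QA_carrier by (elim bexE)
  have "u \<oplus>\<^bsub>QA\<^esub> v = coset (f \<oplus>\<^bsub>PA\<^esub> g)" unfolding QA_simps f(2) g(2) by (rule I.a_rcos_sum[OF f(1) g(1)])
  then show "qco p (u \<oplus>\<^bsub>QA\<^esub> v) = qco p u + qco p v" unfolding f(2) g(2) by (simp add: qco_coset PA_simps)
  have "u \<otimes>\<^bsub>QA\<^esub> v = coset (f \<otimes>\<^bsub>PA\<^esub> g)" unfolding QA_simps f(2) g(2) by (rule I.rcoset_mult_add[OF f(1) g(1)])
  then show "qco p (u \<otimes>\<^bsub>QA\<^esub> v) = (if p \<notin> star_basis r s rel then 0 else case p of
         BX i \<Rightarrow> qco (BX i) u * qco (BX i) v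
       | BZ \<Rightarrow> qco BZ u * qco BZ v
       | BY j \<Rightarrow> qco (BY j) u * qco (BY j) v
       | BA i \<Rightarrow> qco (BX i) u * qco (BA i) v + qco (BA i) u * qco BZ v
       | BB j \<Rightarrow> qco BZ u * qco (BB j) v + qco (BB j) u * qco (BY j) v
       | BC i j \<Rightarrow> qco (BX i) u * qco (BC i j) v + qco (BA i) u * qco (BB j) v + qco (BC i j) u * qco (BY j) v)"
    unfolding f(2) g(2) by (cases p) (simp_all add: qco_coset PA_mult Let_def del: star_path_of.simps)
next
  fix u p c assume u: "u \<in> carrier QA"
  obtain f where f: "f \<in> carrier PA" "u = coset f" using u unfolding QA_carrier by (elim bexE)
  show "qco p (c \<odot>\<^bsub>QA\<^esub> u) = c * qco p u" unfolding f(2) QA_smult[OF f(1)] by (simp add: qco_coset PA_simps)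
next
  show "qco p u = 0" if "p \<notin> star_basis r s rel" for u p using that by (simp add: qco_def)
next
  fix u v assume u: "u \<in> carrier QA" and v: "v \<in> carrier QA" and eq: "\<And>p. qco p u = qco p v"
  obtain f where f: "f \<in> carrier PA" "u = coset f" using u unfolding QA_carrier by (elim bexE)
  obtain g where g: "g \<in> carrier PA" "v = coset g" using v unfolding QA_carrier by (elim bexE)
  show "u = v" unfolding f(2) g(2)
  proof (rule coset_eqI[OF f(1) g(1)])
    fix p assume "p \<in> star_basis r s rel"
    then show "f (star_path_of p) = g (star_path_of p)" using eq[of p] unfolding f(2) g(2) qco_coset by simp
  qed
next
  show "qmk h \<in> carrier QA" for h unfolding QA_carrier qmk_def by (rule bexI[OF refl of_coeffs(1)])
  show "qco p (qmk h) = (if p \<in> star_basis r s rel then h p else 0)" for p h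
    unfolding qmk_def qco_coset using of_coeffs(2)[OF star_basis_full] by simp
  show "qco p \<one>\<^bsub>QA\<^esub> = (case p of BX i \<Rightarrow> if i \<in> {1..r} then 1 else 0 | BZ \<Rightarrow> 1
       | BY j \<Rightarrow> if j \<in> {1..s} then 1 else 0 | _ \<Rightarrow> 0)" for p
    unfolding QA_simps qco_coset using PA_one[OF star_basis_full, of p]
    by (cases p) (simp_all del: star_path_of.simps)
qed

end

section \<open>From the ideal to the graph\<close>

context admissible_star
begin

text \<open>The degree of x_1, which semi-regularity makes the degree of every x_i;
  \<open>deg_y\<close> plays the same part for the y_j.\<close>

definition deg_x :: nat where "deg_x = card {j \<in> {1..s}. \<not> rel 1 j}"
definition deg_y :: nat where "deg_y = card {i \<in> {1..r}. \<not> rel i 1}"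

abbreviation BG where "BG \<equiv> underlying_graph (B_quiver r s I)"

lemma BG: "BG = (VX ` {1..r} \<union> VY ` {1..s}, {{VX i, VY j} | i j. i \<in> {1..r} \<and> j \<in> {1..s} \<and> \<not> rel i j})"
proof -
  have "(\<lambda>e. {tail (B_quiver r s I) e, head (B_quiver r s I) e}) ` arcs (B_quiver r s I) =
      {{VX i, VY j} | i j. i \<in> {1..r} \<and> j \<in> {1..s} \<and> \<not> rel i j}" (is "?L = ?R")
  proof (intro equalityI subsetI)
    fix u assume "u \<in> ?L"
    then show "u \<in> ?R" unfolding B_quiver_def rel_def by (auto simp: insert_commute)
  next
    fix u assume "u \<in> ?R"
    then obtain i j where "u = {VX i, VY j}" "i \<in> {1..r}" "j \<in> {1..s}" "\<not> rel i j" by blast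
    then show "u \<in> ?L"
      unfolding B_quiver_def rel_def by (intro image_eqI[of _ _ "(i, j)"]) (simp_all add: insert_commute)
  qed
  then show ?thesis unfolding underlying_graph_def by (simp add: B_quiver_def)
qed

lemma degree_BG:
  shows "i \<in> {1..r} \<Longrightarrow> degree_in BG (VX i) = card {j \<in> {1..s}. \<not> rel i j}"
    "j \<in> {1..s} \<Longrightarrow> degree_in BG (VY j) = card {i \<in> {1..r}. \<not> rel i j}"
proof -
  assume i: "i \<in> {1..r}"
  have "{e \<in> snd BG. VX i \<in> e} = (\<lambda>j. {VX i, VY j}) ` {j \<in> {1..s}. \<not> rel i j}"
    unfolding BG using i by auto
  moreover have "inj_on (\<lambda>j. {VX i, VY j}) S" for S by (auto simp: inj_on_def doubleton_eq_iff)
  ultimately show "degree_in BG (VX i) = card {j \<in> {1..s}. \<not> rel i j}"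
    unfolding degree_in_def by (simp only: card_image)
next
  assume j: "j \<in> {1..s}"
  have "{e \<in> snd BG. VY j \<in> e} = (\<lambda>i. {VX i, VY j}) ` {i \<in> {1..r}. \<not> rel i j}"
    unfolding BG using j by auto
  moreover have "inj_on (\<lambda>i. {VX i, VY j}) S" for S by (auto simp: inj_on_def doubleton_eq_iff)
  ultimately show "degree_in BG (VY j) = card {i \<in> {1..r}. \<not> rel i j}"
    unfolding degree_in_def by (simp only: card_image)
qed

text \<open>The algebraic and the spectral side meet here: \<open>representation_finite_cox\<close>
  supplies the assumptions of \<open>cox_cyclic\<close>, and
  \<open>balanced_eigenvector_zero\<close> the assumption on eigenvectors in
  \<open>semiregular_bipartite\<close>.\<close>

lemma reflexive_salem_BG:
  assumes rs: "r \<ge> 1" "s \<ge> 1" and rf: "n_representation_finite 2 QA" and reg: "semi_regular r s I"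
  shows "reflexive_graph BG \<and> (salem_graph BG \<longleftrightarrow> (r, s) \<noteq> (1, 1) \<and> (r, s) \<noteq> (4, 4))"
proof -
  have one: "1 \<in> {1..r}" "1 \<in> {1..s}" using rs by simp_all
  have D: "card {j \<in> {1..s}. \<not> rel i j} = deg_x" if "i \<in> {1..r}" for i
    using reg degree_BG(1)[OF that] degree_BG(1)[OF one(1)] that one(1)
    unfolding semi_regular_def Let_def deg_x_def by metis
  have E: "card {i \<in> {1..r}. \<not> rel i j} = deg_y" if "j \<in> {1..s}" for j
    using reg degree_BG(2)[OF that] degree_BG(2)[OF one(2)] that one(2)
    unfolding semi_regular_def Let_def deg_y_def by metis
  interpret S: star_alg QA r s rel qco qmk by (rule star_alg)
  interpret C: cox_cyclic QA r s rel qco qmk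
    by unfold_locales (use rs S.representation_finite_cox[OF rf] in auto)
  interpret G: semiregular_bipartite r s deg_x deg_y rel
  proof
    show "r \<ge> 1" "s \<ge> 1" by (rule rs)+
    show "i \<in> {1..r} \<Longrightarrow> card {j \<in> {1..s}. \<not> rel i j} = deg_x" for i by (rule D)
    show "j \<in> {1..s} \<Longrightarrow> card {i \<in> {1..r}. \<not> rel i j} = deg_y" for j by (rule E)
    show "(\<forall>i \<in> {1..r}. p i = 0) \<and> (\<forall>j \<in> {1..s}. t j = 0)"
      if "(\<Sum>i \<in> {1..r}. p i) = 0" "(\<Sum>j \<in> {1..s}. t j) = 0"
        "\<And>i. i \<in> {1..r} \<Longrightarrow> (\<Sum>j | j \<in> {1..s} \<and> \<not> rel i j. t j) = of_real \<theta> * p i"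
        "\<And>j. j \<in> {1..s} \<Longrightarrow> (\<Sum>i | i \<in> {1..r} \<and> \<not> rel i j. p i) = of_real \<theta> * t j" "\<theta> > 2"
      for p t :: "nat \<Rightarrow> complex" and \<theta>
      using C.balanced_eigenvector_zero[OF that] by blast
  qed
  have "BG = G.graph" unfolding BG G.graph_def ..
  then show ?thesis
    using G.reflexive_salem C.degree_product_gt_4[OF D E] by simp
qed

end

theorem theorem1p3:
  fixes r s :: nat
    and I :: "((star_vertex, star_arrow) path \<Rightarrow> 'k::{alg_closed_field, field_char_0}) set"
  assumes "r \<ge> 1" and "s \<ge> 1"
    and "admissible_ideal (star_quiver r s) I"
    and "n_representation_finite 2 (bound_quiver_algebra (star_quiver r s) I)"
    and "semi_regular r s I"
  shows "reflexive_graph (underlying_graph (B_quiver r s I)) \<and>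
    (salem_graph (underlying_graph (B_quiver r s I)) \<longleftrightarrow> (r, s) \<noteq> (1, 1) \<and> (r, s) \<noteq> (4, 4))"
proof -
  interpret admissible_star r s I
    using assms(3,4) by unfold_locales (auto simp: n_representation_finite_def)
  show ?thesis by (rule reflexive_salem_BG[OF assms(1,2,4,5)])
qed

end
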